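(* Let $1\le p,q\le\infty$ with $p\ne q$. Let $1<u\le\infty$, $t>0$ and $s\in\mathbb{R}$. Suppose $m\in L^\infty(\mathbb{R}^d)$ satisfies $\mathcal{K}_u^{s,t}[m]<\infty$. Then $T_m$ is bounded on $\dot F_p^{0,q}$ if one of the following conditions holds: (1) $s=d-d/u$, $t\le1$, $1<p<\infty$ and $\big|1/p-1/q\big|<1-1/u$; (2) $s>d-d/u$. Moreover, in both cases $$\|T_mf\|_{\dot F_p^{0,q}}\lesssim \mathcal{K}_u^{s,t}[m]\,\|f\|_{\dot F_p^{0,q}}\qquad\text{for all } f\in\dot F_p^{0,q},$$ with an implicit constant depending only on $d,p,q,u,s,t$ and the fixed auxiliary functions $\phi,\varphi$, not on $m$ or $f$.
   Context: Convention: $1/\infty=0$. Fourier transform: $\widehat f(\xi)=\int_{\mathbb{R}^d} f(x)e^{-2\pi i\langle x,\xi\rangle}dx$; $f^\vee$ is the inverse Fourier transform. Cutoff: $\varphi$ is a fixed smooth function on $\mathbb{R}^d$ with $0\le\varphi\le1$, $\varphi=1$ on $\{1/2\le|\xi|\le2\}$, $\mathrm{supp}\,\varphi\subset\{1/4\le|\xi|\le4\}$. Herz spaces: let $B_0=\{x:|x|\le2\}$ and $B_k=\{x\in\mathbb{R}^d:2^k<|x|\le2^{k+1}\}$ for $k\ge1$. For $0<u\le\infty$, $t>0$ ($t=\infty$ allowed), $s\in\mathbb{R}$, $\|f\|_{K_u^{s,t}}:=\big(\sum_{k=0}^\infty 2^{skt}\|f\|_{L^u(B_k)}^t\big)^{1/t}$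 (supremum if $t=\infty$). Put $\mathcal{K}_u^{s,t}[m]:=\sup_{k\in\mathbb{Z}}\big\|(m(2^k\cdot)\varphi)^\vee\big\|_{K_u^{s,t}}$. Littlewood–Paley pieces: $\phi$ is a fixed smooth function with $\widehat\phi$ supported in $\{1/2\le|\xi|\le2\}$ and $\sum_{k\in\mathbb{Z}}\widehat{\phi_k}(\xi)=1$ for $\xi\ne0$, where $\phi_k=2^{kd}\phi(2^k\cdot)$; $\Pi_kf:=\phi_k*f$. Triebel–Lizorkin space: $\dot F_p^{0,q}$ is the space of $f\in S'/\mathcal{P}$ (tempered distributions modulo polynomials) with finite norm $\|f\|_{\dot F_p^{0,q}}:=\big\|\big(\sum_{k\in\mathbb{Z}}|\Pi_kf|^q\big)^{1/q}\big\|_{L^p}$ if $p<\infty$ or $p=q=\infty$ (supremum over $k$ if $q=\infty$), and $\|f\|_{\dot F_\infty^{0,q}}:=\sup_{P}\big(\frac1{|P|}\int_P\sum_{k=-\log_2 l(P)}^\infty|\Pi_kf(x)|^q\,dx\big)^{1/q}$ if $p=\infty$, $q<\infty$, the supremum being over all dyadic cubes $P\subset\mathbb{R}^d$ with side length $l(P)$. Multiplier operator: $T_mf=(m\widehat f)^\vee$. For general $f$ in the space it is understood through its pieces: with $m_k:=m\,\varphi(\cdot/2^k)$, $\Pi_kT_mf=m_k^\vee*\Pi_kf$ and $T_mf=\sum_{k\in\mathbb{Z}}m_k^\vee*\Pi_kf$ (under the hypotheses $m_k^\vee\in L^1$). *)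

theory Defs
  imports "HOL-Analysis.Analysis" "HOL-Probability.Essential_Supremum"
begin

text \<open>
  Throughout, \<open>'a::euclidean_space\<close> plays the role of Euclidean \<open>d\<close>-space with \<open>d = DIM('a)\<close>.
  Integrability exponents in \<open>(0,\<infinity>]\<close> have type \<^typ>\<open>ennreal\<close>, and so do all (quasi-)norms, since
  finiteness of a norm is part of the hypotheses. The reciprocal \<open>1/p\<close> as a real number is
  \<open>enn2real (1 / p)\<close>, which is \<open>0\<close> for \<open>p = \<infinity>\<close>.
\<close>

section \<open>Lebesgue quasi-norms\<close>

text \<open>Only positive exponents \<open>a\<close> are used below.\<close>
definition epowr :: "ennreal \<Rightarrow> real \<Rightarrow> ennreal" where
  "epowr x a = (if x = \<infinity> then \<infinity> else ennreal (enn2real x powr a))"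

definition Lp_norm :: "ennreal \<Rightarrow> 'a::euclidean_space set \<Rightarrow> ('a \<Rightarrow> ennreal) \<Rightarrow> ennreal" where
  "Lp_norm p A g =
     (if p = \<infinity> then esssup lebesgue (\<lambda>x. g x * indicator A x)
      else epowr (\<integral>\<^sup>+x\<in>A. epowr (g x) (enn2real p) \<partial>lebesgue) (enn2real (1 / p)))"

definition lq_norm :: "ennreal \<Rightarrow> (int \<Rightarrow> ennreal) \<Rightarrow> ennreal" where
  "lq_norm q c =
     (if q = \<infinity> then (SUP k. c k)
      else epowr (\<Sum>\<^sub>\<infinity>k. epowr (c k) (enn2real q)) (enn2real (1 / q)))"

definition L_infinity :: "('a::euclidean_space \<Rightarrow> complex) set" where
  "L_infinity = {m \<in> borel_measurable lebesgue. Lp_norm \<infinity> UNIV (\<lambda>x. ennreal (norm (m x))) < \<infinity>}"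

section \<open>Fourier transform and convolution of functions\<close>

definition fourier :: "('a::euclidean_space \<Rightarrow> complex) \<Rightarrow> 'a \<Rightarrow> complex" where
  "fourier f \<xi> = (LINT x|lebesgue. f x * cis (- 2 * pi * (x \<bullet> \<xi>)))"

definition inv_fourier :: "('a::euclidean_space \<Rightarrow> complex) \<Rightarrow> 'a \<Rightarrow> complex" where
  "inv_fourier g x = (LINT \<xi>|lebesgue. g \<xi> * cis (2 * pi * (x \<bullet> \<xi>)))"

definition convolve :: "('a::euclidean_space \<Rightarrow> complex) \<Rightarrow> ('a \<Rightarrow> complex) \<Rightarrow> 'a \<Rightarrow> complex" where
  "convolve g h x = (LINT y|lebesgue. g (x - y) * h y)"

section \<open>Smooth functions, Schwartz functions, tempered distributions modulo polynomials\<close>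

text \<open>Iterated partial derivative along a list of coordinate directions.\<close>
fun partial_derivs :: "'a::euclidean_space list \<Rightarrow> ('a \<Rightarrow> 'b::real_normed_vector) \<Rightarrow> 'a \<Rightarrow> 'b" where
  "partial_derivs [] f = f"
| "partial_derivs (b # bs) f = (\<lambda>x. frechet_derivative (partial_derivs bs f) (at x) b)"

definition smooth :: "('a::euclidean_space \<Rightarrow> 'b::real_normed_vector) \<Rightarrow> bool" where
  "smooth f \<longleftrightarrow> (\<forall>bs. set bs \<subseteq> Basis \<longrightarrow> partial_derivs bs f differentiable_on UNIV)"

definition schwartz :: "('a::euclidean_space \<Rightarrow> complex) set" where
  "schwartz = {\<psi>. smooth \<psi> \<and>
     (\<forall>N bs. set bs \<subseteq> Basis \<longrightarrow> bounded (range (\<lambda>x. (1 + norm x) ^ N *\<^sub>R partial_derivs bs \<psi> x)))}"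

definition schwartz_seminorm :: "nat \<Rightarrow> ('a::euclidean_space \<Rightarrow> complex) \<Rightarrow> real" where
  "schwartz_seminorm N \<psi> =
     (\<Sum>bs | set bs \<subseteq> Basis \<and> length bs \<le> N. SUP x. (1 + norm x) ^ N * norm (partial_derivs bs \<psi> x))"

text \<open>
  Continuous linear functionals on the Schwartz space. The values of such a functional outside
  \<^const>\<open>schwartz\<close> are irrelevant; they are identified by the quotient below.
\<close>
definition tempered :: "(('a::euclidean_space \<Rightarrow> complex) \<Rightarrow> complex) set" where
  "tempered = {F.
     (\<forall>\<psi>\<in>schwartz. \<forall>\<eta>\<in>schwartz. F (\<lambda>x. \<psi> x + \<eta> x) = F \<psi> + F \<eta>) \<and>
     (\<forall>c. \<forall>\<psi>\<in>schwartz. F (\<lambda>x. c * \<psi> x) = c * F \<psi>) \<and>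
     (\<exists>C N. \<forall>\<psi>\<in>schwartz. norm (F \<psi>) \<le> C * schwartz_seminorm N \<psi>)}"

definition mod_polynomials ::
  "((('a::euclidean_space \<Rightarrow> complex) \<Rightarrow> complex) \<times> (('a \<Rightarrow> complex) \<Rightarrow> complex)) set" where
  "mod_polynomials = {(F, G). F \<in> tempered \<and> G \<in> tempered \<and>
     (\<exists>P. polynomial_function P \<and> (\<forall>\<psi>\<in>schwartz. F \<psi> - G \<psi> = (LINT x|lebesgue. P x * \<psi> x)))}"

definition tempered_mod_poly :: "(('a::euclidean_space \<Rightarrow> complex) \<Rightarrow> complex) set set" where
  "tempered_mod_poly = tempered // mod_polynomials"

text \<open>Schwartz functions with all moments vanishing, i.e. those annihilated by every polynomial.\<close>
definition schwartz0 :: "('a::euclidean_space \<Rightarrow> complex) set" where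
  "schwartz0 = {\<psi> \<in> schwartz. \<forall>P. polynomial_function P \<longrightarrow> (LINT x|lebesgue. P x * \<psi> x) = 0}"

text \<open>
  The pairing of a class modulo polynomials with \<open>\<psi> \<in> schwartz0\<close>: the common value \<open>F \<psi>\<close> of all
  representatives \<open>F\<close> (see \<open>pairing_eq\<close>).
\<close>
definition pairing ::
  "(('a::euclidean_space \<Rightarrow> complex) \<Rightarrow> complex) set \<Rightarrow> ('a \<Rightarrow> complex) \<Rightarrow> complex" where
  "pairing X \<psi> = the_elem ((\<lambda>F. F \<psi>) ` X)"

lemma pairing_eq:
  assumes "X \<in> tempered_mod_poly" and "F \<in> X" and "\<psi> \<in> schwartz0"
  shows "pairing X \<psi> = F \<psi>"
proof -
  obtain F0 where X: "X = mod_polynomials `` {F0}"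
    using assms(1) unfolding tempered_mod_poly_def by (auto elim: quotientE)
  have *: "G \<psi> = F0 \<psi>" if G: "G \<in> X" for G
  proof -
    obtain P where "polynomial_function P"
        and "\<forall>\<psi>\<in>schwartz. F0 \<psi> - G \<psi> = (LINT x|lebesgue. P x * \<psi> x)"
      using G unfolding X mod_polynomials_def by auto
    with assms(3) show ?thesis
      unfolding schwartz0_def by force
  qed
  have "(\<lambda>G. G \<psi>) ` X = {F \<psi>}"
  proof -
    have "(\<lambda>G. G \<psi>) ` X = (\<lambda>G. F0 \<psi>) ` X"
      by (rule image_cong) (simp_all add: *)
    also have "\<dots> = {F \<psi>}"
      using assms(2) *[OF assms(2)] by auto
    finally show ?thesis .
  qed
  then show ?thesis
    by (simp add: pairing_def)
qed

section \<open>Cutoff function and Herz spaces\<close>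

definition cutoff :: "('a::euclidean_space \<Rightarrow> real) \<Rightarrow> bool" where
  "cutoff \<phi> \<longleftrightarrow> smooth \<phi> \<and> (\<forall>\<xi>. 0 \<le> \<phi> \<xi> \<and> \<phi> \<xi> \<le> 1) \<and>
     (\<forall>\<xi>. 1/2 \<le> norm \<xi> \<and> norm \<xi> \<le> 2 \<longrightarrow> \<phi> \<xi> = 1) \<and>
     closure {\<xi>. \<phi> \<xi> \<noteq> 0} \<subseteq> {\<xi>. 1/4 \<le> norm \<xi> \<and> norm \<xi> \<le> 4}"

definition herz_shell :: "nat \<Rightarrow> 'a::euclidean_space set" where
  "herz_shell k =
     (if k = 0 then {x. norm x \<le> 2} else {x. 2 ^ k < norm x \<and> norm x \<le> 2 ^ (k + 1)})"

definition herz_norm :: "ennreal \<Rightarrow> real \<Rightarrow> ennreal \<Rightarrow> ('a::euclidean_space \<Rightarrow> complex) \<Rightarrow> ennreal" where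
  "herz_norm u s t f =
     (let a = (\<lambda>k::nat. ennreal (2 powr (s * real k)) *
                        Lp_norm u (herz_shell k) (\<lambda>x. ennreal (norm (f x))))
      in if t = \<infinity> then (SUP k. a k)
         else epowr (\<Sum>k. epowr (a k) (enn2real t)) (enn2real (1 / t)))"

definition herz_multiplier_norm ::
  "('a::euclidean_space \<Rightarrow> real) \<Rightarrow> ennreal \<Rightarrow> real \<Rightarrow> ennreal \<Rightarrow> ('a \<Rightarrow> complex) \<Rightarrow> ennreal" where
  "herz_multiplier_norm \<phi> u s t m =
     (SUP k::int. herz_norm u s t
        (inv_fourier (\<lambda>\<xi>. m ((2 powi k) *\<^sub>R \<xi>) * complex_of_real (\<phi> \<xi>))))"

section \<open>Littlewood--Paley pieces and Triebel--Lizorkin spaces\<close>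

definition dilate :: "('a::euclidean_space \<Rightarrow> complex) \<Rightarrow> int \<Rightarrow> 'a \<Rightarrow> complex" where
  "dilate \<Phi> k x = of_real (2 powi (k * int DIM('a))) * \<Phi> ((2 powi k) *\<^sub>R x)"

definition littlewood_paley :: "('a::euclidean_space \<Rightarrow> complex) \<Rightarrow> bool" where
  "littlewood_paley \<Phi> \<longleftrightarrow> \<Phi> \<in> schwartz \<and>
     closure {\<xi>. fourier \<Phi> \<xi> \<noteq> 0} \<subseteq> {\<xi>. 1/2 \<le> norm \<xi> \<and> norm \<xi> \<le> 2} \<and>
     (\<forall>\<xi>. \<xi> \<noteq> 0 \<longrightarrow> ((\<lambda>k::int. fourier (dilate \<Phi> k) \<xi>) has_sum 1) UNIV)"

text \<open>
  The convolution of a distribution class with \<open>dilate \<Phi> k\<close>; for a Littlewood--Paley function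
  \<open>\<Phi>\<close> the test function \<open>y \<mapsto> dilate \<Phi> k (x - y)\<close> belongs to \<^const>\<open>schwartz0\<close>.
\<close>
definition LP_piece ::
  "('a::euclidean_space \<Rightarrow> complex) \<Rightarrow> int \<Rightarrow> (('a \<Rightarrow> complex) \<Rightarrow> complex) set \<Rightarrow> 'a \<Rightarrow> complex" where
  "LP_piece \<Phi> k X x = pairing X (\<lambda>y. dilate \<Phi> k (x - y))"

text \<open>Dyadic cube of side length \<open>2 powi (- j)\<close>; the lattice point is given by \<open>n\<close> on \<^const>\<open>Basis\<close>.\<close>
definition dyadic_cube :: "int \<Rightarrow> ('a::euclidean_space \<Rightarrow> int) \<Rightarrow> 'a set" where
  "dyadic_cube j n = {x. \<forall>b\<in>Basis.
     2 powi (- j) * of_int (n b) \<le> x \<bullet> b \<and> x \<bullet> b < 2 powi (- j) * (of_int (n b) + 1)}"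

definition TL_norm ::
  "('a::euclidean_space \<Rightarrow> complex) \<Rightarrow> ennreal \<Rightarrow> ennreal
    \<Rightarrow> (('a \<Rightarrow> complex) \<Rightarrow> complex) set \<Rightarrow> ennreal" where
  "TL_norm \<Phi> p q X =
     (if p < \<infinity> \<or> q = \<infinity>
      then Lp_norm p UNIV (\<lambda>x. lq_norm q (\<lambda>k. ennreal (norm (LP_piece \<Phi> k X x))))
      else (SUP (j, n) \<in> (UNIV :: (int \<times> ('a \<Rightarrow> int)) set).
              epowr ((\<integral>\<^sup>+x\<in>dyadic_cube j n.
                        (\<Sum>\<^sub>\<infinity>k\<in>{j..}. epowr (ennreal (norm (LP_piece \<Phi> k X x))) (enn2real q)) \<partial>lebesgue)
                     / emeasure lebesgue (dyadic_cube j n :: 'a set))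
                (enn2real (1 / q))))"

definition TL_space ::
  "('a::euclidean_space \<Rightarrow> complex) \<Rightarrow> ennreal \<Rightarrow> ennreal
    \<Rightarrow> (('a \<Rightarrow> complex) \<Rightarrow> complex) set set" where
  "TL_space \<Phi> p q = {X \<in> tempered_mod_poly. TL_norm \<Phi> p q X < \<infinity>}"

section \<open>The multiplier operator\<close>

definition multiplier_kernel ::
  "('a::euclidean_space \<Rightarrow> real) \<Rightarrow> ('a \<Rightarrow> complex) \<Rightarrow> int \<Rightarrow> 'a \<Rightarrow> complex" where
  "multiplier_kernel \<phi> m k =
     inv_fourier (\<lambda>\<xi>. m \<xi> * complex_of_real (\<phi> ((2 powi (- k)) *\<^sub>R \<xi>)))"

text \<open>
  \<open>Y = T\<^sub>m X\<close> in the space of tempered distributions modulo polynomials. With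
  \<open>K\<^sub>k = multiplier_kernel \<phi> m k\<close> (integrable) and \<open>\<Pi>\<^sub>k = LP_piece \<Phi> k\<close>, this says that the functions
  \<open>K\<^sub>k * \<Pi>\<^sub>k X\<close> are well defined, that \<open>\<Pi>\<^sub>k Y = K\<^sub>k * \<Pi>\<^sub>k X\<close>, and that \<open>Y\<close> is the sum of these
  functions. The last statement refers to the quotient topology, which is the weak topology given
  by pairing with \<^const>\<open>schwartz0\<close>. The integrability requirements exclude the default value
  \<open>0\<close> of the Bochner integral.
\<close>
definition multiplier_image ::
  "('a::euclidean_space \<Rightarrow> real) \<Rightarrow> ('a \<Rightarrow> complex) \<Rightarrow> ('a \<Rightarrow> complex)
    \<Rightarrow> (('a \<Rightarrow> complex) \<Rightarrow> complex) set \<Rightarrow> (('a \<Rightarrow> complex) \<Rightarrow> complex) set \<Rightarrow> bool" where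
  "multiplier_image \<phi> \<Phi> m X Y \<longleftrightarrow>
     Y \<in> tempered_mod_poly \<and>
     (\<forall>k. integrable lebesgue (multiplier_kernel \<phi> m k)) \<and>
     (\<forall>k x. integrable lebesgue (\<lambda>y. multiplier_kernel \<phi> m k (x - y) * LP_piece \<Phi> k X y)) \<and>
     (\<forall>k. LP_piece \<Phi> k Y = convolve (multiplier_kernel \<phi> m k) (LP_piece \<Phi> k X)) \<and>
     (\<forall>\<psi>\<in>schwartz0.
        (\<forall>k. integrable lebesgue
               (\<lambda>x. convolve (multiplier_kernel \<phi> m k) (LP_piece \<Phi> k X) x * \<psi> x)) \<and>
        ((\<lambda>k. LINT x|lebesgue. convolve (multiplier_kernel \<phi> m k) (LP_piece \<Phi> k X) x * \<psi> x)
          has_sum pairing Y \<psi>) UNIV)"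

end

theory Submission
 imports Defs "HOL-Probability.Characteristic_Functions"
begin

text \<open>
 Let \<open>K\<^sub>k\<close> be the kernels of the multiplier and \<open>f\<^sub>k\<close> the pieces of \<open>X\<close>. The norm estimate only uses the
 positive operators \<open>f\<^sub>k \<mapsto> \<bar>K\<^sub>k\<bar> * \<bar>f\<^sub>k\<bar>\<close>. In the critical case the Herz norm splits \<open>K\<^sub>k\<close> into blocks, each
 controlled in \<open>L\<^sup>u\<close> at its own scale with summable constants. Hoelder's inequality gives a weighted bound for
 one block in terms of a maximal function of the weight; summation and duality with \<open>L\<^sup>p\<^sup>/\<^sup>q\<close> do the rest.
 In the supercritical case \<open>K\<^sub>k\<close> lives essentially at scale \<open>2\<^sup>-\<^sup>k\<close>. As \<open>f\<^sub>k\<close> is band limited, it may be replaced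
 by its supremum over dyadic cubes of generation \<open>k\<close>; the square roots in Peetre's inequality make \<open>p = 1\<close> accessible.
 For a sequence constant on such cubes and increasing in \<open>k\<close>, telescoping in \<open>k\<close> bounds the supremum of the
 convolutions in \<open>L\<^sup>1\<close>, and the other exponents follow from this bound, by duality if \<open>q < p\<close>; the Carleson
 condition for \<open>p = \<infinity>\<close> is propagated directly.
 The image is the sum of the \<open>K\<^sub>k * f\<^sub>k\<close>, with constants subtracted for \<open>k \<le> 0\<close> to make it converge. Its
 pieces are found from \<open>K\<^sub>l * \<Phi>\<^sub>l * \<Phi>\<^sub>k = K\<^sub>k * \<Phi>\<^sub>l * \<Phi>\<^sub>k\<close>, where the cutoff equals \<open>1\<close> on the spectrum of \<open>\<Phi>\<^sub>l\<close>.
\<close>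

text \<open>The condition |1/p - 1/q| < 1 - 1/u enters at one point. For q < p a block in L^u costs
  a maximal function of order v with 1/v = q (1 - 1/u) on the weight, and this is bounded on L^rho,
  rho the conjugate of p/q, if v < rho, that is 1/q - 1/p < 1 - 1/u. For p < q that conjugate does
  not exist; there the sequence is factored through powers of its pointwise l^q norm, and the mirror
  condition appears. Both arguments also ask that u be not too large, which is harmless: u may be
  lowered, and the conditions are open. The block estimates serve twice, for the K_k and, in the
  supercritical case, for the decaying kernel \<open>eta\<close> that majorizes the dilates of
  \<Phi>; \<open>eta\<close> is a block kernel for every u. For the existence of the image the
  obstacle is that m is only bounded, so T_m has no transpose acting on Schwartz functions. Each
  piece is paired separately with test functions, and a bound 2^(-|l|) against a fixed seminorm is
  needed; it comes from the vanishing mean of the l-th dilate for l > 0 and from the slow variation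
  of f_l for l <= 0.\<close>

abbreviation BM :: "('a::topological_space => 'b::topological_space) set" where "BM \<equiv> borel_measurable borel"
abbreviation LM :: "('a::euclidean_space => 'b::topological_space) set" where "LM \<equiv> borel_measurable lborel"
abbreviation integ :: "('a::euclidean_space => 'b::{banach, second_countable_topology}) => bool" where "integ \<equiv> integrable lborel"
abbreviation nn_lborel :: "('a::euclidean_space => ennreal) => ennreal" (binder "NN " [60] 60) where "nn_lborel f \<equiv> nn_integral lborel f"
abbreviation nn_count :: "('i => ennreal) => ennreal" (binder "CC " [60] 60) where "nn_count f \<equiv> nn_integral (count_space UNIV) f"
abbreviation int_lborel :: "('a::euclidean_space => 'b::{banach, second_countable_topology}) => 'b" (binder "LL " [60] 60)
 where "int_lborel f \<equiv> integral\<^sup>L lborel f"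
abbreviation rint :: "int => real" where "rint \<equiv> of_int"
abbreviation tp :: "int => real" where "tp k \<equiv> 2 powr rint k"
abbreviation tm :: "int => real" where "tm k \<equiv> 2 powr (- rint k)"
abbreviation en :: "real => ennreal" where "en \<equiv> ennreal"
abbreviation pd :: "'a::euclidean_space list => ('a => 'b::real_normed_vector) => 'a => 'b" where "pd \<equiv> partial_derivs"

section \<open>Powers and integral inequalities in the extended nonnegative reals\<close>

lemma epowr_ennreal [simp]: "0 <= x ==> epowr (en x) a = en (x powr a)"
 by (simp add: epowr_def)

lemma epowr_top [simp]: "epowr top a = top"
 by (simp add: epowr_def)

lemma epowr_0 [simp]: "epowr 0 a = 0"
 by (simp add: epowr_def)

lemma epowr_1 [simp]: "epowr 1 a = 1"
 by (simp add: epowr_def)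

lemma epowr_one [simp]: "epowr x 1 = x"
 by (cases x) auto

lemma epowr_eq_top_iff [simp]: "epowr x a = top \<longleftrightarrow> x = top"
 by (simp add: epowr_def)

lemma epowr_less_top_iff [simp]: "epowr x a < top \<longleftrightarrow> x < top"
 by (metis epowr_eq_top_iff top.not_eq_extremum)

lemma epowr_eq_0_iff [simp]: "epowr x a = 0 \<longleftrightarrow> x = 0"
 by (cases x) auto

text \<open>\<open>epowr\<close> sends 0 to 0 and infinity to infinity for every exponent, negative
  ones and 0 included. With this convention the laws for products, sums of exponents and iterated
  powers hold without sign conditions, so factors such as \<open>epowr F (1 - q)\<close> can be
  split off and recombined later.\<close>

lemma epowr_mult: "epowr (x * y) a = epowr x a * epowr y a"
proof (cases "x = top \<or> y = top")
 case True
 then show ?thesis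
  by (cases "x = 0"; cases "y = 0") (auto simp: ennreal_mult_top ennreal_top_mult)
next
 case False
 then obtain r s where "x = en r" "y = en s" "0 <= r" "0 <= s"
  by (metis ennreal_cases)
 then show ?thesis
  by (simp add: powr_mult ennreal_mult flip: ennreal_mult)
qed

lemma epowr_epowr: "epowr (epowr x a) b = epowr x (a * b)"
 by (cases x) (auto simp: powr_powr)

lemma epowr_add: "epowr x (a + b) = epowr x a * epowr x b"
 by (cases x) (auto simp: powr_add ennreal_mult ennreal_top_mult)

lemma epowr_mono: "0 <= a ==> x <= y ==> epowr x a <= epowr y a"
 by (cases x; cases y) (auto simp: powr_mono2 top_unique)

lemma epowr_le_iff: "0 < a ==> epowr x a <= epowr y a \<longleftrightarrow> x <= y"
 using epowr_mono[of a x y] epowr_mono[of "1 / a" "epowr x a" "epowr y a"]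
 by (auto simp: epowr_epowr)

lemma epowr_inverse: "a ~= 0 ==> epowr (epowr x a) (1 / a) = x"
 by (simp add: epowr_epowr)

lemma epowr_le_swap: "0 < a ==> epowr x a <= y \<longleftrightarrow> x <= epowr y (1 / a)"
 using epowr_le_iff[of a x "epowr y (1 / a)"] by (simp add: epowr_epowr)

lemma epowr_SUP: "0 < a ==> epowr (SUP i\<in>I. f i) a = (SUP i\<in>I. epowr (f i) a)"
 by (intro antisym) (auto simp: epowr_le_swap epowr_le_iff intro!: SUP_least SUP_upper epowr_mono,
   metis SUP_upper epowr_inverse epowr_le_swap less_irrefl)

lemma borel_measurable_epowr [measurable (raw)]:
 assumes [measurable]: "f : borel_measurable M"
 shows "(%x. epowr (f x) a) : borel_measurable M"
proof -
 have [measurable]: "{x : space M. f x = \<infinity>} : sets M"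
  using measurable_sets[OF assms, of "{\<infinity>}"] by (simp add: vimage_def Int_def conj_commute)
 have [measurable]: "(%x. enn2real (f x) powr a) : borel_measurable M"
  by (intro powr_real_measurable) measurable
 show ?thesis unfolding epowr_def by measurable
qed

lemma young_epowr:
 assumes "0 < th" "th < 1"
 shows "epowr x th * epowr y (1 - th) <= en th * x + en (1 - th) * y"
proof (cases "x = 0 \<or> y = 0 \<or> x = top \<or> y = top")
 case True
 then show ?thesis using assms by (auto simp: ennreal_mult_top)
next
 case False
 then obtain r s where rs: "x = en r" "y = en s" "0 < r" "0 < s"
  by (metis ennreal_cases ennreal_0 less_eq_real_def)
 then show ?thesis
  using Youngs_inequality_0[of th "1 - th" r s] assms
  by (simp flip: ennreal_mult ennreal_plus)
qed

text \<open>The exponents sit on the integrands, so 1/th and 1/(1 - th) are the usual conjugate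
  pair. Both integrals are normalized to 1 and Young's inequality is integrated; zero and infinite
  integrals are settled first, hence no finiteness is asked of the caller.\<close>

lemma holder_epowr:
 assumes [measurable]: "f : borel_measurable M" "g : borel_measurable M" and "0 < th" "th < 1"
 shows "(\<integral>\<^sup>+x. epowr (f x) th * epowr (g x) (1 - th) \<partial>M)
    <= epowr (\<integral>\<^sup>+x. f x \<partial>M) th * epowr (\<integral>\<^sup>+x. g x \<partial>M) (1 - th)"
proof -
 define I J where "I = (\<integral>\<^sup>+x. f x \<partial>M)" and "J = (\<integral>\<^sup>+x. g x \<partial>M)"
 consider "I = 0 \<or> J = 0" | "I ~= 0" "J ~= 0" "I = top \<or> J = top" | "I ~= 0" "J ~= 0" "I < top" "J < top"
  by (meson top.not_eq_extremum)
 then have "(\<integral>\<^sup>+x. epowr (f x) th * epowr (g x) (1 - th) \<partial>M) <= epowr I th * epowr J (1 - th)"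
 proof cases
  case 1
  then have "AE x in M. f x = 0 \<or> g x = 0"
   unfolding I_def J_def by (auto simp: nn_integral_0_iff_AE)
  then have "(\<integral>\<^sup>+x. epowr (f x) th * epowr (g x) (1 - th) \<partial>M) = 0"
   by (subst nn_integral_0_iff_AE) auto
  then show ?thesis by simp
 next
  case 2
  then show ?thesis by (auto simp: ennreal_mult_top ennreal_top_mult)
 next
  case 3
  then obtain i j where ij: "I = en i" "J = en j" "0 < i" "0 < j"
   by (metis ennreal_cases ennreal_0 less_eq_real_def top.not_eq_extremum)
  have fi: "f x = en i * (en (1/i) * f x)" "g x = en j * (en (1/j) * g x)" for x
   using ij by (simp_all flip: mult.assoc ennreal_mult)
  have "(\<integral>\<^sup>+x. epowr (f x) th * epowr (g x) (1 - th) \<partial>M)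
   = (\<integral>\<^sup>+x. epowr I th * epowr J (1 - th) *
      (epowr (en (1/i) * f x) th * epowr (en (1/j) * g x) (1 - th)) \<partial>M)"
  proof (rule nn_integral_cong)
   fix x
   show "epowr (f x) th * epowr (g x) (1 - th) = epowr I th * epowr J (1 - th) *
      (epowr (en (1/i) * f x) th * epowr (en (1/j) * g x) (1 - th))"
    unfolding ij by (subst fi(1), subst fi(2)) (simp only: epowr_mult mult_ac)
  qed
  also have "... = epowr I th * epowr J (1 - th) *
    (\<integral>\<^sup>+x. (epowr (en (1/i) * f x) th * epowr (en (1/j) * g x) (1 - th)) \<partial>M)"
   by (simp add: nn_integral_cmult)
  also have "... <= epowr I th * epowr J (1 - th) *
    (\<integral>\<^sup>+x. en th * (en (1/i) * f x) + en (1 - th) * (en (1/j) * g x) \<partial>M)"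
   by (intro mult_left_mono nn_integral_mono young_epowr assms) auto
  also have "(\<integral>\<^sup>+x. en th * (en (1/i) * f x) + en (1 - th) * (en (1/j) * g x) \<partial>M)
    = en th * (en (1/i) * I) + en (1 - th) * (en (1/j) * J)"
   unfolding I_def J_def by (simp add: nn_integral_add nn_integral_cmult)
  also have "... = 1"
   using ij assms by (simp flip: ennreal_mult ennreal_plus)
  finally show ?thesis by simp
 qed
 then show ?thesis by (simp add: I_def J_def)
qed

text \<open>Hoelder after writing h = h^(1/q) h^(1 - 1/q). The density \<open>h\<close> has mass at
  most A instead of 1, which accounts for A^(q - 1).\<close>

lemma jensen_epowr:
 assumes [measurable]: "h : borel_measurable M" "f : borel_measurable M"
  and "1 <= q" "(\<integral>\<^sup>+x. h x \<partial>M) <= en A" "0 < A"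
 shows "epowr (\<integral>\<^sup>+x. h x * f x \<partial>M) q <= en (A powr (q - 1)) * (\<integral>\<^sup>+x. h x * epowr (f x) q \<partial>M)"
proof (cases "q = 1")
 case True
 then show ?thesis using assms by simp
next
 case False
 with \<open>1 <= q\<close> have q: "1 < q" by simp
 have "(\<integral>\<^sup>+x. h x * f x \<partial>M) = (\<integral>\<^sup>+x. epowr (h x * epowr (f x) q) (1/q) * epowr (h x) (1 - 1/q) \<partial>M)"
 proof (rule nn_integral_cong)
  fix x
  have "epowr (h x * epowr (f x) q) (1/q) * epowr (h x) (1 - 1/q)
    = epowr (h x) (1/q + (1 - 1/q)) * f x"
   unfolding epowr_add epowr_mult using q by (simp add: epowr_inverse mult_ac)
  then show "h x * f x = epowr (h x * epowr (f x) q) (1/q) * epowr (h x) (1 - 1/q)" by simp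
 qed
 also have "... <= epowr (\<integral>\<^sup>+x. h x * epowr (f x) q \<partial>M) (1/q) * epowr (\<integral>\<^sup>+x. h x \<partial>M) (1 - 1/q)"
  by (rule holder_epowr) (use q in auto)
 finally have "epowr (\<integral>\<^sup>+x. h x * f x \<partial>M) q
   <= epowr (epowr (\<integral>\<^sup>+x. h x * epowr (f x) q \<partial>M) (1/q) * epowr (\<integral>\<^sup>+x. h x \<partial>M) (1 - 1/q)) q"
  using q by (intro epowr_mono) auto
 also have "... = (\<integral>\<^sup>+x. h x * epowr (f x) q \<partial>M) * epowr (\<integral>\<^sup>+x. h x \<partial>M) (q - 1)"
 proof -
  have "(1 - 1/q) * q = q - 1" using q by (simp add: field_simps)
  then show ?thesis using q by (simp add: epowr_mult epowr_epowr)
 qed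
 also have "... <= (\<integral>\<^sup>+x. h x * epowr (f x) q \<partial>M) * epowr (en A) (q - 1)"
  using q assms by (intro mult_left_mono epowr_mono) auto
 finally show ?thesis using assms by (simp add: mult.commute)
qed

text \<open>The absorption step in a duality argument: dividing by X^(1 - 1/P) is legitimate because
  X is a real number, that is finite.\<close>

lemma powr_ball_bound:
 fixes X :: real
 assumes "0 <= X" "0 <= C" "1 < P" "X <= C * X powr (1 - 1 / P)"
 shows "X <= C powr P"
proof (cases "X = 0")
 case False
 then have X: "X > 0" using assms by simp
 have "X powr (1/P) * X powr (1 - 1/P) <= C * X powr (1 - 1 / P)"
  using assms X by (simp flip: powr_add)
 then have "X powr (1/P) <= C" using X by simp
 then have "(X powr (1/P)) powr P <= C powr P"
  using assms by (intro powr_mono2) auto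
 then show ?thesis using X assms by (simp add: powr_powr)
qed auto

text \<open>Test with a truncation of the power \<open>P - 1\<close> of \<open>S\<close>, so that its norm is finite and can be cancelled.\<close>
lemma dual_bound:
 fixes S :: "'a::euclidean_space => ennreal"
 assumes [measurable]: "S : LM" and P: "1 < P" and C: "0 <= C"
  and dual: "!!w. w : LM ==> (NN x. S x * w x)
    <= en C * epowr (NN x. epowr (w x) (P / (P - 1))) (1 - 1 / P)"
 shows "(NN x. epowr (S x) P) <= en (C powr P)"
proof -
 define T where "T n x = epowr (min (S x) (of_nat n)) P * indicator (ball 0 (real n)) x" for n :: nat and x
 have [measurable]: "S : BM" using assms(1) by simp
 have [measurable]: "ball 0 (real n) : sets (borel :: 'a measure)" for n by simp
 have [measurable]: "T n : LM" for n
  unfolding T_def by simp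
 have bnd: "(NN x. T n x) <= en (C powr P)" for n
 proof -
  define w where "w x = epowr (min (S x) (of_nat n)) (P - 1) * indicator (ball 0 (real n)) x" for x
  have [measurable]: "w : LM" unfolding w_def by measurable
  have "(NN x. T n x) <= (NN x. epowr (of_nat n) P * indicator (ball (0::'a) (real n)) x)"
   unfolding T_def using P by (intro nn_integral_mono) (auto intro!: epowr_mono simp: indicator_def)
  also have "... = epowr (of_nat n) P * emeasure lborel (ball (0::'a) (real n))"
   by (simp add: nn_integral_cmult)
  also have "... < top"
   using emeasure_lborel_ball_finite[of "0::'a" "real n"]
   by (auto simp: ennreal_mult_less_top of_nat_less_top)
  finally obtain X where X: "(NN x. T n x) = en X" "0 <= X"
   by (metis ennreal_cases top.not_eq_extremum)
  have wT: "epowr (w x) (P / (P - 1)) = T n x" for x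
   unfolding w_def T_def epowr_mult epowr_epowr using P by (auto simp: indicator_def)
  have "(NN x. T n x) <= (NN x. S x * w x)"
  proof (rule nn_integral_mono)
   fix x
   have "epowr (min (S x) (of_nat n)) P = epowr (min (S x) (of_nat n)) (1 + (P - 1))" by simp
   also have "... = min (S x) (of_nat n) * epowr (min (S x) (of_nat n)) (P - 1)"
    unfolding epowr_add by simp
   also have "... <= S x * epowr (min (S x) (of_nat n)) (P - 1)"
    by (intro mult_right_mono) auto
   finally show "T n x <= S x * w x"
    unfolding T_def w_def by (auto simp: indicator_def)
  qed
  also have "... <= en C * epowr (NN x. T n x) (1 - 1 / P)"
   using dual[of w] by (simp add: wT)
  finally have "X <= C * X powr (1 - 1 / P)"
   unfolding X(1) using X(2) C by (simp flip: ennreal_mult)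
  with powr_ball_bound[OF X(2) C P] show ?thesis
   unfolding X(1) by (simp add: ennreal_leI)
 qed
 have "(SUP n. T n x) = epowr (S x) P" for x
 proof (rule antisym)
  show "(SUP n. T n x) <= epowr (S x) P"
   unfolding T_def using P by (intro SUP_least) (auto simp: indicator_def intro!: epowr_mono)
  obtain N :: nat where N: "norm x < real N" using reals_Archimedean2 by blast
  have "S x = (SUP n\<in>{N..}. min (S x) (of_nat n))"
  proof (rule antisym)
   show "S x <= (SUP n\<in>{N..}. min (S x) (of_nat n))"
   proof (cases "S x = top")
    case True
    have "(SUP n\<in>{N..}. of_nat n :: ennreal) \<ge> (SUP n. of_nat n)"
    proof (rule SUP_least)
     fix n :: nat
     show "(of_nat n :: ennreal) <= (SUP n\<in>{N..}. of_nat n)"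
      by (rule SUP_upper2[of "max N n"]) auto
    qed
    then show ?thesis using True by (simp add: ennreal_SUP_of_nat_eq_top)
   next
    case False
    then obtain m :: nat where "S x < of_nat m" using ennreal_Ex_less_of_nat
     by (metis top.not_eq_extremum)
    then have "min (S x) (of_nat (max N m)) = S x"
     by (simp add: min_def) (meson less_imp_le max.cobounded2 of_nat_le_iff order_trans)
    then show ?thesis by (intro SUP_upper2[of "max N m"]) auto
   qed
  qed (auto intro!: SUP_least)
  then have "epowr (S x) P = (SUP n\<in>{N..}. epowr (min (S x) (of_nat n)) P)"
   using P epowr_SUP[of P "%n. min (S x) (of_nat n)" "{N..}"] by simp
  also have "... <= (SUP n. T n x)"
  proof (rule SUP_least)
   fix n assume "n : {N..}"
   then have "epowr (min (S x) (of_nat n)) P = T n x"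
    using N by (simp add: T_def)
   then show "epowr (min (S x) (of_nat n)) P <= (SUP n. T n x)"
    by (metis SUP_upper UNIV_I)
  qed
  finally show "epowr (S x) P <= (SUP n. T n x)" .
 qed
 then have "(NN x. epowr (S x) P) = (NN x. (SUP n. T n x))" by simp
 also have "... = (SUP n. NN x. T n x)"
 proof (rule nn_integral_monotone_convergence_SUP)
  show "incseq T"
   unfolding incseq_def le_fun_def T_def using P
   by (intro allI impI mult_mono epowr_mono min.mono) (auto simp: indicator_def)
 qed simp
 also have "... <= en (C powr P)" by (intro SUP_least bnd)
 finally show ?thesis .
qed

lemma ball_borel_measurable [measurable]: "ball (x :: 'a::euclidean_space) r : sets borel"
 by simp

section \<open>Sums over the integers as integrals\<close>

text \<open>Sums over k are treated as integrals for counting measure, so that Tonelli, Hoelder and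
  Jensen apply to them without a separate discrete version.\<close>

lemma infsum_int_nn_integral:
 fixes f :: "int => ennreal"
 shows "infsum f UNIV = (CC k. f k)"
proof (rule antisym)
 have eq: "infsum f UNIV = (SUP F\<in>{F. finite F & F <= UNIV}. sum f F)"
  by (rule nonneg_infsum_complete) auto
 show "infsum f UNIV <= (CC k. f k)"
  unfolding eq
 proof (rule SUP_least)
  fix F :: "int set" assume "F : {F. finite F & F <= UNIV}"
  then have F: "finite F" by simp
  have "sum f F = (CC k. f k * indicator F k)"
   using F by (simp add: nn_integral_indicator_finite)
  also have "... <= (CC k. f k)"
   by (intro nn_integral_mono) (auto simp: indicator_def)
  finally show "sum f F <= (CC k. f k)" .
 qed
 have "(CC k. f k) = (CC n. f (int_decode n))"
  using nn_integral_bij_count_space[OF bij_int_decode, of f] by simp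
 also have "... = (SUP n. \<Sum>i<n. f (int_decode i))"
  by (simp add: nn_integral_count_space_nat suminf_eq_SUP)
 also have "... <= infsum f UNIV"
  unfolding eq
 proof (rule SUP_least)
  fix n
  have "(\<Sum>i<n. f (int_decode i)) = sum f (int_decode ` {..<n})"
   by (subst sum.reindex) (auto simp: inj_int_decode inj_on_subset[OF inj_int_decode])
  also have "... <= (SUP F\<in>{F. finite F & F <= UNIV}. sum f F)"
   by (intro SUP_upper) auto
  finally show "(\<Sum>i<n. f (int_decode i)) <= (SUP F\<in>{F. finite F & F <= UNIV}. sum f F)" .
 qed
 finally show "(CC k. f k) <= infsum f UNIV" .
qed

lemma infsum_int_nn_integral_on:
 fixes f :: "int => ennreal"
 shows "infsum f A = (CC k. f k * indicator A k)"
 unfolding infsum_int_nn_integral[symmetric]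
 by (rule infsum_cong_neutral) auto

lemma count_int_swap:
 fixes f :: "int => 'a => ennreal"
 assumes "!!k. f k : borel_measurable M"
 shows "(\<integral>\<^sup>+x. (CC k. f k x) \<partial>M) = (CC k. (\<integral>\<^sup>+x. f k x \<partial>M))"
 using assms by (simp add: nn_integral_count_space_nn_integral)

lemma borel_measurable_count_int [measurable (raw)]:
 fixes f :: "int => 'a => ennreal"
 assumes [measurable]: "!!k. f k : borel_measurable M"
 shows "(%x. CC k. f k x) : borel_measurable M"
proof -
 have "(CC k. f k x) = (\<Sum>n. f (int_decode n) x)" for x
  using nn_integral_bij_count_space[OF bij_int_decode, of "%k. f k x"]
  by (simp add: nn_integral_count_space_nat)
 then show ?thesis by simp
qed

section \<open>Convolution of nonnegative functions\<close>

lemma nn_affine: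
 fixes f :: "'a::euclidean_space => ennreal"
 assumes [measurable]: "f : LM" and c: "c ~= 0"
 shows "(NN x. f x) = en (\<bar>c\<bar> ^ DIM('a)) * (NN x. f (t + c *\<^sub>R x))"
 by (subst lborel_affine[OF c, of t])
   (simp add: nn_integral_density nn_integral_distr nn_integral_cmult)

lemma nn_reflect:
 fixes f :: "'a::euclidean_space => ennreal"
 assumes [measurable]: "f : LM"
 shows "(NN y. f (x - y)) = (NN y. f y)"
 using nn_affine[OF assms, of "-1" x] by simp

lemma nn_shift:
 fixes f :: "'a::euclidean_space => ennreal"
 assumes [measurable]: "f : LM"
 shows "(NN y. f (x + y)) = (NN y. f y)" "(NN y. f (y - x)) = (NN y. f y)"
 using nn_affine[OF assms, of "1" x] nn_affine[OF assms, of "1" "-x"]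
 by (simp_all)

text \<open>Values in the extended reals make convolution commutative, associative and compatible
  with Tonelli for all measurable functions; the norm estimates are carried out in this
  calculus.\<close>

definition nnconv :: "('a::euclidean_space => ennreal) => ('a => ennreal) => 'a => ennreal" where
 "nnconv h f x = (NN y. h (x - y) * f y)"

lemma meas_nnconv [measurable]:
 assumes [measurable]: "h : LM" "f : LM"
 shows "nnconv h f : LM"
proof -
 have [measurable]: "h : BM" "f : BM" using assms by simp_all
 show ?thesis unfolding nnconv_def by measurable
qed

lemma nnconv_commute:
 assumes [measurable]: "h : LM" "f : LM"
 shows "nnconv h f x = nnconv f h x"
proof -
 have [measurable]: "h : BM" "f : BM" using assms by simp_all
 have "nnconv f h x = (NN y. f (x - y) * h (x - (x - y)))"
  unfolding nnconv_def by simp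
 also have "... = nnconv h f x"
  unfolding nnconv_def using nn_reflect[of "%y. f y * h (x - y)" x]
  by (simp add: mult.commute)
 finally show ?thesis ..
qed

lemma nnconv_mono: "(!!x. h x <= h' x) ==> (!!x. f x <= f' x) ==> nnconv h f x <= nnconv h' f' x"
 unfolding nnconv_def by (intro nn_integral_mono mult_mono) auto

text \<open>Tonelli: the transpose of convolution with \<open>h\<close> is convolution with its
  reflection. All weighted and dual estimates move kernels onto the weight in this way.\<close>

lemma nn_nnconv_mult:
 fixes h :: "'a::euclidean_space => ennreal"
 assumes [measurable]: "h : LM" "f : LM" "w : LM"
 shows "(NN x. nnconv h f x * w x) = (NN y. f y * nnconv (%z. h (- z)) w y)"
proof -
 have [measurable]: "h : BM" "f : BM" "w : BM"
  using assms by simp_all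
 have "(NN x. nnconv h f x * w x) = (NN x. (NN y. h (x - y) * f y * w x))"
  unfolding nnconv_def by (simp add: nn_integral_multc)
 also have "... = (NN y. (NN x. h (x - y) * f y * w x))"
  by (rule lborel_pair.Fubini') measurable
 also have "... = (NN y. (NN x. f y * (h (- (y - x)) * w x)))"
  by (simp add: mult_ac)
 also have "... = (NN y. f y * nnconv (%z. h (- z)) w y)"
  unfolding nnconv_def by (intro nn_integral_cong nn_integral_cmult) measurable
 finally show ?thesis .
qed

lemma nn_nnconv:
 fixes h :: "'a::euclidean_space => ennreal"
 assumes [measurable]: "h : LM" "f : LM"
 shows "(NN x. nnconv h f x) = (NN x. h x) * (NN x. f x)"
proof -
 have [measurable]: "h : BM" "f : BM" using assms by simp_all
 have "nnconv (%z. h (- z)) (%_. 1) y = (NN x. h x)" for y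
  unfolding nnconv_def using nn_shift(2)[of h y] by simp
 then show ?thesis
  using nn_nnconv_mult[of h f "%_. 1"] by (simp add: nn_integral_multc mult.commute)
qed

lemma nnconv_assoc:
 fixes h :: "'a::euclidean_space => ennreal"
 assumes [measurable]: "h : LM" "g : LM" "f : LM"
 shows "nnconv h (nnconv g f) x = nnconv (nnconv h g) f x"
proof -
 have [measurable]: "h : BM" "f : BM" "g : BM"
  using assms by simp_all
 have "nnconv h (nnconv g f) x = (NN y. nnconv g f y * h (x - y))"
  unfolding nnconv_def by (simp add: mult.commute)
 also have "... = (NN z. f z * nnconv (%z. g (- z)) (%y. h (x - y)) z)"
  by (rule nn_nnconv_mult) measurable
 also have "... = (NN z. f z * nnconv h g (x - z))"
 proof (intro nn_integral_cong arg_cong2[where f="(*)"] refl)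
  fix z
  show "nnconv (%z. g (- z)) (%y. h (x - y)) z = nnconv h g (x - z)"
   unfolding nnconv_def
   using nn_shift(2)[of "%y. g y * h (x - z - y)" z]
   by (simp add: mult.commute algebra_simps)
 qed
 finally show ?thesis unfolding nnconv_def by (simp add: mult.commute)
qed

section \<open>The Hardy--Littlewood maximal function\<close>

text \<open>Centred Hardy-Littlewood maximal function over dyadic radii. Dividing by the power of
  the radius, not by the volume of the ball, keeps the constants simple, and a countable supremum
  makes measurability immediate.\<close>

definition HL :: "('a::euclidean_space => ennreal) => 'a => ennreal" where
 "HL w x = (SUP i::int. en (2 powr (- (rint i * real DIM('a)))) *
        (NN y. indicator (ball x (2 powr i)) y * w y))"

lemma borel_measurable_HL:
 fixes w :: "'a::euclidean_space => ennreal"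
 assumes [measurable]: "w : LM"
 shows "HL w : LM"
proof -
 have [measurable]: "w : BM" using assms by simp
 have "(%x. NN y. indicator (ball x (tp i)) y * w y)
   = nnconv (indicator (ball (0::'a) (tp i))) w" for i
  unfolding nnconv_def by (intro ext nn_integral_cong) (auto simp: indicator_def dist_norm norm_minus_commute)
 moreover have "nnconv (indicator (ball (0::'a) (tp i))) w : LM" for i
  by measurable
 ultimately have [measurable]:
  "(%x. NN y. indicator (ball x (tp i)) y * w y) : LM" for i
  by simp
 show ?thesis unfolding HL_def by measurable
qed

lemma nn_integral_ball_le_HL:
 fixes w :: "'a::euclidean_space => ennreal"
 shows "(NN y. indicator (ball x (tp i)) y * w y)
   <= en (2 powr (rint i * real DIM('a))) * HL w x"
proof -
 let ?a = "2 powr (rint i * real DIM('a))" and ?b = "2 powr (- (rint i * real DIM('a)))"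
 let ?I = "NN y. indicator (ball x (tp i)) y * w y"
 have ab: "en ?a * en ?b = 1"
  by (simp add: powr_minus flip: ennreal_mult)
 have "?I = en ?a * (en ?b * ?I)"
  by (simp add: ab flip: mult.assoc)
 also have "... <= en ?a * HL w x"
  unfolding HL_def by (intro mult_left_mono SUP_upper) auto
 finally show ?thesis .
qed

text \<open>Vitali covering: disjoint balls on which w has large average carry total mass at most
  the integral of w, and their fivefold enlargements cover the level set; hence 5^d and the volume
  of the unit ball.\<close>

lemma HL_weak_type:
 fixes w :: "'a::euclidean_space => ennreal"
 assumes w [measurable]: "w : LM" and l: "0 < l"
 shows "emeasure lborel {x. en l < HL w x}
    <= en (5 ^ DIM('a) * unit_ball_vol (real DIM('a)) / l) * (NN x. w x)"
proof -
 let ?d = "real DIM('a)"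
 let ?K = "5 ^ DIM('a) * unit_ball_vol (real DIM('a)) / l"
 define E where "E = {x. en l < HL w x}"
 have [measurable]: "w : BM" "HL w : BM"
  using w borel_measurable_HL[OF w] by simp_all
 have [measurable]: "E : sets borel" unfolding E_def by measurable
 have K: "?K > 0" using l by simp
 show ?thesis
 proof (cases "(NN x. w x) = top")
  case True
  have "en ?K ~= 0" using K by (simp only: ennreal_eq_0_iff not_le)
  then show ?thesis unfolding True by (simp only: ennreal_mult_top if_False top_greatest)
 next
  case False
  then obtain I where I: "(NN x. w x) = en I" "0 <= I"
   by (metis ennreal_cases)
  define B where "B x i = (NN y. indicator (ball x (tp i)) y * w y)"
   for x :: 'a and i :: int
  have "EX i. en l < en (2 powr (- (rint i * ?d))) * B x i" if "x : E" for x
   using that unfolding E_def HL_def B_def by (simp add: less_SUP_iff)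
  then obtain i where i: "!!x. x : E ==> ennreal l < en (2 powr (- (rint (i x) * ?d))) * B x (i x)"
   by metis
  define r where "r x = 2 powr rint (i x)" for x
  have rd: "r x ^ DIM('a) = 2 powr (rint (i x) * ?d)" for x
   by (simp add: r_def powr_realpow[symmetric] powr_powr)
  have Blow: "en (l * r x ^ DIM('a)) <= B x (i x)" if "x : E" for x
  proof -
   have "en (2 powr (- (rint (i x) * ?d))) * en (r x ^ DIM('a)) = 1"
    by (simp add: rd powr_minus flip: ennreal_mult)
   then have "B x (i x) = en (2 powr (- (rint (i x) * ?d))) * B x (i x) * en (r x ^ DIM('a))"
    by (metis mult.commute mult.left_commute mult_1)
   then show ?thesis
    using mult_right_mono[OF less_imp_le[OF i[OF that]], of "en (r x ^ DIM('a))"] l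
    by (simp add: ennreal_mult r_def)
  qed
  \<comment> \<open>The covering lemma needs bounded radii. A selected ball carries mass at least l
    r^d but at most the finite integral of w.\<close>
  have r_bound: "0 < r x & r x <= max 1 (I / l)" if "x : E" for x
  proof -
   have "B x (i x) <= en I"
    unfolding B_def I(1)[symmetric] by (intro nn_integral_mono) (auto simp: indicator_def)
   with Blow[OF that] have "en (l * r x ^ DIM('a)) <= en I" by (rule order_trans)
   then have le: "r x ^ DIM('a) <= I / l"
    using I(2) l by (simp add: field_simps)
   have "r x <= r x ^ DIM('a)" if "1 <= r x"
    using that by (metis DIM_positive One_nat_def Suc_leI power_increasing power_one_right)
   with le have "r x <= max 1 (I / l)" by linarith
   then show ?thesis by (simp add: r_def)
  qed
  have cov: "E <= (\<Union>x\<in>E. ball x (r x))" using r_bound by auto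
  obtain C where C: "countable C" "C <= E"
    and disj: "pairwise (%x y. disjnt (ball x (r x)) (ball y (r y))) C"
    and E5: "E <= (\<Union>x\<in>C. ball x (5 * r x))"
   by (rule Vitali_covering_lemma_balls[OF cov r_bound]) auto
  have "emeasure lborel E = (NN x. indicator E x)" by simp
  also have "... <= (NN x. (\<integral>\<^sup>+c. indicator (ball c (5 * r c)) x \<partial>count_space C))"
  proof (rule nn_integral_mono)
   fix x
   show "indicator E x <= (\<integral>\<^sup>+c. indicator (ball c (5 * r c)) x \<partial>count_space C)"
   proof (cases "x : E")
    case True
    then obtain c where "c : C" "x : ball c (5 * r c)" using E5 by auto
    then show ?thesis
     using nn_integral_ge_point[of c C "%c. indicator (ball c (5 * r c)) x"] True by simp
   qed auto
  qed
  also have "... = (\<integral>\<^sup>+c. (NN x. indicator (ball c (5 * r c)) x) \<partial>count_space C)"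
   using C by (intro nn_integral_count_space_nn_integral) auto
  also have "... <= (\<integral>\<^sup>+c. en ?K * B c (i c) \<partial>count_space C)"
  proof (rule nn_integral_mono)
   fix c assume "c : space (count_space C)"
   then have c: "c : E" using C by auto
   have "(NN x. indicator (ball c (5 * r c)) x) = en (unit_ball_vol ?d * (5 * r c) ^ DIM('a))"
    using r_bound[OF c] by (simp add: emeasure_ball)
   also have "... = en (?K * (l * r c ^ DIM('a)))"
    using l by (simp add: power_mult_distrib mult_ac)
   also have "... = en ?K * en (l * r c ^ DIM('a))"
    using K l r_bound[OF c] by (intro ennreal_mult) auto
   also have "... <= en ?K * B c (i c)"
    by (intro mult_left_mono Blow c) auto
   finally show "(NN x. indicator (ball c (5 * r c)) x) <= en ?K * B c (i c)" .
  qed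
  also have "... = en ?K * (\<integral>\<^sup>+c. B c (i c) \<partial>count_space C)"
   by (rule nn_integral_cmult) simp
  also have "(\<integral>\<^sup>+c. B c (i c) \<partial>count_space C)
    = (NN x. (\<integral>\<^sup>+c. indicator (ball c (r c)) x * w x \<partial>count_space C))"
   unfolding B_def r_def[symmetric] using C
   by (intro nn_integral_count_space_nn_integral[symmetric]) auto
  \<comment> \<open>The selected balls are disjoint, so each point is counted at most once.\<close>
  also have "... <= (NN x. w x)"
  proof (rule nn_integral_mono)
   fix x
   show "(\<integral>\<^sup>+c. indicator (ball c (r c)) x * w x \<partial>count_space C) <= w x"
   proof (cases "\<exists>c\<in>C. x : ball c (r c)")
    case True
    then obtain c where c: "c : C" "x : ball c (r c)" by auto
    have "(\<integral>\<^sup>+c. indicator (ball c (r c)) x * w x \<partial>count_space C)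
      = (\<integral>\<^sup>+c'. w x * indicator {c} c' \<partial>count_space C)"
     using disj c by (intro nn_integral_cong) (fastforce simp: indicator_def pairwise_def disjnt_def)
    also have "... = w x" using c by (simp add: nn_integral_cmult)
    finally show ?thesis by simp
   next
    case False
    then have "(\<integral>\<^sup>+c. indicator (ball c (r c)) x * w x \<partial>count_space C) = (\<integral>\<^sup>+c. 0 \<partial>count_space C)"
     by (intro nn_integral_cong) auto
    then show ?thesis by simp
   qed
  qed
  finally show ?thesis unfolding E_def by (simp add: mult_left_mono)
 qed
qed

lemma dyadic_bracket:
 fixes x :: real
 assumes "0 < x"
 obtains n :: int where "tp n < x" "x <= 2 powr (rint n + 1)"
proof
 let ?n = "\<lceil>log 2 x\<rceil> - 1"
 have "rint ?n < log 2 x" "log 2 x <= rint ?n + 1"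
  by linarith+
 then show "2 powr rint ?n < x" "x <= 2 powr (rint ?n + 1)"
  using assms by (simp_all add: less_log_iff[symmetric] log_le_iff[symmetric] powr_less_iff le_powr_iff)
qed

text \<open>Discrete layer cake: for 0 < X < infinity the single height with 2^n < X <= 2^(n + 1)
  already suffices. For X infinite all heights occur and the sum diverges, which is checked
  separately.\<close>

lemma layer_upper:
 assumes r: "0 < r"
 shows "epowr X r <= (CC i. en (2 powr ((rint i + 1) * r)) * indicator {i. en (tp i) < X} i)" (is "_ <= ?S")
proof (cases X)
 case top
 have "en (real n) <= ?S" for n
 proof -
  obtain m :: nat where m: "real n powr (1/r) < 2 powr real m"
   using real_arch_pow[of 2 "real n powr (1/r)"] by (auto simp: powr_realpow)
  have "real n = (real n powr (1/r)) powr r" using r by (simp add: powr_powr)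
  also have "... <= (2 powr real m) powr r" using m r by (intro powr_mono2) auto
  finally have "en (real n) <= en (2 powr ((rint (int m - 1) + 1) * r)) *
    indicator {i. en (tp i) < X} (int m - 1)"
   using top by (simp add: powr_powr ennreal_leI)
  also have "... <= ?S" by (rule nn_integral_ge_point) simp
  finally show ?thesis .
 qed
 then have "?S = top"
 proof -
  have False if "?S ~= top"
  proof -
   have "?S < top" using that by (simp add: top.not_eq_extremum)
   then obtain n where "?S < of_nat n" using ennreal_Ex_less_of_nat by blast
   then show False using \<open>!!n. en (real n) <= ?S\<close>[of n] by (simp add: ennreal_of_nat_eq_real_of_nat)
  qed
  then show ?thesis by blast
 qed
 then show ?thesis by simp
next
 case (real x)
 show ?thesis
 proof (cases "x = 0")
  case False
  then obtain n where n: "tp n < x" "x <= 2 powr (rint n + 1)"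
   using dyadic_bracket[of x] real by auto
  have "epowr X r <= en (2 powr ((rint n + 1) * r))"
   using real n r powr_mono2[of r x "2 powr (rint n + 1)"] by (simp add: powr_powr ennreal_leI)
  also have "... = en (2 powr ((rint n + 1) * r)) * indicator {i. en (tp i) < X} n"
   using n real by (simp add: ennreal_less_iff)
  also have "... <= ?S" by (rule nn_integral_ge_point) simp
  finally show ?thesis .
 qed (use real in auto)
qed

text \<open>A geometric series that ends at the largest 2^i below X is comparable to its last
  term.\<close>

lemma layer_lower:
 assumes s: "0 < s"
 shows "(CC i. en (2 powr (rint i * s)) * indicator {i. en (tp i) < X} i) <= en (1 / (1 - 2 powr (- s))) * epowr X s" (is "?S <= _")
proof -
 have q: "0 < 2 powr (- s)" "2 powr (- s) < 1" using s by (auto simp: powr_less_one)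
 show ?thesis
 proof (cases X)
  case top
  then show ?thesis using q s by (simp add: ennreal_mult_top)
 next
  case (real x)
  show ?thesis
  proof (cases "x = 0")
   case False
   then obtain n where n: "tp n < x" "x <= 2 powr (rint n + 1)"
    using dyadic_bracket[of x] real by auto
   have iff: "en (tp i) < X \<longleftrightarrow> i <= n" for i
   proof -
    have "tp i < x \<longleftrightarrow> i <= n"
    proof
     assume "tp i < x"
     then have "tp i < 2 powr (rint n + 1)" using n by linarith
     then show "i <= n" by simp
    next
     assume "i <= n"
     then have "tp i <= tp n" by simp
     then show "tp i < x" using n by linarith
    qed
    then show ?thesis using real by (simp add: ennreal_less_iff)
   qed
   have "?S = (\<integral>\<^sup>+i. en (2 powr (rint i * s)) \<partial>count_space {..n})"
    by (subst nn_integral_count_space_indicator) (auto intro!: nn_integral_cong simp: iff indicator_def)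
   also have "... = (CC m. en (2 powr (rint (n - int m) * s)))"
   proof (rule nn_integral_bij_count_space[symmetric])
    show "bij_betw (%m. n - int m) UNIV {..n}"
     by (rule bij_betwI[where g="%i. nat (n - i)"]) auto
   qed
   also have "... = (\<Sum>m. en (2 powr (rint n * s) * (2 powr (- s)) ^ m))"
    by (simp add: nn_integral_count_space_nat powr_realpow[symmetric] powr_powr algebra_simps
      flip: powr_add)
   also have "... = en (2 powr (rint n * s) * (1 / (1 - 2 powr (- s))))"
    using q by (intro suminf_ennreal_eq sums_mult geometric_sums) auto
   also have "... <= en (1 / (1 - 2 powr (- s)) * x powr s)"
   proof (rule ennreal_leI)
    have "2 powr (rint n * s) <= x powr s"
     using powr_mono2[of s "tp n" x] n s by (simp add: powr_powr)
    then show "2 powr (rint n * s) * (1 / (1 - 2 powr (- s))) <= 1 / (1 - 2 powr (- s)) * x powr s"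
     using q by (simp add: divide_right_mono)
   qed
   also have "... = en (1 / (1 - 2 powr (- s))) * epowr X s"
    using real q by (simp only: epowr_ennreal) (rule ennreal_mult, auto)
   finally show ?thesis .
  qed (use real in auto)
 qed
qed

text \<open>Marcinkiewicz interpolation between the weak bound on L^1 and the trivial bound on
  L^infinity: at height l only the part of w above l counts, and the contributions of all dyadic
  heights are added by the two layer-cake bounds.\<close>

theorem HL_strong_type:
 fixes rh :: real
 assumes rh: "1 < rh"
 shows "EX B>0. \<forall>w\<in>borel_measurable (lborel :: 'a::euclidean_space measure).
   (NN x. epowr (HL w x) rh) <= en B * (NN x. epowr (w x) rh)"
proof -
 define v where "v = unit_ball_vol (real DIM('a))"
 have v: "v > 0" by (simp add: v_def)
 define G where "G = 1 / (1 - 2 powr (- (rh - 1)))"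
 have "2 powr (- (rh - 1)) < 1" using rh by (simp add: powr_less_one)
 then have G: "0 < G" by (simp add: G_def)
 define B where "B = (2 * v) powr rh * (2 powr rh * 5 ^ DIM('a) * G)"
 have B: "0 < B" using v G by (simp add: B_def)
 have "(NN x. epowr (HL w x) rh) <= en B * (NN x. epowr (w x) rh)"
  if w [measurable]: "w : LM" for w :: "'a => ennreal"
 proof -
  have [measurable]: "w : BM" "HL w : BM"
   using w borel_measurable_HL[OF w] by simp_all
  \<comment> \<open>With v the volume of the unit ball, the part of w below l contributes at most v
    l to \<open>HL\<close>. Hence HL w > 2 v l forces HL (W l) > v l, and dividing by 2 v aligns the
    heights of both functions.\<close>
  define X where "X x = en (1 / (2 * v)) * HL w x" for x
  have [measurable]: "X : LM" "X : BM" unfolding X_def by measurable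
  have HLX: "HL w x = en (2 * v) * X x" for x
   unfolding X_def using v by (simp flip: mult.assoc ennreal_mult)
  define W where "W l x = w x * indicator {x. en l < w x} x" for l x
  have W [measurable]: "W l : LM" for l unfolding W_def by measurable
  have level: "emeasure lborel {x. en l < X x} <= en (5 ^ DIM('a) / l) * (NN x. W l x)"
   if l: "0 < l" for l
  proof -
   have split: "HL w x <= HL (W l) x + en (v * l)" for x
    unfolding HL_def[of w]
   proof (rule SUP_least)
    fix i :: int
    let ?a = "2 powr (- (rint i * real DIM('a)))" and ?B = "ball x (tp i)"
    have "(NN y. indicator ?B y * w y) <= (NN y. indicator ?B y * W l y + en l * indicator ?B y)"
     by (intro nn_integral_mono) (auto simp: W_def indicator_def not_less)
    also have "... = (NN y. indicator ?B y * W l y) + en l * emeasure lborel ?B"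
     by (simp add: nn_integral_add nn_integral_cmult)
    finally have "en ?a * (NN y. indicator ?B y * w y) <=
      en ?a * (NN y. indicator ?B y * W l y) + en ?a * (en l * emeasure lborel ?B)"
     unfolding distrib_left[symmetric] by (rule mult_left_mono) simp
    also have "en ?a * (en l * emeasure lborel ?B) = en (v * l)"
    proof -
     have p: "(tp i) ^ DIM('a) = 2 powr (rint i * real DIM('a))"
      by (simp add: powr_realpow[symmetric] powr_powr)
     have "?a * (l * (v * (2 powr (rint i * real DIM('a))))) = v * l"
      by (simp add: powr_minus)
     then show ?thesis
      using l v by (simp add: emeasure_ball v_def[symmetric] p flip: ennreal_mult)
    qed
    also have "en ?a * (NN y. indicator ?B y * W l y) <= HL (W l) x"
     unfolding HL_def by (rule SUP_upper) simp
    finally show "en ?a * (NN y. indicator ?B y * w y) <= HL (W l) x + en (v * l)"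
     by (simp add: add_right_mono)
   qed
   have "{x. en l < X x} <= {x. en (v * l) < HL (W l) x}"
   proof safe
    fix x assume x: "en l < X x"
    show "en (v * l) < HL (W l) x"
    proof (rule ccontr)
     assume "\<not> en (v * l) < HL (W l) x"
     then have "HL w x <= en (v * l) + en (v * l)"
      by (intro order_trans[OF split[of x]] add_right_mono) (simp add: not_less)
     then have "HL w x <= en (2 * v * l)" using v l by (simp add: mult_ac flip: ennreal_plus)
     then have "en (1 / (2 * v)) * HL w x <= en (1 / (2 * v)) * en (2 * v * l)"
      by (rule mult_left_mono) simp
     then have "X x <= en l" unfolding X_def using v l by (simp flip: ennreal_mult)
     with x show False by simp
    qed
   qed
   then have "emeasure lborel {x. en l < X x} <= emeasure lborel {x. en (v * l) < HL (W l) x}"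
    by (intro emeasure_mono) (use borel_measurable_HL[OF W[of l]] in simp_all)
   also have "... <= en (5 ^ DIM('a) * v / (v * l)) * (NN x. W l x)"
    unfolding v_def by (rule HL_weak_type) (use l in simp_all)
   finally show ?thesis using v by simp
  qed
  have "(NN x. epowr (X x) rh)
   <= (NN x. (CC i. en (2 powr ((rint i + 1) * rh)) *
      indicator {i. en (tp i) < X x} i))"
   using rh by (intro nn_integral_mono layer_upper) auto
  also have "... = (NN x. (CC i. en (2 powr ((rint i + 1) * rh)) *
      indicator {x. en (tp i) < X x} x))"
   by (simp add: indicator_def)
  also have "... = (CC i. (NN x. en (2 powr ((rint i + 1) * rh)) *
      indicator {x. en (tp i) < X x} x))"
   by (rule count_int_swap) measurable
  also have "... = (CC i. en (2 powr ((rint i + 1) * rh)) *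
      emeasure lborel {x. en (tp i) < X x})"
   by (simp add: nn_integral_cmult)
  \<comment> \<open>After the weak bound at height 2^i, sum and integral are exchanged; at each
    point the remaining sum runs over the heights below w x.\<close>
  also have "... <= (CC i. (NN x. en (2 powr rh * 5 ^ DIM('a)) *
      (w x * (en (2 powr (rint i * (rh - 1))) * indicator {x. en (tp i) < w x} x))))"
  proof (rule nn_integral_mono)
   fix i :: int
   let ?t = "tp i"
   have "en (2 powr ((rint i + 1) * rh)) * emeasure lborel {x. en ?t < X x}
    <= en (2 powr ((rint i + 1) * rh)) * (en (5 ^ DIM('a) / ?t) * (NN x. W ?t x))"
    by (intro mult_left_mono level) auto
   also have "... = en (2 powr ((rint i + 1) * rh) * (5 ^ DIM('a) / ?t)) * (NN x. W ?t x)"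
    by (subst ennreal_mult) (auto simp: mult.assoc)
   also have "2 powr ((rint i + 1) * rh) * (5 ^ DIM('a) / ?t)
     = 2 powr rh * 5 ^ DIM('a) * 2 powr (rint i * (rh - 1))"
   proof -
    have "2 powr ((rint i + 1) * rh) / ?t = 2 powr rh * 2 powr (rint i * (rh - 1))"
     by (simp add: powr_diff[symmetric] powr_add[symmetric] algebra_simps)
    then show ?thesis by (simp add: field_simps)
   qed
   also have "ennreal ... * (NN x. W ?t x) = (NN x. en (2 powr rh * 5 ^ DIM('a) * 2 powr (rint i * (rh - 1))) * W ?t x)"
    by (simp add: nn_integral_cmult)
   also have "... = (NN x. en (2 powr rh * 5 ^ DIM('a)) *
      (w x * (en (2 powr (rint i * (rh - 1))) * indicator {x. en (tp i) < w x} x)))"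
    unfolding W_def by (intro nn_integral_cong) (simp add: ennreal_mult mult_ac)
   finally show "en (2 powr ((rint i + 1) * rh)) * emeasure lborel {x. en ?t < X x} <= ..." .
  qed
  also have "... = (NN x. (CC i. en (2 powr rh * 5 ^ DIM('a)) *
      (w x * (en (2 powr (rint i * (rh - 1))) * indicator {x. en (tp i) < w x} x))))"
   by (rule count_int_swap[symmetric]) measurable
  also have "... = (NN x. en (2 powr rh * 5 ^ DIM('a)) *
      (w x * (CC i. en (2 powr (rint i * (rh - 1))) * indicator {i. en (tp i) < w x} i)))"
   by (simp add: nn_integral_cmult indicator_def)
  also have "... <= (NN x. en (2 powr rh * 5 ^ DIM('a)) * (w x * (en G * epowr (w x) (rh - 1))))"
   unfolding G_def using rh by (intro nn_integral_mono mult_left_mono layer_lower) auto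
  also have "... = (NN x. en (2 powr rh * 5 ^ DIM('a) * G) * epowr (w x) rh)"
  proof (rule nn_integral_cong)
   fix x
   have "epowr (w x) rh = w x * epowr (w x) (rh - 1)"
    using epowr_add[of "w x" 1 "rh - 1"] by simp
   then show "en (2 powr rh * 5 ^ DIM('a)) * (w x * (en G * epowr (w x) (rh - 1)))
     = en (2 powr rh * 5 ^ DIM('a) * G) * epowr (w x) rh"
    using G by (simp add: ennreal_mult mult_ac)
  qed
  finally have fin: "(NN x. epowr (X x) rh)
    <= (NN x. en (2 powr rh * 5 ^ DIM('a) * G) * epowr (w x) rh)" .
  have "(NN x. epowr (HL w x) rh) = en ((2 * v) powr rh) * (NN x. epowr (X x) rh)"
   unfolding HLX using v by (simp add: epowr_mult nn_integral_cmult)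
  also have "... <= en ((2 * v) powr rh) * (NN x. en (2 powr rh * 5 ^ DIM('a) * G) * epowr (w x) rh)"
   by (intro mult_left_mono fin) auto
  also have "... = en B * (NN x. epowr (w x) rh)"
   unfolding B_def using G v by (simp add: nn_integral_cmult ennreal_mult mult.assoc)
  finally show ?thesis .
 qed
 with B show ?thesis by blast
qed

text \<open>The maximal function in the sense of power means of order v; it is bounded on L^rh for
  rh > v because \<open>HL\<close> is bounded on L^(rh / v).\<close>

definition HLv :: "real => ('a::euclidean_space => ennreal) => 'a => ennreal" where
 "HLv v w x = epowr (HL (%y. epowr (w y) v) x) (1 / v)"

lemma borel_measurable_HLv:
 assumes "w : LM"
 shows "HLv v w : LM"
 using borel_measurable_epowr[OF borel_measurable_HL[OF borel_measurable_epowr[OF assms]]]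
 by (simp add: HLv_def[abs_def])

lemma HLv_strong_type:
 fixes rh v :: real
 assumes "0 < v" "v < rh"
 shows "EX B>0. \<forall>w\<in>borel_measurable (lborel :: 'a::euclidean_space measure).
   (NN x. epowr (HLv v w x) rh) <= en B * (NN x. epowr (w x) rh)"
proof -
 have "1 < rh / v" using assms by simp
 from HL_strong_type[OF this, where 'a='a] obtain B where B: "B > 0"
  and *: "!!w. w : borel_measurable (lborel :: 'a measure) ==>
   (NN x. epowr (HL w x) (rh / v)) <= en B * (NN x. epowr (w x) (rh / v))" by blast
 show ?thesis
 proof (intro exI conjI ballI)
  show "B > 0" by fact
  fix w :: "'a => ennreal" assume [measurable]: "w : LM"
  show "(NN x. epowr (HLv v w x) rh) <= en B * (NN x. epowr (w x) rh)"
   using *[of "%y. epowr (w y) v"] assms by (simp add: HLv_def epowr_epowr)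
 qed
qed

lemma nn_integral_ball_le_HLv:
 fixes w :: "'a::euclidean_space => ennreal"
 assumes "0 < v"
 shows "epowr (NN y. indicator (ball x (tp i)) y * epowr (w y) v) (1 / v)
   <= en (2 powr (rint i * real DIM('a) / v)) * HLv v w x"
 using epowr_mono[OF _ nn_integral_ball_le_HL, of "1/v" x i "%y. epowr (w y) v"] assms
 by (simp add: HLv_def epowr_mult powr_powr)

section \<open>Convolution with block kernels\<close>

text \<open>The bound on H_j says that its L^u norm is at most c_j 2^(-R_j d (1 - 1/u)): c_j
  measures the block after rescaling the ball of radius 2^R_j to unit size. The scales are arbitrary
  and only the sum of the c_j counts, so the notion is invariant under L^1-normalized dyadic
  dilations. Positivity of c_j allows division by it in \<open>sum_power_le\<close>.\<close>

definition block_kernel :: "real => real => ('a::euclidean_space => ennreal) => bool" where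
 "block_kernel u A h \<longleftrightarrow> (\<exists>(c :: nat => real) (R :: nat => int) H.
   (ALL j. H j : LM & 0 < c j & (ALL y. H j y ~= 0 --> norm y < 2 powr rint (R j)) &
     (NN y. epowr (H j y) u)
      <= en (c j powr u * 2 powr (- (rint (R j) * real DIM('a) * (u - 1))))) &
   (\<Sum>j. en (c j)) <= en A & (ALL y. h y <= (\<Sum>j. H j y)))"

locale block =
 fixes G :: "'a::euclidean_space => ennreal" and u c :: real and R :: int
 assumes G [measurable]: "G : LM" and u: "1 < u" and c: "0 < c"
  and supp: "!!y. G y ~= 0 ==> norm y < tp R"
  and Gu: "(NN y. epowr (G y) u)
      <= en (c powr u * 2 powr (- (rint R * real DIM('a) * (u - 1))))"
begin

lemma G_borel [measurable]: "G : BM"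
 using G by simp

lemma reflect: "block (%y. G (- y)) u c R"
proof
 show "(NN y. epowr (G (- y)) u) <= en (c powr u * 2 powr (- (rint R * real DIM('a) * (u - 1))))"
  using Gu nn_reflect[of "%y. epowr (G y) u" 0] by simp
qed (use u c supp in "auto dest: supp")

text \<open>Hoelder on the ball supporting the block, with G^ga in L^(u / ga) and w in the conjugate
  exponent 1 / (1 - ga / u), which becomes the order of the maximal function. A power of the scale
  with exponent proportional to 1 - ga is left over.\<close>

lemma conv_power_le:
 assumes [measurable]: "w : LM" and ga: "0 < ga" "ga < u"
 shows "nnconv (%y. epowr (G y) ga) w x
   <= en (c powr ga * 2 powr (rint R * real DIM('a) * (1 - ga))) * HLv (1 / (1 - ga / u)) w x"
proof -
 have [measurable]: "w : BM" using assms by simp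
 define th where "th = ga / u"
 define v where "v = 1 / (1 - th)"
 have th: "0 < th" "th < 1" using ga u by (auto simp: th_def)
 have v: "v > 0" "1 / v = 1 - th" "v * (1 - th) = 1" using th by (auto simp: v_def)
 let ?B = "ball x (tp R)"
 have "nnconv (%y. epowr (G y) ga) w x
   <= (NN y. epowr (epowr (G (x - y)) u) th * epowr (indicator ?B y * epowr (w y) v) (1 - th))"
  unfolding nnconv_def
 proof (rule nn_integral_mono)
  fix y
  have 1: "epowr (epowr (G (x - y)) u) th = epowr (G (x - y)) ga"
   using u by (simp add: epowr_epowr th_def)
  have 2: "epowr (indicator ?B y * epowr (w y) v) (1 - th) = indicator ?B y * w y"
   using v by (auto simp: epowr_mult epowr_epowr indicator_def)
  show "epowr (G (x - y)) ga * w y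
    <= epowr (epowr (G (x - y)) u) th * epowr (indicator ?B y * epowr (w y) v) (1 - th)"
   unfolding 1 2 using supp[of "x - y"]
   by (cases "G (x - y) = 0") (auto simp: dist_norm)
 qed
 also have "... <= epowr (NN y. epowr (G (x - y)) u) th *
    epowr (NN y. indicator ?B y * epowr (w y) v) (1 - th)"
  by (rule holder_epowr) (use th in auto)
 also have "(NN y. epowr (G (x - y)) u) = (NN y. epowr (G y) u)"
  by (rule nn_reflect) measurable
 also have "epowr (NN y. epowr (G y) u) th * epowr (NN y. indicator ?B y * epowr (w y) v) (1 - th)
  <= epowr (en (c powr u * 2 powr (- (rint R * real DIM('a) * (u - 1))))) th *
    (en (2 powr (rint R * real DIM('a) / v)) * HLv v w x)"
  unfolding v(2)[symmetric] using th Gu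
  by (intro mult_mono epowr_mono nn_integral_ball_le_HLv v) auto
 also have "... = en ((c powr u * 2 powr (- (rint R * real DIM('a) * (u - 1)))) powr th *
    2 powr (rint R * real DIM('a) / v)) * HLv v w x"
  by (subst epowr_ennreal, simp, subst ennreal_mult) (simp_all only: mult.assoc zero_le powr_ge_zero)
 also have "(c powr u * 2 powr (- (rint R * real DIM('a) * (u - 1)))) powr th *
    2 powr (rint R * real DIM('a) / v) = c powr ga * 2 powr (rint R * real DIM('a) * (1 - ga))"
 proof -
  have uth: "u * th = ga" using u by (simp add: th_def)
  have "(2 powr (- (rint R * real DIM('a) * (u - 1)))) powr th * 2 powr (rint R * real DIM('a) / v)
    = 2 powr (- (rint R * real DIM('a) * (u - 1)) * th + rint R * real DIM('a) * (1 - th))"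
   unfolding powr_powr powr_add v(2)[symmetric] by simp
  also have "- (rint R * real DIM('a) * (u - 1)) * th + rint R * real DIM('a) * (1 - th)
    = rint R * real DIM('a) * (1 - u * th)" by (simp add: algebra_simps)
  finally show ?thesis unfolding uth using c by (simp add: powr_mult powr_powr uth)
 qed
 finally show ?thesis unfolding v_def th_def .
qed

text \<open>Write G = G^u G^(1 - u) and use Jensen with the density G^u, whose mass is known. This
  leaves a linear convolution with G^be, be = u + (1 - u) q, which is moved onto the weight. The
  powers of the scale from both steps cancel since 1 - be = (q - 1) (u - 1).\<close>

lemma conv_weighted_le:
 assumes [measurable]: "f : LM" "w : LM"
  and q: "1 <= q" and be: "be = q - u * (q - 1)" "0 < be"
 shows "(NN x. epowr (nnconv G f x) q * w x)
   <= en (c powr q) * (NN y. epowr (f y) q * HLv (1 / (1 - be / u)) w y)"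
proof -
 have [measurable]: "f : BM" "w : BM" using assms by simp_all
 define A where "A = c powr u * 2 powr (- (rint R * real DIM('a) * (u - 1)))"
 have A: "A > 0" using c by (simp add: A_def)
 define C where "C = c powr be * 2 powr (rint R * real DIM('a) * (1 - be))"
 have beu: "be < u"
 proof -
  have "q < u * q" using u q by simp
  then show ?thesis by (simp add: be(1) algebra_simps)
 qed
 have 1: "epowr (nnconv G f x) q <= en (A powr (q - 1)) * nnconv (%y. epowr (G y) be) (%y. epowr (f y) q) x" for x
 proof -
  have "nnconv G f x = (NN y. epowr (G (x - y)) u * (epowr (G (x - y)) (1 - u) * f y))"
   unfolding nnconv_def
  proof (rule nn_integral_cong)
   fix y
   have "G (x - y) = epowr (G (x - y)) u * epowr (G (x - y)) (1 - u)"
    using epowr_add[of "G (x - y)" u "1 - u"] by simp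
   then show "G (x - y) * f y = epowr (G (x - y)) u * (epowr (G (x - y)) (1 - u) * f y)"
    by (metis mult.assoc)
  qed
  also have "epowr ... q <= en (A powr (q - 1)) *
    (NN y. epowr (G (x - y)) u * epowr (epowr (G (x - y)) (1 - u) * f y) q)"
  proof (rule jensen_epowr)
   have "(NN y. epowr (G (x - y)) u) = (NN y. epowr (G y) u)"
    by (rule nn_reflect) measurable
   then show "(NN y. epowr (G (x - y)) u) <= en A" using Gu by (simp add: A_def)
  qed (use q A in auto)
  also have "(NN y. epowr (G (x - y)) u * epowr (epowr (G (x - y)) (1 - u) * f y) q)
    = nnconv (%y. epowr (G y) be) (%y. epowr (f y) q) x"
   unfolding nnconv_def
  proof (rule nn_integral_cong)
   fix y
   have "be = u + (1 - u) * q" using be by (simp add: algebra_simps)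
   then show "epowr (G (x - y)) u * epowr (epowr (G (x - y)) (1 - u) * f y) q = epowr (G (x - y)) be * epowr (f y) q"
    by (simp add: epowr_mult epowr_epowr epowr_add mult.assoc)
  qed
  finally show ?thesis .
 qed
 have "(NN x. epowr (nnconv G f x) q * w x)
   <= (NN x. en (A powr (q - 1)) * (nnconv (%y. epowr (G y) be) (%y. epowr (f y) q) x * w x))"
  using 1 by (intro nn_integral_mono) (simp add: mult.assoc[symmetric] mult_right_mono)
 also have "... = en (A powr (q - 1)) * (NN x. nnconv (%y. epowr (G y) be) (%y. epowr (f y) q) x * w x)"
  by (intro nn_integral_cmult borel_measurable_times_ennreal meas_nnconv) measurable
 also have "(NN x. nnconv (%y. epowr (G y) be) (%y. epowr (f y) q) x * w x)
   = (NN y. epowr (f y) q * nnconv (%y. epowr (G (- y)) be) w y)"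
  by (rule nn_nnconv_mult) measurable
 also have "... <= (NN y. en C * (epowr (f y) q * HLv (1 / (1 - be / u)) w y))"
 proof (rule nn_integral_mono)
  fix y
  interpret r: block "%y. G (- y)" u c R by (rule reflect)
  show "epowr (f y) q * nnconv (%y. epowr (G (- y)) be) w y <= en C * (epowr (f y) q * HLv (1 / (1 - be / u)) w y)"
   using mult_left_mono[OF r.conv_power_le[of w be y], of "epowr (f y) q"] be beu
   by (simp add: C_def mult_ac)
 qed
 also have "... = en C * (NN y. epowr (f y) q * HLv (1 / (1 - be / u)) w y)"
  by (intro nn_integral_cmult borel_measurable_times_ennreal borel_measurable_HLv) measurable
 also have "en (A powr (q - 1)) * (en C * (NN y. epowr (f y) q * HLv (1 / (1 - be / u)) w y))
   = en (c powr q) * (NN y. epowr (f y) q * HLv (1 / (1 - be / u)) w y)"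
 proof -
  have "A powr (q - 1) * C = c powr (u * (q - 1) + be) *
    2 powr (- (rint R * real DIM('a) * (u - 1)) * (q - 1) + rint R * real DIM('a) * (1 - be))"
  proof -
   have "A powr (q - 1) = c powr (u * (q - 1)) * 2 powr (- (rint R * real DIM('a) * (u - 1)) * (q - 1))"
    unfolding A_def using c by (simp add: powr_mult powr_powr)
   then show ?thesis unfolding C_def powr_add by (simp only: mult_ac)
  qed
  also have "u * (q - 1) + be = q" using be by simp
  also have "- (rint R * real DIM('a) * (u - 1)) * (q - 1) + rint R * real DIM('a) * (1 - be) = 0"
   unfolding be(1) by (simp add: algebra_simps)
  finally show ?thesis by (simp add: C_def flip: mult.assoc ennreal_mult)
 qed
 finally show ?thesis by (simp add: mult_left_mono)
qed

text \<open>The counterpart for large q. Hoelder gives G^(u/q) to the factor g and G^(ga (1 - 1/q))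
  to the factor w; the exponent ga is forced by u/q + ga (1 - 1/q) = 1. The first factor becomes a
  convolution with the integrable function G^u, the second a maximal function of w.\<close>

lemma conv_factored_le:
 assumes [measurable]: "f : LM" "g : LM" "w : LM"
  and q: "u < q" and ga: "ga = (q - u) / (q - 1)"
  and fac: "!!y. f y <= epowr (g y) (1/q) * epowr (w y) (1 - 1/q)"
 shows "epowr (nnconv G f x) q
   <= en (c powr (q - u) * 2 powr (rint R * real DIM('a) * (u - 1))) * nnconv (%y. epowr (G y) u) g x
    * epowr (HLv (1 / (1 - ga / u)) w x) (q - 1)"
proof -
 have [measurable]: "f : BM" "w : BM" "g : BM"
  using assms by simp_all
 have q1: "1 < q" using q u by simp
 have gab: "0 < ga" "ga < 1" "ga < u" using q u by (auto simp: ga field_simps)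
 have e: "1 = u * (1/q) + ga * (1 - 1/q)"
  using q1 by (simp add: ga field_simps)
 have "nnconv G f x
   <= (NN y. epowr (epowr (G (x - y)) u * g y) (1/q) * epowr (epowr (G (x - y)) ga * w y) (1 - 1/q))"
  unfolding nnconv_def
 proof (rule nn_integral_mono)
  fix y
  have "G (x - y) = epowr (G (x - y)) (u * (1/q)) * epowr (G (x - y)) (ga * (1 - 1/q))"
   unfolding epowr_add[symmetric] e[symmetric] by simp
  then have "G (x - y) * f y <= epowr (G (x - y)) (u * (1/q)) * epowr (G (x - y)) (ga * (1 - 1/q)) *
    (epowr (g y) (1/q) * epowr (w y) (1 - 1/q))"
   using mult_left_mono[OF fac[of y], of "G (x - y)"] by simp
  then show "G (x - y) * f y
   <= epowr (epowr (G (x - y)) u * g y) (1/q) * epowr (epowr (G (x - y)) ga * w y) (1 - 1/q)"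
   by (simp only: epowr_mult epowr_epowr mult_ac)
 qed
 also have "... <= epowr (NN y. epowr (G (x - y)) u * g y) (1/q) * epowr (NN y. epowr (G (x - y)) ga * w y) (1 - 1/q)"
  by (rule holder_epowr) (use q1 in auto)
 also have "... = epowr (nnconv (%y. epowr (G y) u) g x) (1/q) * epowr (nnconv (%y. epowr (G y) ga) w x) (1 - 1/q)"
  by (simp add: nnconv_def)
 finally have "epowr (nnconv G f x) q <= epowr (epowr (nnconv (%y. epowr (G y) u) g x) (1/q)
    * epowr (nnconv (%y. epowr (G y) ga) w x) (1 - 1/q)) q"
  using q1 by (intro epowr_mono) auto
 also have "... = nnconv (%y. epowr (G y) u) g x * epowr (nnconv (%y. epowr (G y) ga) w x) (q - 1)"
 proof -
  have "(1 - 1/q) * q = q - 1" using q1 by (simp add: field_simps)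
  then show ?thesis using q1 by (simp add: epowr_mult epowr_epowr)
 qed
 also have "... <= nnconv (%y. epowr (G y) u) g x *
   epowr (en (c powr ga * 2 powr (rint R * real DIM('a) * (1 - ga))) * HLv (1 / (1 - ga / u)) w x) (q - 1)"
  using q1 gab by (intro mult_left_mono epowr_mono conv_power_le) auto
 also have "... = en ((c powr ga * 2 powr (rint R * real DIM('a) * (1 - ga))) powr (q - 1)) *
   nnconv (%y. epowr (G y) u) g x * epowr (HLv (1 / (1 - ga / u)) w x) (q - 1)"
  by (simp add: epowr_mult mult_ac)
 also have "(c powr ga * 2 powr (rint R * real DIM('a) * (1 - ga))) powr (q - 1)
   = c powr (q - u) * 2 powr (rint R * real DIM('a) * (u - 1))"
 proof -
  have "ga * (q - 1) = q - u" "(1 - ga) * (q - 1) = u - 1"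
   using q1 by (auto simp: ga field_simps)
  then show ?thesis using c by (simp add: powr_mult powr_powr mult.assoc)
 qed
 finally show ?thesis .
qed

end

text \<open>Jensen for the measure with masses c_j, applied to Y_j / c_j. Unlike Minkowski's
  inequality this acts pointwise on the q-th power, so it can be integrated against a weight
  afterwards.\<close>

lemma sum_power_le:
 fixes c :: "nat => real"
 assumes "!!j. 0 < c j" "(\<Sum>j. en (c j)) <= en A" "0 < A" "1 <= q"
 shows "epowr (\<Sum>j. Y j) q <= en (A powr (q - 1)) * (\<Sum>j. en (c j powr (1 - q)) * epowr (Y j) q)"
proof -
 have c: "Y j = en (c j) * (en (1 / c j) * Y j)" for j
  using assms(1)[of j] by (simp add: less_imp_le flip: mult.assoc ennreal_mult)
 have "epowr (\<Sum>j. Y j) q = epowr (CC j. en (c j) * (en (1 / c j) * Y j)) q"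
  by (subst c) (simp add: nn_integral_count_space_nat)
 also have "... <= en (A powr (q - 1)) *
   (CC j. en (c j) * epowr (en (1 / c j) * Y j) q)"
  by (rule jensen_epowr) (use assms in "auto simp: nn_integral_count_space_nat")
 also have "(CC j. en (c j) * epowr (en (1 / c j) * Y j) q)
   = (\<Sum>j. en (c j powr (1 - q)) * epowr (Y j) q)"
  unfolding nn_integral_count_space_nat
 proof (intro arg_cong[where f=suminf] ext)
  fix j
  have "c j * (1 / c j) powr q = c j powr (1 - q)"
   using assms(1)[of j] by (simp add: powr_divide powr_diff)
  then show "en (c j) * epowr (en (1 / c j) * Y j) q = en (c j powr (1 - q)) * epowr (Y j) q"
   using assms(1)[of j] by (simp add: epowr_mult less_imp_le flip: mult.assoc ennreal_mult)
 qed
 finally show ?thesis .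
qed

lemma block_kernelE:
 fixes h :: "'a::euclidean_space => ennreal"
 assumes "block_kernel u A h" "1 < u"
 obtains c R H where "!!j :: nat. block (H j) u (c j) (R j)" "(\<Sum>j. en (c j)) <= en A" "0 < A"
  "!!f x. f : LM ==> nnconv h f x <= (\<Sum>j. nnconv (H j) f x)"
proof -
 obtain c R H where *: "!!j. H j : borel_measurable (lborel :: 'a measure)" "!!j. 0 < c j"
   "!!j y. H j y ~= 0 --> norm y < 2 powr rint (R j)"
   "!!j. (NN y. epowr (H j y) u)
      <= en (c j powr u * 2 powr (- (rint (R j) * real DIM('a) * (u - 1))))"
   and A: "(\<Sum>j. en (c j)) <= en A" and hH: "!!y. h y <= (\<Sum>j. H j y)"
  using assms(1) unfolding block_kernel_def by blast
 \<comment> \<open>Positivity of A, used by Jensen's inequality, is inherited from c_0.\<close>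
 have "en (c 0) <= en A"
  using A sum_le_suminf[of "%j. en (c j)" "{0}"] by auto
 then have A0: "0 < A" using *(2)[of 0] order_less_le_trans[of 0 "en (c 0)" "en A"] by simp
 have [measurable]: "H j : BM" for j using *(1)[of j] by simp
 have conv: "nnconv h f x <= (\<Sum>j. nnconv (H j) f x)" if "f : LM" for f x
 proof -
  have [measurable]: "f : BM" using that by simp
  have "nnconv h f x <= (NN y. (\<Sum>j. H j (x - y)) * f y)"
   unfolding nnconv_def by (intro nn_integral_mono mult_right_mono hH) auto
  also have "... = (NN y. (\<Sum>j. H j (x - y) * f y))" by simp
  also have "... = (\<Sum>j. nnconv (H j) f x)"
   unfolding nnconv_def by (rule nn_integral_suminf) measurable
  finally show ?thesis .
 qed
 show ?thesis
  by (rule that[of H c R, OF _ A A0 conv]) (use * assms(2) in "auto simp: block_def")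
qed

lemma block_kernel_pos: "block_kernel u A h ==> 1 < u ==> 0 < A"
 by (erule block_kernelE)

lemma block_kernel_conv_le:
 assumes h: "block_kernel u A h" and u: "1 < u" and [measurable]: "f : LM"
 shows "nnconv h f x <= en A * HLv (1 / (1 - 1 / u)) f x"
proof -
 obtain c R H where b: "!!j :: nat. block (H j) u (c j) (R j)" and A: "(\<Sum>j. en (c j)) <= en A"
  and conv: "!!f x. f : LM ==> nnconv h f x <= (\<Sum>j. nnconv (H j) f x)"
  using block_kernelE[OF h u] by metis
 have "nnconv h f x <= (\<Sum>j. nnconv (H j) f x)" by (rule conv) simp
 also have "... <= (\<Sum>j. en (c j) * HLv (1 / (1 - 1 / u)) f x)"
 proof (rule suminf_le)
  fix j interpret block "H j" u "c j" "R j" by (rule b)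
  \<comment> \<open>For ga = 1 the power of the scale is trivial, so blocks of all scales add
    up.\<close>
  show "nnconv (H j) f x <= en (c j) * HLv (1 / (1 - 1 / u)) f x"
   using conv_power_le[of f 1 x] u c by simp
 qed auto
 also have "... <= en A * HLv (1 / (1 - 1 / u)) f x" using A by (simp add: mult_right_mono)
 finally show ?thesis .
qed

text \<open>The weight c_j^(1 - q) from Jensen meets the constant c_j^q of one block, and what is
  left is the sum of the c_j. The maximal function does not depend on j, so it factors out.\<close>

lemma block_kernel_weighted_le:
 assumes h: "block_kernel u A h" and u: "1 < u"
  and [measurable]: "f : LM" "w : LM"
  and q: "1 <= q" and be: "be = q - u * (q - 1)" "0 < be"
  and [measurable]: "h : LM"
 shows "(NN x. epowr (nnconv h f x) q * w x)
   <= en (A powr q) * (NN y. epowr (f y) q * HLv (1 / (1 - be / u)) w y)" (is "_ <= _ * ?I")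
proof -
 obtain c R H where b: "!!j :: nat. block (H j) u (c j) (R j)" and A: "(\<Sum>j. en (c j)) <= en A" and A0: "0 < A"
  and conv: "!!f x. f : LM ==> nnconv h f x <= (\<Sum>j. nnconv (H j) f x)"
  using block_kernelE[OF h u] by metis
 have c: "0 < c j" for j using b[of j] by (simp add: block_def)
 have [measurable]: "H j : LM" for j using b[of j] by (simp add: block_def)
 have "(NN x. epowr (nnconv h f x) q * w x)
  <= (NN x. en (A powr (q - 1)) * (\<Sum>j. en (c j powr (1 - q)) * (epowr (nnconv (H j) f x) q * w x)))"
 proof (rule nn_integral_mono)
  fix x
  have "epowr (nnconv h f x) q <= epowr (\<Sum>j. nnconv (H j) f x) q"
   using q by (intro epowr_mono conv) auto
  also have "... <= en (A powr (q - 1)) * (\<Sum>j. en (c j powr (1 - q)) * epowr (nnconv (H j) f x) q)"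
   by (rule sum_power_le) (use c A A0 q in auto)
  finally have "epowr (nnconv h f x) q * w x <=
    en (A powr (q - 1)) * (\<Sum>j. en (c j powr (1 - q)) * epowr (nnconv (H j) f x) q) * w x"
   by (rule mult_right_mono) simp
  then show "epowr (nnconv h f x) q * w x <=
    en (A powr (q - 1)) * (\<Sum>j. en (c j powr (1 - q)) * (epowr (nnconv (H j) f x) q * w x))"
   by (simp only: mult.assoc ennreal_suminf_multc[symmetric])
 qed
 also have "... = en (A powr (q - 1)) * (\<Sum>j. en (c j powr (1 - q)) * (NN x. epowr (nnconv (H j) f x) q * w x))"
  by (simp add: nn_integral_cmult nn_integral_suminf)
 also have "... <= en (A powr (q - 1)) * (\<Sum>j. en (c j powr (1 - q)) * (en (c j powr q) * ?I))"
 proof (intro mult_left_mono suminf_le)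
  fix j interpret block "H j" u "c j" "R j" by (rule b)
  show "(NN x. epowr (nnconv (H j) f x) q * w x) <= en (c j powr q) * ?I"
   by (rule conv_weighted_le) (use q be in auto)
 qed auto
 also have "... = en (A powr (q - 1)) * ((\<Sum>j. en (c j)) * ?I)"
 proof -
  have "en (c j powr (1 - q)) * (en (c j powr q) * ?I) = en (c j) * ?I" for j
   using c[of j] by (simp flip: mult.assoc ennreal_mult powr_add)
  then show ?thesis by simp
 qed
 also have "... <= en (A powr (q - 1)) * (en A * ?I)"
  by (intro mult_left_mono mult_right_mono A) auto
 also have "... = en (A powr q) * ?I"
 proof -
  have "A powr (q - 1) * A = A powr q" using A0 powr_add[of A "q - 1" 1] by simp
  then show ?thesis using A0 by (simp flip: mult.assoc ennreal_mult)
 qed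
 finally show ?thesis .
qed

text \<open>The maximal factor depends on \<open>w\<close> only. In a sequence of convolutions with
  a common \<open>w\<close> it is therefore common to all k, and the integrable factors
  \<open>D\<close> can be summed before the next use of Hoelder's inequality.\<close>

lemma block_kernel_factored_le:
 fixes h :: "'a::euclidean_space => ennreal"
 assumes h: "block_kernel u A h" and u: "1 < u"
  and [measurable]: "f : LM" "g : LM" "w : LM"
  and q: "u < q" and ga: "ga = (q - u) / (q - 1)"
  and fac: "!!y. f y <= epowr (g y) (1/q) * epowr (w y) (1 - 1/q)"
 shows "\<exists>D\<in>borel_measurable lborel. (ALL x. epowr (nnconv h f x) q <= D x * epowr (HLv (1 / (1 - ga / u)) w x) (q - 1)) &
   (NN x. D x) <= en (A powr q) * (NN x. g x)"
proof -
 obtain c R H where b: "!!j :: nat. block (H j) u (c j) (R j)" and A: "(\<Sum>j. en (c j)) <= en A" and A0: "0 < A"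
  and conv: "!!f x. f : LM ==> nnconv h f x <= (\<Sum>j. nnconv (H j) f x)"
  using block_kernelE[OF h u] by metis
 have c: "0 < c j" for j using b[of j] by (simp add: block_def)
 have [measurable]: "H j : LM" for j using b[of j] by (simp add: block_def)
 have q1: "1 < q" using q u by simp
 define E where "E j = c j powr (q - u) * 2 powr (rint (R j) * real DIM('a) * (u - 1))" for j
 define K where "K j = nnconv (%y. epowr (H j y) u) g" for j
 have [measurable]: "K j : LM" for j
  unfolding K_def by (rule meas_nnconv) measurable
 define D where "D x = en (A powr (q - 1)) * (\<Sum>j. en (c j powr (1 - q)) * (en (E j) * K j x))" for x
 let ?V = "%x. epowr (HLv (1 / (1 - ga / u)) w x) (q - 1)"
 have "epowr (nnconv h f x) q <= D x * ?V x" for x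
 proof -
  have "epowr (nnconv h f x) q <= epowr (\<Sum>j. nnconv (H j) f x) q"
   using q1 by (intro epowr_mono conv) auto
  also have "... <= en (A powr (q - 1)) * (\<Sum>j. en (c j powr (1 - q)) * epowr (nnconv (H j) f x) q)"
   by (rule sum_power_le) (use c A A0 q1 in auto)
  also have "... <= en (A powr (q - 1)) * (\<Sum>j. en (c j powr (1 - q)) * (en (E j) * K j x * ?V x))"
  proof (intro mult_left_mono suminf_le)
   fix j interpret block "H j" u "c j" "R j" by (rule b)
   show "epowr (nnconv (H j) f x) q <= en (E j) * K j x * ?V x"
    unfolding E_def K_def by (rule conv_factored_le) (use q ga fac in auto)
  qed auto
  also have "... = D x * ?V x"
   unfolding D_def by (simp only: mult.assoc ennreal_suminf_multc[symmetric])
  finally show ?thesis .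
 qed
 moreover have "(NN x. D x) <= en (A powr q) * (NN x. g x)"
 proof -
  have "(NN x. D x) = en (A powr (q - 1)) * (\<Sum>j. en (c j powr (1 - q)) * (en (E j) * (NN x. K j x)))"
   unfolding D_def by (simp add: nn_integral_cmult nn_integral_suminf)
  also have "... <= en (A powr (q - 1)) * (\<Sum>j. en (c j) * (NN x. g x))"
  proof (intro mult_left_mono suminf_le)
   fix j interpret block "H j" u "c j" "R j" by (rule b)
   let ?M = "c j powr u * 2 powr (- (rint (R j) * real DIM('a) * (u - 1)))"
   have "(NN x. K j x) = (NN x. epowr (H j x) u) * (NN x. g x)"
    unfolding K_def by (rule nn_nnconv) measurable
   also have "... <= en ?M * (NN x. g x)"
    by (intro mult_right_mono Gu) auto
   finally have "en (c j powr (1 - q)) * (en (E j) * (NN x. K j x))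
    <= en (c j powr (1 - q)) * (en (E j) * (en ?M * (NN x. g x)))"
    by (intro mult_left_mono) auto
   also have "... = en (c j powr (1 - q) * (E j * ?M)) * (NN x. g x)"
    unfolding E_def by (simp add: ennreal_mult mult.assoc)
   \<comment> \<open>Jensen's weight, the factor from Hoelder and the L^u mass of the block multiply
     to c_j; the powers of the scale cancel.\<close>
   also have "c j powr (1 - q) * (E j * ?M) = c j"
   proof -
    have "c j powr (1 - q) * (E j * ?M) = (c j powr (1 - q) * c j powr (q - u) * c j powr u) *
      (2 powr (rint (R j) * real DIM('a) * (u - 1)) * 2 powr (- (rint (R j) * real DIM('a) * (u - 1))))"
     unfolding E_def by (simp only: mult_ac)
    also have "... = c j" using c by (simp flip: powr_add)
    finally show ?thesis .
   qed
   finally show "en (c j powr (1 - q)) * (en (E j) * (NN x. K j x)) <= en (c j) * (NN x. g x)" .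
  qed auto
  also have "... <= en (A powr (q - 1)) * (en A * (NN x. g x))"
   using A by (simp add: mult_left_mono mult_right_mono)
  also have "... = en (A powr q) * (NN x. g x)"
  proof -
   have "A powr (q - 1) * A = A powr q" using A0 powr_add[of A "q - 1" 1] by simp
   then show ?thesis using A0 by (simp flip: mult.assoc ennreal_mult)
  qed
  finally show ?thesis .
 qed
 moreover have "D : LM" unfolding D_def by measurable
 ultimately show ?thesis by blast
qed

section \<open>Block kernels acting on sequences in L^p(l^q), norms taken to the power p\<close>

definition mixed_int :: "real => real => (int => 'a::euclidean_space => ennreal) => ennreal" where
 "mixed_int p q f = (NN x. epowr (CC k. epowr (f k x) q) (p / q))"

definition mixed_sup :: "real => (int => 'a::euclidean_space => ennreal) => ennreal" where
 "mixed_sup p f = (NN x. epowr (SUP k. f k x) p)"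

text \<open>The sum of the q-th powers is tested against a weight in L^rh, rh the conjugate of p /
  q. One weighted block bound per k leaves \<open>HLv v w\<close> with 1 / v = q (1 - 1/u), and the
  first condition on u says v < rh. The second makes the exponent \<open>be\<close>
  positive.\<close>

lemma block_bound_less:
 fixes p q u :: real
 assumes q: "1 <= q" "q < p" and u: "1 < u" and a: "1/q - 1/p < 1 - 1/u" "1 - 1/u < 1/q"
 shows "EX C>0. \<forall>A (h :: int => 'a::euclidean_space => ennreal) f.
   (ALL k. block_kernel u A (h k) & h k : LM & f k : LM) -->
   mixed_int p q (%k. nnconv (h k) (f k)) <= en (C * A powr p) * mixed_int p q f"
proof -
 define be where "be = q - u * (q - 1)"
 define v where "v = 1 / (1 - be / u)"
 define P where "P = p / q"
 define rh where "rh = P / (P - 1)"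
 have P: "1 < P" using q by (simp add: P_def)
 have be: "0 < be"
 proof -
  have "u * q * (1 - 1/u) < u * q * (1 / q)" using a u q by (intro mult_strict_left_mono) auto
  then show ?thesis using u q by (simp add: be_def algebra_simps)
 qed
 have iv: "1 - be / u = q * (1 - 1/u)" using u by (simp add: be_def field_simps)
 have v0: "0 < v" unfolding v_def iv using u q by simp
 have "1 / rh < q * (1 - 1/u)"
 proof -
  have "1 / rh = q * (1/q - 1/p)" using q P by (simp add: rh_def P_def field_simps)
  then show ?thesis using mult_strict_left_mono[OF a(1), of q] q by simp
 qed
 moreover have rh: "0 < rh" using P by (simp add: rh_def)
 ultimately have vrh: "v < rh" unfolding v_def iv using u q by (simp add: field_simps)
 obtain B where B: "B > 0" and HB: "!!w. w : borel_measurable (lborel :: 'a measure) ==>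
   (NN x. epowr (HLv v w x) rh) <= en B * (NN x. epowr (w x) rh)"
  using HLv_strong_type[OF v0 vrh] by blast
 define C where "C = (B powr (1 - 1/P)) powr P"
 have C: "C > 0" using B by (simp add: C_def)
 have "mixed_int p q (%k. nnconv (h k) (f k)) <= en (C * A powr p) * mixed_int p q f"
  if h: "!!k. block_kernel u A (h k)" and [measurable]: "!!k. h k : LM" "!!k. f k : LM"
  for A and h f :: "int => 'a => ennreal"
 proof -
  have A: "A > 0" using h[of 0] u by (rule block_kernel_pos)
  define S where "S x = (CC k. epowr (nnconv (h k) (f k) x) q)" for x
  define F where "F x = (CC k. epowr (f k x) q)" for x
  have [measurable]: "S : LM" "F : LM"
   unfolding S_def F_def by measurable
  have mF: "mixed_int p q f = (NN x. epowr (F x) P)"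
   by (simp add: mixed_int_def F_def P_def)
  have mS: "mixed_int p q (%k. nnconv (h k) (f k)) = (NN x. epowr (S x) P)"
   by (simp add: mixed_int_def S_def P_def)
  show ?thesis
  \<comment> \<open>\<open>dual_bound\<close> works with a real constant, so an infinite right-hand
    side is settled beforehand.\<close>
  proof (cases "mixed_int p q f = top")
   case True
   have "en (C * A powr p) ~= 0" using C A by (simp add: ennreal_eq_0_iff not_le)
   then show ?thesis unfolding True by (simp only: ennreal_mult_top if_False top_greatest)
  next
   case False
   then obtain I where I: "mixed_int p q f = en I" "0 <= I" by (metis ennreal_cases)
   define C0 where "C0 = A powr q * I powr (1/P) * B powr (1 - 1/P)"
   have "(NN x. epowr (S x) P) <= en (C0 powr P)"
   proof (rule dual_bound)
    fix w :: "'a => ennreal" assume w [measurable]: "w : LM"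
    have [measurable]: "HLv v w : LM" by (rule borel_measurable_HLv) fact
    have "(NN x. S x * w x) = (NN x. (CC k. epowr (nnconv (h k) (f k) x) q * w x))"
     unfolding S_def by (simp add: nn_integral_multc)
    also have "... = (CC k. (NN x. epowr (nnconv (h k) (f k) x) q * w x))"
     by (rule count_int_swap) measurable
    also have "... <= (CC k. en (A powr q) * (NN x. epowr (f k x) q * HLv v w x))"
     unfolding v_def
     by (intro nn_integral_mono block_kernel_weighted_le h u) (use q be in "auto simp: be_def")
    also have "... = en (A powr q) * (CC k. (NN x. epowr (f k x) q * HLv v w x))"
     by (rule nn_integral_cmult) simp
    also have "(CC k. (NN x. epowr (f k x) q * HLv v w x))
      = (NN x. F x * HLv v w x)"
     unfolding F_def by (subst count_int_swap[symmetric]) (auto simp: nn_integral_multc)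
    also have "... = (NN x. epowr (epowr (F x) P) (1/P) * epowr (epowr (HLv v w x) rh) (1 - 1/P))"
    proof -
     have "rh * (1 - 1/P) = 1" using P by (simp add: rh_def field_simps)
     then show ?thesis using P by (simp add: epowr_epowr)
    qed
    also have "... <= epowr (NN x. epowr (F x) P) (1/P) * epowr (NN x. epowr (HLv v w x) rh) (1 - 1/P)"
     by (rule holder_epowr) (use P in auto)
    also have "... <= epowr (en I) (1/P) * epowr (en B * (NN x. epowr (w x) rh)) (1 - 1/P)"
     using P I mF by (intro mult_mono epowr_mono HB w) auto
    also have "... = en (I powr (1/P) * B powr (1 - 1/P)) * epowr (NN x. epowr (w x) (P / (P - 1))) (1 - 1/P)"
     using I B by (simp add: epowr_mult ennreal_mult mult.assoc rh_def)
    finally show "(NN x. S x * w x) <= en C0 * epowr (NN x. epowr (w x) (P / (P - 1))) (1 - 1/P)"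
     unfolding C0_def by (simp add: ennreal_mult mult.assoc mult_left_mono)
   qed (use P in "auto simp: C0_def")
   also have "C0 powr P = C * A powr p * I"
   proof -
    have "q * P = p" using q by (simp add: P_def)
    then show ?thesis unfolding C0_def C_def using P I B
     by (simp add: powr_mult powr_powr mult_ac)
   qed
   finally show ?thesis unfolding mS I(1) using C I by (simp add: ennreal_mult)
  qed
 qed
 with C show ?thesis by blast
qed

text \<open>p / q < 1 excludes duality. With F the pointwise l^q norm, f_k is factored as g_k^(1/q)
  w^(1 - 1/q), where the powers of F in w and g_k are chosen such that w^rh and the sum over k of
  g_k both reduce to F^p. The condition v < rh is again the one on u, and a second Hoelder
  inequality with exponent p / q concludes.\<close>

lemma block_bound_greater:
 fixes p q u :: real
 assumes p: "1 < p" "p < q" and u: "1 < u" and a: "1/p - 1/q < 1 - 1/u" "1 - 1/u < 1 - 1/q"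
 shows "EX C>0. \<forall>A (h :: int => 'a::euclidean_space => ennreal) f.
   (ALL k. block_kernel u A (h k) & h k : LM & f k : LM) -->
   mixed_int p q (%k. nnconv (h k) (f k)) <= en (C * A powr p) * mixed_int p q f"
proof -
 define ga where "ga = (q - u) / (q - 1)"
 define v where "v = 1 / (1 - ga / u)"
 define rh where "rh = (q - 1) * p / (q - p)"
 define th where "th = p / q"
 have q: "1 < q" using p by simp
 have uq: "u < q" using a(2) u q by (simp add: field_simps)
 have th: "0 < th" "th < 1" using p by (auto simp: th_def)
 have iv: "1 - ga / u = q / (q - 1) * (1 - 1/u)" using u q by (simp add: ga_def field_simps)
 have v0: "0 < v" unfolding v_def iv using u q by simp
 have rh: "0 < rh" using p q by (simp add: rh_def)
 have "1 / rh < q / (q - 1) * (1 - 1/u)"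
 proof -
  have "1 / rh = q / (q - 1) * (1/p - 1/q)" using p q by (simp add: rh_def field_simps)
  then show ?thesis using mult_strict_left_mono[OF a(1), of "q / (q - 1)"] q by simp
 qed
 then have vrh: "v < rh" unfolding v_def iv using u q rh by (simp add: field_simps)
 obtain B where B: "B > 0" and HB: "!!w. w : borel_measurable (lborel :: 'a measure) ==>
   (NN x. epowr (HLv v w x) rh) <= en B * (NN x. epowr (w x) rh)"
  using HLv_strong_type[OF v0 vrh] by blast
 define C where "C = B powr (1 - th)"
 have C: "C > 0" using B by (simp add: C_def)
 have "mixed_int p q (%k. nnconv (h k) (f k)) <= en (C * A powr p) * mixed_int p q f"
  if h: "!!k. block_kernel u A (h k)" and [measurable]: "!!k. h k : LM" "!!k. f k : LM"
  for A and h f :: "int => 'a => ennreal"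
 proof -
  have A: "A > 0" using h[of 0] u by (rule block_kernel_pos)
  define F where "F x = epowr (CC k. epowr (f k x) q) (1 / q)" for x
  have [measurable]: "F : LM" unfolding F_def by measurable
  have mF: "mixed_int p q f = (NN x. epowr (F x) p)"
   by (simp add: mixed_int_def F_def epowr_epowr)
  define w where "w x = epowr (F x) ((q - p) / (q - 1))" for x
  define g where "g k x = epowr (f k x) q * epowr (F x) (p - q)" for k x
  have w [measurable]: "w : LM" unfolding w_def by measurable
  have [measurable]: "g k : LM" for k unfolding g_def by measurable
  have fac: "f k y <= epowr (g k y) (1/q) * epowr (w y) (1 - 1/q)" for k y
  proof -
   have "(q - p) / (q - 1) * (1 - 1/q) = (q - p) / q" using q by (simp add: field_simps)
   then have "epowr (g k y) (1/q) * epowr (w y) (1 - 1/q)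
     = f k y * (epowr (F y) ((p - q) / q) * epowr (F y) ((q - p) / q))"
    unfolding g_def w_def using q by (simp add: epowr_mult epowr_epowr mult.assoc)
   also have "... = f k y * epowr (F y) 0"
    unfolding epowr_add[symmetric] by (simp add: add_divide_distrib[symmetric])
   finally have *: "epowr (g k y) (1/q) * epowr (w y) (1 - 1/q) = f k y * epowr (F y) 0" .
   have "epowr (f k y) q <= (CC k. epowr (f k y) q)"
    by (rule nn_integral_ge_point) simp
   then have "f k y <= F y" unfolding F_def using q by (simp add: epowr_le_swap)
   \<comment> \<open>Here \<open>epowr F 0\<close> is 1 except at F = 0, where f_k vanishes as well,
     and at F infinite, where the inequality is trivial.\<close>
   then show ?thesis unfolding *
    by (cases "F y") (auto simp: ennreal_mult_top)
  qed
  have "\<exists>D\<in>borel_measurable lborel. (ALL x. epowr (nnconv (h k) (f k) x) q <= D x * epowr (HLv v w x) (q - 1)) &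
   (NN x. D x) <= en (A powr q) * (NN x. g k x)" for k
   unfolding v_def by (rule block_kernel_factored_le) (use h u uq fac in "auto simp: ga_def")
  then obtain D where D [measurable]: "!!k. D k : LM"
   and Dle: "!!k x. epowr (nnconv (h k) (f k) x) q <= D k x * epowr (HLv v w x) (q - 1)"
   and Dint: "!!k. (NN x. D k x) <= en (A powr q) * (NN x. g k x)"
   by metis
  define DD where "DD x = (CC k. D k x)" for x
  have [measurable]: "DD : LM" unfolding DD_def by measurable
  have [measurable]: "HLv v w : LM" by (rule borel_measurable_HLv) fact
  have sum_g: "(CC k. g k x) <= epowr (F x) p" for x
  proof -
   have "(CC k. g k x) = epowr (F x) q * epowr (F x) (p - q)"
    unfolding g_def F_def using q by (simp add: nn_integral_multc epowr_epowr)
   also have "... = epowr (F x) p" unfolding epowr_add[symmetric] by simp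
   finally show ?thesis by simp
  qed
  have intDD: "(NN x. DD x) <= en (A powr q) * mixed_int p q f"
  proof -
   have "(NN x. DD x) = (CC k. (NN x. D k x))"
    unfolding DD_def by (rule count_int_swap) measurable
   also have "... <= (CC k. en (A powr q) * (NN x. g k x))"
    by (intro nn_integral_mono Dint)
   also have "... = en (A powr q) * (CC k. (NN x. g k x))"
    by (rule nn_integral_cmult) simp
   also have "(CC k. (NN x. g k x)) = (NN x. (CC k. g k x))"
    by (rule count_int_swap[symmetric]) measurable
   also have "... <= mixed_int p q f" unfolding mF by (intro nn_integral_mono sum_g)
   finally show ?thesis by (simp add: mult_left_mono)
  qed
  have "mixed_int p q (%k. nnconv (h k) (f k))
    <= (NN x. epowr (DD x) th * epowr (epowr (HLv v w x) rh) (1 - th))"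
   unfolding mixed_int_def
  proof (rule nn_integral_mono)
   fix x
   have "(CC k. epowr (nnconv (h k) (f k) x) q) <=
     (CC k. D k x * epowr (HLv v w x) (q - 1))"
    by (intro nn_integral_mono Dle)
   also have "... = DD x * epowr (HLv v w x) (q - 1)"
    unfolding DD_def by (rule nn_integral_multc) simp
   finally have "epowr (CC k. epowr (nnconv (h k) (f k) x) q) (p / q)
     <= epowr (DD x * epowr (HLv v w x) (q - 1)) th"
    unfolding th_def[symmetric] using th by (intro epowr_mono) auto
   also have "... = epowr (DD x) th * epowr (epowr (HLv v w x) rh) (1 - th)"
   proof -
    have "(q - 1) * th = rh * (1 - th)" using p q by (simp add: th_def rh_def field_simps)
    then show ?thesis by (simp add: epowr_mult epowr_epowr)
   qed
   finally show "epowr (CC k. epowr (nnconv (h k) (f k) x) q) (p / q)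
    <= epowr (DD x) th * epowr (epowr (HLv v w x) rh) (1 - th)" .
  qed
  also have "... <= epowr (NN x. DD x) th * epowr (NN x. epowr (HLv v w x) rh) (1 - th)"
   by (rule holder_epowr) (use th in auto)
  also have "... <= epowr (en (A powr q) * mixed_int p q f) th * epowr (en B * (NN x. epowr (w x) rh)) (1 - th)"
   using th by (intro mult_mono epowr_mono HB intDD w) auto
  also have "(NN x. epowr (w x) rh) = mixed_int p q f"
  proof -
   have "(q - p) / (q - 1) * rh = p" using p q by (simp add: rh_def)
   then show ?thesis by (simp add: mF w_def epowr_epowr)
  qed
  also have "epowr (en (A powr q) * mixed_int p q f) th * epowr (en B * mixed_int p q f) (1 - th)
    = en ((A powr q) powr th * B powr (1 - th)) * (epowr (mixed_int p q f) th * epowr (mixed_int p q f) (1 - th))"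
   using A B by (simp add: epowr_mult ennreal_mult mult_ac)
  also have "epowr (mixed_int p q f) th * epowr (mixed_int p q f) (1 - th) = mixed_int p q f"
   unfolding epowr_add[symmetric] by simp
  also have "(A powr q) powr th * B powr (1 - th) = C * A powr p"
   using p q by (simp add: C_def powr_powr th_def)
  finally show ?thesis .
 qed
 with C show ?thesis by blast
qed

text \<open>All f_k are replaced by their supremum; convolution with a block kernel is then
  dominated by one maximal function of order 1 / (1 - 1/u), which is below p.\<close>

lemma block_bound_sup:
 fixes p u :: real
 assumes p: "1 < p" and u: "1 < u" and a: "1/p < 1 - 1/u"
 shows "EX C>0. \<forall>A (h :: int => 'a::euclidean_space => ennreal) f.
   (ALL k. block_kernel u A (h k) & h k : LM & f k : LM) -->
   mixed_sup p (%k. nnconv (h k) (f k)) <= en (C * A powr p) * mixed_sup p f"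
proof -
 define v where "v = 1 / (1 - 1 / u)"
 have v: "0 < v" "v < p" using a p u by (auto simp: v_def field_simps)
 obtain B where B: "B > 0" and HB: "!!w. w : borel_measurable (lborel :: 'a measure) ==>
   (NN x. epowr (HLv v w x) p) <= en B * (NN x. epowr (w x) p)"
  using HLv_strong_type[OF v] by blast
 have "mixed_sup p (%k. nnconv (h k) (f k)) <= en (B * A powr p) * mixed_sup p f"
  if h: "!!k. block_kernel u A (h k)" and [measurable]: "!!k. h k : LM" "!!k. f k : LM"
  for A and h f :: "int => 'a => ennreal"
 proof -
  have A: "A > 0" using h[of 0] u by (rule block_kernel_pos)
  define F where "F x = (SUP k. f k x)" for x
  have F [measurable]: "F : LM" unfolding F_def by measurable
  have [measurable]: "HLv v F : LM" by (rule borel_measurable_HLv) fact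
  have "(SUP k. nnconv (h k) (f k) x) <= en A * HLv v F x" for x
  proof (rule SUP_least)
   fix k
   have "nnconv (h k) (f k) x <= nnconv (h k) F x"
    by (rule nnconv_mono) (auto simp: F_def intro: SUP_upper)
   also have "... <= en A * HLv v F x"
    unfolding v_def by (rule block_kernel_conv_le[OF h u F])
   finally show "nnconv (h k) (f k) x <= en A * HLv v F x" .
  qed
  then have "mixed_sup p (%k. nnconv (h k) (f k)) <= (NN x. epowr (en A * HLv v F x) p)"
   unfolding mixed_sup_def using p by (intro nn_integral_mono epowr_mono) auto
  also have "... = en (A powr p) * (NN x. epowr (HLv v F x) p)"
   using A by (simp add: epowr_mult nn_integral_cmult)
  also have "... <= en (A powr p) * (en B * (NN x. epowr (F x) p))"
   by (intro mult_left_mono HB F) auto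
  finally show ?thesis using B by (simp add: mixed_sup_def F_def ennreal_mult mult_ac)
 qed
 with B show ?thesis by blast
qed

section \<open>Dyadic lattices\<close>

text \<open>Lower corner of the dyadic cube of side 2^(-k) through x. Cubes become the fibres of a
  measurable map with countable range, which avoids carrying lattice indices around.\<close>

definition corner :: "int => 'a::euclidean_space => 'a" where
 "corner k x = (\<Sum>b\<in>Basis. (tm k * rint \<lfloor>tp k * (x \<bullet> b)\<rfloor>) *\<^sub>R b)"

abbreviation cube :: "int => 'a::euclidean_space => 'a set" where
 "cube k x \<equiv> {y. corner k y = corner k x}"

lemma corner_inner:
 "b : Basis ==> corner k x \<bullet> b = tm k * rint \<lfloor>tp k * (x \<bullet> b)\<rfloor>"
 unfolding corner_def by (simp add: inner_sum_left inner_Basis if_distrib cong: if_cong)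

lemma corner_eq_iff:
 "corner k x = corner k y \<longleftrightarrow>
   (\<forall>b\<in>Basis. \<lfloor>tp k * (x \<bullet> b)\<rfloor> = \<lfloor>tp k * (y \<bullet> b)\<rfloor>)"
 by (simp add: euclidean_eq_iff[where 'a='a] corner_inner)

text \<open>Division by a power of two followed by rounding down is integer division of the floor,
  so a cube of generation k determines the cubes of all coarser generations.\<close>

lemma corner_nested:
 assumes "corner k x = corner k y" "l <= k"
 shows "corner l x = corner l y"
 unfolding corner_eq_iff
proof
 fix b :: 'a assume b: "b : Basis"
 define n where "n = nat (k - l)"
 have *: "\<lfloor>tp l * t\<rfloor> = \<lfloor>tp k * t\<rfloor> div (2 ^ n)" for t
 proof -
  have "tp l = tp k / 2 ^ n"
   using assms(2) by (simp add: n_def powr_realpow[symmetric] powr_diff[symmetric])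
  then have "\<lfloor>tp l * t\<rfloor> = \<lfloor>(tp k * t) / rint (2 ^ n)\<rfloor>" by simp
  also have "... = \<lfloor>tp k * t\<rfloor> div (2 ^ n)"
   by (rule floor_divide_real_eq_div) simp
  finally show ?thesis .
 qed
 show "\<lfloor>tp l * (x \<bullet> b)\<rfloor> = \<lfloor>tp l * (y \<bullet> b)\<rfloor>"
  using assms(1) b unfolding corner_eq_iff * by simp
qed

lemma norm_diff_corner:
 fixes x :: "'a::euclidean_space"
 shows "norm (x - corner k x) <= real DIM('a) * tm k"
proof -
 have "\<bar>(x - corner k x) \<bullet> b\<bar> <= tm k" if b: "b : Basis" for b
 proof -
  let ?t = "tp k * (x \<bullet> b)"
  have "x \<bullet> b = tm k * ?t" by (simp add: powr_minus)
  then have "(x - corner k x) \<bullet> b = tm k * (?t - rint \<lfloor>?t\<rfloor>)"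
   unfolding inner_diff_left corner_inner[OF b] by (simp add: algebra_simps)
  moreover have "\<bar>?t - rint \<lfloor>?t\<rfloor>\<bar> <= 1" by linarith
  ultimately show ?thesis by (simp add: abs_mult mult_left_le)
 qed
 then have "(\<Sum>b\<in>Basis. \<bar>(x - corner k x) \<bullet> b\<bar>) <= (\<Sum>b\<in>(Basis::'a set). tm k)"
  by (intro sum_mono)
 then show ?thesis using norm_le_l1[of "x - corner k x"] by simp
qed

lemma norm_same_cube:
 fixes x y :: "'a::euclidean_space"
 assumes "corner k x = corner k y"
 shows "norm (x - y) <= 2 * real DIM('a) * tm k"
proof -
 have "x - y = (x - corner k x) - (y - corner k y)" using assms by simp
 then have "norm (x - y) <= norm (x - corner k x) + norm (y - corner k y)"
  by (metis norm_triangle_ineq4)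
 then show ?thesis using norm_diff_corner[of x k] norm_diff_corner[of y k] by simp
qed

lemma borel_measurable_corner [measurable]: "corner k : BM"
 unfolding corner_def[abs_def] by measurable

lemma countable_range_corner: "countable (range (corner k :: 'a::euclidean_space => 'a))"
proof -
 have "range (corner k :: 'a => 'a)
   <= (%n. \<Sum>b\<in>Basis. (tm k * rint (n b)) *\<^sub>R b) ` (Pi\<^sub>E Basis (%_. UNIV :: int set))"
 proof
  fix z assume "z : range (corner k :: 'a => 'a)"
  then obtain x where z: "z = corner k x" by auto
  show "z : (%n. \<Sum>b\<in>Basis. (tm k * rint (n b)) *\<^sub>R b) ` (Pi\<^sub>E Basis (%_. UNIV :: int set))"
   unfolding z corner_def
   by (rule image_eqI[of _ _ "restrict (%b. \<lfloor>tp k * (x \<bullet> b)\<rfloor>) Basis"]) auto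
 qed
 moreover have "countable (Pi\<^sub>E (Basis :: 'a set) (%_. UNIV :: int set))"
  by (intro countable_PiE) auto
 ultimately show ?thesis by (meson countable_image countable_subset)
qed

definition cube_constant :: "int => ('a::euclidean_space => 'b) => bool" where
 "cube_constant k f \<longleftrightarrow> (ALL x y. corner k x = corner k y --> f x = f y)"

lemma cube_constantD: "cube_constant k f ==> corner k x = corner k y ==> f x = f y"
 unfolding cube_constant_def by blast

lemma cube_constant_nested: "cube_constant l f ==> l <= k ==> cube_constant k f"
 unfolding cube_constant_def using corner_nested by blast

text \<open>Each preimage is a countable union of cubes, whatever the target sigma-algebra
  is.\<close>

lemma cube_measurable:
 fixes f :: "'a::euclidean_space => 'b"
 assumes "cube_constant k f" "space M = UNIV"
 shows "f : measurable borel M"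
proof (rule measurableI)
 fix A assume "A : sets M"
 have "f -` A \<inter> space borel = (\<Union>z\<in>range (corner k) \<inter> corner k ` (f -` A). corner k -` {z})"
 proof (intro set_eqI iffI)
  fix y assume "y : f -` A \<inter> space borel"
  then show "y : (\<Union>z\<in>range (corner k) \<inter> corner k ` (f -` A). corner k -` {z})"
   by (intro UN_I[of "corner k y"]) auto
 next
  fix y assume "y : (\<Union>z\<in>range (corner k) \<inter> corner k ` (f -` A). corner k -` {z})"
  then obtain z where "z : corner k ` (f -` A)" "y : corner k -` {z}" by (elim UN_E IntE)
  then obtain x where x: "f x : A" "corner k y = corner k x" by (elim imageE) simp
  have "f y = f x" by (rule cube_constantD[OF assms(1) x(2)])
  with x show "y : f -` A \<inter> space borel" by simp
 qed
 also have "... : sets borel"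
 proof (rule sets.countable_UN'')
  show "countable (range (corner k) \<inter> corner k ` (f -` A))"
   by (intro countable_Int1 countable_range_corner)
  fix z :: 'a
  show "corner k -` {z} : sets borel"
   using measurable_sets[OF borel_measurable_corner, of "{z}"] by simp
 qed
 finally show "f -` A \<inter> space borel : sets borel" .
next
 fix x show "f x : space M" using assms(2) by simp
qed

lemma dyadic_cube_eq:
 "{y :: 'a::euclidean_space. corner k y = corner k x} =
   dyadic_cube k (%b. \<lfloor>tp k * (x \<bullet> b)\<rfloor>)"
proof -
 have *: "\<lfloor>tp k * t\<rfloor> = n \<longleftrightarrow> 2 powi (- k) * of_int n <= t & t < 2 powi (- k) * (of_int n + 1)" for t n
 proof -
  have "2 powi (- k) * of_int n <= t \<longleftrightarrow> of_int n <= tp k * t"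
   by (simp add: powr_real_of_int' power_int_minus field_simps)
  moreover have "t < 2 powi (- k) * (of_int n + 1) \<longleftrightarrow> tp k * t < of_int n + 1"
   by (simp add: powr_real_of_int' power_int_minus field_simps)
  ultimately show ?thesis by (auto simp: floor_eq_iff)
 qed
 show ?thesis unfolding dyadic_cube_def corner_eq_iff * by simp
qed

lemma dyadic_cube_point: "EX x. dyadic_cube k n = {y :: 'a::euclidean_space. corner k y = corner k x}"
proof -
 define x :: 'a where "x = (\<Sum>b\<in>Basis. (tm k * rint (n b)) *\<^sub>R b)"
 have "x \<bullet> b = tm k * rint (n b)" if "b : Basis" for b
  unfolding x_def using that by (simp add: inner_sum_left inner_Basis if_distrib cong: if_cong)
 then have "\<lfloor>tp k * (x \<bullet> b)\<rfloor> = n b" if "b : Basis" for b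
  using that by (simp flip: mult.assoc powr_add)
 then have "dyadic_cube k n = dyadic_cube k (%b. \<lfloor>tp k * (x \<bullet> b)\<rfloor>)"
  unfolding dyadic_cube_def by auto
 then show ?thesis using dyadic_cube_eq[of k x] by blast
qed

lemma sets_cube [measurable]: "{y :: 'a::euclidean_space. corner k y = z} : sets borel"
 using measurable_sets[OF borel_measurable_corner, of "{z}" k] by (simp add: vimage_def)

lemma emeasure_cube:
 fixes x :: "'a::euclidean_space"
 shows "emeasure lborel (cube k x) = en (2 powr (- (rint k * real DIM('a))))"
proof -
 let ?h = "tm k"
 define l where "l = corner k x"
 define r where "r = l + (\<Sum>b\<in>Basis. ?h *\<^sub>R b)"
 have rb: "r \<bullet> b = l \<bullet> b + ?h" if "b : Basis" for b
  using that unfolding r_def inner_add_left by (simp add: inner_sum_left inner_Basis if_distrib cong: if_cong)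
 have mem: "corner k y = l \<longleftrightarrow> (\<forall>b\<in>Basis. l \<bullet> b <= y \<bullet> b & y \<bullet> b < r \<bullet> b)" for y
 proof -
  have "\<lfloor>tp k * (y \<bullet> b)\<rfloor> = \<lfloor>tp k * (x \<bullet> b)\<rfloor> \<longleftrightarrow> l \<bullet> b <= y \<bullet> b & y \<bullet> b < r \<bullet> b"
   if b: "b : Basis" for b
   unfolding rb[OF b] unfolding l_def corner_inner[OF b] floor_eq_iff
   by (auto simp: powr_minus field_simps)
  then show ?thesis unfolding l_def corner_eq_iff by (auto simp: l_def)
 qed
 \<comment> \<open>The half-open cube is squeezed between an open and a closed box of equal
   volume.\<close>
 have "box l r <= {y. corner k y = l}" "{y. corner k y = l} <= cbox l r"
  unfolding mem by (auto simp: box_def cbox_def intro: less_imp_le)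
 moreover have "emeasure lborel (box l r) = en (2 powr (- (rint k * real DIM('a))))"
  "emeasure lborel (cbox l r) = en (2 powr (- (rint k * real DIM('a))))"
  using rb by (simp_all add: emeasure_lborel_box_eq emeasure_lborel_cbox_eq inner_diff_left
    powr_realpow[symmetric] powr_powr)
 ultimately show ?thesis
  unfolding l_def[symmetric] by (intro antisym) (metis emeasure_mono sets_cube sets_lborel
    borel_closed closed_cbox borel_open open_box)+
qed

text \<open>\<open>g z\<close> is the average of \<open>g\<close> over its cube, which lies in the
  ball about x: |x - z| contributes 1, the diameter of the cube at most 2 d, and the last 1 gives a
  strict inequality.\<close>

lemma cube_constant_le_average:
 fixes g :: "'a::euclidean_space => ennreal"
 assumes g: "cube_constant l g" and xz: "norm (x - z) <= tm l"
 shows "g z <= nnconv (%y. en (2 powr (rint l * real DIM('a))) *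
   indicator (ball 0 ((2 * real DIM('a) + 2) * tm l)) y) g x"
proof -
 let ?a = "2 powr (rint l * real DIM('a))" and ?Q = "(cube l z)"
 let ?B = "ball (0::'a) ((2 * real DIM('a) + 2) * tm l)"
 have "g z = en ?a * emeasure lborel ?Q * g z"
  by (simp add: emeasure_cube powr_minus flip: ennreal_mult)
 also have "... = (NN y. en ?a * g z * indicator ?Q y)"
  by (subst nn_integral_cmult_indicator) (simp_all add: mult_ac)
 also have "... <= (NN y. en ?a * indicator ?B (x - y) * g y)"
 proof (rule nn_integral_mono)
  fix y
  show "en ?a * g z * indicator ?Q y <= en ?a * indicator ?B (x - y) * g y"
  proof (cases "y : ?Q")
   case True
   then have eq: "corner l y = corner l z" by simp
   have "norm (x - y) <= norm (x - z) + norm (z - y)"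
    by (metis norm_diff_triangle_ineq diff_add_cancel norm_triangle_sub add_diff_eq norm_triangle_ineq)
   also have "... <= tm l + 2 * real DIM('a) * tm l"
    using norm_same_cube[OF eq[symmetric]] xz by linarith
   also have "... < (2 * real DIM('a) + 2) * tm l" by (simp add: algebra_simps)
   finally have "x - y : ?B" by simp
   then show ?thesis using True cube_constantD[OF g eq] by simp
  qed auto
 qed
 finally show ?thesis by (simp add: nnconv_def)
qed

section \<open>Kernels with integrable tails at dyadic scales\<close>

text \<open>Mass concentrated at scale 2^(-k), with a power gain \<open>ep\<close> in the tails.
  This is all that is kept of the Herz norm in the supercritical case.\<close>

definition scale_kernel :: "real => real => (int => 'a::euclidean_space => ennreal) => bool" where
 "scale_kernel ep A h \<longleftrightarrow> (ALL k. h k : LM & (NN y. h k y) <= en A &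
   (ALL l<=k. (NN y. h k y * indicator {y. tm l < norm y} y)
        <= en (A * 2 powr (- (rint (k - l) * ep)))))"

lemma scale_kernelD:
 assumes "scale_kernel ep A h"
 shows "h k : LM" "(NN y. h k y) <= en A"
  "l <= k ==> (NN y. h k y * indicator {y. tm l < norm y} y)
        <= en (A * 2 powr (- (rint (k - l) * ep)))"
 using assms unfolding scale_kernel_def by auto

lemma scale_kernel_reflect:
 assumes "scale_kernel ep A h"
 shows "scale_kernel ep A (%k y. h k (- y))"
 unfolding scale_kernel_def
proof (intro allI conjI impI)
 fix k
 have [measurable]: "h k : LM" "h k : BM" using scale_kernelD[OF assms] by auto
 show "(%y. h k (- y)) : LM" by measurable
 show "(NN y. h k (- y)) <= en A"
  using scale_kernelD(2)[OF assms, of k] nn_reflect[of "h k" 0] by simp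
 fix l assume "l <= k"
 then show "(NN y. h k (- y) * indicator {y. tm l < norm y} y)
        <= en (A * 2 powr (- (rint (k - l) * ep)))"
  using scale_kernelD(3)[OF assms, of l k]
   nn_reflect[of "%y. h k y * indicator {y. tm l < norm y} y" 0]
  by (simp add: indicator_def)
qed

text \<open>First summand: the mass of the averaging kernel in
  \<open>cube_constant_le_average\<close>. Second: the geometric sum of the tails over the
  generations k >= l.\<close>

definition sup_const :: "real => nat => real" where
 "sup_const ep d = unit_ball_vol (real d) * (2 * real d + 2) ^ d + 1 / (1 - 2 powr (- ep))"

lemma sup_const_pos: "0 < ep ==> 0 < sup_const ep d"
 unfolding sup_const_def by (intro add_nonneg_pos) (auto simp: powr_less_one)

lemma nn_integral_average_kernel:
 "(NN y. en (2 powr (rint l * real DIM('a))) *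
   indicator (ball (0::'a::euclidean_space) ((2 * real DIM('a) + 2) * tm l)) y)
  = en (unit_ball_vol (real DIM('a)) * (2 * real DIM('a) + 2) ^ DIM('a))"
proof -
 have "2 powr (rint l * real DIM('a)) * (tm l) ^ DIM('a) = 1"
  by (simp add: powr_realpow[symmetric] powr_powr powr_add[symmetric])
 then have "2 powr (rint l * real DIM('a)) * (unit_ball_vol (real DIM('a)) *
   ((2 * real DIM('a) + 2) * tm l) ^ DIM('a))
  = unit_ball_vol (real DIM('a)) * (2 * real DIM('a) + 2) ^ DIM('a)"
  by (simp add: power_mult_distrib)
 then show ?thesis
  by (simp add: nn_integral_cmult emeasure_ball flip: ennreal_mult)
qed

text \<open>Within distance 2^(-l) the function \<open>g\<close> is dominated by one average that
  does not depend on k; the tails are summable over k >= l. Hence the supremum over k needs no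
  maximal function and the bound holds in L^1.\<close>

lemma sup_conv_cube_constant_le:
 fixes g :: "'a::euclidean_space => ennreal"
 assumes h: "scale_kernel ep A h" and ep: "0 < ep" and A: "0 < A" and g: "cube_constant l g"
 shows "(NN x. (SUP k\<in>{l..}. nnconv (h k) g x))
   <= en (A * sup_const ep DIM('a)) * (NN x. g x)"
proof -
 have [measurable]: "g : BM" "g : LM"
  using cube_measurable[OF g, of borel] by simp_all
 have [measurable]: "h k : BM" "h k : LM" for k
  using scale_kernelD(1)[OF h, of k] by auto
 define T where "T = {y::'a. tm l < norm y}"
 have [measurable]: "T : sets borel" unfolding T_def by measurable
 define far where "far k y = h k y * indicator T y" for k y
 have [measurable]: "far k : LM" for k unfolding far_def by measurable
 define av where "av y = en (2 powr (rint l * real DIM('a))) *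
   indicator (ball (0::'a) ((2 * real DIM('a) + 2) * tm l)) y" for y
 have [measurable]: "av : LM" unfolding av_def by measurable
 let ?V = "unit_ball_vol (real DIM('a)) * (2 * real DIM('a) + 2) ^ DIM('a)"
 have avI: "(NN x. av x) = en ?V"
  unfolding av_def by (rule nn_integral_average_kernel)
 have "(SUP k\<in>{l..}. nnconv (h k) g x)
   <= en A * nnconv av g x + (\<Sum>n. nnconv (far (l + int n)) g x)" for x
 proof (rule SUP_least)
  fix k assume "k : {l..}"
  then obtain n where k: "k = l + int n" by (metis atLeast_iff zle_iff_zadd)
  have "nnconv (h k) g x <= (NN y. nnconv av g x * h k (x - y) + far k (x - y) * g y)"
   unfolding nnconv_def[of "h k"]
  proof (rule nn_integral_mono)
   fix y
   show "h k (x - y) * g y <= nnconv av g x * h k (x - y) + far k (x - y) * g y"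
   proof (cases "x - y : T")
    case False
    then have "g y <= nnconv av g x"
     unfolding av_def T_def by (intro cube_constant_le_average[OF g]) simp
    then show ?thesis by (simp add: mult.commute mult_right_mono add_increasing2)
   qed (simp add: far_def)
  qed
  also have "... = nnconv av g x * (NN y. h k (x - y)) + nnconv (far k) g x"
   unfolding nnconv_def[of "far k"] using meas_nnconv
   by (subst nn_integral_add) (auto simp: nn_integral_cmult far_def)
  also have "(NN y. h k (x - y)) = (NN y. h k y)"
   by (rule nn_reflect) measurable
  also have "nnconv av g x * (NN y. h k y) <= en A * nnconv av g x"
   using scale_kernelD(2)[OF h, of k] by (subst mult.commute) (rule mult_right_mono, auto)
  also have "nnconv (far k) g x <= (\<Sum>n. nnconv (far (l + int n)) g x)"
   unfolding k using sum_le_suminf[of "%n. nnconv (far (l + int n)) g x" "{n}"] by simp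
  finally show "nnconv (h k) g x <= en A * nnconv av g x + (\<Sum>n. nnconv (far (l + int n)) g x)"
   by (simp add: add_mono)
 qed
 then have "(NN x. (SUP k\<in>{l..}. nnconv (h k) g x))
   <= (NN x. en A * nnconv av g x + (\<Sum>n. nnconv (far (l + int n)) g x))"
  by (intro nn_integral_mono)
 also have "... = en A * (NN x. nnconv av g x) + (\<Sum>n. NN x. nnconv (far (l + int n)) g x)"
  by (subst nn_integral_add) (auto simp: nn_integral_cmult nn_integral_suminf)
 also have "... = en A * (en ?V * (NN x. g x))
    + (\<Sum>n. (NN x. far (l + int n) x) * (NN x. g x))"
  unfolding nn_nnconv[OF \<open>av : _\<close> \<open>g : LM\<close>]
   nn_nnconv[OF \<open>far _ : _\<close> \<open>g : LM\<close>]
  by (simp only: avI)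
 also have "... <= en A * (en ?V * (NN x. g x))
    + (\<Sum>n. en (A * (2 powr (- ep)) ^ n) * (NN x. g x))"
 proof (intro add_left_mono suminf_le mult_right_mono)
  fix n
  have "(NN x. far (l + int n) x) <= en (A * 2 powr (- (rint (l + int n - l) * ep)))"
   unfolding far_def T_def by (rule scale_kernelD(3)[OF h]) simp
  also have "2 powr (- (rint (l + int n - l) * ep)) = (2 powr (- ep)) ^ n"
   by (simp add: powr_realpow[symmetric] powr_powr mult.commute)
  finally show "(NN x. far (l + int n) x) <= en (A * (2 powr (- ep)) ^ n)" .
 qed simp_all
 also have "... = (en (A * ?V) + en (A * (1 / (1 - 2 powr (- ep))))) * (NN x. g x)"
 proof -
  have "2 powr (- ep) < 1" using ep by (simp add: powr_less_one)
  then have "(\<Sum>n. en (A * (2 powr (- ep)) ^ n)) = en (A * (1 / (1 - 2 powr (- ep))))"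
   using A by (intro suminf_ennreal_eq sums_mult geometric_sums) auto
  moreover have "en A * en ?V = en (A * ?V)"
   using A by (intro ennreal_mult[symmetric]) auto
  ultimately show ?thesis by (simp only: ennreal_suminf_multc distrib_right mult.assoc[symmetric])
 qed
 also have "en (A * ?V) + en (A * (1 / (1 - 2 powr (- ep)))) = en (A * sup_const ep DIM('a))"
 proof -
  have "2 powr (- ep) < 1" using ep by (simp add: powr_less_one)
  then show ?thesis using A unfolding sup_const_def distrib_left by (intro ennreal_plus[symmetric]) auto
 qed
 finally show ?thesis .
qed

lemma suminf_eq_SUP_atMost:
 fixes f :: "nat => ennreal"
 shows "(\<Sum>n. f n) = (SUP n. \<Sum>i\<le>n. f i)"
 unfolding suminf_eq_SUP
proof (intro antisym SUP_least)
 fix n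
 have "(\<Sum>i<n. f i) <= (\<Sum>i\<le>n. f i)" by (rule sum_mono2) auto
 then show "(\<Sum>i<n. f i) <= (SUP n. \<Sum>i\<le>n. f i)" by (rule SUP_upper2[OF UNIV_I])
 show "(\<Sum>i\<le>n. f i) <= (SUP n. \<Sum>i<n. f i)"
  by (rule SUP_upper2[of "Suc n"]) (auto simp: lessThan_Suc_atMost)
qed

text \<open>The increments d_n are nonnegative and constant on cubes of generation k0 + n, and d_n
  enters h_k * F_k only for k >= k0 + n, where the previous bound applies. The increments add up
  exactly to the supremum of the F_k, so nothing is lost.\<close>

lemma sup_conv_increasing_le:
 fixes F :: "int => 'a::euclidean_space => ennreal"
 assumes h: "scale_kernel ep A h" and ep: "0 < ep" and A: "0 < A"
  and F: "!!k. k0 <= k ==> cube_constant k (F k)" and mono: "!!k l x. k0 <= l ==> l <= k ==> F l x <= F k x"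
 shows "(NN x. (SUP k\<in>{k0..}. nnconv (h k) (F k) x))
   <= en (A * sup_const ep DIM('a)) * (NN x. (SUP k\<in>{k0..}. F k x))"
proof -
 \<comment> \<open>Differences of extended reals are faithful here because the sequence is
   increasing, infinite values included.\<close>
 define d where "d n x = (if n = 0 then F k0 x else F (k0 + int n) x - F (k0 + int n - 1) x)" for n :: nat and x
 have d: "cube_constant (k0 + int n) (d n)" for n
 proof (cases "n = 0")
  case True
  then have "d n = F (k0 + int n)" by (simp add: d_def fun_eq_iff)
  then show ?thesis using F[of "k0 + int n"] by simp
 next
  case False
  have 1: "cube_constant (k0 + int n) (F (k0 + int n))" by (rule F) simp
  have 2: "cube_constant (k0 + int n) (F (k0 + int n - 1))"
   by (rule cube_constant_nested[OF F]) (use False in auto)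
  show ?thesis
   unfolding cube_constant_def
  proof (intro allI impI)
   fix x y :: 'a assume eq: "corner (k0 + int n) x = corner (k0 + int n) y"
   show "d n x = d n y"
    unfolding d_def using False cube_constantD[OF 1 eq] cube_constantD[OF 2 eq] by simp
  qed
 qed
 have [measurable]: "d n : LM" for n
  using cube_measurable[OF d, of borel n] by simp
 have [measurable]: "d n : BM" for n
  using cube_measurable[OF d, of borel n] by simp
 have [measurable]: "h k : BM" "h k : LM" for k
  using scale_kernelD(1)[OF h, of k] by auto
 have Fsum: "F (k0 + int n) x = (\<Sum>i\<le>n. d i x)" for n x
 proof (induction n)
  case (Suc n)
  have "F (k0 + int n) x <= F (k0 + int (Suc n)) x" by (rule mono) auto
  then have "F (k0 + int (Suc n)) x = F (k0 + int n) x + d (Suc n) x"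
  proof -
   assume le: "F (k0 + int n) x <= F (k0 + int (Suc n)) x"
   have "d (Suc n) x = F (k0 + int (Suc n)) x - F (k0 + int n) x" by (simp add: d_def)
   with diff_add_cancel_ennreal[OF le] show ?thesis by (simp only: add.commute)
  qed
  then show ?case using Suc by simp
 qed (simp add: d_def)
 have SUPF: "(SUP k\<in>{k0..}. F k x) = (\<Sum>n. d n x)" for x
 proof -
  have "(SUP k\<in>{k0..}. F k x) = (SUP n. F (k0 + int n) x)"
  proof (rule antisym)
   show "(SUP k\<in>{k0..}. F k x) <= (SUP n. F (k0 + int n) x)"
   proof (rule SUP_least)
    fix k assume "k : {k0..}"
    then obtain n where "k = k0 + int n" by (metis atLeast_iff zle_iff_zadd)
    then show "F k x <= (SUP n. F (k0 + int n) x)" by (auto intro: SUP_upper)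
   qed
  qed (auto intro!: SUP_mono)
  also have "... = (\<Sum>n. d n x)" unfolding Fsum by (rule suminf_eq_SUP_atMost[symmetric])
  finally show ?thesis .
 qed
 have "(SUP k\<in>{k0..}. nnconv (h k) (F k) x) <= (\<Sum>n. SUP k\<in>{k0 + int n..}. nnconv (h k) (d n) x)" for x
 proof (rule SUP_least)
  fix k assume "k : {k0..}"
  then obtain m where k: "k = k0 + int m" by (metis atLeast_iff zle_iff_zadd)
  have "nnconv (h k) (F k) x = (\<Sum>i\<le>m. nnconv (h k) (d i) x)"
   unfolding nnconv_def k Fsum sum_distrib_left by (rule nn_integral_sum) measurable
  also have "... <= (\<Sum>i\<le>m. SUP k\<in>{k0 + int i..}. nnconv (h k) (d i) x)"
   by (intro sum_mono SUP_upper) (auto simp: k)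
  also have "... <= (\<Sum>n. SUP k\<in>{k0 + int n..}. nnconv (h k) (d n) x)"
   by (rule sum_le_suminf) auto
  finally show "nnconv (h k) (F k) x <= ..." .
 qed
 then have "(NN x. (SUP k\<in>{k0..}. nnconv (h k) (F k) x))
  <= (NN x. (\<Sum>n. SUP k\<in>{k0 + int n..}. nnconv (h k) (d n) x))"
  by (intro nn_integral_mono)
 also have "... = (\<Sum>n. NN x. (SUP k\<in>{k0 + int n..}. nnconv (h k) (d n) x))"
  by (rule nn_integral_suminf) (intro borel_measurable_SUP meas_nnconv, auto)
 also have "... <= (\<Sum>n. en (A * sup_const ep DIM('a)) * (NN x. d n x))"
  by (intro suminf_le sup_conv_cube_constant_le h ep A d) auto
 also have "... = en (A * sup_const ep DIM('a)) * (NN x. (\<Sum>n. d n x))"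
  by (simp add: nn_integral_suminf)
 finally show ?thesis unfolding SUPF .
qed

text \<open>Monotone convergence as the starting index tends to minus infinity; sequences over the
  integers are first cut off at k0, where telescoping can begin.\<close>

lemma nn_integral_SUP_int_down:
 fixes f :: "int => 'a => ennreal"
 assumes "!!k. f k : borel_measurable M" and anti: "!!k l x. k <= l ==> f l x <= f k x"
  and le: "!!k. (\<integral>\<^sup>+x. f k x \<partial>M) <= B"
 shows "(\<integral>\<^sup>+x. (SUP k. f k x) \<partial>M) <= B"
proof -
 have "(SUP k. f k x) = (SUP n. f (- int n) x)" for x
 proof (rule antisym)
  show "(SUP k. f k x) <= (SUP n. f (- int n) x)"
  proof (rule SUP_least)
   fix k
   have "f k x <= f (- int (nat (- k))) x" by (rule anti) auto
   then show "f k x <= (SUP n. f (- int n) x)" by (rule SUP_upper2[OF UNIV_I])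
  qed
 qed (auto intro: SUP_mono)
 then have "(\<integral>\<^sup>+x. (SUP k. f k x) \<partial>M) = (\<integral>\<^sup>+x. (SUP n. f (- int n) x) \<partial>M)" by simp
 also have "... = (SUP n. \<integral>\<^sup>+x. f (- int n) x \<partial>M)"
  by (rule nn_integral_monotone_convergence_SUP) (auto simp: incseq_def le_fun_def assms intro!: anti)
 also have "... <= B" by (intro SUP_least le)
 finally show ?thesis .
qed

lemma cube_constant_compose: "(!!i. i : I ==> cube_constant k (f i)) ==> (!!x y. (!!i. i : I ==> f i x = f i y) ==> g x = g y)
  ==> cube_constant k g"
 unfolding cube_constant_def by blast

text \<open>The running maximum of a_k0, ..., a_k is increasing in k and, since cubes are nested,
  still constant on cubes of generation k; its supremum is at most that of the whole
  sequence.\<close>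

theorem sup_conv_bound:
 fixes a :: "int => 'a::euclidean_space => ennreal"
 assumes h: "scale_kernel ep A h" and ep: "0 < ep" and A: "0 < A" and a: "!!k. cube_constant k (a k)"
 shows "(NN x. (SUP k. nnconv (h k) (a k) x))
   <= en (A * sup_const ep DIM('a)) * (NN x. (SUP k. a k x))"
proof -
 have [measurable]: "h k : LM" for k using scale_kernelD(1)[OF h, of k] by auto
 have [measurable]: "a k : LM" for k using cube_measurable[OF a, of borel k] by simp
 have "(NN x. (SUP k0. SUP k\<in>{k0..}. nnconv (h k) (a k) x))
   <= en (A * sup_const ep DIM('a)) * (NN x. (SUP k. a k x))"
 proof (rule nn_integral_SUP_int_down)
  fix k0 :: int
  show "(%x. SUP k\<in>{k0..}. nnconv (h k) (a k) x) : LM"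
   by (intro borel_measurable_SUP) auto
  show "(SUP k\<in>{l..}. nnconv (h k) (a k) x) <= (SUP k\<in>{k0..}. nnconv (h k) (a k) x)" if "k0 <= l" for l x
   by (rule SUP_subset_mono) (use that in auto)
  define F where "F k x = (SUP l\<in>{k0..k}. a l x)" for k x
  have "(NN x. (SUP k\<in>{k0..}. nnconv (h k) (a k) x)) <= (NN x. (SUP k\<in>{k0..}. nnconv (h k) (F k) x))"
  proof (intro nn_integral_mono SUP_mono)
   fix x k assume k: "k : {k0..}"
   have "nnconv (h k) (a k) x <= nnconv (h k) (F k) x"
    using k unfolding F_def by (intro nnconv_mono SUP_upper) auto
   with k show "\<exists>m\<in>{k0..}. nnconv (h k) (a k) x <= nnconv (h m) (F m) x" by blast
  qed
  also have "... <= en (A * sup_const ep DIM('a)) * (NN x. (SUP k\<in>{k0..}. F k x))"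
  proof (rule sup_conv_increasing_le[OF h ep A])
   show "cube_constant k (F k)" for k
    by (rule cube_constant_compose[of "{k0..k}" k a]) (auto simp: F_def intro: cube_constant_nested[OF a])
   show "F l x <= F k x" if "l <= k" for l k x
    unfolding F_def by (rule SUP_subset_mono) (use that in auto)
  qed
  also have "... <= en (A * sup_const ep DIM('a)) * (NN x. (SUP k. a k x))"
   unfolding F_def by (intro mult_left_mono nn_integral_mono SUP_least) (auto intro: SUP_upper)
  finally show "(NN x. (SUP k\<in>{k0..}. nnconv (h k) (a k) x))
   <= en (A * sup_const ep DIM('a)) * (NN x. (SUP k. a k x))" .
 qed
 moreover have "(SUP k. nnconv (h k) (a k) x) <= (SUP k0. SUP k\<in>{k0..}. nnconv (h k) (a k) x)" for x
 proof (rule SUP_least)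
  fix k
  show "nnconv (h k) (a k) x <= (SUP k0. SUP k\<in>{k0..}. nnconv (h k) (a k) x)"
   by (rule SUP_upper2[of k]) (auto intro: SUP_upper)
 qed
 ultimately show ?thesis by (meson nn_integral_mono order_trans)
qed

section \<open>The l^q estimate for scale kernels in L^1\<close>

lemma power_difference_le:
 fixes x y :: real
 assumes "0 <= y" "y <= x" "1 < q"
 shows "(x powr q - y powr q) * x powr (1 - q) <= q * (x - y)"
proof (cases "y = 0")
 case True
 have "x powr q * x powr (1 - q) = x" using assms by (cases "x = 0") (auto simp flip: powr_add)
 moreover have "1 * x <= q * x" using assms True by (intro mult_right_mono) auto
 ultimately show ?thesis using True by simp
next
 case False
 then have xy: "0 < x" "0 < y" using assms by auto
 \<comment> \<open>Young's inequality yields the tangent inequality x^q - y^q <= q x^(q - 1) (x -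
   y).\<close>
 have "(x powr q) powr (1 - 1/q) * (y powr q) powr (1/q) <= (1 - 1/q) * x powr q + (1/q) * y powr q"
  using assms xy by (intro Youngs_inequality_0) auto
 then have "x powr (q - 1) * y <= (1 - 1/q) * x powr q + (1/q) * y powr q"
  using assms xy by (simp add: powr_powr algebra_simps)
 then have "q * (x powr (q - 1) * y) <= q * ((1 - 1/q) * x powr q + (1/q) * y powr q)"
  using assms by (intro mult_left_mono) auto
 also have "... = (q - 1) * x powr q + y powr q" using assms by (simp add: algebra_simps)
 finally have 1: "x powr q - y powr q <= q * x powr q - q * (x powr (q - 1) * y)" by (simp add: algebra_simps)
 have e: "x powr q * x powr (1 - q) = x" "x powr (q - 1) * x powr (1 - q) = 1"
  using xy by (auto simp flip: powr_add)
 have "(x powr q - y powr q) * x powr (1 - q) <= (q * x powr q - q * (x powr (q - 1) * y)) * x powr (1 - q)"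
  by (intro mult_right_mono 1) auto
 also have "... = q * (x powr q * x powr (1 - q)) - q * ((x powr (q - 1) * x powr (1 - q)) * y)"
  by (simp add: algebra_simps)
 also have "... = q * (x - y)" unfolding e by (simp add: algebra_simps)
 finally show ?thesis .
qed

text \<open>The discrete form of integrating S^(1/q - 1) dS: with S_i the partial sums of the a_i^q
  and F_i = S_i^(1/q), each summand is at most q (F_i - F_(i-1)), and the differences
  telescope.\<close>

lemma sum_quotient_le:
 fixes a :: "nat => ennreal"
 assumes q: "1 < q" and F: "!!n. F n = epowr (\<Sum>i\<le>n. epowr (a i) q) (1 / q)"
 shows "(\<Sum>i\<le>n. epowr (a i) q * epowr (F i) (1 - q)) <= en q * F n"
proof (induction n)
 case 0
 have "epowr (a 0) q * epowr (a 0) (1 - q) = a 0" unfolding epowr_add[symmetric] by simp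
 moreover have "1 * a 0 <= en q * a 0" using q by (intro mult_right_mono) auto
 ultimately show ?case using q by (simp add: F epowr_epowr)
next
 case (Suc n)
 have Fq: "epowr (F n) q = (\<Sum>i\<le>n. epowr (a i) q)" for n using q by (simp add: F epowr_epowr)
 have rec: "epowr (F (Suc n)) q = epowr (F n) q + epowr (a (Suc n)) q" unfolding Fq by simp
 have le: "epowr (a (Suc n)) q * epowr (F (Suc n)) (1 - q) + en q * F n <= en q * F (Suc n)"
 proof (cases "F (Suc n)")
  case top
  then show ?thesis using q by (simp add: ennreal_mult_top)
 next
  case (real x)
  have "epowr (F n) q <= epowr (F (Suc n)) q" unfolding rec by simp
  then have "F n <= F (Suc n)" using q epowr_le_iff[of q] by simp
  then obtain y where y: "F n = en y" "0 <= y" using real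
   by (metis ennreal_cases ennreal_less_top leD top.not_eq_extremum)
  have yx: "y <= x" using \<open>F n <= F (Suc n)\<close> y real by simp
  have "epowr (a (Suc n)) q ~= top" using rec real by (metis ennreal_add_eq_top epowr_eq_top_iff ennreal_neq_top)
  then obtain z where z: "epowr (a (Suc n)) q = en z" "0 <= z" by (metis ennreal_cases)
  have "x powr q = y powr q + z" using rec real y z by (simp flip: ennreal_plus)
  then have "z = x powr q - y powr q" by simp
  then have "z * x powr (1 - q) + q * y <= q * x"
   unfolding \<open>z = x powr q - y powr q\<close> using power_difference_le[OF y(2) yx q] by (simp add: algebra_simps)
  then show ?thesis unfolding z(1) y(1) real(2) using z y real q
   by (simp flip: ennreal_mult ennreal_plus)
 qed
 have "(\<Sum>i\<le>Suc n. epowr (a i) q * epowr (F i) (1 - q))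
   <= epowr (a (Suc n)) q * epowr (F (Suc n)) (1 - q) + en q * F n"
  using Suc by (simp add: add.commute add_left_mono)
 from this le show ?case by (rule order_trans)
qed

lemma factor_self_le:
 fixes a F :: ennreal
 assumes "1 < q" "a <= F"
 shows "a <= epowr (epowr a q * epowr F (1 - q)) (1/q) * epowr F (1 - 1/q)"
proof -
 have "(1 - q) / q + (1 - 1 / q) = 0" using assms by (simp add: field_simps)
 then have "epowr (epowr a q * epowr F (1 - q)) (1/q) * epowr F (1 - 1/q) = a * epowr F 0"
  using assms by (simp add: epowr_mult epowr_epowr mult.assoc flip: epowr_add)
 then show ?thesis using assms(2) by (cases F) (auto simp: ennreal_mult_top)
qed

lemma conv_holder:
 assumes [measurable]: "h : LM" "g : LM" "w : LM"
  and q: "1 < q" and fac: "!!y. f y <= epowr (g y) (1/q) * epowr (w y) (1 - 1/q)"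
 shows "epowr (nnconv h f x) q <= nnconv h g x * epowr (nnconv h w x) (q - 1)"
proof -
 have [measurable]: "h : BM" "g : BM" "w : BM" using assms by simp_all
 have "nnconv h f x <= (NN y. epowr (h (x - y) * g y) (1/q) * epowr (h (x - y) * w y) (1 - 1/q))"
  unfolding nnconv_def
 proof (rule nn_integral_mono)
  fix y
  have "h (x - y) = epowr (h (x - y)) (1/q) * epowr (h (x - y)) (1 - 1/q)"
   unfolding epowr_add[symmetric] by simp
  then have "h (x - y) * f y <= epowr (h (x - y)) (1/q) * epowr (h (x - y)) (1 - 1/q) *
    (epowr (g y) (1/q) * epowr (w y) (1 - 1/q))"
   using mult_left_mono[OF fac[of y], of "h (x - y)"] by simp
  then show "h (x - y) * f y <= epowr (h (x - y) * g y) (1/q) * epowr (h (x - y) * w y) (1 - 1/q)"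
   by (simp only: epowr_mult mult_ac)
 qed
 also have "... <= epowr (nnconv h g x) (1/q) * epowr (nnconv h w x) (1 - 1/q)"
  unfolding nnconv_def by (rule holder_epowr) (use q in auto)
 finally have "epowr (nnconv h f x) q <= epowr (epowr (nnconv h g x) (1/q) * epowr (nnconv h w x) (1 - 1/q)) q"
  using q by (intro epowr_mono) auto
 also have "... = nnconv h g x * epowr (nnconv h w x) (q - 1)"
 proof -
  have "(1 - 1/q) * q = q - 1" using q by (simp add: field_simps)
  then show ?thesis using q by (simp add: epowr_mult epowr_epowr)
 qed
 finally show ?thesis .
qed

text \<open>With F_k the l^q norm of a_k0, ..., a_k, factor a_k through g_k^(1/q) F_k^(1 - 1/q). The
  F_k are increasing and constant on cubes, so the supremum W of the h_k * F_k is controlled in L^1.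
  The g_k are summable at the cost of a factor q by \<open>sum_quotient_le\<close>, so the sum D of
  the h_k * g_k is controlled in L^1 too. Hoelder for D and W concludes.\<close>

theorem lq_conv_bound:
 fixes a :: "int => 'a::euclidean_space => ennreal"
 assumes h: "scale_kernel ep A h" and ep: "0 < ep" and A: "0 < A" and q: "1 < q" and a: "!!k. cube_constant k (a k)"
 shows "mixed_int 1 q (%k. nnconv (h k) (a k))
   <= en (A * (q + sup_const ep DIM('a))) * mixed_int 1 q a"
proof -
 have [measurable]: "h k : LM" for k using scale_kernelD(1)[OF h, of k] by auto
 have [measurable]: "a k : LM" for k using cube_measurable[OF a, of borel k] by simp
 define K where "K = sup_const ep DIM('a)"
 have K: "0 < K" unfolding K_def by (rule sup_const_pos[OF ep])
 define X where "X = mixed_int 1 q a"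
 define S where "S k0 x = epowr (CC k. epowr (nnconv (h k) (a k) x) q * indicator {k0..} k) (1/q)" for k0 x
 have "(NN x. (SUP k0. S k0 x)) <= en (A * (q + K)) * X"
 proof (rule nn_integral_SUP_int_down)
  fix k0 :: int
  show "S k0 : LM" unfolding S_def by measurable
  show "S l x <= S k0 x" if "k0 <= l" for l x
   unfolding S_def using q that by (intro epowr_mono nn_integral_mono) (auto simp: indicator_def)
  define F where "F k x = epowr (\<Sum>l\<in>{k0..k}. epowr (a l x) q) (1/q)" for k x
  define g where "g k x = epowr (a k x) q * epowr (F k x) (1 - q)" for k x
  have F: "cube_constant k (F k)" for k
   by (rule cube_constant_compose[of "{k0..k}" k a]) (auto simp: F_def intro: cube_constant_nested[OF a])
  have [measurable]: "F k : LM" for k using cube_measurable[OF F, of borel k] by simp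
  have [measurable]: "g k : LM" for k unfolding g_def by measurable
  have Fmono: "F l x <= F k x" if "l <= k" for l k x
   unfolding F_def using q that by (intro epowr_mono sum_mono2) auto
  define W where "W x = (SUP k\<in>{k0..}. nnconv (h k) (F k) x)" for x
  define D where "D x = (CC k. nnconv (h k) (g k) x * indicator {k0..} k)" for x
  have [measurable]: "W : LM" "D : LM"
   unfolding W_def D_def by (intro borel_measurable_SUP, auto)
  have FX: "F k x <= epowr (CC k. epowr (a k x) q) (1/q)" for k x
  proof -
   have "(\<Sum>l\<in>{k0..k}. epowr (a l x) q) = (CC l. epowr (a l x) q * indicator {k0..k} l)"
    by (simp add: nn_integral_indicator_finite)
   also have "... <= (CC k. epowr (a k x) q)"
    by (intro nn_integral_mono) (auto simp: indicator_def)
   finally show ?thesis unfolding F_def using q by (intro epowr_mono) auto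
  qed
  have WX: "(NN x. W x) <= en (A * K) * X"
  proof -
   have "(NN x. W x) <= en (A * K) * (NN x. (SUP k\<in>{k0..}. F k x))"
    unfolding W_def K_def by (rule sup_conv_increasing_le[OF h ep A F Fmono])
   also have "... <= en (A * K) * X"
    unfolding X_def mixed_int_def by (intro mult_left_mono nn_integral_mono SUP_least FX) auto
   finally show ?thesis .
  qed
  have sum_g: "(CC k. g k x * indicator {k0..} k)
    <= en q * epowr (CC k. epowr (a k x) q) (1/q)" for x
  proof -
   have bij: "bij_betw (%n. k0 + int n) UNIV {k0..}"
    by (rule bij_betwI[where g="%i. nat (i - k0)"]) auto
   have img: "(%n. k0 + int n) ` {..n} = {k0..k0 + int n}" for n
   proof safe
    fix k assume "k : {k0..k0 + int n}"
    then show "k : (%n. k0 + int n) ` {..n}" by (intro image_eqI[of _ _ "nat (k - k0)"]) auto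
   qed auto
   have F': "F (k0 + int n) x = epowr (\<Sum>i\<le>n. epowr (a (k0 + int i) x) q) (1/q)" for n
    unfolding F_def img[symmetric] by (subst sum.reindex) (auto simp: inj_on_def)
   have "(CC k. g k x * indicator {k0..} k) = (\<integral>\<^sup>+k. g k x \<partial>count_space {k0..})"
    by (subst (2) nn_integral_count_space_indicator) auto
   also have "... = (CC n. g (k0 + int n) x)"
    by (rule nn_integral_bij_count_space[OF bij, symmetric])
   also have "... = (SUP n. \<Sum>i\<le>n. g (k0 + int i) x)"
    by (simp add: nn_integral_count_space_nat suminf_eq_SUP_atMost)
   also have "... <= en q * epowr (CC k. epowr (a k x) q) (1/q)"
   proof (rule SUP_least)
    fix n
    have "(\<Sum>i\<le>n. g (k0 + int i) x) <= en q * F (k0 + int n) x"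
     unfolding g_def by (rule sum_quotient_le[OF q]) (rule F')
    also have "... <= en q * epowr (CC k. epowr (a k x) q) (1/q)"
     by (intro mult_left_mono FX) auto
    finally show "(\<Sum>i\<le>n. g (k0 + int i) x) <= en q * epowr (CC k. epowr (a k x) q) (1/q)" .
   qed
   finally show ?thesis .
  qed
  have DX: "(NN x. D x) <= en (A * q) * X"
  proof -
   have "(NN x. D x) = (CC k. (NN x. nnconv (h k) (g k) x * indicator {k0..} k))"
    unfolding D_def by (rule count_int_swap) measurable
   also have "... <= (CC k. en A * (NN x. g k x * indicator {k0..} k))"
    by (intro nn_integral_mono)
     (simp add: nn_integral_multc nn_nnconv mult.assoc[symmetric] mult_right_mono scale_kernelD(2)[OF h])
   also have "... = en A * (CC k. (NN x. g k x * indicator {k0..} k))"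
    by (rule nn_integral_cmult) simp
   also have "(CC k. (NN x. g k x * indicator {k0..} k))
     = (NN x. (CC k. g k x * indicator {k0..} k))"
    by (rule count_int_swap[symmetric]) measurable
   also have "... <= (NN x. en q * epowr (CC k. epowr (a k x) q) (1/q))"
    by (intro nn_integral_mono sum_g)
   also have "... = en q * X" unfolding X_def mixed_int_def by (simp add: nn_integral_cmult)
   finally show ?thesis using A q by (simp add: ennreal_mult mult.assoc mult_left_mono)
  qed
  have "(NN x. S k0 x) <= (NN x. epowr (D x) (1/q) * epowr (W x) (1 - 1/q))"
  proof (rule nn_integral_mono)
   fix x
   have "(CC k. epowr (nnconv (h k) (a k) x) q * indicator {k0..} k)
     <= (CC k. nnconv (h k) (g k) x * indicator {k0..} k * epowr (W x) (q - 1))"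
   proof (rule nn_integral_mono)
    fix k
    show "epowr (nnconv (h k) (a k) x) q * indicator {k0..} k
      <= nnconv (h k) (g k) x * indicator {k0..} k * epowr (W x) (q - 1)"
    proof (cases "k0 <= k")
     case True
     have "a k y <= F k y" for y
     proof -
      have "epowr (a k y) q <= (\<Sum>l\<in>{k0..k}. epowr (a l y) q)"
       using True by (intro member_le_sum) auto
      then show ?thesis unfolding F_def using q by (simp add: epowr_le_swap)
     qed
     then have "a k y <= epowr (g k y) (1/q) * epowr (F k y) (1 - 1/q)" for y
      unfolding g_def by (rule factor_self_le[OF q])
     then have "epowr (nnconv (h k) (a k) x) q <= nnconv (h k) (g k) x * epowr (nnconv (h k) (F k) x) (q - 1)"
      by (intro conv_holder q) auto
     also have "... <= nnconv (h k) (g k) x * epowr (W x) (q - 1)"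
      unfolding W_def using q True by (intro mult_left_mono epowr_mono SUP_upper) auto
     finally show ?thesis using True by simp
    qed auto
   qed
   also have "... = D x * epowr (W x) (q - 1)" unfolding D_def by (simp add: nn_integral_multc)
   finally have "S k0 x <= epowr (D x * epowr (W x) (q - 1)) (1/q)"
    unfolding S_def using q by (intro epowr_mono) auto
   also have "... = epowr (D x) (1/q) * epowr (W x) (1 - 1/q)"
   proof -
    have "(q - 1) * (1/q) = 1 - 1/q" using q by (simp add: field_simps)
    then show ?thesis by (simp only: epowr_mult epowr_epowr)
   qed
   finally show "S k0 x <= epowr (D x) (1/q) * epowr (W x) (1 - 1/q)" .
  qed
  also have "... <= epowr (NN x. D x) (1/q) * epowr (NN x. W x) (1 - 1/q)"
   by (rule holder_epowr) (use q in auto)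
  also have "... <= epowr (en (A * (q + K)) * X) (1/q) * epowr (en (A * (q + K)) * X) (1 - 1/q)"
   using q A K by (intro mult_mono epowr_mono order_trans[OF DX] order_trans[OF WX] mult_right_mono ennreal_leI mult_left_mono) auto
  also have "... = en (A * (q + K)) * X" unfolding epowr_add[symmetric] by simp
  finally show "(NN x. S k0 x) <= en (A * (q + K)) * X" .
 qed
 moreover have "epowr (CC k. epowr (nnconv (h k) (a k) x) q) (1/q) <= (SUP k0. S k0 x)" for x
 proof -
  have "(CC k. epowr (nnconv (h k) (a k) x) q)
   = (CC k. (SUP k0. epowr (nnconv (h k) (a k) x) q * indicator {k0..} k))"
  proof (rule nn_integral_cong)
   fix k
   show "epowr (nnconv (h k) (a k) x) q = (SUP k0. epowr (nnconv (h k) (a k) x) q * indicator {k0..} k)"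
    by (intro antisym SUP_least SUP_upper2[of k]) (auto simp: indicator_def)
  qed
  also have "... <= epowr (SUP k0. S k0 x) q"
  proof (rule nn_integral_SUP_int_down)
   fix k0
   have "S k0 x <= (SUP k0. S k0 x)" by (rule SUP_upper) simp
   then show "(CC k. epowr (nnconv (h k) (a k) x) q * indicator {k0..} k) <= epowr (SUP k0. S k0 x) q"
    unfolding S_def[of k0] using q by (simp add: epowr_le_swap)
  qed (auto simp: indicator_def)
  finally show ?thesis using q epowr_le_swap[of "1/q"] by simp
 qed
 ultimately show ?thesis unfolding mixed_int_def X_def K_def
  by (meson nn_integral_mono order_trans)
qed

section \<open>Passage from L^1 to L^p by Jensen's inequality\<close>

lemma conv_jensen:
 assumes h: "scale_kernel ep A h" and A: "0 < A" and [measurable]: "f : LM" and p: "1 <= p"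
 shows "epowr (nnconv (h k) f x) p <= en (A powr (p - 1)) * nnconv (h k) (%y. epowr (f y) p) x"
proof -
 have [measurable]: "h k : BM" "f : BM" using scale_kernelD(1)[OF h, of k] assms by auto
 have "(NN y. h k (x - y)) = (NN y. h k y)" by (rule nn_reflect) measurable
 then show ?thesis
  unfolding nnconv_def using scale_kernelD(2)[OF h, of k] by (intro jensen_epowr p A) auto
qed

theorem scale_kernel_bound_sup:
 fixes a :: "int => 'a::euclidean_space => ennreal"
 assumes h: "scale_kernel ep A h" and ep: "0 < ep" and A: "0 < A" and p: "1 <= p" and a: "!!k. cube_constant k (a k)"
 shows "mixed_sup p (%k. nnconv (h k) (a k)) <= en (sup_const ep DIM('a) * A powr p) * mixed_sup p a"
proof -
 have [measurable]: "h k : LM" for k using scale_kernelD(1)[OF h, of k] by auto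
 have [measurable]: "a k : LM" for k using cube_measurable[OF a, of borel k] by simp
 define b where "b k x = epowr (a k x) p" for k x
 have b: "cube_constant k (b k)" for k using a[of k] unfolding cube_constant_def b_def by metis
 have [measurable]: "b k : LM" for k unfolding b_def by measurable
 have "mixed_sup p (%k. nnconv (h k) (a k)) <= (NN x. en (A powr (p - 1)) * (SUP k. nnconv (h k) (b k) x))"
  unfolding mixed_sup_def
 proof (rule nn_integral_mono)
  fix x
  have "epowr (SUP k. nnconv (h k) (a k) x) p = (SUP k. epowr (nnconv (h k) (a k) x) p)"
   using p by (intro epowr_SUP) auto
  also have "... <= en (A powr (p - 1)) * (SUP k. nnconv (h k) (b k) x)"
   unfolding b_def
   by (intro SUP_least order_trans[OF conv_jensen[OF h A _ p]] mult_left_mono SUP_upper) auto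
  finally show "epowr (SUP k. nnconv (h k) (a k) x) p <= en (A powr (p - 1)) * (SUP k. nnconv (h k) (b k) x)" .
 qed
 also have "... = en (A powr (p - 1)) * (NN x. (SUP k. nnconv (h k) (b k) x))"
  by (rule nn_integral_cmult) (intro borel_measurable_SUP, auto)
 also have "... <= en (A powr (p - 1)) * (en (A * sup_const ep DIM('a)) * (NN x. (SUP k. b k x)))"
  by (intro mult_left_mono sup_conv_bound h ep A b) auto
 also have "(NN x. (SUP k. b k x)) = mixed_sup p a"
  unfolding mixed_sup_def b_def using p by (simp add: epowr_SUP)
 also have "en (A powr (p - 1)) * (en (A * sup_const ep DIM('a)) * mixed_sup p a)
   = en (sup_const ep DIM('a) * A powr p) * mixed_sup p a"
 proof -
  have "A powr (p - 1) * (A * sup_const ep DIM('a)) = sup_const ep DIM('a) * A powr p"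
   using A powr_add[of A "p - 1" 1] by simp
  then show ?thesis using A sup_const_pos[OF ep] by (simp only: mult.assoc[symmetric] ennreal_mult'[symmetric] powr_ge_zero)
 qed
 finally show ?thesis .
qed

text \<open>Jensen replaces a_k by its p-th power, which turns the pair (p, q) into (1, q / p) with
  q / p > 1.\<close>

theorem scale_kernel_bound_less:
 fixes a :: "int => 'a::euclidean_space => ennreal"
 assumes h: "scale_kernel ep A h" and ep: "0 < ep" and A: "0 < A" and p: "1 <= p" "p < q" and a: "!!k. cube_constant k (a k)"
 shows "mixed_int p q (%k. nnconv (h k) (a k)) <= en ((q / p + sup_const ep DIM('a)) * A powr p) * mixed_int p q a"
proof -
 have [measurable]: "h k : LM" for k using scale_kernelD(1)[OF h, of k] by auto
 have [measurable]: "a k : LM" for k using cube_measurable[OF a, of borel k] by simp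
 define b where "b k x = epowr (a k x) p" for k x
 have b: "cube_constant k (b k)" for k using a[of k] unfolding cube_constant_def b_def by metis
 have [measurable]: "b k : LM" for k unfolding b_def by measurable
 define Q where "Q = q / p"
 have Q: "1 < Q" "p / q = 1 / Q" "0 < p" "0 < q" "p * Q = q" using p by (auto simp: Q_def)
 have "mixed_int p q (%k. nnconv (h k) (a k)) <= (NN x. en (A powr (p - 1)) *
   epowr (CC k. epowr (nnconv (h k) (b k) x) Q) (1/Q))"
  unfolding mixed_int_def Q(2)
 proof (rule nn_integral_mono)
  fix x
  have "(CC k. epowr (nnconv (h k) (a k) x) q)
    <= (CC k. epowr (en (A powr (p - 1))) Q * epowr (nnconv (h k) (b k) x) Q)"
  proof (rule nn_integral_mono)
   fix k
   have "epowr (nnconv (h k) (a k) x) q = epowr (epowr (nnconv (h k) (a k) x) p) Q"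
    using Q by (simp add: epowr_epowr)
   also have "... <= epowr (en (A powr (p - 1)) * nnconv (h k) (b k) x) Q"
    unfolding b_def using Q by (intro epowr_mono conv_jensen[OF h A _ p(1)]) auto
   finally show "epowr (nnconv (h k) (a k) x) q <= epowr (en (A powr (p - 1))) Q * epowr (nnconv (h k) (b k) x) Q"
    by (simp only: epowr_mult)
  qed
  also have "... = epowr (en (A powr (p - 1))) Q * (CC k. epowr (nnconv (h k) (b k) x) Q)"
   by (rule nn_integral_cmult) simp
  finally have "epowr (CC k. epowr (nnconv (h k) (a k) x) q) (1/Q) <= epowr ... (1/Q)"
   using Q by (intro epowr_mono) auto
  also have "... = en (A powr (p - 1)) * epowr (CC k. epowr (nnconv (h k) (b k) x) Q) (1/Q)"
   using Q(1) by (simp only: epowr_mult epowr_epowr) simp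
  finally show "epowr (CC k. epowr (nnconv (h k) (a k) x) q) (1/Q)
   <= en (A powr (p - 1)) * epowr (CC k. epowr (nnconv (h k) (b k) x) Q) (1/Q)" .
 qed
 also have "... = en (A powr (p - 1)) * mixed_int 1 Q (%k. nnconv (h k) (b k))"
  unfolding mixed_int_def by (rule nn_integral_cmult) measurable
 also have "... <= en (A powr (p - 1)) * (en (A * (Q + sup_const ep DIM('a))) * mixed_int 1 Q b)"
  by (intro mult_left_mono lq_conv_bound h ep A b Q) auto
 also have "mixed_int 1 Q b = mixed_int p q a"
  unfolding mixed_int_def b_def using Q by (simp add: epowr_epowr)
 also have "en (A powr (p - 1)) * (en (A * (Q + sup_const ep DIM('a))) * mixed_int p q a)
   = en ((q / p + sup_const ep DIM('a)) * A powr p) * mixed_int p q a"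
 proof -
  have "A powr (p - 1) * (A * (Q + sup_const ep DIM('a))) = (q / p + sup_const ep DIM('a)) * A powr p"
   using A powr_add[of A "p - 1" 1] by (simp add: Q_def)
  then show ?thesis by (simp only: mult.assoc[symmetric] ennreal_mult'[symmetric] powr_ge_zero)
 qed
 finally show ?thesis .
qed

section \<open>Polynomially decaying kernels\<close>

text \<open>An L^1-normalized bump of scale 2^(-k) with decay of order N; it majorizes the dilates
  of a Schwartz function.\<close>

definition eta :: "real => int => 'a::euclidean_space => ennreal" where
 "eta N k x = en (2 powr (rint k * real DIM('a)) * (1 + tp k * norm x) powr (- N))"

lemma borel_measurable_eta [measurable]: "eta N k : BM"
 unfolding eta_def[abs_def] by measurable

lemma eta_uminus [simp]: "eta N k (- x) = eta N k x"
 by (simp add: eta_def)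

lemma eta_slow:
 fixes x x' :: "'a::euclidean_space"
 assumes N: "0 <= N" and c: "0 <= c" and xx: "norm (x - x') <= c * tm k"
 shows "eta N k x <= en ((1 + c) powr N) * eta N k x'"
proof -
 let ?s = "tp k"
 have "norm x' <= norm x + norm (x - x')" by (metis norm_minus_commute norm_triangle_sub)
 then have "?s * norm x' <= ?s * (norm x + c * tm k)"
  using xx by (intro mult_left_mono) auto
 also have "... = ?s * norm x + c" by (simp add: algebra_simps powr_minus)
 finally have "1 + ?s * norm x' <= (1 + c) * (1 + ?s * norm x)"
  using c by (simp add: algebra_simps) (smt (verit) mult_nonneg_nonneg norm_ge_zero powr_ge_zero)
 then have "(1 + ?s * norm x') powr N <= ((1 + c) * (1 + ?s * norm x)) powr N"
  using N by (intro powr_mono2) auto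
 also have "... = (1 + c) powr N * (1 + ?s * norm x) powr N" using c by (simp add: powr_mult)
 finally have le: "(1 + ?s * norm x') powr N <= (1 + c) powr N * (1 + ?s * norm x) powr N" .
 have p: "0 < (1 + ?s * norm x) powr N" "0 < (1 + ?s * norm x') powr N"
  by (smt (verit) mult_nonneg_nonneg norm_ge_zero powr_ge_zero powr_gt_zero)+
 have "(1 + ?s * norm x) powr (- N) <= (1 + c) powr N * (1 + ?s * norm x') powr (- N)"
  using le p by (simp add: powr_minus field_simps)
 then have "2 powr (rint k * real DIM('a)) * (1 + ?s * norm x) powr (- N)
  <= (1 + c) powr N * (2 powr (rint k * real DIM('a)) * (1 + ?s * norm x') powr (- N))"
  by (simp add: mult.left_commute)
 then show ?thesis unfolding eta_def by (simp add: ennreal_leI flip: ennreal_mult)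
qed

text \<open>A bound for \<open>eta\<close> on the j-th dyadic annulus, extended to the whole ball
  since only upper bounds are needed.\<close>

definition eta_block :: "real => int => nat => 'a::euclidean_space => ennreal" where
 "eta_block N k j x = en (2 powr (rint k * real DIM('a)) * 2 powr (- (real j * N)))
   * indicator (ball 0 (2 powr rint (int j + 1 - k))) x"

lemma borel_measurable_eta_block [measurable]: "eta_block N k j : BM"
 unfolding eta_block_def[abs_def] by measurable

lemma eta_le_blocks:
 assumes N: "0 < N"
 shows "eta N k x <= (\<Sum>j. eta_block N k j x)"
proof -
 let ?t = "1 + tp k * norm x"
 define j where "j = nat \<lfloor>log 2 ?t\<rfloor>"
 have t: "1 <= ?t" by simp
 have "0 <= log 2 ?t" by (rule iffD2[OF zero_le_log_cancel_iff]) (use t in linarith)+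
 then have j: "real j <= log 2 ?t" "log 2 ?t < real j + 1"
  unfolding j_def by (simp_all add: of_nat_floor)
 have j1: "2 powr real j <= ?t" using j t by (simp add: le_log_iff)
 have j2: "?t < 2 powr (real j + 1)" using j t by (simp add: log_less_iff)
 have "?t powr (- N) <= (2 powr real j) powr (- N)"
  using j1 N by (intro powr_mono2') auto
 then have 1: "?t powr (- N) <= 2 powr (- (real j * N))" by (simp add: powr_powr)
 have "tp k * norm x < 2 powr (real j + 1)" using j2 by linarith
 then have "norm x < 2 powr (real j + 1) * tm k"
  by (simp add: powr_minus field_simps)
 then have "norm x < 2 powr rint (int j + 1 - k)"
  unfolding powr_add[symmetric] by (simp add: algebra_simps)
 then have "eta N k x <= eta_block N k j x"
  unfolding eta_def eta_block_def using 1 by (simp add: ennreal_leI mult_left_mono)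
 also have "... <= (\<Sum>j. eta_block N k j x)"
  using sum_le_suminf[of "%j. eta_block N k j x" "{j}"] by simp
 finally show ?thesis .
qed

lemma nn_integral_eta_block_power:
 assumes u: "0 < u"
 shows "(\<integral>\<^sup>+x. epowr (eta_block N k j x :: ennreal) u \<partial>(lborel :: 'a::euclidean_space measure))
   = en (unit_ball_vol (real DIM('a)) * (2 powr ((rint k * real DIM('a) - real j * N) * u)
     * 2 powr (rint (int j + 1 - k) * real DIM('a))))"
proof -
 let ?a = "2 powr ((rint k * real DIM('a) - real j * N) * u)"
 let ?r = "2 powr rint (int j + 1 - k)"
 let ?V = "unit_ball_vol (real DIM('a))"
 have 1: "?r ^ DIM('a) = 2 powr (rint (int j + 1 - k) * real DIM('a))"
  by (simp add: powr_realpow[symmetric] powr_powr)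
 have 2: "epowr (eta_block N k j x) u = en (2 powr ((rint k * real DIM('a) - real j * N) * u))
   * indicator (ball 0 (2 powr rint (int j + 1 - k))) x" for x :: 'a
  unfolding eta_block_def epowr_mult
  by (simp add: powr_add[symmetric] powr_powr indicator_def)
 have "(\<integral>\<^sup>+x. epowr (eta_block N k j x :: ennreal) u \<partial>(lborel :: 'a measure)) = en ?a * emeasure lborel (ball (0::'a) ?r)"
  unfolding 2 by (rule nn_integral_cmult_indicator) simp
 also have "... = en ?a * en (?V * ?r ^ DIM('a))"
  by (subst emeasure_ball) auto
 also have "... = en (?a * (?V * ?r ^ DIM('a)))" by (rule ennreal_mult[symmetric]) auto
 also have "?a * (?V * ?r ^ DIM('a)) = ?V * (?a * 2 powr (rint (int j + 1 - k) * real DIM('a)))"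
  unfolding 1 by (rule mult.left_commute)
 finally show ?thesis .
qed

lemma geometric_decay_suminf:
 assumes "0 < s" "0 <= c"
 shows "(\<Sum>j. en (c * 2 powr (- (real j * s)))) = en (c / (1 - 2 powr (- s)))"
proof -
 have 1: "2 powr (- s) < 1" using assms by (simp add: powr_less_one)
 have "2 powr (- (real j * s)) = (2 powr (- s)) ^ j" for j
  by (simp add: powr_realpow[symmetric] powr_powr mult.commute)
 then have "(\<Sum>j. en (c * 2 powr (- (real j * s)))) = (\<Sum>j. en (c * (2 powr (- s)) ^ j))" by simp
 also have "... = en (c * (1 / (1 - 2 powr (- s))))"
  using 1 assms by (intro suminf_ennreal_eq sums_mult geometric_sums) auto
 finally show ?thesis by simp
qed

text \<open>Decay of order N > d beats the volumes of the balls, so the constants c_j form a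
  geometric series. One bound serves for all k because the notion of block kernel is scale
  invariant.\<close>

lemma eta_block_kernel:
 assumes N: "real DIM('a::euclidean_space) < N" and u: "1 < u"
 shows "EX A>0. ALL k. block_kernel u A (eta N k :: 'a => ennreal)"
proof -
 let ?d = "real DIM('a)"
 \<comment> \<open>The maximum with 1 yields a constant that is at least the volume of the unit ball
   and at most its own u-th power; 2^d comes from the radius 2^(j + 1 - k) in place of 2^(j -
   k).\<close>
 define C where "C = max 1 (unit_ball_vol ?d) * 2 powr ?d"
 have C: "C > 0" by (simp add: C_def)
 define A where "A = C / (1 - 2 powr (- (N - ?d)))"
 have "2 powr (- (N - ?d)) < 1" using N by (simp add: powr_less_one)
 then have A: "A > 0" using C by (simp add: A_def)
 have "block_kernel u A (eta N k :: 'a => ennreal)" for k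
  unfolding block_kernel_def
 proof (intro exI conjI allI impI)
  fix j :: nat
  show "eta_block N k j : borel_measurable (lborel :: 'a measure)" by measurable
  show "0 < C * 2 powr (- (real j * (N - ?d)))" using C by simp
  show "norm y < 2 powr rint (int j + 1 - k)" if "eta_block N k j y ~= 0" for y :: 'a
   using that by (auto simp: eta_block_def indicator_def split: if_splits)
  have V: "unit_ball_vol ?d <= max 1 (unit_ball_vol ?d) powr u"
  proof -
   have "max 1 (unit_ball_vol ?d) powr 1 <= max 1 (unit_ball_vol ?d) powr u"
    using u by (intro powr_mono) auto
   then show ?thesis by simp
  qed
  have e: "2 powr ((rint k * ?d - real j * N) * u) * 2 powr (rint (int j + 1 - k) * ?d)
    = 2 powr (?d * u) * 2 powr (- (real j * (N - ?d)) * u) * 2 powr (- (rint (int j + 1 - k) * ?d * (u - 1)))"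
   unfolding powr_add[symmetric] by (simp add: algebra_simps)
  have le: "unit_ball_vol ?d * (2 powr ((rint k * ?d - real j * N) * u) * 2 powr (rint (int j + 1 - k) * ?d))
    <= (C * 2 powr (- (real j * (N - ?d)))) powr u * 2 powr (- (rint (int j + 1 - k) * ?d * (u - 1)))"
  proof -
   have "max 1 (unit_ball_vol ?d) powr u * (2 powr ((rint k * ?d - real j * N) * u) * 2 powr (rint (int j + 1 - k) * ?d))
    = (C * 2 powr (- (real j * (N - ?d)))) powr u * 2 powr (- (rint (int j + 1 - k) * ?d * (u - 1)))"
    unfolding e C_def by (simp add: powr_mult powr_powr)
   then show ?thesis by (metis V mult_right_mono mult_nonneg_nonneg powr_ge_zero)
  qed
  have u0: "0 < u" using u by simp
  show "(\<integral>\<^sup>+y. epowr (eta_block N k j y) u \<partial>(lborel :: 'a measure))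
    <= en ((C * 2 powr (- (real j * (N - ?d)))) powr u * 2 powr (- (rint (int j + 1 - k) * ?d * (u - 1))))"
   unfolding nn_integral_eta_block_power[OF u0] by (rule ennreal_leI[OF le])
 next
  show "(\<Sum>j. en (C * 2 powr (- (real j * (N - ?d))))) <= en A"
   unfolding A_def using C N by (subst geometric_decay_suminf) auto
  show "eta N k y <= (\<Sum>j. eta_block N k j y)" for y :: 'a by (rule eta_le_blocks) (use N in auto)
 qed
 with A show ?thesis by blast
qed

lemma nn_integral_eta_bound:
 assumes N: "real DIM('a::euclidean_space) < N"
 shows "EX E>0. ALL k. (NN x. eta N k (x :: 'a)) <= en E"
proof -
 let ?d = "real DIM('a)"
 define C where "C = unit_ball_vol ?d * 2 powr ?d"
 have C: "C > 0" by (simp add: C_def)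
 have "2 powr (- (N - ?d)) < 1" using N by (simp add: powr_less_one)
 then have E: "C / (1 - 2 powr (- (N - ?d))) > 0" using C by simp
 have "(NN x. eta N k (x :: 'a)) <= en (C / (1 - 2 powr (- (N - ?d))))" for k
 proof -
  have "(NN x. eta N k (x :: 'a)) <= (NN x. (\<Sum>j. eta_block N k j (x :: 'a)))"
   by (intro nn_integral_mono eta_le_blocks) (use N in auto)
  also have "... = (\<Sum>j. NN x. epowr (eta_block N k j (x :: 'a)) 1)"
   by (simp add: nn_integral_suminf)
  also have "... = (\<Sum>j. en (C * 2 powr (- (real j * (N - ?d)))))"
  proof (intro arg_cong[where f=suminf] ext)
   fix j
   have "2 powr ((rint k * ?d - real j * N) * 1) * 2 powr (rint (int j + 1 - k) * ?d)
    = 2 powr ?d * 2 powr (- (real j * (N - ?d)))"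
    unfolding powr_add[symmetric] by (simp add: algebra_simps)
   then show "(NN x. epowr (eta_block N k j (x :: 'a)) 1) = en (C * 2 powr (- (real j * (N - ?d))))"
    by (subst nn_integral_eta_block_power) (simp_all only: C_def mult.assoc zero_less_one)
  qed
  also have "... = en (C / (1 - 2 powr (- (N - ?d))))"
   using C N by (intro geometric_decay_suminf) auto
  finally show ?thesis .
 qed
 with E show ?thesis by blast
qed

text \<open>A majorant constant on cubes, hence measurable for arbitrary \<open>f\<close>; it puts
  band-limited pieces into the form required by the scale kernel estimates.\<close>

definition cube_sup :: "int => ('a::euclidean_space => ennreal) => 'a => ennreal" where
 "cube_sup k f x = (SUP y\<in>(cube k x). f y)"

lemma cube_sup_constant: "cube_constant k (cube_sup k f)"
 unfolding cube_constant_def cube_sup_def by simp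

lemma le_cube_sup: "f x <= cube_sup k f x"
 unfolding cube_sup_def by (rule SUP_upper) simp

lemma borel_measurable_cube_sup [measurable]: "cube_sup k f : BM"
 by (rule cube_measurable[OF cube_sup_constant]) simp

text \<open>\<open>eta\<close> at generation k changes by at most a bounded factor across a cube of
  generation k, so averages absorb the supremum.\<close>

lemma cube_sup_conv_eta_le:
 fixes f :: "'a::euclidean_space => ennreal"
 assumes N: "0 <= N" and [measurable]: "f : BM"
 shows "cube_sup k (nnconv (eta N k) f) x <= en ((1 + 2 * real DIM('a)) powr N) * nnconv (eta N k) f x"
 unfolding cube_sup_def
proof (rule SUP_least)
 fix x' assume "x' : (cube k x)"
 then have "norm (x' - x) <= 2 * real DIM('a) * tm k"
  by (intro norm_same_cube) simp
 then have "nnconv (eta N k) f x' <= (NN y. en ((1 + 2 * real DIM('a)) powr N) * (eta N k (x - y) * f y))"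
  unfolding nnconv_def mult.assoc[symmetric] using N
  by (intro nn_integral_mono mult_right_mono eta_slow) auto
 also have "... = en ((1 + 2 * real DIM('a)) powr N) * nnconv (eta N k) f x"
  unfolding nnconv_def by (rule nn_integral_cmult) measurable
 finally show "nnconv (eta N k) f x' <= en ((1 + 2 * real DIM('a)) powr N) * nnconv (eta N k) f x" .
qed

lemma exists_exponent:
 fixes L R :: real
 assumes "0 <= L" "L < R" "R <= 1"
 shows "EX u>1. L < 1 - 1/u & 1 - 1/u < R"
proof (intro exI conjI)
 \<comment> \<open>1 - 1/u is the midpoint of L and R.\<close>
 let ?u = "1 / (1 - (L + R) / 2)"
 show "1 < ?u" using assms by (simp add: field_simps)
 show "L < 1 - 1 / ?u" "1 - 1 / ?u < R" using assms by (auto simp: field_simps)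
qed

lemma mixed_int_mono:
 "(!!k x. f k x <= g k x) ==> 0 < p ==> 0 < q ==> mixed_int p q f <= mixed_int p q g"
 unfolding mixed_int_def by (intro nn_integral_mono epowr_mono) auto

lemma mixed_sup_mono: "(!!k x. f k x <= g k x) ==> 0 < p ==> mixed_sup p f <= mixed_sup p g"
 unfolding mixed_sup_def by (intro nn_integral_mono epowr_mono SUP_mono) auto

lemma mixed_int_cmult:
 assumes [measurable]: "!!k. f k : LM" and "0 <= c" "0 < q"
 shows "mixed_int p q (%k x. en c * f k x) = en (c powr p) * mixed_int p q f"
 unfolding mixed_int_def using assms(2,3)
 by (simp add: epowr_mult nn_integral_cmult powr_powr)

lemma mixed_sup_cmult:
 assumes [measurable]: "!!k. f k : LM" and "0 <= c"
 shows "mixed_sup p (%k x. en c * f k x) = en (c powr p) * mixed_sup p f"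
proof -
 have "mixed_sup p (%k x. en c * f k x) = (NN x. en (c powr p) * epowr (SUP k. f k x) p)"
  unfolding mixed_sup_def using assms(2) by (simp add: SUP_mult_left_ennreal[symmetric] epowr_mult)
 also have "... = en (c powr p) * mixed_sup p f"
  unfolding mixed_sup_def by (rule nn_integral_cmult) measurable
 finally show ?thesis .
qed

lemma mixed_int_epowr: "0 < a ==> mixed_int p q (%k x. epowr (f k x) a) = mixed_int (a * p) (a * q) f"
 unfolding mixed_int_def by (simp add: epowr_epowr)

lemma mixed_sup_epowr: "0 < a ==> mixed_sup p (%k x. epowr (f k x) a) = mixed_sup (a * p) f"
 unfolding mixed_sup_def by (simp add: epowr_epowr flip: epowr_SUP)

section \<open>Sequences dominated by averages of their square roots\<close>

text \<open>Peetre's inequality with power 1/2. For p >= 1 the square roots are measured with the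
  exponent 2p > 1, where averages against \<open>eta\<close> are bounded.\<close>

definition sqrt_dominated :: "real => real => (int => 'a::euclidean_space => ennreal) => bool" where
 "sqrt_dominated N c f \<longleftrightarrow> (ALL k. f k : BM &
   (ALL x. epowr (f k x) (1/2) <= en c * nnconv (eta N k) (%y. epowr (f k y) (1/2)) x))"

lemma cube_sup_sqrt_dominated:
 fixes f :: "int => 'a::euclidean_space => ennreal"
 assumes f: "sqrt_dominated N c f" and N: "0 <= N" and c: "0 <= c"
 shows "epowr (cube_sup k (f k) x) (1/2)
   <= en (c * (1 + 2 * real DIM('a)) powr N) * nnconv (eta N k) (%y. epowr (f k y) (1/2)) x"
proof -
 have [measurable]: "f k : BM" using f by (simp add: sqrt_dominated_def)
 let ?G = "nnconv (eta N k) (%y. epowr (f k y) (1/2))"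
 have "epowr (cube_sup k (f k) x) (1/2) = (SUP y\<in>(cube k x). epowr (f k y) (1/2))"
  unfolding cube_sup_def by (rule epowr_SUP) simp
 also have "... <= en c * cube_sup k ?G x"
 proof (rule SUP_least)
  fix y assume y: "y : (cube k x)"
  have "epowr (f k y) (1/2) <= en c * ?G y" using f by (simp add: sqrt_dominated_def)
  also have "... <= en c * cube_sup k ?G x"
   unfolding cube_sup_def using y by (intro mult_left_mono SUP_upper) auto
  finally show "epowr (f k y) (1/2) <= en c * cube_sup k ?G x" .
 qed
 also have "... <= en c * (en ((1 + 2 * real DIM('a)) powr N) * ?G x)"
  by (intro mult_left_mono cube_sup_conv_eta_le N) auto
 finally show ?thesis using c by (simp add: ennreal_mult mult.assoc)
qed

text \<open>Pieces are majorized by their suprema over cubes, to which the scale kernel bound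
  applies; the suprema are brought back to the pieces through square roots, where the block bound
  acts on \<open>eta\<close>.\<close>

theorem sqrt_dominated_bound_less:
 assumes p: "1 <= p" "p < q" and N: "real DIM('a::euclidean_space) < N" and c: "0 < c" and ep: "0 < ep"
 shows "EX C>0. ALL A>0. \<forall>h (f :: int => 'a => ennreal). scale_kernel ep A h & sqrt_dominated N c f -->
   mixed_int p q (%k. nnconv (h k) (f k)) <= en (C * A powr p) * mixed_int p q f"
proof -
 let ?c = "c * (1 + 2 * real DIM('a)) powr N"
 \<comment> \<open>These are the hypotheses of \<open>block_bound_greater\<close> for 2p < 2q. As
   \<open>eta\<close> is a block kernel for every u > 1, only this interval restricts the
   choice.\<close>
 have "EX u>1. 1/(2*p) - 1/(2*q) < 1 - 1/u & 1 - 1/u < 1 - 1/(2*q)"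
  by (rule exists_exponent) (use p in "auto simp: field_simps")
 then obtain u where u: "1 < u" "1/(2*p) - 1/(2*q) < 1 - 1/u" "1 - 1/u < 1 - 1/(2*q)" by blast
 obtain E where E: "E > 0" "!!k. block_kernel u E (eta N k :: 'a => ennreal)"
  using eta_block_kernel[OF N u(1)] by blast
 obtain B where B: "B > 0" and blk: "!!A (h :: int => 'a => ennreal) f.
   (ALL k. block_kernel u A (h k) & h k : LM & f k : LM) ==>
   mixed_int (2*p) (2*q) (%k. nnconv (h k) (f k)) <= en (B * A powr (2*p)) * mixed_int (2*p) (2*q) f"
  using block_bound_greater[of "2*p" "2*q" u, where 'a='a] p u by auto
 define S where "S = q / p + sup_const ep DIM('a)"
 have S: "S > 0" using sup_const_pos[OF ep] p unfolding S_def by (intro add_pos_pos) auto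
 define C where "C = S * (?c powr (2*p) * (B * E powr (2*p)))"
 have C: "C > 0" using S c B E by (simp add: C_def)
 have "mixed_int p q (%k. nnconv (h k) (f k)) <= en (C * A powr p) * mixed_int p q f"
  if A: "A > 0" and h: "scale_kernel ep A h" and f: "sqrt_dominated N c f" for A h and f :: "int => 'a => ennreal"
 proof -
  have [measurable]: "f k : BM" "f k : LM" for k
   using f by (simp_all add: sqrt_dominated_def)
  define a where "a k = cube_sup k (f k)" for k
  have [measurable]: "a k : LM" for k unfolding a_def by simp
  let ?G = "%k. nnconv (eta N k) (%y. epowr (f k y) (1/2))"
  have "mixed_int p q (%k. nnconv (h k) (f k)) <= mixed_int p q (%k. nnconv (h k) (a k))"
   using p by (intro mixed_int_mono nnconv_mono) (auto simp: a_def le_cube_sup)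
  also have "... <= en (S * A powr p) * mixed_int p q a"
   unfolding S_def by (intro scale_kernel_bound_less h ep A p) (simp add: a_def cube_sup_constant)
  also have "mixed_int p q a = mixed_int (2*p) (2*q) (%k x. epowr (a k x) (1/2))"
   by (simp add: mixed_int_epowr)
  also have "... <= mixed_int (2*p) (2*q) (%k x. en ?c * ?G k x)"
   unfolding a_def using p N c by (intro mixed_int_mono cube_sup_sqrt_dominated f) auto
  also have "... = en (?c powr (2*p)) * mixed_int (2*p) (2*q) ?G"
   using p c by (intro mixed_int_cmult) auto
  also have "mixed_int (2*p) (2*q) ?G <= en (B * E powr (2*p)) * mixed_int (2*p) (2*q) (%k y. epowr (f k y) (1/2))"
   by (rule blk) (use E in auto)
  also have "mixed_int (2*p) (2*q) (%k y. epowr (f k y) (1/2)) = mixed_int p q f"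
   by (simp add: mixed_int_epowr)
  finally have "mixed_int p q (%k. nnconv (h k) (f k))
    <= en (S * A powr p) * (en (?c powr (2*p)) * (en (B * E powr (2*p)) * mixed_int p q f))"
   by (simp add: mult_left_mono)
  also have "... = en (S * A powr p * (?c powr (2*p) * (B * E powr (2*p)))) * mixed_int p q f"
   using S B by (simp add: ennreal_mult mult.assoc)
  also have "S * A powr p * (?c powr (2*p) * (B * E powr (2*p))) = C * A powr p" by (simp add: C_def)
  finally show ?thesis .
 qed
 with C show ?thesis by blast
qed

theorem sqrt_dominated_bound_sup:
 assumes p: "1 <= p" and N: "real DIM('a::euclidean_space) < N" and c: "0 < c" and ep: "0 < ep"
 shows "EX C>0. ALL A>0. \<forall>h (f :: int => 'a => ennreal). scale_kernel ep A h & sqrt_dominated N c f -->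
   mixed_sup p (%k. nnconv (h k) (f k)) <= en (C * A powr p) * mixed_sup p f"
proof -
 let ?c = "c * (1 + 2 * real DIM('a)) powr N"
 have "EX u>1. 1/(2*p) < 1 - 1/u & 1 - 1/u < 1"
  by (rule exists_exponent) (use p in "auto simp: field_simps")
 then obtain u where u: "1 < u" "1/(2*p) < 1 - 1/u" by blast
 obtain E where E: "E > 0" "!!k. block_kernel u E (eta N k :: 'a => ennreal)"
  using eta_block_kernel[OF N u(1)] by blast
 obtain B where B: "B > 0" and blk: "!!A (h :: int => 'a => ennreal) f.
   (ALL k. block_kernel u A (h k) & h k : LM & f k : LM) ==>
   mixed_sup (2*p) (%k. nnconv (h k) (f k)) <= en (B * A powr (2*p)) * mixed_sup (2*p) f"
  using block_bound_sup[of "2*p" u, where 'a='a] p u by auto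
 define S where "S = sup_const ep DIM('a)"
 have S: "S > 0" using sup_const_pos[OF ep] unfolding S_def .
 define C where "C = S * (?c powr (2*p) * (B * E powr (2*p)))"
 have C: "C > 0" using S c B E by (simp add: C_def)
 have "mixed_sup p (%k. nnconv (h k) (f k)) <= en (C * A powr p) * mixed_sup p f"
  if A: "A > 0" and h: "scale_kernel ep A h" and f: "sqrt_dominated N c f" for A h and f :: "int => 'a => ennreal"
 proof -
  have [measurable]: "f k : BM" "f k : LM" for k
   using f by (simp_all add: sqrt_dominated_def)
  define a where "a k = cube_sup k (f k)" for k
  have [measurable]: "a k : LM" for k unfolding a_def by simp
  let ?G = "%k. nnconv (eta N k) (%y. epowr (f k y) (1/2))"
  have "mixed_sup p (%k. nnconv (h k) (f k)) <= mixed_sup p (%k. nnconv (h k) (a k))"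
   using p by (intro mixed_sup_mono nnconv_mono) (auto simp: a_def le_cube_sup)
  also have "... <= en (S * A powr p) * mixed_sup p a"
   unfolding S_def by (intro scale_kernel_bound_sup h ep A p) (simp add: a_def cube_sup_constant)
  also have "mixed_sup p a = mixed_sup (2*p) (%k x. epowr (a k x) (1/2))"
   by (simp add: mixed_sup_epowr)
  also have "... <= mixed_sup (2*p) (%k x. en ?c * ?G k x)"
   unfolding a_def using p N c by (intro mixed_sup_mono cube_sup_sqrt_dominated f) auto
  also have "... = en (?c powr (2*p)) * mixed_sup (2*p) ?G"
   using p c by (intro mixed_sup_cmult) auto
  also have "mixed_sup (2*p) ?G <= en (B * E powr (2*p)) * mixed_sup (2*p) (%k y. epowr (f k y) (1/2))"
   by (rule blk) (use E in auto)
  also have "mixed_sup (2*p) (%k y. epowr (f k y) (1/2)) = mixed_sup p f"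
   by (simp add: mixed_sup_epowr)
  finally have "mixed_sup p (%k. nnconv (h k) (f k))
    <= en (S * A powr p) * (en (?c powr (2*p)) * (en (B * E powr (2*p)) * mixed_sup p f))"
   by (simp add: mult_left_mono)
  also have "... = en (S * A powr p * (?c powr (2*p) * (B * E powr (2*p)))) * mixed_sup p f"
   using S B by (simp add: ennreal_mult mult.assoc)
  also have "S * A powr p * (?c powr (2*p) * (B * E powr (2*p))) = C * A powr p" by (simp add: C_def)
  finally show ?thesis .
 qed
 with C show ?thesis by blast
qed

section \<open>Sequences dominated by their averages\<close>

lemma conv_eta_jensen:
 fixes f :: "'a::euclidean_space => ennreal"
 assumes E: "(NN x. eta N k (x :: 'a)) <= en E" "0 < E" and [measurable]: "f : BM" and q: "1 <= q"
 shows "epowr (nnconv (eta N k) f x) q <= en (E powr (q - 1)) * nnconv (eta N k) (%y. epowr (f y) q) x"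
proof -
 have "(NN y. eta N k (x - y)) = (NN y. eta N k (y :: 'a))" by (rule nn_reflect) measurable
 then show ?thesis unfolding nnconv_def using E by (intro jensen_epowr q) auto
qed

text \<open>For q < p the estimate is dualized: with w in L^rh, rh the conjugate of p / q, both the
  kernel and the average are moved onto w. There the averages of w take the role of the pieces, and
  the supremum bound applies because rh > 1.\<close>

theorem smoothed_bound_greater:
 assumes q: "1 <= q" "q < p" and N: "real DIM('a::euclidean_space) < N" and c: "0 < c" and ep: "0 < ep"
 shows "EX C>0. ALL A>0. \<forall>h (f :: int => 'a => ennreal) g. scale_kernel ep A h &
   (ALL k. f k : BM & g k : BM &
     (ALL x. g k x <= nnconv (h k) (%y. en c * nnconv (eta N k) (f k) y) x)) -->
   mixed_int p q g <= en (C * A powr p) * mixed_int p q f"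
proof -
 define P where "P = p / q"
 define rh where "rh = P / (P - 1)"
 have P: "1 < P" using q by (simp add: P_def)
 have rh: "1 < rh" using P by (simp add: rh_def)
 have "EX u>1. 1/rh < 1 - 1/u & 1 - 1/u < 1"
  by (rule exists_exponent) (use rh in "auto simp: field_simps")
 then obtain u where u: "1 < u" "1/rh < 1 - 1/u" by blast
 define v where "v = 1 / (1 - 1/u)"
 have v: "0 < v" "v < rh" using u rh by (auto simp: v_def field_simps)
 obtain K where K: "K > 0" "!!k. block_kernel u K (eta N k :: 'a => ennreal)"
  using eta_block_kernel[OF N u(1)] by blast
 obtain E where E: "E > 0" "!!k. (NN x. eta N k (x :: 'a)) <= en E"
  using nn_integral_eta_bound[OF N] by blast
 obtain B where B: "B > 0" and HB: "!!w. w : borel_measurable (lborel :: 'a measure) ==>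
   (NN x. epowr (HLv v w x) rh) <= en B * (NN x. epowr (w x) rh)"
  using HLv_strong_type[OF v] by blast
 define D where "D = (1 + 2 * real DIM('a)) powr N * K"
 have D: "D > 0" using K by (simp add: D_def)
 define S where "S = sup_const ep DIM('a)"
 have S: "S > 0" using sup_const_pos[OF ep] unfolding S_def .
 define M where "M = c powr q * E powr (q - 1)"
 have M: "M > 0" using c E by (simp add: M_def)
 define C where "C = (M * (S * (D powr rh * B)) powr (1 - 1/P)) powr P"
 have C: "C > 0" using M S D B by (simp add: C_def)
 have "mixed_int p q g <= en (C * A powr p) * mixed_int p q f"
  if A: "A > 0" and h: "scale_kernel ep A h"
   and f [measurable]: "!!k. f k : BM" and g [measurable]: "!!k. g k : BM"
   and gle: "!!k x. g k x <= nnconv (h k) (%y. en c * nnconv (eta N k) (f k) y) x"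
  for A h and f g :: "int => 'a => ennreal"
 proof -
  have [measurable]: "h k : BM" "h k : LM" for k
   using scale_kernelD(1)[OF h, of k] by auto
  define T where "T x = (CC k. epowr (g k x) q)" for x
  define F where "F x = (CC k. epowr (f k x) q)" for x
  have [measurable]: "T : LM" "F : LM"
   unfolding T_def F_def by measurable
  have mF: "mixed_int p q f = (NN x. epowr (F x) P)"
   by (simp add: mixed_int_def F_def P_def)
  have mT: "mixed_int p q g = (NN x. epowr (T x) P)"
   by (simp add: mixed_int_def T_def P_def)
  have AM: "A powr (q - 1) * M > 0" using A M by simp
  have gq: "epowr (g k x) q <= en (A powr (q - 1) * M) * nnconv (h k) (nnconv (eta N k) (%y. epowr (f k y) q)) x" for k x
  proof -
   let ?Y = "%y. en c * nnconv (eta N k) (f k) y"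
   have Ym [measurable]: "?Y : LM" by (intro borel_measurable_times_ennreal meas_nnconv) auto
   have "epowr (g k x) q <= epowr (nnconv (h k) ?Y x) q"
    using gle q by (intro epowr_mono) auto
   also have "... <= en (A powr (q - 1)) * nnconv (h k) (%y. epowr (?Y y) q) x"
    by (rule conv_jensen[OF h A Ym q(1)])
   also have "... <= en (A powr (q - 1)) * nnconv (h k) (%y. en M * nnconv (eta N k) (%y. epowr (f k y) q) y) x"
   proof (intro mult_left_mono nnconv_mono)
    fix y
    have "epowr (?Y y) q = en (c powr q) * epowr (nnconv (eta N k) (f k) y) q"
     using c by (simp add: epowr_mult)
    also have "... <= en (c powr q) * (en (E powr (q - 1)) * nnconv (eta N k) (%y. epowr (f k y) q) y)"
     by (intro mult_left_mono conv_eta_jensen E f q) auto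
    finally show "epowr (?Y y) q <= en M * nnconv (eta N k) (%y. epowr (f k y) q) y"
     by (simp add: M_def ennreal_mult mult.assoc)
   qed auto
   also have "nnconv (h k) (%y. en M * nnconv (eta N k) (%y. epowr (f k y) q) y) x
     = en M * nnconv (h k) (nnconv (eta N k) (%y. epowr (f k y) q)) x"
    unfolding nnconv_def[of "h k"] mult.left_commute[of _ "en M"]
    using meas_nnconv[of "eta N k" "%y. epowr (f k y) q"] by (intro nn_integral_cmult) auto
   finally show ?thesis using M by (simp add: ennreal_mult mult.assoc)
  qed
  show ?thesis
  proof (cases "mixed_int p q f = top")
   case True
   have "en (C * A powr p) ~= 0" using C A by (simp add: ennreal_eq_0_iff not_le)
   then show ?thesis unfolding True by (simp only: ennreal_mult_top if_False top_greatest)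
  next
   case False
   then obtain I where I: "mixed_int p q f = en I" "0 <= I" by (metis ennreal_cases)
   define W where "W = S * A powr rh * (D powr rh * B)"
   have W: "W > 0" using S A D B by (simp add: W_def)
   define C0 where "C0 = A powr (q - 1) * M * (I powr (1/P) * W powr (1 - 1/P))"
   have "(NN x. epowr (T x) P) <= en (C0 powr P)"
   proof (rule dual_bound)
    fix w :: "'a => ennreal" assume w: "w : LM"
    then have [measurable]: "w : BM" "w : LM" by auto
    have [measurable]: "HLv v w : LM" by (rule borel_measurable_HLv) fact
    define h' where "h' k y = h k (- y)" for k y
    have h': "scale_kernel ep A h'" using scale_kernel_reflect[OF h] by (simp add: h'_def[abs_def])
    have [measurable]: "h' k : BM" "h' k : LM" for k
     using scale_kernelD(1)[OF h', of k] by auto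
    \<comment> \<open>Only averages of w at generation k occur, and these may be replaced by their
      suprema over cubes.\<close>
    define b where "b k = cube_sup k (nnconv (eta N k) w)" for k
    have [measurable]: "b k : BM" for k unfolding b_def by simp
    define Z where "Z x = (SUP k. nnconv (h' k) (b k) x)" for x
    have [measurable]: "Z : LM" unfolding Z_def by (intro borel_measurable_SUP meas_nnconv) auto
    have bV: "b k x <= en D * HLv v w x" for k x
    proof -
     have "b k x <= en ((1 + 2 * real DIM('a)) powr N) * nnconv (eta N k) w x"
      unfolding b_def using N by (intro cube_sup_conv_eta_le) auto
     also have "... <= en ((1 + 2 * real DIM('a)) powr N) * (en K * HLv v w x)"
      unfolding v_def using K u by (intro mult_left_mono block_kernel_conv_le) auto
     finally show ?thesis using K by (simp add: D_def ennreal_mult mult.assoc)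
    qed
    have ZW: "(NN x. epowr (Z x) rh) <= en W * (NN x. epowr (w x) rh)"
    proof -
     have "(NN x. epowr (Z x) rh) = mixed_sup rh (%k. nnconv (h' k) (b k))"
      by (simp add: mixed_sup_def Z_def)
     also have "... <= en (S * A powr rh) * mixed_sup rh b"
      unfolding S_def using rh by (intro scale_kernel_bound_sup h' ep A) (auto simp: b_def cube_sup_constant)
     also have "mixed_sup rh b <= (NN x. epowr (en D * HLv v w x) rh)"
      unfolding mixed_sup_def using rh by (intro nn_integral_mono epowr_mono SUP_least bV) auto
     also have "... = en (D powr rh) * (NN x. epowr (HLv v w x) rh)"
      using D by (simp add: epowr_mult nn_integral_cmult)
     also have "... <= en (D powr rh) * (en B * (NN x. epowr (w x) rh))"
      by (intro mult_left_mono HB w) auto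
     finally show ?thesis
      using S A D B by (simp add: W_def ennreal_mult mult.assoc mult_left_mono)
    qed
    have one: "(NN x. epowr (g k x) q * w x)
      <= en (A powr (q - 1) * M) * (NN x. epowr (f k x) q * Z x)" for k
    proof -
     let ?f = "%y. epowr (f k y) q"
     have "(NN x. epowr (g k x) q * w x)
       <= (NN x. en (A powr (q - 1) * M) * (nnconv (h k) (nnconv (eta N k) ?f) x * w x))"
      unfolding mult.assoc[symmetric] by (intro nn_integral_mono mult_right_mono gq) auto
     also have "... = en (A powr (q - 1) * M) * (NN x. nnconv (h k) (nnconv (eta N k) ?f) x * w x)"
      by (intro nn_integral_cmult borel_measurable_times_ennreal meas_nnconv) auto
     also have "(NN x. nnconv (h k) (nnconv (eta N k) ?f) x * w x)
       = (NN y. nnconv (eta N k) ?f y * nnconv (h' k) w y)"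
      unfolding h'_def by (intro nn_nnconv_mult meas_nnconv) auto
     also have "... = (NN y. ?f y * nnconv (%z. eta N k (- z)) (nnconv (h' k) w) y)"
      by (intro nn_nnconv_mult meas_nnconv) auto
     also have "... <= (NN y. ?f y * Z y)"
     proof (intro nn_integral_mono mult_left_mono)
      fix y
      \<comment> \<open>The order is exchanged so that \<open>eta\<close> hits w first and the
        reflected kernel then acts on a function that varies slowly on cubes.\<close>
      have com: "nnconv (eta N k) (h' k) = nnconv (h' k) (eta N k)" by (intro ext nnconv_commute) auto
      have "nnconv (%z. eta N k (- z)) (nnconv (h' k) w) y = nnconv (nnconv (eta N k) (h' k)) w y"
       by (simp add: nnconv_assoc)
      also have "... = nnconv (h' k) (nnconv (eta N k) w) y"
       unfolding com by (simp add: nnconv_assoc)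
      also have "... <= nnconv (h' k) (b k) y"
       unfolding b_def by (intro nnconv_mono le_cube_sup) auto
      also have "... <= Z y" unfolding Z_def by (rule SUP_upper) simp
      finally show "nnconv (%z. eta N k (- z)) (nnconv (h' k) w) y <= Z y" .
     qed auto
     finally show ?thesis by (simp add: mult_left_mono)
    qed
    have "(NN x. T x * w x) = (NN x. (CC k. epowr (g k x) q * w x))"
     unfolding T_def by (simp add: nn_integral_multc)
    also have "... = (CC k. (NN x. epowr (g k x) q * w x))"
     by (rule count_int_swap) measurable
    also have "... <= (CC k. en (A powr (q - 1) * M) * (NN x. epowr (f k x) q * Z x))"
     by (intro nn_integral_mono one)
    also have "... = en (A powr (q - 1) * M) * (CC k. (NN x. epowr (f k x) q * Z x))"
     by (rule nn_integral_cmult) simp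
    also have "(CC k. (NN x. epowr (f k x) q * Z x)) = (NN x. F x * Z x)"
     unfolding F_def by (subst count_int_swap[symmetric]) (auto simp: nn_integral_multc)
    also have "... = (NN x. epowr (epowr (F x) P) (1/P) * epowr (epowr (Z x) rh) (1 - 1/P))"
    proof -
     have "rh * (1 - 1/P) = 1" using P by (simp add: rh_def field_simps)
     then show ?thesis using P by (simp add: epowr_epowr)
    qed
    also have "... <= epowr (NN x. epowr (F x) P) (1/P) * epowr (NN x. epowr (Z x) rh) (1 - 1/P)"
     by (rule holder_epowr) (use P in auto)
    also have "... <= epowr (en I) (1/P) * epowr (en W * (NN x. epowr (w x) rh)) (1 - 1/P)"
     using P I mF by (intro mult_mono epowr_mono ZW) auto
    also have "... = en (I powr (1/P) * W powr (1 - 1/P)) * epowr (NN x. epowr (w x) (P / (P - 1))) (1 - 1/P)"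
     using I W by (simp add: epowr_mult ennreal_mult mult.assoc rh_def)
    finally have "(NN x. T x * w x) <= en (A powr (q - 1) * M) *
      (en (I powr (1/P) * W powr (1 - 1/P)) * epowr (NN x. epowr (w x) (P / (P - 1))) (1 - 1/P))"
     by (simp add: mult_left_mono)
    also have "... = en C0 * epowr (NN x. epowr (w x) (P / (P - 1))) (1 - 1/P)"
    proof -
     have "en C0 = en (A powr (q - 1) * M) * en (I powr (1/P) * W powr (1 - 1/P))"
      unfolding C0_def using AM I W by (intro ennreal_mult) auto
     then show ?thesis by (simp only: mult.assoc)
    qed
    finally show "(NN x. T x * w x) <= en C0 * epowr (NN x. epowr (w x) (P / (P - 1))) (1 - 1/P)" .
   qed (use P AM in "auto simp: C0_def")
   also have "C0 powr P = C * A powr p * I"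
   proof -
    define V where "V = S * (D powr rh * B)"
    have V: "V > 0" using S D B by (simp add: V_def)
    have "W powr (1 - 1/P) = V powr (1 - 1/P) * A"
    proof -
     have "rh * (1 - 1/P) = 1" using P by (simp add: rh_def field_simps)
     moreover have "W = V * A powr rh" by (simp add: W_def V_def)
     ultimately show ?thesis using A V by (simp add: powr_mult powr_powr)
    qed
    then have "C0 = A powr q * (M * V powr (1 - 1/P)) * I powr (1/P)"
     unfolding C0_def using A powr_add[of A "q - 1" 1] by simp
    then show ?thesis unfolding C_def V_def[symmetric] using A M V I P q
     by (simp add: powr_mult powr_powr P_def)
   qed
   finally show ?thesis unfolding mT I(1) using C I by (simp add: ennreal_mult)
  qed
 qed
 with C show ?thesis by blast
qed

section \<open>Carleson bounds\<close>

lemma corner_idem [simp]: "corner k (corner k x) = corner k x"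
proof -
 have "tp k * (corner k x \<bullet> b) = rint \<lfloor>tp k * (x \<bullet> b)\<rfloor>" if "b : Basis" for b
  using corner_inner[OF that, of k x] by (simp flip: mult.assoc powr_add)
 then show ?thesis by (simp add: corner_eq_iff)
qed

text \<open>Split the integral into cubes of generation j: W is constant on each, so G enters only
  through its cube averages, which are at most M.\<close>

lemma nn_integral_cube_average:
 fixes G W :: "'a::euclidean_space => ennreal"
 assumes [measurable]: "G : BM"
  and G: "!!x. (NN y. G y * indicator (cube j x) y)
       <= en M * en (2 powr (- (rint j * real DIM('a))))"
  and W: "cube_constant j W"
 shows "(NN y. G y * W y) <= en M * (NN y. W y)"
proof -
 let ?L = "range (corner j :: 'a => 'a)"
 let ?I = "%z. indicator {y. corner j y = z} :: 'a => ennreal"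
 have [measurable]: "W : BM" by (rule cube_measurable[OF W]) simp
 have W': "W y = W (corner j y)" for y by (rule cube_constantD[OF W]) simp
 have dec: "(NN y. H y * W y) = (\<integral>\<^sup>+z. W z * (NN y. H y * ?I z y) \<partial>count_space ?L)"
  if [measurable]: "H : BM" for H
 proof -
  have "H y * W y = (\<integral>\<^sup>+z. W z * (H y * ?I z y) \<partial>count_space ?L)" for y
  proof -
   have "(\<integral>\<^sup>+z. W z * (H y * ?I z y) \<partial>count_space ?L) = (\<integral>\<^sup>+z. (W (corner j y) * H y) * indicator {corner j y} z \<partial>count_space ?L)"
    by (intro nn_integral_cong) (auto simp: indicator_def)
   also have "... = W (corner j y) * H y" by (simp add: nn_integral_cmult)
   finally show ?thesis using W'[of y] by (simp add: mult.commute)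
  qed
  then have "(NN y. H y * W y) = (NN y. (\<integral>\<^sup>+z. W z * (H y * ?I z y) \<partial>count_space ?L))" by simp
  also have "... = (\<integral>\<^sup>+z. (NN y. W z * (H y * ?I z y)) \<partial>count_space ?L)"
   by (rule nn_integral_count_space_nn_integral) (auto intro: countable_range_corner)
  also have "... = (\<integral>\<^sup>+z. W z * (NN y. H y * ?I z y) \<partial>count_space ?L)"
   by (simp add: nn_integral_cmult)
  finally show ?thesis .
 qed
 have "(NN y. G y * W y) = (\<integral>\<^sup>+z. W z * (NN y. G y * ?I z y) \<partial>count_space ?L)"
  by (rule dec) simp
 also have "... <= (\<integral>\<^sup>+z. en M * (W z * (NN y. 1 * ?I z y)) \<partial>count_space ?L)"
 proof (rule nn_integral_mono)
  fix z assume "z : space (count_space ?L)"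
  then obtain x where z: "z = corner j x" by auto
  have "(NN y. G y * ?I z y) <= en M * (NN y. 1 * ?I z y)"
   using G[of x] unfolding z by (simp add: emeasure_cube)
  then show "W z * (NN y. G y * ?I z y) <= en M * (W z * (NN y. 1 * ?I z y))"
   by (metis mult.left_commute mult_left_mono zero_le)
 qed
 also have "... = en M * (\<integral>\<^sup>+z. W z * (NN y. 1 * ?I z y) \<partial>count_space ?L)"
  by (rule nn_integral_cmult) simp
 also have "(\<integral>\<^sup>+z. W z * (NN y. 1 * ?I z y) \<partial>count_space ?L) = (NN y. 1 * W y)"
  by (rule dec[symmetric]) simp
 finally show ?thesis by simp
qed

text \<open>The endpoint p = infinity: 2^(-jd) is the volume of the cube and \<open>M\<close> stands
  for the q-th power of the Triebel-Lizorkin norm.\<close>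

definition carleson :: "real => real => (int => 'a::euclidean_space => ennreal) => bool" where
 "carleson q M f \<longleftrightarrow> (ALL j x. (NN y. (CC k. epowr (f k y) q * indicator {j..} k)
    * indicator (cube j x) y)
   <= en M * en (2 powr (- (rint j * real DIM('a)))))"

text \<open>The single term k of the Carleson condition bounds the averages of f_k^q over cubes of
  its own generation; as f_k is dominated by its average at that scale, these bounds become
  pointwise.\<close>

lemma carleson_sup_bound:
 fixes f :: "int => 'a::euclidean_space => ennreal"
 assumes q: "1 <= q" and N: "0 <= N" and c: "0 < c" and E: "0 < E" "!!k. (NN x. eta N k (x :: 'a)) <= en E"
  and [measurable]: "!!k. f k : BM"
  and f: "!!x. f k x <= en c * nnconv (eta N k) (f k) x" and M: "carleson q M f"
 shows "epowr (f k x) q <= en (c powr q * E powr q * (1 + 2 * real DIM('a)) powr N) * en M"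
proof -
 let ?D = "(1 + 2 * real DIM('a)) powr N"
 define W where "W = cube_sup k (%y. eta N k (x - y))"
 have W: "W y <= en ?D * eta N k (x - y)" for y
  unfolding W_def cube_sup_def
 proof (rule SUP_least)
  fix z assume "z : (cube k y)"
  then have "norm (y - z) <= 2 * real DIM('a) * tm k" by (intro norm_same_cube) simp
  then show "eta N k (x - z) <= en ?D * eta N k (x - y)" using N by (intro eta_slow) auto
 qed
 have "(NN y. W y) <= (NN y. en ?D * eta N k (x - y))" by (intro nn_integral_mono W)
 also have "... = en ?D * (NN y. eta N k (y :: 'a))"
  by (simp add: nn_integral_cmult nn_reflect)
 also have "... <= en ?D * en E" by (intro mult_left_mono E) auto
 finally have WE: "(NN y. W y) <= en ?D * en E" .
 have cube: "(NN y. epowr (f k y) q * indicator (cube k z) y)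
       <= en M * en (2 powr (- (rint k * real DIM('a))))" for z
 proof -
  have "epowr (f k y) q <= (CC k'. epowr (f k' y) q * indicator {k..} k')" for y
   using nn_integral_ge_point[of k UNIV "%k'. epowr (f k' y) q * indicator {k..} k'"] by simp
  then have "(NN y. epowr (f k y) q * indicator (cube k z) y)
   <= (NN y. (CC k'. epowr (f k' y) q * indicator {k..} k') * indicator (cube k z) y)"
   by (intro nn_integral_mono mult_right_mono) auto
  also have "... <= en M * en (2 powr (- (rint k * real DIM('a))))"
   using M unfolding carleson_def by blast
  finally show ?thesis .
 qed
 have "epowr (f k x) q <= epowr (en c * nnconv (eta N k) (f k) x) q" using f q by (intro epowr_mono) auto
 also have "... = en (c powr q) * epowr (nnconv (eta N k) (f k) x) q" using c by (simp add: epowr_mult)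
 also have "... <= en (c powr q) * (en (E powr (q - 1)) * nnconv (eta N k) (%y. epowr (f k y) q) x)"
  by (intro mult_left_mono conv_eta_jensen E q) auto
 also have "nnconv (eta N k) (%y. epowr (f k y) q) x <= (NN y. epowr (f k y) q * W y)"
  unfolding nnconv_def W_def
  by (subst mult.commute) (intro nn_integral_mono mult_left_mono le_cube_sup[of "%y. eta N k (x - y)"], auto)
 also have "... <= en M * (NN y. W y)"
  by (rule nn_integral_cube_average[OF _ cube]) (auto simp: W_def cube_sup_constant)
 also have "... <= en M * (en ?D * en E)" by (intro mult_left_mono WE) auto
 finally have "epowr (f k x) q <= en (c powr q) * (en (E powr (q - 1)) * (en M * (en ?D * en E)))"
  by (simp add: mult_left_mono)
 also have "... = en (c powr q * (E powr (q - 1) * (?D * E))) * en M"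
  using E by (simp add: ennreal_mult mult_ac)
 also have "c powr q * (E powr (q - 1) * (?D * E)) = c powr q * E powr q * ?D"
  using E powr_add[of E "q - 1" 1] by simp
 finally show ?thesis .
qed

text \<open>The kernel is moved onto the indicator of the test cube Q of generation j. Up to
  distance 2^(-j) it only reaches a fixed neighbourhood U of Q, where the hypothesis on f is used
  cube by cube. Beyond that distance f_k is bounded pointwise and the tails of h_k sum geometrically
  over k >= j.\<close>

theorem carleson_bound:
 assumes q: "1 <= q" and N: "real DIM('a::euclidean_space) < N" and c: "0 < c" and ep: "0 < ep"
 shows "EX C>0. ALL A>0. \<forall>M\<ge>0. \<forall>h (f :: int => 'a => ennreal) g. scale_kernel ep A h &
   (ALL k. f k : BM & g k : BM & (ALL x. g k x <= nnconv (h k) (f k) x) &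
     (ALL x. f k x <= en c * nnconv (eta N k) (f k) x)) & carleson q M f -->
   carleson q (C * A powr q * M) g"
proof -
 let ?d = "real DIM('a)"
 obtain E where E: "E > 0" "!!k. (NN x. eta N k (x :: 'a)) <= en E"
  using nn_integral_eta_bound[OF N] by blast
 define L where "L = c powr q * E powr q * (1 + 2 * ?d) powr N"
 have L: "L > 0" using c E by (simp add: L_def add_pos_nonneg)
 define V where "V = unit_ball_vol ?d * (4 * ?d + 2) ^ DIM('a)"
 have V: "V > 0" by (simp add: V_def add_nonneg_pos)
 define R where "R = 1 / (1 - 2 powr (- ep))"
 have R: "R > 0" using ep by (simp add: R_def powr_less_one)
 define C where "C = V + L * R"
 have C: "C > 0" using V L R by (simp add: C_def add_pos_pos)
 have main: "carleson q (C * A powr q * M) g"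
  if A: "A > 0" and M: "M \<ge> 0" and h: "scale_kernel ep A h"
   and [measurable]: "!!k. f k : BM" "!!k. g k : BM"
   and gle: "!!k x. g k x <= nnconv (h k) (f k) x"
   and fle: "!!k x. f k x <= en c * nnconv (eta N k) (f k) x"
   and car: "carleson q M f"
  for A M h and f g :: "int => 'a => ennreal"
  unfolding carleson_def
 proof (intro allI)
  fix j :: int and x :: 'a
  let ?h = "tm j"
  define Q where "Q = (cube j x :: 'a set)"
  have [measurable]: "Q : sets borel" unfolding Q_def by measurable
  have Qm: "emeasure lborel Q = en (2 powr (- (rint j * ?d)))"
   unfolding Q_def by (rule emeasure_cube)
  have [measurable]: "h k : BM" "h k : LM" for k
   using scale_kernelD(1)[OF h, of k] by auto
  define h' where "h' k y = h k (- y)" for k y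
  have h': "scale_kernel ep A h'" using scale_kernel_reflect[OF h] by (simp add: h'_def[abs_def])
  have [measurable]: "h' k : BM" "h' k : LM" for k
   using scale_kernelD(1)[OF h', of k] by auto
  define T where "T = {y::'a. ?h < norm y}"
  have [measurable]: "T : sets borel" unfolding T_def by measurable
  define far where "far k y = h' k y * indicator T y" for k y
  have [measurable]: "far k : BM" for k unfolding far_def by measurable
  \<comment> \<open>U consists of whole cubes. A point within 2^(-j) of Q has its corner within d +
    d + 1 side lengths of that of Q; conversely U lies in a ball of radius 4 d + 2 side
    lengths.\<close>
  define U where "U = {y :: 'a. norm (corner j y - corner j x) <= (2 * ?d + 1) * ?h}"
  have [measurable]: "U : sets borel" unfolding U_def by measurable
  have U: "cube_constant j (indicator U :: 'a => ennreal)"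
   unfolding cube_constant_def U_def indicator_def by auto
  have Um: "emeasure lborel U <= en (V * 2 powr (- (rint j * ?d)))"
  proof -
   have "U <= ball x ((4 * ?d + 2) * ?h)"
   proof
    fix y assume "y : U"
    then have y: "norm (corner j y - corner j x) <= (2 * ?d + 1) * ?h" by (simp add: U_def)
    have "x - y = (x - corner j x) - (y - corner j y) - (corner j y - corner j x)" by simp
    then have "norm (x - y) <= norm (x - corner j x) + norm (y - corner j y) + norm (corner j y - corner j x)"
     by (smt (verit) norm_triangle_ineq4)
    also have "... <= ?d * ?h + ?d * ?h + (2 * ?d + 1) * ?h"
     by (intro add_mono norm_diff_corner y)
    also have "... < (4 * ?d + 2) * ?h" by (simp add: algebra_simps)
    finally show "y : ball x ((4 * ?d + 2) * ?h)" by (simp add: dist_norm)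
   qed
   then have "emeasure lborel U <= emeasure lborel (ball x ((4 * ?d + 2) * ?h))" by (intro emeasure_mono) auto
   also have "... = en (V * 2 powr (- (rint j * ?d)))"
    by (simp add: emeasure_ball V_def power_mult_distrib powr_realpow[symmetric] powr_powr mult.assoc)
   finally show ?thesis .
  qed
  have near: "nnconv (h' k) (indicator Q) y <= en A * indicator U y + nnconv (far k) (indicator Q) y" for k y
  proof -
   have "nnconv (h' k) (indicator Q) y <= (NN z. indicator U y * h' k (y - z) + far k (y - z) * indicator Q z)"
    unfolding nnconv_def[of "h' k"]
   proof (rule nn_integral_mono)
    fix z
    show "h' k (y - z) * indicator Q z <= indicator U y * h' k (y - z) + far k (y - z) * indicator Q z"
    proof (cases "z : Q & y - z \<notin> T")
     case True
     then have z: "corner j z = corner j x" "norm (y - z) <= ?h" by (auto simp: Q_def T_def)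
     have "corner j y - corner j x = (z - corner j z) - (y - corner j y) + (y - z)"
      using z by simp
     then have "norm (corner j y - corner j x)
       <= norm (z - corner j z) + norm (y - corner j y) + norm (y - z)"
      by (smt (verit) norm_triangle_ineq4 norm_triangle_ineq)
     also have "... <= ?d * ?h + ?d * ?h + ?h" by (intro add_mono norm_diff_corner z)
     finally have "y : U" by (simp add: U_def algebra_simps)
     then show ?thesis using True by simp
    qed (auto simp: far_def indicator_def)
   qed
   also have "... = indicator U y * (NN z. h' k (y - z)) + nnconv (far k) (indicator Q) y"
    unfolding nnconv_def by (simp add: nn_integral_add nn_integral_cmult)
   also have "(NN z. h' k (y - z)) = (NN z. h' k z)" by (rule nn_reflect) measurable
   also have "indicator U y * (NN z. h' k z) <= en A * indicator U y"
    using scale_kernelD(2)[OF h', of k] by (subst mult.commute) (rule mult_right_mono, auto)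
   finally show ?thesis by (simp add: add_right_mono)
  qed
  have farint: "(NN y. epowr (f k y) q * nnconv (far k) (indicator Q) y)
    <= en (L * M * A * 2 powr (- (rint (k - j) * ep)) * 2 powr (- (rint j * ?d)))" if k: "j <= k" for k
  proof -
   have "epowr (f k y) q <= en L * en M" for y
    unfolding L_def by (rule carleson_sup_bound) (use q N c E fle car in auto)
   then have "(NN y. epowr (f k y) q * nnconv (far k) (indicator Q) y)
    <= (NN y. (en L * en M) * nnconv (far k) (indicator Q) y)"
    by (intro nn_integral_mono mult_right_mono) auto
   also have "... = (en L * en M) * (NN y. nnconv (far k) (indicator Q) y)"
    by (intro nn_integral_cmult meas_nnconv) auto
   also have "(NN y. nnconv (far k) (indicator Q) y) = (NN y. far k y) * emeasure lborel Q"
    by (subst nn_nnconv) auto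
   also have "... <= en (A * 2 powr (- (rint (k - j) * ep))) * en (2 powr (- (rint j * ?d)))"
    unfolding Qm far_def T_def by (intro mult_right_mono scale_kernelD(3)[OF h' k]) auto
   finally have "(NN y. epowr (f k y) q * nnconv (far k) (indicator Q) y) <= (en L * en M) *
    (en (A * 2 powr (- (rint (k - j) * ep))) * en (2 powr (- (rint j * ?d))))"
    by (simp add: mult_left_mono)
   also have "... = en (L * M * A * 2 powr (- (rint (k - j) * ep)) * 2 powr (- (rint j * ?d)))"
    using L M A by (simp add: ennreal_mult mult_ac)
   finally show ?thesis .
  qed
  have gk: "(NN y. epowr (g k y) q * indicator Q y) <= en (A powr (q - 1)) *
    ((NN y. en A * (epowr (f k y) q * indicator U y)) +
     (NN y. epowr (f k y) q * nnconv (far k) (indicator Q) y))" for k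
  proof -
   let ?f = "%y. epowr (f k y) q"
   have "?f : LM" by measurable
   have "epowr (g k y) q <= en (A powr (q - 1)) * nnconv (h k) ?f y" for y
   proof -
    have "epowr (g k y) q <= epowr (nnconv (h k) (f k) y) q" using gle q by (intro epowr_mono) auto
    also have "... <= en (A powr (q - 1)) * nnconv (h k) ?f y"
     by (rule conv_jensen[OF h A _ q]) simp
    finally show ?thesis .
   qed
   then have "(NN y. epowr (g k y) q * indicator Q y)
    <= (NN y. en (A powr (q - 1)) * (nnconv (h k) ?f y * indicator Q y))"
    unfolding mult.assoc[symmetric] by (intro nn_integral_mono mult_right_mono) auto
   also have "... = en (A powr (q - 1)) * (NN y. nnconv (h k) ?f y * indicator Q y)"
    by (intro nn_integral_cmult borel_measurable_times_ennreal meas_nnconv) auto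
   also have "(NN y. nnconv (h k) ?f y * indicator Q y) = (NN y. ?f y * nnconv (h' k) (indicator Q) y)"
    unfolding h'_def by (intro nn_nnconv_mult) auto
   also have "... <= (NN y. en A * (?f y * indicator U y) + ?f y * nnconv (far k) (indicator Q) y)"
   proof (rule nn_integral_mono)
    fix y
    show "?f y * nnconv (h' k) (indicator Q) y <= en A * (?f y * indicator U y) + ?f y * nnconv (far k) (indicator Q) y"
     using mult_left_mono[OF near[of k y], of "?f y"] by (simp add: distrib_left mult_ac)
   qed
   also have "... = (NN y. en A * (?f y * indicator U y)) + (NN y. ?f y * nnconv (far k) (indicator Q) y)"
    by (intro nn_integral_add borel_measurable_times_ennreal meas_nnconv) auto
   finally show ?thesis by (simp add: mult_left_mono)
  qed
  have [measurable]: "nnconv (far k) (indicator Q) : BM" for k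
   using meas_nnconv[of "far k" "indicator Q"] by simp
  let ?J = "%k. indicator {j..} k :: ennreal"
  define G where "G y = (CC k. epowr (f k y) q * ?J k)" for y
  have [measurable]: "G : BM" unfolding G_def by measurable
  have "(NN y. (CC k. epowr (g k y) q * ?J k) * indicator Q y)
    = (NN y. (CC k. epowr (g k y) q * indicator Q y * ?J k))"
  proof (rule nn_integral_cong)
   fix y
   show "(CC k. epowr (g k y) q * ?J k) * indicator Q y
     = (CC k. epowr (g k y) q * indicator Q y * ?J k)"
    by (subst nn_integral_multc[symmetric]) (simp_all add: mult_ac)
  qed
  also have "... = (CC k. (NN y. epowr (g k y) q * indicator Q y * ?J k))"
   by (rule count_int_swap) measurable
  also have "... = (CC k. (NN y. epowr (g k y) q * indicator Q y) * ?J k)"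
   by (simp add: nn_integral_multc)
  also have "... <= (CC k. en (A powr (q - 1)) * (en A * (NN y. epowr (f k y) q * indicator U y * ?J k) +
     en (L * M * A * 2 powr (- (rint (k - j) * ep)) * 2 powr (- (rint j * ?d))) * ?J k))"
  proof (rule nn_integral_mono)
   fix k
   show "(NN y. epowr (g k y) q * indicator Q y) * ?J k
    <= en (A powr (q - 1)) * (en A * (NN y. epowr (f k y) q * indicator U y * ?J k) +
     en (L * M * A * 2 powr (- (rint (k - j) * ep)) * 2 powr (- (rint j * ?d))) * ?J k)"
   proof (cases "j <= k")
    case True
    have "(NN y. epowr (g k y) q * indicator Q y) <= en (A powr (q - 1)) *
    ((NN y. en A * (epowr (f k y) q * indicator U y)) +
     en (L * M * A * 2 powr (- (rint (k - j) * ep)) * 2 powr (- (rint j * ?d))))"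
     by (rule order_trans[OF gk]) (intro mult_left_mono add_left_mono farint True, simp)
    then show ?thesis using True by (simp add: nn_integral_cmult)
   qed auto
  qed
  also have "... = en (A powr (q - 1)) * (en A * (CC k. (NN y. epowr (f k y) q * indicator U y * ?J k)) +
     (CC k. en (L * M * A * 2 powr (- (rint (k - j) * ep)) * 2 powr (- (rint j * ?d))) * ?J k))"
   by (simp add: nn_integral_cmult nn_integral_add)
  also have "(CC k. (NN y. epowr (f k y) q * indicator U y * ?J k))
    = (NN y. (CC k. epowr (f k y) q * indicator U y * ?J k))"
   by (rule count_int_swap[symmetric]) measurable
  also have "... = (NN y. G y * indicator U y)"
  proof (rule nn_integral_cong)
   fix y
   show "(CC k. epowr (f k y) q * indicator U y * ?J k) = G y * indicator U y"
    unfolding G_def by (subst nn_integral_multc[symmetric]) (simp_all add: mult_ac)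
  qed
  also have "... <= en M * (NN y. indicator U y)"
   by (rule nn_integral_cube_average[OF _ _ U]) (use car in "auto simp: G_def carleson_def")
  also have "... <= en M * en (V * 2 powr (- (rint j * ?d)))"
   using Um by (simp add: mult_left_mono)
  also have "(CC k. en (L * M * A * 2 powr (- (rint (k - j) * ep)) * 2 powr (- (rint j * ?d))) * ?J k)
    = en (L * M * A * 2 powr (- (rint j * ?d)) * R)"
  proof -
   have bij: "bij_betw (%n. j + int n) UNIV {j..}"
    by (rule bij_betwI[where g="%i. nat (i - j)"]) auto
   have "(CC k. en (L * M * A * 2 powr (- (rint (k - j) * ep)) * 2 powr (- (rint j * ?d))) * ?J k)
    = (\<integral>\<^sup>+k. en (L * M * A * 2 powr (- (rint (k - j) * ep)) * 2 powr (- (rint j * ?d))) \<partial>count_space {j..})"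
    by (subst (2) nn_integral_count_space_indicator) auto
   also have "... = (CC n. en (L * M * A * 2 powr (- (rint (j + int n - j) * ep)) * 2 powr (- (rint j * ?d))))"
    by (rule nn_integral_bij_count_space[OF bij, symmetric])
   also have "... = (\<Sum>n. en ((L * M * A * 2 powr (- (rint j * ?d))) * 2 powr (- (real n * ep))))"
    by (simp add: nn_integral_count_space_nat mult_ac)
   also have "... = en ((L * M * A * 2 powr (- (rint j * ?d))) / (1 - 2 powr (- ep)))"
    using L M A ep by (intro geometric_decay_suminf) auto
   finally show ?thesis by (simp add: R_def)
  qed
  finally have "(NN y. (CC k. epowr (g k y) q * ?J k) * indicator Q y)
   <= en (A powr (q - 1)) * (en A * (en M * en (V * 2 powr (- (rint j * ?d)))) +
      en (L * M * A * 2 powr (- (rint j * ?d)) * R))"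
   by (simp add: mult_left_mono add_right_mono)
  also have "... = en (A powr (q - 1) * (A * (M * (V * 2 powr (- (rint j * ?d)))) + L * M * A * 2 powr (- (rint j * ?d)) * R))"
   using A M V L R by (simp add: ennreal_mult ennreal_plus)
  also have "A powr (q - 1) * (A * (M * (V * 2 powr (- (rint j * ?d)))) + L * M * A * 2 powr (- (rint j * ?d)) * R)
    = C * A powr q * M * 2 powr (- (rint j * ?d))"
  proof -
   have "A powr q = A powr (q - 1) * A" using A powr_add[of A "q - 1" 1] by simp
   then show ?thesis by (simp add: C_def algebra_simps)
  qed
  also have "ennreal ... = en (C * A powr q * M) * en (2 powr (- (rint j * ?d)))"
   using C M by (intro ennreal_mult) auto
  finally show "(NN y. (CC k. epowr (g k y) q * ?J k) * indicator (cube j x) y)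
   <= en (C * A powr q * M) * en (2 powr (- (rint j * ?d)))"
   unfolding Q_def .
 qed
 show ?thesis
 proof (intro exI[of _ C] conjI allI impI C)
  fix A M :: real and h f g :: "int => 'a => ennreal"
  assume A: "0 < A" and M: "0 <= M" and *: "scale_kernel ep A h &
   (ALL k. f k : BM & g k : BM & (ALL x. g k x <= nnconv (h k) (f k) x) &
     (ALL x. f k x <= en c * nnconv (eta N k) (f k) x)) & carleson q M f"
  show "carleson q (C * A powr q * M) g"
   by (rule main[OF A M, of h f g]) (use * in auto)
 qed
qed

section \<open>Schwartz functions\<close>

lemma one_plus_norm_add_le:
 fixes x y :: "'a::real_normed_vector"
 shows "(1 + norm (x + y)) ^ N <= (1 + norm x) ^ N * (1 + norm y) ^ N"
proof -
 have "1 + norm (x + y) <= (1 + norm x) * (1 + norm y)"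
 proof -
  have "1 + norm (x + y) <= 1 + (norm x + norm y) + norm x * norm y"
   using norm_triangle_ineq[of x y] by (simp add: add_increasing2)
  then show ?thesis by (simp add: algebra_simps)
 qed
 then have "(1 + norm (x + y)) ^ N <= ((1 + norm x) * (1 + norm y)) ^ N"
  by (intro power_mono) auto
 then show ?thesis by (simp add: power_mult_distrib)
qed

lemma one_plus_norm_pos: "0 < (1 + norm x) ^ N"
 by (intro zero_less_power) (smt (verit) norm_ge_zero)

lemma partial_derivs_append: "pd (bs @ cs) f = pd bs (pd cs f)"
 by (induction bs) auto

lemma smooth_partial_derivs: "smooth f ==> set bs <= Basis ==> smooth (pd bs f)"
 unfolding smooth_def partial_derivs_append[symmetric] by auto

lemma smooth_differentiable: "smooth f ==> set bs <= Basis ==> pd bs f differentiable (at x)"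
 unfolding smooth_def differentiable_on_def by simp

lemma smooth_differentiable_at: "smooth f ==> f differentiable (at x)"
 using smooth_differentiable[of f "[]"] by simp

lemma smooth_continuous_on: "smooth f ==> continuous_on S f"
 by (meson continuous_at_imp_continuous_on differentiable_imp_continuous_within smooth_differentiable_at)

lemma schwartz_partial_derivs: "ps : schwartz ==> set bs <= Basis ==> pd bs ps : schwartz"
 unfolding schwartz_def using smooth_partial_derivs by (auto simp: partial_derivs_append[symmetric])

lemma schwartz_smooth: "ps : schwartz ==> smooth ps"
 by (simp add: schwartz_def)

lemma schwartz_bound:
 assumes "ps : schwartz" "set bs <= Basis"
 obtains B where "0 < B" "!!x. (1 + norm x) ^ N * norm (pd bs ps x) <= B"
proof -
 have "bounded (range (%x. (1 + norm x) ^ N *\<^sub>R pd bs ps x))"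
  using assms by (auto simp: schwartz_def)
 then obtain B where "B > 0" and B: "!!x. norm ((1 + norm x) ^ N *\<^sub>R pd bs ps x) <= B"
  by (auto simp: bounded_pos)
 have "(1 + norm x) ^ N * norm (pd bs ps x) <= B" for x
  using B[of x] one_plus_norm_pos[of x N] by simp
 with \<open>B > 0\<close> show ?thesis by (rule that)
qed

lemma schwartzI:
 assumes "smooth ps" "!!N bs. set bs <= Basis ==> EX B. ALL x. (1 + norm x) ^ N * norm (pd bs ps x) <= B"
 shows "ps : schwartz"
proof -
 have "bounded (range (%x. (1 + norm x) ^ N *\<^sub>R pd bs ps x))" if bs: "set bs <= Basis" for N bs
 proof -
  obtain B where B: "!!x. (1 + norm x) ^ N * norm (pd bs ps x) <= B" using assms(2)[OF bs] by blast
  have "norm ((1 + norm x) ^ N *\<^sub>R pd bs ps x) <= B" for x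
   using B[of x] one_plus_norm_pos[of x N] by simp
  then show ?thesis unfolding bounded_iff by auto
 qed
 with assms(1) show ?thesis by (auto simp: schwartz_def)
qed

definition multi_indices :: "nat => 'a::euclidean_space list set" where
 "multi_indices N = {bs. set bs <= Basis & length bs <= N}"

lemma finite_multi_indices: "finite (multi_indices N)"
 unfolding multi_indices_def by (rule finite_lists_length_le) simp

lemma schwartz_seminorm_ge:
 assumes ps: "ps : schwartz" and bs: "set bs <= Basis" "length bs <= N"
 shows "(1 + norm x) ^ N * norm (pd bs ps x) <= schwartz_seminorm N ps"
proof -
 let ?p = "%bs x. (1 + norm x) ^ N * norm (pd bs ps x)"
 have bdd: "bdd_above (range (?p bs))" if bs: "set bs <= Basis" for bs
 proof -
  obtain B where "!!x. ?p bs x <= B" using schwartz_bound[OF ps bs, of N] by blast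
  then show ?thesis by (rule bdd_aboveI2)
 qed
 have nonneg: "0 <= (SUP x. ?p bs x)" if "set bs <= Basis" for bs
  by (rule cSUP_upper2[OF bdd[OF that], of _ 0]) auto
 have "?p bs x <= (SUP x. ?p bs x)" using bs by (intro cSUP_upper bdd) auto
 also have "... <= (\<Sum>bs\<in>multi_indices N. SUP x. ?p bs x)"
  using bs nonneg by (intro member_le_sum finite_multi_indices) (auto simp: multi_indices_def)
 finally show ?thesis by (simp add: schwartz_seminorm_def multi_indices_def)
qed

lemma schwartz_seminorm_le:
 fixes ps :: "'a::euclidean_space => complex"
 assumes "!!bs x. set bs <= Basis ==> length bs <= N ==> (1 + norm x) ^ N * norm (pd bs ps x) <= B"
 shows "schwartz_seminorm N ps <= real (card (multi_indices N :: 'a list set)) * B"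
proof -
 have "schwartz_seminorm N ps = (\<Sum>bs\<in>multi_indices N. SUP x. (1 + norm x) ^ N * norm (pd bs ps x))"
  by (simp add: schwartz_seminorm_def multi_indices_def)
 also have "... <= (\<Sum>bs\<in>(multi_indices N :: 'a list set). B)"
  by (intro sum_mono cSUP_least assms) (auto simp: multi_indices_def)
 finally show ?thesis by simp
qed

lemma schwartz_seminorm_nonneg: "ps : schwartz ==> 0 <= schwartz_seminorm N ps"
 using schwartz_seminorm_ge[of ps "[]" N 0] by (intro order_trans[OF norm_ge_zero[of "ps 0"]]) simp

lemma frechet_derivative_expand:
 fixes f :: "'a::euclidean_space => 'b::real_normed_vector"
 assumes "f differentiable (at x)"
 shows "frechet_derivative f (at x) h = (\<Sum>b\<in>Basis. (h \<bullet> b) *\<^sub>R pd [b] f x)"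
proof -
 interpret linear "frechet_derivative f (at x)" by (rule linear_frechet_derivative[OF assms])
 have "frechet_derivative f (at x) h = frechet_derivative f (at x) (\<Sum>b\<in>Basis. (h \<bullet> b) *\<^sub>R b)"
  by (simp add: euclidean_representation)
 then show ?thesis by (simp add: sum scale)
qed

lemma norm_frechet_derivative_le:
 fixes f :: "'a::euclidean_space => 'b::real_normed_vector"
 assumes "f differentiable (at x)" and B: "!!b. b : Basis ==> norm (pd [b] f x) <= B"
 shows "norm (frechet_derivative f (at x) h) <= real DIM('a) * B * norm h"
proof -
 have B0: "0 <= B" using B[OF SOME_Basis] by (meson norm_ge_zero order_trans)
 have "norm (frechet_derivative f (at x) h) <= (\<Sum>b\<in>Basis. norm ((h \<bullet> b) *\<^sub>R pd [b] f x))"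
  unfolding frechet_derivative_expand[OF assms(1)] by (rule norm_sum)
 also have "... <= (\<Sum>b\<in>(Basis::'a set). norm h * B)"
  using B by (intro sum_mono) (simp add: mult_mono Basis_le_norm B0)
 finally show ?thesis by (simp add: mult_ac)
qed

text \<open>Mean value inequality along the segment from w to z. The weight at w is transported to
  the points of the segment at the cost of (1 + |z - w|)^N.\<close>

lemma weighted_difference_le:
 fixes f :: "'a::euclidean_space => 'b::real_normed_vector"
 assumes diff: "!!x. f differentiable (at x)"
  and B: "!!b x. b : Basis ==> (1 + norm x) ^ N * norm (pd [b] f x) <= B"
 shows "(1 + norm w) ^ N * norm (f z - f w) <= real DIM('a) * B * norm (z - w) * (1 + norm (z - w)) ^ N"
proof -
 let ?K = "(1 + norm (z - w)) ^ N / (1 + norm w) ^ N"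
 note pos = one_plus_norm_pos[of _ N]
 have seg: "norm (xi - w) <= norm (z - w)" if "xi : closed_segment w z" for xi
  by (rule segment_bound1[OF that])
 have "norm (f z - f w) <= real DIM('a) * (B * ?K) * norm (z - w)"
 proof (rule differentiable_bound[of "closed_segment w z" f "%xi. frechet_derivative f (at xi)"])
  fix xi assume xi: "xi : closed_segment w z"
  show "(f has_derivative frechet_derivative f (at xi)) (at xi within closed_segment w z)"
   by (rule has_derivative_at_withinI[OF frechet_derivative_works[THEN iffD1, OF diff]])
  have "(1 + norm w) ^ N <= (1 + norm xi) ^ N * (1 + norm (w - xi)) ^ N"
   using one_plus_norm_add_le[of xi "w - xi" N] by simp
  also have "... <= (1 + norm xi) ^ N * (1 + norm (z - w)) ^ N"
   using seg[OF xi] by (intro mult_left_mono power_mono) (auto simp: norm_minus_commute)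
  finally have w: "(1 + norm w) ^ N <= (1 + norm xi) ^ N * (1 + norm (z - w)) ^ N" .
  have "norm (pd [b] f xi) <= B * ?K" if b: "b : Basis" for b
  proof -
   have "(1 + norm w) ^ N * norm (pd [b] f xi)
     <= (1 + norm xi) ^ N * (1 + norm (z - w)) ^ N * norm (pd [b] f xi)"
    by (intro mult_right_mono w) auto
   also have "... = (1 + norm (z - w)) ^ N * ((1 + norm xi) ^ N * norm (pd [b] f xi))" by (simp add: mult_ac)
   also have "... <= (1 + norm (z - w)) ^ N * B" by (intro mult_left_mono B b) auto
   finally show ?thesis using pos[of w] by (simp add: field_simps)
  qed
  then show "onorm (frechet_derivative f (at xi)) <= real DIM('a) * (B * ?K)"
   by (intro onorm_le norm_frechet_derivative_le diff)
 qed auto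
 then have "(1 + norm w) ^ N * norm (f z - f w) <= (1 + norm w) ^ N * (real DIM('a) * (B * ?K) * norm (z - w))"
  using pos[of w] by (intro mult_left_mono) auto
 also have "... = real DIM('a) * B * norm (z - w) * (1 + norm (z - w)) ^ N"
  using pos[of w] less_imp_neq[OF pos[of w]] by simp
 finally show ?thesis .
qed

lemma difference_le:
 fixes f :: "'a::euclidean_space => 'b::real_normed_vector"
 assumes "!!x. f differentiable (at x)" "!!b x. b : Basis ==> norm (pd [b] f x) <= B"
 shows "norm (f z - f w) <= real DIM('a) * B * norm (z - w)"
 using weighted_difference_le[of f 0 B w z] assms by simp

text \<open>Mean value inequality for f minus its linear part at z: the derivative of this
  difference at z + t is an increment of first derivatives and thus bounded by second ones.\<close>

lemma second_difference_le:
 fixes f :: "'a::euclidean_space => 'b::real_normed_vector"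
 assumes f: "smooth f" and B: "!!b c x. b : Basis ==> c : Basis ==> norm (pd [c, b] f x) <= B"
 shows "norm (f (z + h) - f z - frechet_derivative f (at z) h) <= (real DIM('a))\<^sup>2 * B * (norm h)\<^sup>2"
proof -
 have diff: "f differentiable (at x)" for x using smooth_differentiable_at[OF f] .
 interpret D: linear "frechet_derivative f (at z)" by (rule linear_frechet_derivative[OF diff])
 let ?g = "%t. f (z + t) - frechet_derivative f (at z) t"
 have B0: "0 <= B" using B[OF SOME_Basis SOME_Basis] by (meson norm_ge_zero order_trans)
 have "norm (?g h - ?g 0) <= (real DIM('a) * (real DIM('a) * B * norm h)) * norm (h - 0)"
 proof (rule differentiable_bound[of "closed_segment 0 h" ?g "%t s. frechet_derivative f (at (z + t)) s - frechet_derivative f (at z) s"])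
  fix t assume t: "t : closed_segment 0 h"
  have nt: "norm t <= norm h" using segment_bound1[OF t] by simp
  have "((%t. f (z + t)) has_derivative frechet_derivative f (at (z + t))) (at t)"
  proof -
   have "(f has_derivative frechet_derivative f (at (z + t))) (at (z + t))"
    by (rule frechet_derivative_works[THEN iffD1, OF diff])
   then have "((f \<circ> (%t. z + t)) has_derivative (frechet_derivative f (at (z + t)) \<circ> (%t. t))) (at t)"
    by (intro diff_chain_at) (auto intro!: derivative_eq_intros)
   then show ?thesis by (simp add: o_def)
  qed
  moreover have "(frechet_derivative f (at z) has_derivative frechet_derivative f (at z)) (at t)"
  proof -
   have "(f has_derivative frechet_derivative f (at z)) (at z)"
    by (rule frechet_derivative_works[THEN iffD1, OF diff])
   then show ?thesis by (rule bounded_linear_imp_has_derivative[OF has_derivative_bounded_linear])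
  qed
  ultimately show "(?g has_derivative (%s. frechet_derivative f (at (z + t)) s - frechet_derivative f (at z) s)) (at t within closed_segment 0 h)"
   by (rule has_derivative_at_withinI[OF has_derivative_diff])
  have "norm (frechet_derivative f (at (z + t)) s - frechet_derivative f (at z) s)
    <= (real DIM('a) * (real DIM('a) * B * norm h)) * norm s" for s
  proof -
   have "frechet_derivative f (at (z + t)) s - frechet_derivative f (at z) s
    = (\<Sum>b\<in>Basis. (s \<bullet> b) *\<^sub>R (pd [b] f (z + t) - pd [b] f z))"
    unfolding frechet_derivative_expand[OF diff] by (simp add: sum_subtractf scaleR_diff_right)
   also have "norm ... <= (\<Sum>b\<in>Basis. norm ((s \<bullet> b) *\<^sub>R (pd [b] f (z + t) - pd [b] f z)))"
    by (rule norm_sum)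
   also have "... <= (\<Sum>b\<in>(Basis::'a set). norm s * (real DIM('a) * B * norm h))"
   proof (rule sum_mono)
    fix b :: 'a assume b: "b : Basis"
    have "norm (pd [b] f (z + t) - pd [b] f z) <= real DIM('a) * B * norm (z + t - z)"
    proof (rule difference_le)
     show "pd [b] f differentiable at x" for x
      using smooth_differentiable[OF f, of "[b]"] b by simp
     show "norm (pd [c] (pd [b] f) x) <= B" if "c : Basis" for c x
      using B[OF b that, of x] by simp
    qed
    also have "... <= real DIM('a) * B * norm h" using nt B0 by (simp add: mult_left_mono)
    finally show "norm ((s \<bullet> b) *\<^sub>R (pd [b] f (z + t) - pd [b] f z)) <= norm s * (real DIM('a) * B * norm h)"
     using b by (simp only: norm_scaleR) (intro mult_mono, auto simp: Basis_le_norm)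
   qed
   finally show ?thesis by (simp add: mult_ac)
  qed
  then show "onorm (%s. frechet_derivative f (at (z + t)) s - frechet_derivative f (at z) s) <= real DIM('a) * (real DIM('a) * B * norm h)"
   by (rule onorm_le)
 qed auto
 then show ?thesis by (simp add: D.zero power2_eq_square mult_ac algebra_simps)
qed

lemma partial_derivs_affine:
 fixes f :: "'a::euclidean_space => 'b::real_normed_vector"
 assumes f: "smooth f" and bs: "set bs <= Basis"
 shows "pd bs (%x. f (c *\<^sub>R x + t)) = (%x. c ^ length bs *\<^sub>R pd bs f (c *\<^sub>R x + t))"
  and "pd bs (%x. f (c *\<^sub>R x + t)) differentiable (at x)"
proof -
 have der: "((%x. c ^ n *\<^sub>R pd bs f (c *\<^sub>R x + t)) has_derivative
   (%h. c ^ n *\<^sub>R frechet_derivative (pd bs f) (at (c *\<^sub>R x + t)) (c *\<^sub>R h))) (at x)"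
  if "set bs <= Basis" for n bs x
 proof -
  have "(pd bs f has_derivative frechet_derivative (pd bs f) (at (c *\<^sub>R x + t))) (at (c *\<^sub>R x + t))"
   by (rule frechet_derivative_works[THEN iffD1, OF smooth_differentiable[OF f that]])
  then have "((pd bs f \<circ> (%x. c *\<^sub>R x + t)) has_derivative
    (frechet_derivative (pd bs f) (at (c *\<^sub>R x + t)) \<circ> (%h. c *\<^sub>R h))) (at x)"
   by (intro diff_chain_at) (auto intro!: derivative_eq_intros)
  then show ?thesis by (intro has_derivative_scaleR_right) (simp add: o_def)
 qed
 have eq: "pd bs (%x. f (c *\<^sub>R x + t)) = (%x. c ^ length bs *\<^sub>R pd bs f (c *\<^sub>R x + t))"
  if "set bs <= Basis" for bs
  using that
 proof (induction bs)
  case (Cons b bs)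
  then have bs: "set bs <= Basis" by simp
  show ?case
  proof
   fix x
   interpret linear "frechet_derivative (pd bs f) (at (c *\<^sub>R x + t))"
    by (rule linear_frechet_derivative[OF smooth_differentiable[OF f bs]])
   show "pd (b # bs) (%x. f (c *\<^sub>R x + t)) x = c ^ length (b # bs) *\<^sub>R pd (b # bs) f (c *\<^sub>R x + t)"
    using frechet_derivative_at[OF der[OF bs, of "length bs" x], symmetric]
    by (simp add: Cons.IH[OF bs] scale mult.commute)
  qed
 qed simp
 from eq[OF bs] show "pd bs (%x. f (c *\<^sub>R x + t)) = (%x. c ^ length bs *\<^sub>R pd bs f (c *\<^sub>R x + t))" .
 show "pd bs (%x. f (c *\<^sub>R x + t)) differentiable (at x)"
  unfolding eq[OF bs] using der[OF bs] by (metis differentiable_def)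
qed

lemma schwartz_affine:
 fixes ps :: "'a::euclidean_space => complex"
 assumes ps: "ps : schwartz" and c: "c ~= 0"
 shows "(%x. ps (c *\<^sub>R x + t)) : schwartz"
proof (rule schwartzI)
 show "smooth (%x. ps (c *\<^sub>R x + t))"
  unfolding smooth_def differentiable_on_def using partial_derivs_affine(2)[OF schwartz_smooth[OF ps]] by simp
 fix N and bs :: "'a list" assume bs: "set bs <= Basis"
 obtain B where B: "0 < B" "!!x. (1 + norm x) ^ N * norm (pd bs ps x) <= B"
  using schwartz_bound[OF ps bs] by blast
 let ?K = "(1 + 1 / \<bar>c\<bar>) ^ N * (1 + norm t) ^ N"
 have "(1 + norm x) ^ N * norm (pd bs (%x. ps (c *\<^sub>R x + t)) x) <= \<bar>c\<bar> ^ length bs * (?K * B)" for x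
 proof -
  let ?z = "c *\<^sub>R x + t"
  have "\<bar>c\<bar> * norm x = norm (?z + (- t))" by simp
  then have "norm x = norm (?z + (- t)) / \<bar>c\<bar>" using c by (simp add: field_simps)
  then have "1 + norm x <= (1 + 1/\<bar>c\<bar>) * (1 + norm (?z + (- t)))"
   by (simp add: algebra_simps)
  then have "(1 + norm x) ^ N <= (1 + 1/\<bar>c\<bar>) ^ N * (1 + norm (?z + (- t))) ^ N"
   by (metis power_mono power_mult_distrib add_nonneg_nonneg norm_ge_zero zero_le_one)
  also have "... <= (1 + 1/\<bar>c\<bar>) ^ N * ((1 + norm ?z) ^ N * (1 + norm (- t)) ^ N)"
   by (intro mult_left_mono one_plus_norm_add_le) auto
  finally have "(1 + norm x) ^ N <= ?K * (1 + norm ?z) ^ N" by (simp add: mult_ac)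
  then have "(1 + norm x) ^ N * norm (pd bs ps ?z) <= ?K * ((1 + norm ?z) ^ N * norm (pd bs ps ?z))"
   by (metis mult.assoc mult_right_mono norm_ge_zero)
  also have "... <= ?K * B" by (intro mult_left_mono B) auto
  finally have "\<bar>c\<bar> ^ length bs * ((1 + norm x) ^ N * norm (pd bs ps ?z)) <= \<bar>c\<bar> ^ length bs * (?K * B)"
   by (intro mult_left_mono) auto
  then show ?thesis
   unfolding partial_derivs_affine(1)[OF schwartz_smooth[OF ps] bs] by (simp add: power_abs mult_ac)
 qed
 then show "EX B. ALL x. (1 + norm x) ^ N * norm (pd bs (%x. ps (c *\<^sub>R x + t)) x) <= B" by blast
qed

lemma partial_derivs_add:
 assumes "smooth f" "smooth g" "set bs <= Basis"
 shows "pd bs (%x. f x + g x) = (%x. pd bs f x + pd bs g x)"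
 using assms(3)
proof (induction bs)
 case (Cons b bs)
 then have bs: "set bs <= Basis" by simp
 show ?case
 proof
  fix x
  have "((%x. pd bs f x + pd bs g x) has_derivative
    (%h. frechet_derivative (pd bs f) (at x) h + frechet_derivative (pd bs g) (at x) h)) (at x)"
   by (intro has_derivative_add frechet_derivative_works[THEN iffD1] smooth_differentiable assms bs)
  from frechet_derivative_at[OF this, symmetric]
  show "pd (b # bs) (%x. f x + g x) x = pd (b # bs) f x + pd (b # bs) g x"
   by (simp add: Cons.IH[OF bs])
 qed
qed simp

lemma partial_derivs_bounded_linear:
 assumes "smooth f" "set bs <= Basis" and L: "bounded_linear L"
 shows "pd bs (%x. L (f x)) = (%x. L (pd bs f x))"
 using assms(2)
proof (induction bs)
 case (Cons b bs)
 then have bs: "set bs <= Basis" by simp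
 show ?case
 proof
  fix x
  have "((%x. L (pd bs f x)) has_derivative
    (%h. L (frechet_derivative (pd bs f) (at x) h))) (at x)"
   by (intro bounded_linear.has_derivative[OF L] frechet_derivative_works[THEN iffD1] smooth_differentiable assms bs)
  from frechet_derivative_at[OF this, symmetric]
  show "pd (b # bs) (%x. L (f x)) x = L (pd (b # bs) f x)"
   by (simp add: Cons.IH[OF bs])
 qed
qed simp

lemma smooth_add: "smooth f ==> smooth g ==> smooth (%x. f x + g x)"
 unfolding smooth_def[of "%x. f x + g x"] differentiable_on_def
 by (auto simp: partial_derivs_add intro!: differentiable_add smooth_differentiable)

lemma smooth_bounded_linear: "smooth f ==> bounded_linear L ==> smooth (%x. L (f x))"
 unfolding smooth_def[of "%x. L (f x)"] differentiable_on_def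
proof (intro allI impI ballI)
 fix bs :: "'a list" and x assume f: "smooth f" and L: "bounded_linear L" and bs: "set bs <= Basis"
 obtain D where "(pd bs f has_derivative D) (at x)"
  using smooth_differentiable[OF f bs] by (auto simp: differentiable_def)
 from bounded_linear.has_derivative[OF L this]
 show "pd bs (%x. L (f x)) differentiable at x within UNIV"
  unfolding partial_derivs_bounded_linear[OF f bs L] differentiable_def by auto
qed

lemma schwartz_add:
 assumes f: "f : schwartz" and g: "g : schwartz"
 shows "(%x. f x + g x) : schwartz"
proof (rule schwartzI)
 show "smooth (%x. f x + g x)" using assms by (intro smooth_add schwartz_smooth)
 fix N and bs :: "'a list" assume bs: "set bs <= Basis"
 obtain B1 where B1: "!!x. (1 + norm x) ^ N * norm (pd bs f x) <= B1"
  using schwartz_bound[OF f bs] by blast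
 obtain B2 where B2: "!!x. (1 + norm x) ^ N * norm (pd bs g x) <= B2"
  using schwartz_bound[OF g bs] by blast
 have "(1 + norm x) ^ N * norm (pd bs f x + pd bs g x) <= B1 + B2" for x
 proof -
  have "(1 + norm x) ^ N * norm (pd bs f x + pd bs g x)
   <= (1 + norm x) ^ N * (norm (pd bs f x) + norm (pd bs g x))"
   by (intro mult_left_mono norm_triangle_ineq) auto
  then show ?thesis using B1[of x] B2[of x] by (simp add: distrib_left)
 qed
 then show "EX B. ALL x. (1 + norm x) ^ N * norm (pd bs (%x. f x + g x) x) <= B"
  using assms by (auto simp: partial_derivs_add schwartz_smooth bs)
qed

lemma partial_derivs_cmult:
 fixes f :: "'a::euclidean_space => complex"
 shows "smooth f ==> set bs <= Basis ==> pd bs (%x. c * f x) = (%x. c * pd bs f x)"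
 using partial_derivs_bounded_linear[OF _ _ bounded_linear_mult_right] .

lemma schwartz_cmult:
 assumes f: "f : schwartz"
 shows "(%x. c * f x) : schwartz"
proof (rule schwartzI)
 show "smooth (%x. c * f x)" using assms by (intro smooth_bounded_linear[OF _ bounded_linear_mult_right] schwartz_smooth)
 fix N and bs :: "'a list" assume bs: "set bs <= Basis"
 obtain B where B: "!!x. (1 + norm x) ^ N * norm (pd bs f x) <= B"
  using schwartz_bound[OF f bs] by blast
 have "(1 + norm x) ^ N * norm (c * pd bs f x) <= norm c * B" for x
  using mult_left_mono[OF B[of x], of "norm c"] by (simp add: norm_mult mult_ac)
 then show "EX B. ALL x. (1 + norm x) ^ N * norm (pd bs (%x. c * f x) x) <= B"
  using assms by (auto simp: partial_derivs_cmult schwartz_smooth bs)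
qed

lemma schwartz_zero: "(%x. 0) : schwartz"
proof -
 have [simp]: "pd bs (%x::'a. 0 :: complex) = (%x. 0)" for bs
  by (induction bs) (auto simp: frechet_derivative_const)
 show ?thesis by (intro schwartzI) (auto simp: smooth_def)
qed

lemma schwartz_sum: "(!!i. i : I ==> f i : schwartz) ==> (%x. \<Sum>i\<in>I. f i x) : schwartz"
 by (induction I rule: infinite_finite_induct) (auto intro: schwartz_add schwartz_zero)

lemma schwartz_diff: "f : schwartz ==> g : schwartz ==> (%x. f x - g x) : schwartz"
 using schwartz_add[of f "%x. (-1) * g x"] schwartz_cmult[of g "-1"] by simp

lemma schwartz_continuous: "ps : schwartz ==> continuous_on S ps"
 by (intro smooth_continuous_on schwartz_smooth)

lemma schwartz_meas: "ps : schwartz ==> ps : BM"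
 by (intro borel_measurable_continuous_onI schwartz_continuous)

lemma integrable_decay:
 fixes f :: "'a::euclidean_space => 'b::{banach, second_countable_topology}"
 assumes [measurable]: "f : BM" and B: "!!x. (1 + norm x) ^ (DIM('a) + 1) * norm (f x) <= B"
 shows "integ f"
proof (rule integrableI_bounded)
 have B0: "0 <= B" using B[of 0] by (meson mult_nonneg_nonneg norm_ge_zero one_plus_norm_pos less_imp_le order_trans)
 obtain E where E: "!!k. (NN x. eta (real DIM('a) + 1) k (x :: 'a)) <= en E"
  using nn_integral_eta_bound[of "real DIM('a) + 1", where 'a='a] by auto
 have "(NN x. en (norm (f x))) <= (NN x. en B * eta (real DIM('a) + 1) 0 (x :: 'a))"
 proof (rule nn_integral_mono)
  fix x :: 'a
  have p: "(1 + norm x) powr (real DIM('a) + 1) = (1 + norm x) ^ (DIM('a) + 1)"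
   using powr_realpow[of "1 + norm x" "DIM('a) + 1"] by (smt (verit) norm_ge_zero of_nat_1 of_nat_add)
  have "norm (f x) <= B * (1 + norm x) powr (- (real DIM('a) + 1))"
   using B[of x] one_plus_norm_pos[of x "DIM('a) + 1"] unfolding powr_minus p by (simp add: field_simps)
  then show "en (norm (f x)) <= en B * eta (real DIM('a) + 1) 0 x"
   unfolding eta_def using B0 by (simp add: ennreal_leI flip: ennreal_mult)
 qed
 also have "... = en B * (NN x. eta (real DIM('a) + 1) 0 (x :: 'a))" by (simp add: nn_integral_cmult)
 also have "... <= en B * en E" by (intro mult_left_mono E) auto
 also have "... < \<infinity>" by (simp add: ennreal_mult_less_top)
 finally show "(NN x. en (norm (f x))) < \<infinity>" .
qed simp

lemma schwartz_L1:
 fixes ps :: "'a::euclidean_space => complex"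
 assumes ps: "ps : schwartz"
 shows "integ (%x. (1 + norm x) ^ N * norm (ps x))" "integ ps"
proof -
 have [measurable]: "ps : BM" using ps by (rule schwartz_meas)
 have empty: "set [] <= (Basis :: 'a set)" by simp
 obtain B where B: "!!x. (1 + norm x) ^ (DIM('a) + 1 + N) * norm (pd [] ps x) <= B"
  using schwartz_bound[OF ps empty, where N="DIM('a) + 1 + N"] by blast
 show "integ (%x. (1 + norm x) ^ N * norm (ps x))"
  by (rule integrable_decay[of _ B]) (use B in "auto simp: power_add mult_ac")
 obtain B where B: "!!x. (1 + norm x) ^ (DIM('a) + 1) * norm (pd [] ps x) <= B"
  using schwartz_bound[OF ps empty, where N="DIM('a) + 1"] by blast
 then show "integ ps" by (intro integrable_decay[of _ B]) auto
qed

section \<open>Convolution of Schwartz functions\<close>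

text \<open>The order of the arguments is such that derivatives fall on \<open>ka\<close>, while
  \<open>th\<close> is merely integrable.\<close>

definition sconv :: "('a::euclidean_space => complex) => ('a => complex) => 'a => complex" where
 "sconv th ka x = (LL y. th y * ka (x - y))"

lemma integ_bounded:
 fixes th g :: "'a::euclidean_space => complex"
 assumes "integ th" and [measurable]: "g : BM" and "!!x. norm (g x) <= B"
 shows "integ (%y. th y * g y)"
proof (rule Bochner_Integration.integrable_bound[of _ "%y. norm (th y) * B"])
 show "integ (%y. norm (th y) * B)" using assms(1) by simp
 show "(%y. th y * g y) : LM" using borel_measurable_integrable[OF assms(1)] by simp
 show "AE x in lborel. norm (th x * g x) <= norm (norm (th x) * B)"
  unfolding norm_mult real_norm_def
  by (intro AE_I2 order_trans[OF _ abs_ge_self] mult_left_mono assms(3)) auto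
qed

lemma schwartz_bounded: "ps : schwartz ==> set bs <= Basis ==> EX B>0. ALL x. norm (pd bs ps x) <= B"
proof -
 assume "ps : schwartz" "set bs <= Basis"
 from schwartz_bound[OF this, where N=0] show ?thesis by (metis mult_1 power_0)
qed

lemma sconv_integrable:
 assumes "integ th" "ka : schwartz"
 shows "integ (%y. th y * ka (x - y))"
proof -
 have [measurable]: "ka : BM" using assms(2) by (rule schwartz_meas)
 obtain B where "!!x. norm (ka x) <= B" using schwartz_bounded[OF assms(2), of "[]"] by auto
 then show ?thesis by (intro integ_bounded[of _ _ B] assms) auto
qed

text \<open>The second order Taylor bound is uniform in the base point, so integrating it against
  \<open>th\<close> leaves an error of order |h|^2; this replaces a limit theorem for
  differentiation under the integral.\<close>

lemma sconv_has_derivative: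
 fixes ka :: "'a::euclidean_space => complex"
 assumes th: "integ th" and ka: "ka : schwartz"
 shows "(sconv th ka has_derivative (%h. \<Sum>b\<in>Basis. (h \<bullet> b) *\<^sub>R sconv th (pd [b] ka) x)) (at x)"
proof -
 let ?L = "%h. \<Sum>b\<in>Basis. (h \<bullet> b) *\<^sub>R sconv th (pd [b] ka) x"
 have lin: "bounded_linear ?L"
  by (intro bounded_linear_sum bounded_linear_scaleR_left[THEN bounded_linear_compose] bounded_linear_inner_left)
 define K where "K b c = (SOME B. 0 < B & (ALL x. norm (pd [c, b] ka x) <= B))" for b c
 have K: "0 < K b c & (ALL x. norm (pd [c, b] ka x) <= K b c)" if "b : Basis" "c : Basis" for b c
  unfolding K_def by (rule someI_ex) (use schwartz_bounded[OF ka, of "[c, b]"] that in auto)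
 define B where "B = (\<Sum>b\<in>Basis. \<Sum>c\<in>Basis. K b c)"
 have B: "norm (pd [c, b] ka x) <= B" if "b : Basis" "c : Basis" for b c x
 proof -
  have "K b c <= (\<Sum>c\<in>Basis. K b c)" using K that by (intro member_le_sum) (auto intro: less_imp_le)
  also have "... <= B" unfolding B_def using K that
   by (intro member_le_sum[of b Basis "%b. \<Sum>c\<in>Basis. K b c"] sum_nonneg) (auto intro: less_imp_le)
  finally show ?thesis using K[OF that] by (meson order_trans)
 qed
 have B0: "0 <= B" using B[OF SOME_Basis SOME_Basis, of 0] by (meson norm_ge_zero order_trans)
 define M where "M = (real DIM('a))\<^sup>2 * B * (LL y. norm (th y))"
 have M0: "0 <= M" unfolding M_def using B0 by simp
 have dS: "pd [b] ka : schwartz" if "b : Basis" for b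
  using schwartz_partial_derivs[OF ka, of "[b]"] that by simp
 note intka = sconv_integrable[OF th ka]
 have key: "norm (sconv th ka (x + h) - sconv th ka x - ?L h) <= M * (norm h)\<^sup>2" for h
 proof -
  have "?L h = (\<Sum>b\<in>Basis. LL y. (h \<bullet> b) *\<^sub>R (th y * pd [b] ka (x - y)))"
   unfolding sconv_def by simp
  also have "... = (LL y. (\<Sum>b\<in>Basis. (h \<bullet> b) *\<^sub>R (th y * pd [b] ka (x - y))))"
   using dS by (intro Bochner_Integration.integral_sum[symmetric] integrable_scaleR_right sconv_integrable th) auto
  also have "... = (LL y. th y * frechet_derivative ka (at (x - y)) h)"
   by (simp add: frechet_derivative_expand[OF smooth_differentiable_at[OF schwartz_smooth[OF ka]]] sum_distrib_left
      del: partial_derivs.simps)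
  finally have L: "?L h = (LL y. th y * frechet_derivative ka (at (x - y)) h)" .
  have intL: "integ (%y. th y * frechet_derivative ka (at (x - y)) h)"
  proof -
   have "(%y. th y * frechet_derivative ka (at (x - y)) h)
    = (%y. \<Sum>b\<in>Basis. (h \<bullet> b) *\<^sub>R (th y * pd [b] ka (x - y)))"
    by (simp add: frechet_derivative_expand[OF smooth_differentiable_at[OF schwartz_smooth[OF ka]]] sum_distrib_left
      del: partial_derivs.simps)
   then show ?thesis
    using dS by (auto intro!: Bochner_Integration.integrable_sum integrable_scaleR_right sconv_integrable th)
  qed
  let ?R = "%y. ka (x - y + h) - ka (x - y) - frechet_derivative ka (at (x - y)) h"
  have "sconv th ka (x + h) - sconv th ka x - ?L h
   = (LL y. th y * ka (x + h - y) - th y * ka (x - y) - th y * frechet_derivative ka (at (x - y)) h)"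
   unfolding L unfolding sconv_def using intka intL by simp
  also have "... = (LL y. th y * ?R y)"
   by (intro Bochner_Integration.integral_cong) (auto simp: algebra_simps)
  also have "norm ... <= (LL y. norm (th y) * ((real DIM('a))\<^sup>2 * B * (norm h)\<^sup>2))"
  proof (rule Bochner_Integration.integral_norm_bound_integral)
   have "integ (%y. th y * ka (x + h - y) - th y * ka (x - y) - th y * frechet_derivative ka (at (x - y)) h)"
    using intka intL by simp
   then show "integ (%y. th y * ?R y)" by (simp add: algebra_simps)
   show "integ (%y. norm (th y) * ((real DIM('a))\<^sup>2 * B * (norm h)\<^sup>2))" using th by simp
   show "norm (th y * ?R y) <= norm (th y) * ((real DIM('a))\<^sup>2 * B * (norm h)\<^sup>2)" for y
    unfolding norm_mult by (intro mult_left_mono second_difference_le schwartz_smooth ka B) auto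
  qed
  also have "... = M * (norm h)\<^sup>2" by (simp add: M_def mult_ac)
  finally show ?thesis .
 qed
 show ?thesis
  unfolding has_derivative_at
 proof (intro conjI lin)
  show "(%h. norm (sconv th ka (x + h) - sconv th ka x - ?L h) / norm h) \<midarrow>0\<rightarrow> 0"
  proof (rule real_tendsto_sandwich[where f="%_. 0" and h="%h. M * norm h"])
   show "\<forall>\<^sub>F h in at 0. norm (sconv th ka (x + h) - sconv th ka x - ?L h) / norm h <= M * norm h"
    by (rule eventually_mono[OF eventually_at_ball'[of 1]])
     (use key in "auto simp: divide_le_eq power2_eq_square mult.assoc")
   show "(%h. M * norm h) \<midarrow>0\<rightarrow> 0" by (auto intro!: tendsto_eq_intros)
  qed auto
 qed
qed

lemma frechet_sconv:
 fixes ka :: "'a::euclidean_space => complex"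
 assumes "integ th" "ka : schwartz" "b : Basis"
 shows "frechet_derivative (sconv th ka) (at x) b = sconv th (pd [b] ka) x"
proof -
 have "frechet_derivative (sconv th ka) (at x) b = (\<Sum>c\<in>Basis. (b \<bullet> c) *\<^sub>R sconv th (pd [c] ka) x)"
  using frechet_derivative_at[OF sconv_has_derivative[OF assms(1,2)], symmetric] by metis
 also have "... = sconv th (pd [b] ka) x"
  using assms(3) by (simp add: inner_Basis if_distrib[of "%r. r *\<^sub>R _"] del: partial_derivs.simps cong: if_cong)
 finally show ?thesis .
qed

lemma partial_derivs_sconv:
 assumes th: "integ th" and ka: "ka : schwartz" and bs: "set bs <= Basis"
 shows "pd bs (sconv th ka) = sconv th (pd bs ka)"
 using bs
proof (induction bs)
 case (Cons b bs)
 then have bs: "set bs <= Basis" and b: "b : Basis" by auto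
 show ?case
 proof
  fix x
  have "pd (b # bs) (sconv th ka) x = frechet_derivative (sconv th (pd bs ka)) (at x) b"
   by (simp add: Cons.IH[OF bs])
  also have "... = sconv th (pd [b] (pd bs ka)) x"
   by (rule frechet_sconv[OF th schwartz_partial_derivs[OF ka bs] b])
  finally show "pd (b # bs) (sconv th ka) x = sconv th (pd (b # bs) ka) x" by simp
 qed
qed simp

lemma smooth_sconv:
 assumes th: "integ th" and ka: "ka : schwartz"
 shows "smooth (sconv th ka)"
 unfolding smooth_def differentiable_on_def
 using sconv_has_derivative[OF th schwartz_partial_derivs[OF ka]]
 by (auto simp: partial_derivs_sconv[OF th ka] differentiable_def)

lemma weighted_conv_le:
 fixes th g :: "'a::euclidean_space => complex"
 assumes th: "integ (%y. (1 + norm y) ^ N * norm (th y))"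
  and g: "!!x. (1 + norm x) ^ N * norm (g x) <= B"
 shows "(1 + norm x) ^ N * norm (LL y. th y * g (x - y)) <= B * (LL y. (1 + norm y) ^ N * norm (th y))"
proof (cases "integ (%y. th y * g (x - y))")
 case True
 have "(1 + norm x) ^ N * norm (LL y. th y * g (x - y)) = norm (LL y. (1 + norm x) ^ N *\<^sub>R (th y * g (x - y)))"
  using one_plus_norm_pos[of x N] by simp
 also have "... <= (LL y. B * ((1 + norm y) ^ N * norm (th y)))"
 proof (rule Bochner_Integration.integral_norm_bound_integral)
  show "norm ((1 + norm x) ^ N *\<^sub>R (th y * g (x - y))) <= B * ((1 + norm y) ^ N * norm (th y))" for y
  proof -
   have "(1 + norm x) ^ N <= (1 + norm y) ^ N * (1 + norm (x - y)) ^ N"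
    using one_plus_norm_add_le[of y "x - y" N] by simp
   then have "(1 + norm x) ^ N * (norm (th y) * norm (g (x - y)))
     <= (1 + norm y) ^ N * (1 + norm (x - y)) ^ N * (norm (th y) * norm (g (x - y)))"
    by (intro mult_right_mono) auto
   also have "... = (1 + norm y) ^ N * norm (th y) * ((1 + norm (x - y)) ^ N * norm (g (x - y)))" by (simp add: mult_ac)
   also have "... <= (1 + norm y) ^ N * norm (th y) * B" by (intro mult_left_mono g) auto
   finally show ?thesis using one_plus_norm_pos[of x N] by (simp add: norm_mult mult_ac)
  qed
 qed (use th True in auto)
 finally show ?thesis by simp
next
 case False
 \<comment> \<open>A divergent integral has the default value 0, which satisfies the bound.\<close>
 have "0 <= B" using g[of 0] by (meson mult_nonneg_nonneg norm_ge_zero one_plus_norm_pos less_imp_le order_trans)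
 then show ?thesis using False by (simp add: not_integrable_integral_eq)
qed

lemma schwartz_sconv:
 assumes th: "th : schwartz" and ka: "ka : schwartz"
 shows "sconv th ka : schwartz"
proof (rule schwartzI)
 show "smooth (sconv th ka)" by (rule smooth_sconv[OF schwartz_L1(2)[OF th] ka])
 fix N and bs :: "'a list" assume bs: "set bs <= Basis"
 obtain B where B: "!!x. (1 + norm x) ^ N * norm (pd bs ka x) <= B"
  using schwartz_bound[OF ka bs] by blast
 show "EX B. ALL x. (1 + norm x) ^ N * norm (pd bs (sconv th ka) x) <= B"
  unfolding partial_derivs_sconv[OF schwartz_L1(2)[OF th] ka bs] sconv_def
  using weighted_conv_le[OF schwartz_L1(1)[OF th] B] by blast
qed

section \<open>Fourier transform\<close>

text \<open>\<open>fourier\<close> over \<open>lborel\<close> instead of the completed measure,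
  where Fubini applies to product measurable functions.\<close>

definition ft :: "('a::euclidean_space => complex) => 'a => complex" where
 "ft f xi = (LL x. f x * cis (- 2 * pi * (x \<bullet> xi)))"

lemma continuous_cis_inner [continuous_intros]:
 "continuous_on S (%x. cis (c * (x \<bullet> xi)))" "continuous_on S (%x. cis (c * (xi \<bullet> x)))"
 unfolding cis_conv_exp by (intro continuous_intros)+

lemma measurable_cis [measurable (raw)]:
 "f : borel_measurable M ==> (%x. cis (f x)) : borel_measurable M"
 using measurable_compose[of f M borel cis borel] borel_measurable_continuous_onI[of cis] continuous_on_cis
 by (auto simp: continuous_on_cis)

lemma fourier_eq_ft: "f : BM ==> fourier f xi = ft f xi"
 unfolding fourier_def ft_def by (rule integral_completion) simp

lemma integrable_times_cis:
 assumes "integ f" and [measurable]: "g : BM"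
 shows "integ (%x. f x * cis (g x))"
 by (rule integ_bounded[OF assms(1), of _ 1]) auto

lemma norm_cis_diff: "norm (cis a - cis b) <= \<bar>a - b\<bar>"
proof -
 have "cis a - cis b = cis b * (cis (a - b) - 1)" by (simp add: algebra_simps cis_mult)
 then have "norm (cis a - cis b) = norm (iexp (a - b) - 1)"
  by (simp add: norm_mult cis_conv_exp mult.commute)
 then show ?thesis using iexp_approx1[of "a - b" 0] by simp
qed

lemma norm_cis_linear: "norm (cis a - 1 - \<i> * of_real a) <= a\<^sup>2"
proof -
 have "norm (iexp a - (\<Sum>k\<le>1. (\<i> * of_real a) ^ k / fact k)) <= \<bar>a\<bar> ^ 2 / fact 2"
  using iexp_approx1[of a 1] by (simp add: numeral_2_eq_2)
 then have "norm (cis a - 1 - \<i> * of_real a) <= a\<^sup>2 / 2"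
  by (simp add: cis_conv_exp mult.commute diff_diff_eq)
 then show ?thesis by (smt (verit) zero_le_power2 field_sum_of_halves)
qed

lemma int_affine:
 fixes f :: "'a::euclidean_space => complex"
 assumes [measurable]: "f : BM" and c: "c ~= 0"
 shows "(LL x. f x) = \<bar>c\<bar> ^ DIM('a) *\<^sub>R (LL x. f (t + c *\<^sub>R x))"
  and "integ f ==> integ (%x. f (t + c *\<^sub>R x))"
proof -
 show "(LL x. f x) = \<bar>c\<bar> ^ DIM('a) *\<^sub>R (LL x. f (t + c *\<^sub>R x))"
  by (subst lborel_affine[OF c, of t]) (simp add: integral_density integral_distr)
 assume "integ f"
 then have "integ (%x. \<bar>c\<bar> ^ DIM('a) *\<^sub>R f (t + c *\<^sub>R x))"
  by (subst (asm) lborel_affine[OF c, of t]) (simp add: integrable_density integrable_distr_eq)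
 then have "integ (%x. (1 / \<bar>c\<bar> ^ DIM('a)) *\<^sub>R (\<bar>c\<bar> ^ DIM('a) *\<^sub>R f (t + c *\<^sub>R x)))"
  by (rule integrable_scaleR_right)
 then show "integ (%x. f (t + c *\<^sub>R x))"
  using c by simp
qed

lemma int_reflect:
 fixes f :: "'a::euclidean_space => complex"
 assumes [measurable]: "f : BM"
 shows "(LL x. f (t - x)) = (LL x. f x)" "integ f ==> integ (%x. f (t - x))"
 using int_affine[OF assms, of "-1" t] by simp_all

lemma int_shift:
 fixes f :: "'a::euclidean_space => complex"
 assumes [measurable]: "f : BM"
 shows "(LL x. f (x - t)) = (LL x. f x)" "integ f ==> integ (%x. f (x - t))"
 using int_affine[OF assms, of 1 "- t"] by simp_all

lemma fubini_bounded:
 fixes F :: "'a::euclidean_space => 'b::euclidean_space => complex"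
 assumes [measurable]: "(%(x, y). F x y) : borel_measurable (borel \<Otimes>\<^sub>M borel)"
  and fin: "(NN x. (NN y. en (norm (F x y)))) < \<infinity>"
 shows "(LL x. (LL y. F x y)) = (LL y. (LL x. F x y))"
  and "integ (%x. LL y. F x y)"
proof -
 have "integrable (lborel \<Otimes>\<^sub>M lborel) (case_prod F)"
 proof (rule integrableI_bounded)
  have "(\<integral>\<^sup>+z. en (norm (case_prod F z)) \<partial>(lborel \<Otimes>\<^sub>M lborel)) = (NN x. (NN y. en (norm (F x y))))"
   by (subst lborel.nn_integral_fst[symmetric]) (auto simp: case_prod_beta')
  then show "(\<integral>\<^sup>+z. en (norm (case_prod F z)) \<partial>(lborel \<Otimes>\<^sub>M lborel)) < \<infinity>" using fin by simp
 qed simp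
 from lborel_pair.Fubini_integral[OF this] lborel_pair.integrable_fst[OF this]
 show "(LL x. (LL y. F x y)) = (LL y. (LL x. F x y))"
  and "integ (%x. LL y. F x y)" by simp_all
qed

lemma fubini_conv:
 fixes th ka :: "'a::euclidean_space => complex"
 assumes th: "integ th" and ka: "integ ka" and [measurable]: "u : BM"
  and u: "!!x. norm (u x) <= B"
 shows "(LL x. (LL y. th y * ka (x - y)) * u x) = (LL y. th y * (LL x. ka (x - y) * u x))"
  and "integ (%x. (LL y. th y * ka (x - y)) * u x)"
proof -
 have [measurable]: "th : BM" "ka : BM"
  using th ka by (auto dest: borel_measurable_integrable)
 have B0: "0 <= B" using u[of 0] by (meson norm_ge_zero order_trans)
 let ?F = "%x y. th y * ka (x - y) * u x"
 have "(NN x. (NN y. en (norm (?F x y))))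
   <= (NN x. en B * nnconv (%x. en (norm (ka x))) (%y. en (norm (th y))) x)"
 proof (rule nn_integral_mono)
  fix x
  have "(NN y. en (norm (?F x y))) <= (NN y. en B * (en (norm (ka (x - y))) * en (norm (th y))))"
  proof (rule nn_integral_mono)
   fix y
   have "norm (?F x y) <= B * (norm (ka (x - y)) * norm (th y))"
    using mult_left_mono[OF u[of x], of "norm (ka (x - y)) * norm (th y)"] by (simp add: norm_mult mult_ac)
   then show "en (norm (?F x y)) <= en B * (en (norm (ka (x - y))) * en (norm (th y)))"
    using B0 by (simp add: ennreal_leI flip: ennreal_mult)
  qed
  then show "(NN y. en (norm (?F x y))) <= en B * nnconv (%x. en (norm (ka x))) (%y. en (norm (th y))) x"
   by (simp add: nnconv_def nn_integral_cmult)
 qed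
 also have "... = en B * ((NN x. en (norm (ka x))) * (NN x. en (norm (th x))))"
  by (simp add: nn_integral_cmult nn_nnconv)
 also have "... < \<infinity>"
  using th ka by (simp add: integrable_iff_bounded ennreal_mult_less_top)
 finally have fin: "(NN x. (NN y. en (norm (?F x y)))) < \<infinity>" .
 have meas: "(%(x, y). ?F x y) : borel_measurable (borel \<Otimes>\<^sub>M borel)" by measurable
 have e: "(LL y. ?F x y) = (LL y. th y * ka (x - y)) * u x"
  "(LL x. ?F x y) = th y * (LL x. ka (x - y) * u x)" for x y
  by (rule integral_mult_left_zero) (simp only: mult.assoc integral_mult_right_zero)
 from fubini_bounded[OF meas fin]
 show "(LL x. (LL y. th y * ka (x - y)) * u x) = (LL y. th y * (LL x. ka (x - y) * u x))"
  and "integ (%x. (LL y. th y * ka (x - y)) * u x)"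
  unfolding e .
qed

lemma ft_sconv:
 fixes th ka :: "'a::euclidean_space => complex"
 assumes th: "integ th" and ka: "integ ka"
 shows "ft (sconv th ka) xi = ft th xi * ft ka xi"
proof -
 have [measurable]: "th : BM" "ka : BM"
  using th ka by (auto dest: borel_measurable_integrable)
 have "ft (sconv th ka) xi = (LL y. th y * (LL x. ka (x - y) * cis (- 2 * pi * (x \<bullet> xi))))"
  unfolding ft_def sconv_def by (rule fubini_conv(1)[OF th ka, of _ 1]) auto
 also have "... = (LL y. th y * cis (- 2 * pi * (y \<bullet> xi)) * ft ka xi)"
 proof (intro Bochner_Integration.integral_cong refl)
  fix y
  have "(LL x. ka (x - y) * cis (- 2 * pi * (x \<bullet> xi)))
    = (LL x. cis (- 2 * pi * (y \<bullet> xi)) * (ka (x - y) * cis (- 2 * pi * ((x - y) \<bullet> xi))))"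
   by (intro Bochner_Integration.integral_cong refl) (simp add: cis_mult inner_diff_left algebra_simps)
  also have "... = cis (- 2 * pi * (y \<bullet> xi)) * (LL x. ka (x - y) * cis (- 2 * pi * ((x - y) \<bullet> xi)))"
   by simp
  also have "(LL x. ka (x - y) * cis (- 2 * pi * ((x - y) \<bullet> xi))) = ft ka xi"
   unfolding ft_def by (rule int_shift(1)) measurable
  finally show "th y * (LL x. ka (x - y) * cis (- 2 * pi * (x \<bullet> xi))) = th y * cis (- 2 * pi * (y \<bullet> xi)) * ft ka xi"
   by simp
 qed
 also have "... = ft th xi * ft ka xi" by (simp add: ft_def)
 finally show ?thesis .
qed

section \<open>Injectivity of the Fourier transform\<close>

definition gauss :: "'a::euclidean_space => real" where
 "gauss x = (\<Prod>b\<in>Basis. std_normal_density (x \<bullet> b))"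

lemma borel_measurable_gauss [measurable]: "gauss : BM"
 unfolding gauss_def[abs_def] by measurable

lemma sum_inner_squares: "(\<Sum>b\<in>Basis. - ((x \<bullet> b)\<^sup>2 / 2)) = - ((norm (x :: 'a::euclidean_space))\<^sup>2 / 2)"
 unfolding power2_norm_eq_inner[of x] euclidean_inner[of x x]
 by (simp add: sum_negf sum_divide_distrib power2_eq_square)

text \<open>Lebesgue measure as a product over the coordinates reduces the integral to the
  characteristic function of the standard normal distribution.\<close>

lemma gauss_fourier:
 fixes y :: "'a::euclidean_space"
 shows "integ (%x. complex_of_real (gauss x) * cis (x \<bullet> y))"
  and "(LL x. complex_of_real (gauss x) * cis (x \<bullet> y)) = complex_of_real (exp (- (norm y)\<^sup>2 / 2))"
proof -
 let ?g = "%(b::'a) t. complex_of_real (std_normal_density t) * cis (t * (y \<bullet> b))"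
 interpret product_sigma_finite "%_::'a. lborel :: real measure" ..
 have cis_sum: "cis (sum f S) = (\<Prod>b\<in>S. cis (f b))" if "finite S" for f and S :: "'a set"
  using that by (induction S) (auto simp: cis_mult[symmetric])
 have prod: "complex_of_real (gauss x) * cis (x \<bullet> y) = (\<Prod>b\<in>Basis. ?g b (x \<bullet> b))" for x :: 'a
  unfolding gauss_def of_real_prod euclidean_inner[of x y]
  by (simp add: cis_sum prod.distrib)
 have int: "integ (?g b)" for b
 proof -
  have "integ (%t. complex_of_real (std_normal_density t))"
   using integrable_normal_density by (simp add: integrable_of_real)
  then show ?thesis by (rule integrable_times_cis) measurable
 qed
 have val: "(LL t. ?g b t) = complex_of_real (exp (- (y \<bullet> b)\<^sup>2 / 2))" for b
 proof -
  have "complex_of_real (exp (- (y \<bullet> b)\<^sup>2 / 2)) = char std_normal_distribution (y \<bullet> b)"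
   by (simp add: char_std_normal_distribution)
  also have "... = (LL t. std_normal_density t *\<^sub>R iexp ((y \<bullet> b) * t))"
   unfolding char_def by (rule integral_density) auto
  also have "... = (LL t. ?g b t)"
   by (intro Bochner_Integration.integral_cong refl) (simp add: scaleR_conv_of_real cis_conv_exp mult_ac)
  finally show ?thesis ..
 qed
 have coord: "(\<Sum>b\<in>Basis. f b *\<^sub>R b) \<bullet> c = f c" if "c : Basis" for f and c :: 'a
  using that by (simp add: inner_sum_left inner_Basis if_distrib cong: if_cong)
 have [measurable]: "(%x::'a. \<Prod>b\<in>Basis. ?g b (x \<bullet> b)) : BM" by measurable
 have eq: "(\<Prod>b\<in>Basis. ?g b ((\<Sum>b\<in>Basis. f b *\<^sub>R b) \<bullet> b)) = (\<Prod>b\<in>Basis. ?g b (f b))" for f :: "'a => real"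
  by (intro prod.cong refl) (simp add: coord)
 show "integ (%x. complex_of_real (gauss x) * cis (x \<bullet> y))"
  unfolding prod by (subst lborel_eq, subst integrable_distr_eq) (auto simp: eq intro!: product_integrable_prod int)
 have "(LL x. complex_of_real (gauss x) * cis (x \<bullet> y)) = (\<Prod>b\<in>Basis. LL t. ?g b t)"
  unfolding prod by (subst lborel_eq, subst integral_distr) (auto simp: eq intro!: product_integral_prod int)
 also have "... = complex_of_real (exp (- (norm y)\<^sup>2 / 2))"
  unfolding val of_real_prod[symmetric] by (simp add: exp_sum[symmetric] sum_inner_squares)
 finally show "(LL x. complex_of_real (gauss x) * cis (x \<bullet> y)) = complex_of_real (exp (- (norm y)\<^sup>2 / 2))" .
qed

lemma gauss_eq: "gauss (x :: 'a::euclidean_space) = (1 / sqrt (2 * pi)) ^ DIM('a) * exp (- (norm x)\<^sup>2 / 2)"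
 unfolding gauss_def std_normal_density_def prod.distrib
 by (simp add: exp_sum[symmetric] sum_inner_squares)

text \<open>Gaussian averages of \<open>f\<close> around x0 of width de are superpositions of values
  of its Fourier transform, hence 0. As de tends to 0 they tend to \<open>f x0\<close> by
  continuity.\<close>

theorem ft_injective:
 fixes f :: "'a::euclidean_space => complex"
 assumes f: "integ f" and cont: "continuous_on UNIV f" and bdd: "!!x. norm (f x) <= B"
  and zero: "!!xi. ft f xi = 0"
 shows "f x0 = 0"
proof -
 have [measurable]: "f : BM" using f by (auto dest: borel_measurable_integrable)
 have gi: "integ (%x::'a. complex_of_real (gauss x))" using gauss_fourier(1)[of 0] by simp
 then have [measurable]: "(%x::'a. complex_of_real (gauss x)) : BM"
  by (auto dest: borel_measurable_integrable)
 have z: "(LL z. complex_of_real (gauss z) * f (x0 + de *\<^sub>R z)) = 0" if de: "0 < de" for de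
 proof -
  have fd: "integ (%z. f (x0 + de *\<^sub>R z))" using de f by (intro int_affine(2)) auto
  \<comment> \<open>Integrated over \<open>et\<close>, the Gaussian factor gives again a Gaussian in
    z; integrated over z, the expression gives a value of \<open>ft f\<close> up to known
    factors.\<close>
  let ?F = "%z et. f (x0 + de *\<^sub>R z) * (complex_of_real (gauss et) * cis (et \<bullet> z))"
  have fin: "(NN z. (\<integral>\<^sup>+et. en (norm (?F z et)) \<partial>(lborel :: 'a measure))) < \<infinity>"
  proof -
   have "(NN z. (\<integral>\<^sup>+et. en (norm (?F z et)) \<partial>(lborel :: 'a measure)))
    = (NN z. en (norm (f (x0 + de *\<^sub>R z))) * (\<integral>\<^sup>+et. en (norm (complex_of_real (gauss et))) \<partial>(lborel :: 'a measure)))"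
    by (simp add: norm_mult ennreal_mult nn_integral_cmult)
   also have "... = (NN z. en (norm (f (x0 + de *\<^sub>R z)))) * (\<integral>\<^sup>+et. en (norm (complex_of_real (gauss et))) \<partial>(lborel :: 'a measure))"
    by (simp add: nn_integral_multc)
   also have "... < \<infinity>" using fd gi unfolding integrable_iff_bounded by (auto simp: ennreal_mult_less_top)
   finally show ?thesis .
  qed
  have "(LL z. (LINT et|lborel. ?F z et)) = (LINT et|lborel. (LL z. ?F z et))"
   by (rule fubini_bounded(1)[OF _ fin]) measurable
  also have "... = (LINT et|(lborel :: 'a measure). 0)"
  proof (intro Bochner_Integration.integral_cong refl)
   fix et :: 'a
   let ?xi = "- (1 / (2 * pi * de)) *\<^sub>R et"
   have "ft f ?xi = \<bar>de\<bar> ^ DIM('a) *\<^sub>R (LL z. f (x0 + de *\<^sub>R z) * cis (- 2 * pi * ((x0 + de *\<^sub>R z) \<bullet> ?xi)))"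
    unfolding ft_def using de by (intro int_affine) auto
   moreover have "\<bar>de\<bar> ^ DIM('a) ~= 0" using de by simp
   ultimately have 0: "(LL z. f (x0 + de *\<^sub>R z) * cis (- 2 * pi * ((x0 + de *\<^sub>R z) \<bullet> ?xi))) = 0"
    using zero[of ?xi] by simp
   have ph: "cis (et \<bullet> z) = cis (- (1 / de) * (x0 \<bullet> et)) * cis (- 2 * pi * ((x0 + de *\<^sub>R z) \<bullet> ?xi))" for z
    unfolding cis_mult using de by (intro arg_cong[where f=cis]) (simp add: inner_add_left inner_add_right inner_commute field_simps)
   have "(LL z. ?F z et) = (LL z. (complex_of_real (gauss et) * cis (- (1 / de) * (x0 \<bullet> et))) *
     (f (x0 + de *\<^sub>R z) * cis (- 2 * pi * ((x0 + de *\<^sub>R z) \<bullet> ?xi))))"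
    unfolding ph by (intro Bochner_Integration.integral_cong refl) (simp only: mult_ac)
   also have "... = (complex_of_real (gauss et) * cis (- (1 / de) * (x0 \<bullet> et))) *
     (LL z. f (x0 + de *\<^sub>R z) * cis (- 2 * pi * ((x0 + de *\<^sub>R z) \<bullet> ?xi)))"
    by (rule integral_mult_right_zero)
   finally show "(LL z. ?F z et) = 0" unfolding 0 by simp
  qed
  finally have "(LL z. f (x0 + de *\<^sub>R z) * complex_of_real (exp (- (norm z)\<^sup>2 / 2))) = 0"
   by (simp add: gauss_fourier(2))
  moreover have "(LL z. complex_of_real (gauss z) * f (x0 + de *\<^sub>R z))
   = (LL z. complex_of_real ((1 / sqrt (2 * pi)) ^ DIM('a)) * (f (x0 + de *\<^sub>R z) * complex_of_real (exp (- (norm z)\<^sup>2 / 2))))"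
   unfolding gauss_eq by (intro Bochner_Integration.integral_cong refl) (simp only: of_real_mult mult_ac)
  ultimately show ?thesis by simp
 qed
 have "(%n. LL z. complex_of_real (gauss z) * f (x0 + (1 / real (Suc n)) *\<^sub>R z)) \<longlonglongrightarrow> (LINT z|(lborel :: 'a measure). complex_of_real (gauss z) * f x0)"
 proof (rule integral_dominated_convergence[where w="%z::'a. norm (complex_of_real (gauss z)) * B"])
  show "integ (%z::'a. norm (complex_of_real (gauss z)) * B)"
   by (intro integrable_mult_left integrable_norm gi)
  show "AE z in lborel. (%n. complex_of_real (gauss z) * f (x0 + (1 / real (Suc n)) *\<^sub>R z)) \<longlonglongrightarrow> complex_of_real (gauss z) * f x0"
  proof (rule AE_I2)
   fix z :: 'a
   have "(%n. x0 + (1 / real (Suc n)) *\<^sub>R z) \<longlonglongrightarrow> x0 + 0 *\<^sub>R z"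
    by (intro tendsto_intros LIMSEQ_Suc[OF lim_1_over_n])
   then have "(%n. f (x0 + (1 / real (Suc n)) *\<^sub>R z)) \<longlonglongrightarrow> f x0"
    using cont by (intro isCont_tendsto_compose[of x0 f]) (auto simp: continuous_on_eq_continuous_at)
   then show "(%n. complex_of_real (gauss z) * f (x0 + (1 / real (Suc n)) *\<^sub>R z)) \<longlonglongrightarrow> complex_of_real (gauss z) * f x0"
    by (intro tendsto_intros)
  qed
  show "AE z in lborel. norm (complex_of_real (gauss z) * f (x0 + (1 / real (Suc n)) *\<^sub>R z)) <= norm (complex_of_real (gauss z)) * B" for n
   unfolding norm_mult by (intro AE_I2 mult_left_mono bdd) auto
 qed measurable
 then have "(LL z. complex_of_real (gauss (z :: 'a)) * f x0) = 0"
 proof -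
  assume lim: "(%n. LL z. complex_of_real (gauss z) * f (x0 + (1 / real (Suc n)) *\<^sub>R z)) \<longlonglongrightarrow> (LINT z|(lborel :: 'a measure). complex_of_real (gauss z) * f x0)"
  have zz: "(LL z. complex_of_real (gauss z) * f (x0 + (1 / real (Suc n)) *\<^sub>R z)) = 0" for n
   by (rule z) simp
  show ?thesis using lim unfolding zz by (simp only: LIMSEQ_const_iff)
 qed
 then show ?thesis using gauss_fourier(2)[of "0 :: 'a"] by simp
qed

section \<open>Vanishing moments\<close>

lemma cis_plus_mult: "cis (a + b) = cis a * cis b"
 by (simp add: cis_mult)

text \<open>The transform of the product with the Schwartz function vanishes on a ball about the
  origin. Polynomial growth of \<open>g\<close> keeps the product integrable and is preserved when
  polynomials are multiplied in.\<close>

definition low_freq_free :: "real => ('a::euclidean_space => complex) => ('a => complex) => bool" where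
 "low_freq_free r \<phi> g \<longleftrightarrow> g : BM & (EX N C. ALL x. norm (g x) <= C * (1 + norm x) ^ N) &
   (ALL xi. norm xi < r --> (LL x. g x * \<phi> x * cis (- 2 * pi * (x \<bullet> xi))) = 0)"

lemma integrable_poly_growth:
 assumes \<phi>: "\<phi> : schwartz" and [measurable]: "g : BM" and g: "!!x. norm (g x) <= C * (1 + norm x) ^ N"
 shows "integ (%x. g x * \<phi> x)"
proof (rule Bochner_Integration.integrable_bound[of _ "%x. C * ((1 + norm x) ^ N * norm (\<phi> x))"])
 show "integ (%x. C * ((1 + norm x) ^ N * norm (\<phi> x)))"
  using schwartz_L1(1)[OF \<phi>] by simp
 show "(%x. g x * \<phi> x) : LM" using schwartz_meas[OF \<phi>] by simp
 show "AE x in lborel. norm (g x * \<phi> x) <= norm (C * ((1 + norm x) ^ N * norm (\<phi> x)))"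
  unfolding norm_mult[of "g _"] real_norm_def mult.assoc[symmetric]
  by (intro AE_I2 order_trans[OF _ abs_ge_self] mult_right_mono g) auto
qed

text \<open>Multiplication by the inner product with v differentiates the transform in direction v.
  Instead of differentiating, J is compared with a difference quotient of a function that vanishes
  on the ball; the error is of the order of the step.\<close>

lemma low_freq_free_inner:
 fixes g \<phi> :: "'a::euclidean_space => complex"
 assumes \<phi>: "\<phi> : schwartz" and g: "low_freq_free r \<phi> g"
 shows "low_freq_free r \<phi> (%x. complex_of_real (x \<bullet> v) * g x)"
proof -
 obtain N C where C: "!!x. norm (g x) <= C * (1 + norm x) ^ N" using g by (auto simp: low_freq_free_def)
 have [measurable]: "g : BM" using g by (auto simp: low_freq_free_def)
 have C0: "0 <= C" using C[of 0] by simp (meson norm_ge_zero order_trans)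
 have zero: "!!xi. norm xi < r ==> (LL x. g x * \<phi> x * cis (- 2 * pi * (x \<bullet> xi))) = 0"
  using g by (auto simp: low_freq_free_def)
 have g1: "norm (complex_of_real ((x \<bullet> v) ^ n) * g x) <= (C * norm v ^ n) * (1 + norm x) ^ (N + n)" for n x
 proof -
  have "\<bar>x \<bullet> v\<bar> <= norm v * (1 + norm x)"
   using Cauchy_Schwarz_ineq2[of x v] by (simp add: algebra_simps add_increasing)
  then have "\<bar>x \<bullet> v\<bar> ^ n <= (norm v * (1 + norm x)) ^ n" by (intro power_mono) auto
  then have "norm (complex_of_real ((x \<bullet> v) ^ n) * g x) <= (norm v * (1 + norm x)) ^ n * (C * (1 + norm x) ^ N)"
   unfolding norm_mult norm_of_real power_abs by (intro mult_mono C) auto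
  then show ?thesis by (simp add: power_mult_distrib power_add mult_ac)
 qed
 have int: "integ (%x. complex_of_real ((x \<bullet> v) ^ n) * g x * \<phi> x)" for n
  by (rule integrable_poly_growth[OF \<phi> _ g1]) measurable
 show ?thesis
  unfolding low_freq_free_def
 proof (intro conjI allI impI)
  show "EX N C. ALL x. norm (complex_of_real (x \<bullet> v) * g x) <= C * (1 + norm x) ^ N"
   by (intro exI allI) (rule g1[where n=1, unfolded power_one_right])
  fix xi :: 'a assume xi: "norm xi < r"

  define J where "J = (LL x. complex_of_real (x \<bullet> v) * g x * \<phi> x * cis (- 2 * pi * (x \<bullet> xi)))"
  define M where "M = (LL x. norm (complex_of_real ((x \<bullet> v) ^ 2) * g x * \<phi> x))"
  have "norm J <= ta * (2 * pi * M)" if ta: "0 < ta" "norm xi + ta * norm v < r" for ta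
  proof -
   let ?a = "%x. - 2 * pi * ta * (x \<bullet> v)"
   let ?G = "%x. g x * \<phi> x * cis (- 2 * pi * (x \<bullet> xi))"
   have "norm (xi + ta *\<^sub>R v) < r" using norm_triangle_ineq[of xi "ta *\<^sub>R v"] ta by simp
   from zero[OF this] have z1: "(LL x. ?G x * cis (?a x)) = 0"
    by (simp add: inner_add_right distrib_left mult.assoc cis_mult)
   have i0: "integ ?G"
    using int[of 0] by (intro integrable_times_cis) auto
   have i1: "integ (%x. complex_of_real (x \<bullet> v) * g x * \<phi> x * cis (- 2 * pi * (x \<bullet> xi)))"
    using int[of 1] by (intro integrable_times_cis) auto
   have iL: "integ (%x. ?G x * (\<i> * of_real (?a x)))"
   proof -
    have "(%x. ?G x * (\<i> * of_real (?a x))) = (%x. (\<i> * of_real (- 2 * pi * ta)) * (complex_of_real (x \<bullet> v) * g x * \<phi> x * cis (- 2 * pi * (x \<bullet> xi))))"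
     by (intro ext) (simp add: mult_ac)
    then show ?thesis using i1 by simp
   qed
   have L: "(LL x. ?G x * (\<i> * of_real (?a x))) = (\<i> * of_real (- 2 * pi * ta)) * J"
   proof -
    have "(%x. ?G x * (\<i> * of_real (?a x))) = (%x. (\<i> * of_real (- 2 * pi * ta)) * (complex_of_real (x \<bullet> v) * g x * \<phi> x * cis (- 2 * pi * (x \<bullet> xi))))"
     by (intro ext) (simp add: mult_ac)
    then show ?thesis unfolding J_def by (simp only: integral_mult_right_zero)
   qed
   have i2: "integ (%x. ?G x * cis (?a x))" by (rule integrable_times_cis[OF i0]) measurable
   have "(LL x. ?G x * (cis (?a x) - 1 - \<i> * of_real (?a x)))
     = (LL x. ?G x * cis (?a x) - ?G x - ?G x * (\<i> * of_real (?a x)))"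
    by (intro Bochner_Integration.integral_cong refl) (simp only: right_diff_distrib mult_1_right)
   also have "... = (LL x. ?G x * cis (?a x)) - (LL x. ?G x) - (LL x. ?G x * (\<i> * of_real (?a x)))"
    using i0 i2 iL by simp
   also have "... = - ((\<i> * of_real (- 2 * pi * ta)) * J)" unfolding z1 L using zero[OF xi] by simp
   finally have "norm ((\<i> * of_real (- 2 * pi * ta)) * J) = norm (LL x. ?G x * (cis (?a x) - 1 - \<i> * of_real (?a x)))"
    by simp
   also have "... <= (LL x. (2 * pi * ta)\<^sup>2 * norm (complex_of_real ((x \<bullet> v) ^ 2) * g x * \<phi> x))"
   proof (rule Bochner_Integration.integral_norm_bound_integral)
    have "integ (%x. ?G x * cis (?a x) - ?G x - ?G x * (\<i> * of_real (?a x)))"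
     using i0 i2 iL by simp
    then show "integ (%x. ?G x * (cis (?a x) - 1 - \<i> * of_real (?a x)))"
     by (simp only: right_diff_distrib mult_1_right)
    show "integ (%x. (2 * pi * ta)\<^sup>2 * norm (complex_of_real ((x \<bullet> v) ^ 2) * g x * \<phi> x))"
     by (intro integrable_mult_right integrable_norm int)
    fix x
    have "norm (?G x * (cis (?a x) - 1 - \<i> * of_real (?a x))) <= norm (g x * \<phi> x) * (?a x)\<^sup>2"
     unfolding norm_mult[of "?G x"] by (intro mult_mono norm_cis_linear) (auto simp: norm_mult)
    also have "... = (2 * pi * ta)\<^sup>2 * norm (complex_of_real ((x \<bullet> v) ^ 2) * g x * \<phi> x)"
     by (simp add: norm_mult power_mult_distrib norm_power mult_ac)
    finally show "norm (?G x * (cis (?a x) - 1 - \<i> * of_real (?a x))) <= (2 * pi * ta)\<^sup>2 * norm (complex_of_real ((x \<bullet> v) ^ 2) * g x * \<phi> x)" .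
   qed
   also have "... = (2 * pi * ta)\<^sup>2 * M" by (simp add: M_def)
   finally have "(2 * pi * ta) * norm J <= (2 * pi * ta) * (ta * (2 * pi * M))"
    using ta by (simp add: norm_mult power2_eq_square mult_ac)
   then show ?thesis using ta by (simp add: mult_ac)
  qed
  note small = this
  have "norm J <= 0"
  proof (rule ccontr)
   assume "\<not> norm J <= 0"
   then have J: "0 < norm J" by simp
   have M0: "0 <= M" by (simp add: M_def)
   \<comment> \<open>Small enough to stay inside the ball and to make the error at most half of
     |J|.\<close>
   define ta where "ta = min ((r - norm xi) / (2 * (1 + norm v))) (norm J / (2 * (1 + 2 * pi * M)))"
   have pM: "0 < 1 + 2 * pi * M" using M0 by (simp add: add_pos_nonneg)
   have nv: "0 < 1 + norm v" by (simp add: add_pos_nonneg)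
   have ta0: "0 < ta" unfolding ta_def using xi J pM nv by simp
   have "ta * (1 + norm v) <= (r - norm xi) / (2 * (1 + norm v)) * (1 + norm v)"
    using nv by (intro mult_right_mono) (auto simp: ta_def)
   also have "... = (r - norm xi) / 2" using nv by (simp add: field_simps)
   finally have "ta * norm v < r - norm xi" using ta0 xi by (simp add: algebra_simps)
   then have "norm J <= ta * (2 * pi * M)" using small[OF ta0] by simp
   also have "... <= ta * (1 + 2 * pi * M)" using ta0 by (intro mult_left_mono) auto
   also have "... <= norm J / (2 * (1 + 2 * pi * M)) * (1 + 2 * pi * M)"
    using pM by (intro mult_right_mono) (auto simp: ta_def)
   also have "... = norm J / 2" using pM by (simp add: field_simps)
   finally show False using J by simp
  qed
  then show "(LL x. complex_of_real (x \<bullet> v) * g x * \<phi> x * cis (- 2 * pi * (x \<bullet> xi))) = 0"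
   by (simp add: J_def)
 qed measurable
qed

lemma low_freq_free_add:
 fixes \<phi> g h :: "'a::euclidean_space => complex"
 assumes \<phi>: "\<phi> : schwartz" and g: "low_freq_free r \<phi> g" and h: "low_freq_free r \<phi> h"
 shows "low_freq_free r \<phi> (%x. g x + h x)"
proof -
 obtain N C where C: "!!x. norm (g x) <= C * (1 + norm x) ^ N" using g by (auto simp: low_freq_free_def)
 obtain N' C' where C': "!!x. norm (h x) <= C' * (1 + norm x) ^ N'" using h by (auto simp: low_freq_free_def)
 have [measurable]: "g : BM" "h : BM" using g h by (auto simp: low_freq_free_def)
 have C0: "0 <= C" "0 <= C'" using C[of 0] C'[of 0] by simp_all (meson norm_ge_zero order_trans)+
 show ?thesis
  unfolding low_freq_free_def
 proof (intro conjI allI impI exI[of _ "N + N'"] exI[of _ "C + C'"])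
  fix x :: 'a
  have "(1 + norm x) ^ N <= (1 + norm x) ^ (N + N')" "(1 + norm x) ^ N' <= (1 + norm x) ^ (N + N')"
   by (intro power_increasing; simp)+
  then have "C * (1 + norm x) ^ N + C' * (1 + norm x) ^ N' <= (C + C') * (1 + norm x) ^ (N + N')"
   unfolding distrib_right using C0 by (intro add_mono mult_left_mono)
  then show "norm (g x + h x) <= (C + C') * (1 + norm x) ^ (N + N')"
   using norm_triangle_ineq[of "g x" "h x"] C[of x] C'[of x] by linarith
 next
  fix xi :: 'a assume xi: "norm xi < r"
  have "integ (%x. g x * \<phi> x * cis (- 2 * pi * (x \<bullet> xi)))" "integ (%x. h x * \<phi> x * cis (- 2 * pi * (x \<bullet> xi)))"
   by (intro integrable_times_cis integrable_poly_growth[OF \<phi> _ C] integrable_poly_growth[OF \<phi> _ C']; measurable)+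
  then have "(LL x. g x * \<phi> x * cis (- 2 * pi * (x \<bullet> xi)) + h x * \<phi> x * cis (- 2 * pi * (x \<bullet> xi))) = 0"
   using g h xi by (simp add: low_freq_free_def)
  then show "(LL x. (g x + h x) * \<phi> x * cis (- 2 * pi * (x \<bullet> xi))) = 0" by (simp add: distrib_right)
 qed measurable
qed

lemma low_freq_free_cmult:
 assumes g: "low_freq_free r \<phi> g"
 shows "low_freq_free r \<phi> (%x. c * g x)"
proof -
 obtain N C where C: "!!x. norm (g x) <= C * (1 + norm x) ^ N" using g by (auto simp: low_freq_free_def)
 have "norm (c * g x) <= (norm c * C) * (1 + norm x) ^ N" for x
  using mult_left_mono[OF C[of x], of "norm c"] by (simp add: norm_mult mult_ac)
 then have "EX N C. ALL x. norm (c * g x) <= C * (1 + norm x) ^ N" by blast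
 moreover have "(%x. c * g x) : BM"
  using g unfolding low_freq_free_def by (intro borel_measurable_times) auto
 ultimately show ?thesis using g by (simp add: low_freq_free_def mult.assoc)
qed

lemma low_freq_free_poly:
 fixes \<phi> :: "'a::euclidean_space => complex"
 assumes \<phi>: "\<phi> : schwartz" and p: "real_polynomial_function p"
 shows "low_freq_free r \<phi> g ==> low_freq_free r \<phi> (%x. complex_of_real (p x) * g x)"
 using p
proof (induction p arbitrary: g)
 case (linear f)
 define v where "v = (\<Sum>b\<in>Basis. f b *\<^sub>R b)"
 interpret f: bounded_linear f by fact
 have "f x = x \<bullet> v" for x
 proof -
  have "f x = f (\<Sum>b\<in>Basis. (x \<bullet> b) *\<^sub>R b)" by (simp add: euclidean_representation)
  also have "... = (\<Sum>b\<in>Basis. (x \<bullet> b) * f b)" by (simp add: f.sum f.scale)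
  also have "... = x \<bullet> v" by (simp add: v_def inner_sum_right mult.commute)
  finally show ?thesis .
 qed
 then show ?case using low_freq_free_inner[OF \<phi> linear.prems, of v] by simp
next
 case (const c)
 then show ?case by (intro low_freq_free_cmult)
next
 case (add f g')
 have "low_freq_free r \<phi> (%x. complex_of_real (f x) * g x + complex_of_real (g' x) * g x)"
  by (intro low_freq_free_add \<phi> add.IH add.prems)
 then show ?case by (simp add: distrib_right)
next
 case (mult f g')
 have "low_freq_free r \<phi> (%x. complex_of_real (f x) * (complex_of_real (g' x) * g x))"
  by (intro mult.IH mult.prems)
 then show ?case by (simp add: mult.assoc)
qed

text \<open>A polynomial factor becomes a derivative of the Fourier transform, which vanishes near the origin.\<close>
theorem schwartz0I:
 fixes \<phi> :: "'a::euclidean_space => complex"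
 assumes \<phi>: "\<phi> : schwartz" and r: "0 < r" and zero: "!!xi. norm xi < r ==> ft \<phi> xi = 0"
 shows "\<phi> : schwartz0"
 unfolding schwartz0_def
proof (intro CollectI conjI allI impI \<phi>)
 fix P :: "'a => complex" assume P: "polynomial_function P"
 have re: "real_polynomial_function (%x. Re (P x))" "real_polynomial_function (%x. Im (P x))"
  using P bounded_linear_Re bounded_linear_Im unfolding polynomial_function_def by (auto simp: o_def)
 have one: "low_freq_free r \<phi> (%_. 1)"
  unfolding low_freq_free_def
 proof (intro conjI allI impI)
  show "EX N C. \<forall>x::'a. norm (1::complex) <= C * (1 + norm x) ^ N" by (intro exI[of _ 0] exI[of _ 1]) simp
  show "(LL x. 1 * \<phi> x * cis (- 2 * pi * (x \<bullet> xi))) = 0" if "norm xi < r" for xi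
   using zero[OF that] by (simp add: ft_def)
 qed simp
 have "low_freq_free r \<phi> (%x. complex_of_real (Re (P x)) * 1 + \<i> * (complex_of_real (Im (P x)) * 1))"
  by (intro low_freq_free_add \<phi> low_freq_free_cmult low_freq_free_poly re one)
 moreover have "(%x. complex_of_real (Re (P x)) * 1 + \<i> * (complex_of_real (Im (P x)) * 1)) = P"
  using complex_eq by auto
 ultimately have "low_freq_free r \<phi> P" by simp
 then have "P : BM" "(LL x. P x * \<phi> x * cis (- 2 * pi * (x \<bullet> 0))) = 0"
  using r unfolding low_freq_free_def by (auto simp del: inner_zero_right)
 then show "(LINT x|lebesgue. P x * \<phi> x) = 0"
  using schwartz_meas[OF \<phi>] by (subst integral_completion) auto
qed

section \<open>Tempered distributions and convolution\<close>

lemma temperedD: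
 assumes "F : tempered"
 shows "ps : schwartz ==> et : schwartz ==> F (%x. ps x + et x) = F ps + F et"
  "ps : schwartz ==> F (%x. c * ps x) = c * F ps"
 using assms by (auto simp: tempered_def)

lemma tempered_diff: "F : tempered ==> ps : schwartz ==> et : schwartz ==> F (%x. ps x - et x) = F ps - F et"
 using temperedD(1)[of F ps "%x. (-1) * et x"] temperedD(2)[of F et "-1"] schwartz_cmult[of et "-1"] by simp

lemma tempered_zero: "F : tempered ==> F (%x. 0) = 0"
 using temperedD(2)[of F "%x. 0" 0] schwartz_zero by simp

lemma tempered_sum:
 "F : tempered ==> (!!i. i : I ==> f i : schwartz) ==> F (%x. \<Sum>i\<in>I. f i x) = (\<Sum>i\<in>I. F (f i))"
proof (induction I rule: infinite_finite_induct)
 case (insert i I)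
 have "F (%x. f i x + (\<Sum>i\<in>I. f i x)) = F (f i) + F (%x. \<Sum>i\<in>I. f i x)"
  by (rule temperedD(1)[OF insert.prems(1)]) (use insert in "auto intro: schwartz_sum")
 then show ?case using insert by simp
qed (simp_all add: tempered_zero)

lemma partial_derivs_sum:
 assumes "finite I" "!!i. i : I ==> f i : schwartz" "set bs <= Basis"
 shows "pd bs (%x. \<Sum>i\<in>I. f i x) = (%x. \<Sum>i\<in>I. pd bs (f i) x)"
 using assms
proof (induction I)
 case empty
 have "pd bs (%x. 0 * (0::complex)) = (%x. 0 * pd bs (%x. 0) x)"
  using empty by (intro partial_derivs_cmult schwartz_smooth schwartz_zero)
 then show ?case by simp
next
 case (insert i I)
 have "pd bs (%x. f i x + (\<Sum>i\<in>I. f i x)) = (%x. pd bs (f i) x + pd bs (%x. \<Sum>i\<in>I. f i x) x)"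
  using insert by (intro partial_derivs_add schwartz_smooth schwartz_sum) auto
 then show ?case using insert by simp
qed

lemma schwartz_shift: "ka : schwartz ==> (%x. ka (x - z)) : schwartz"
 using schwartz_affine[of ka 1 "- z"] by simp

lemma partial_derivs_shift:
 fixes ka :: "'a::euclidean_space => complex"
 shows "ka : schwartz ==> set bs <= Basis ==> pd bs (%x. ka (x - z)) = (%x. pd bs ka (x - z))"
 using partial_derivs_affine(1)[of ka bs 1 "- z"] by (simp add: schwartz_smooth)

lemma schwartz_diff_le:
 fixes ka :: "'a::euclidean_space => complex"
 assumes ka: "ka : schwartz" and bs: "set bs <= Basis" "length bs <= N"
 shows "(1 + norm w) ^ N * norm (pd bs ka z - pd bs ka w)
   <= real DIM('a) * schwartz_seminorm (N + 1) ka * norm (z - w) * (1 + norm (z - w)) ^ N"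
proof (rule weighted_difference_le)
 show "pd bs ka differentiable at x" for x
  by (rule smooth_differentiable[OF schwartz_smooth[OF ka] bs(1)])
 fix b x :: 'a assume b: "b : Basis"
 have "(1 + norm x) ^ N * norm (pd (b # bs) ka x) <= (1 + norm x) ^ (N + 1) * norm (pd (b # bs) ka x)"
  by (intro mult_right_mono power_increasing) auto
 also have "... <= schwartz_seminorm (N + 1) ka"
  by (rule schwartz_seminorm_ge[OF ka]) (use b bs in auto)
 finally show "(1 + norm x) ^ N * norm (pd [b] (pd bs ka) x) <= schwartz_seminorm (N + 1) ka" by simp
qed

text \<open>Pairings with translates grow polynomially and are locally Lipschitz; this gives the
  continuity of the pieces and the domination in the limit of Riemann sums.\<close>

lemma tempered_shift_bounds:
 fixes ka :: "'a::euclidean_space => complex"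
 assumes F: "F : tempered" and ka: "ka : schwartz"
 obtains A N where "0 <= A" "!!z. norm (F (%x. ka (x - z))) <= A * (1 + norm z) ^ N"
  "!!z w. norm (F (%x. ka (x - z)) - F (%x. ka (x - w))) <= A * norm (z - w) * (1 + norm (z - w)) ^ N * (1 + norm w) ^ N"
proof -
 obtain C0 N where C0: "!!ps. ps : schwartz ==> norm (F ps) <= C0 * schwartz_seminorm N ps"
  using F unfolding tempered_def mem_Collect_eq by blast
 define C where "C = \<bar>C0\<bar>"
 have C: "norm (F ps) <= C * schwartz_seminorm N ps" if "ps : schwartz" for ps
  using C0[OF that] mult_right_mono[OF abs_ge_self schwartz_seminorm_nonneg[OF that]] unfolding C_def by (rule order_trans)
 let ?k = "real (card (multi_indices N :: 'a list set))"
 let ?S = "schwartz_seminorm (N + 1) ka" and ?T = "schwartz_seminorm N ka"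
 define A where "A = C * (?k * (real DIM('a) * ?S)) + C * (?k * ?T)"
 have ST: "0 <= ?S" "0 <= ?T" by (intro schwartz_seminorm_nonneg ka)+
 have nn: "0 <= C * (?k * (real DIM('a) * ?S))" "0 <= C * (?k * ?T)" using ST by (auto simp: C_def)
 show ?thesis
 proof (rule that[of A N])
  show "0 <= A" using nn by (simp add: A_def)
  fix z w
  have "schwartz_seminorm N (%x. ka (x - z)) <= ?k * (?T * (1 + norm z) ^ N)"
  proof (rule schwartz_seminorm_le)
   fix bs :: "'a list" and x assume bs: "set bs <= Basis" "length bs <= N"
   have "(1 + norm x) ^ N <= (1 + norm (x - z)) ^ N * (1 + norm z) ^ N"
    using one_plus_norm_add_le[of "x - z" z N] by simp
   then have "(1 + norm x) ^ N * norm (pd bs ka (x - z))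
     <= (1 + norm (x - z)) ^ N * (1 + norm z) ^ N * norm (pd bs ka (x - z))"
    by (rule mult_right_mono) simp
   also have "... = ((1 + norm (x - z)) ^ N * norm (pd bs ka (x - z))) * (1 + norm z) ^ N" by (simp only: mult_ac)
   also have "... <= ?T * (1 + norm z) ^ N" by (intro mult_right_mono schwartz_seminorm_ge ka bs) auto
   finally show "(1 + norm x) ^ N * norm (pd bs (%x. ka (x - z)) x) <= ?T * (1 + norm z) ^ N"
    by (simp add: partial_derivs_shift ka bs)
  qed
  then have "C * schwartz_seminorm N (%x. ka (x - z)) <= C * (?k * (?T * (1 + norm z) ^ N))"
   by (intro mult_left_mono) (auto simp: C_def)
  also have "... = (C * (?k * ?T)) * (1 + norm z) ^ N" by (simp only: mult_ac)
  also have "... <= A * (1 + norm z) ^ N" unfolding A_def using nn by (intro mult_right_mono) auto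
  finally show "norm (F (%x. ka (x - z))) <= A * (1 + norm z) ^ N"
   using C[OF schwartz_shift[OF ka, of z]] by linarith
  have "schwartz_seminorm N (%x. ka (x - z) - ka (x - w)) <= ?k * (real DIM('a) * ?S * norm (z - w) * (1 + norm (z - w)) ^ N * (1 + norm w) ^ N)"
  proof (rule schwartz_seminorm_le)
   fix bs :: "'a list" and x assume bs: "set bs <= Basis" "length bs <= N"
   have "pd bs (%x. ka (x - z) + (-1) * ka (x - w)) = (%x. pd bs (%x. ka (x - z)) x + pd bs (%x. (-1) * ka (x - w)) x)"
    by (intro partial_derivs_add schwartz_smooth schwartz_cmult schwartz_shift ka bs)
   also have "pd bs (%x. (-1) * ka (x - w)) = (%x. (-1) * pd bs (%x. ka (x - w)) x)"
    by (intro partial_derivs_cmult schwartz_smooth schwartz_shift ka bs)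
   finally have pd: "pd bs (%x. ka (x - z) - ka (x - w)) x = pd bs ka (x - z) - pd bs ka (x - w)"
    by (simp add: partial_derivs_shift ka bs)
   have "(1 + norm x) ^ N <= (1 + norm (x - w)) ^ N * (1 + norm w) ^ N"
    using one_plus_norm_add_le[of "x - w" w N] by simp
   then have "(1 + norm x) ^ N * norm (pd bs ka (x - z) - pd bs ka (x - w))
     <= (1 + norm (x - w)) ^ N * (1 + norm w) ^ N * norm (pd bs ka (x - z) - pd bs ka (x - w))"
    by (rule mult_right_mono) simp
   also have "... = ((1 + norm (x - w)) ^ N * norm (pd bs ka (x - z) - pd bs ka (x - w))) * (1 + norm w) ^ N" by (simp only: mult_ac)
   also have "... <= (real DIM('a) * ?S * norm ((x - z) - (x - w)) * (1 + norm ((x - z) - (x - w))) ^ N) * (1 + norm w) ^ N"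
    by (intro mult_right_mono schwartz_diff_le ka bs) auto
   finally show "(1 + norm x) ^ N * norm (pd bs (%x. ka (x - z) - ka (x - w)) x)
     <= real DIM('a) * ?S * norm (z - w) * (1 + norm (z - w)) ^ N * (1 + norm w) ^ N"
    unfolding pd by (simp add: norm_minus_commute)
  qed
  then have "C * schwartz_seminorm N (%x. ka (x - z) - ka (x - w))
    <= C * (?k * (real DIM('a) * ?S * norm (z - w) * (1 + norm (z - w)) ^ N * (1 + norm w) ^ N))"
   by (intro mult_left_mono) (auto simp: C_def)
  also have "... = (C * (?k * (real DIM('a) * ?S))) * (norm (z - w) * (1 + norm (z - w)) ^ N * (1 + norm w) ^ N)" by (simp only: mult_ac)
  also have "... <= A * (norm (z - w) * (1 + norm (z - w)) ^ N * (1 + norm w) ^ N)"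
   unfolding A_def using nn by (intro mult_right_mono) auto
  finally show "norm (F (%x. ka (x - z)) - F (%x. ka (x - w))) <= A * norm (z - w) * (1 + norm (z - w)) ^ N * (1 + norm w) ^ N"
   using C[OF schwartz_diff[OF schwartz_shift[OF ka, of z] schwartz_shift[OF ka, of w]]]
   unfolding tempered_diff[OF F schwartz_shift[OF ka, of z] schwartz_shift[OF ka, of w]] by (simp only: mult.assoc)
 qed
qed

lemma tempered_shift_continuous:
 assumes F: "F : tempered" and ka: "ka : schwartz"
 shows "continuous_on S (%z. F (%x. ka (x - z)))"
proof -
 obtain A N where A: "!!z w. norm (F (%x. ka (x - z)) - F (%x. ka (x - w))) <= A * norm (z - w) * (1 + norm (z - w)) ^ N * (1 + norm w) ^ N"
  using tempered_shift_bounds[OF F ka] by metis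
 have "isCont (%z. F (%x. ka (x - z))) w" for w
  unfolding isCont_def
 proof (rule Lim_null_comparison[THEN LIM_zero_cancel])
  show "\<forall>\<^sub>F z in at w. norm (F (%x. ka (x - z)) - F (%x. ka (x - w))) <= A * norm (z - w) * (1 + norm (z - w)) ^ N * (1 + norm w) ^ N"
   using A by simp
  show "((%z. A * norm (z - w) * (1 + norm (z - w)) ^ N * (1 + norm w) ^ N) \<longlongrightarrow> 0) (at w)"
   by (auto intro!: tendsto_eq_intros)
 qed
 then show ?thesis by (simp add: continuous_at_imp_continuous_on)
qed

lemma finite_lattice_image: "finite (corner k ` ball (0 :: 'a::euclidean_space) r)"
proof -
 define M where "M = \<lceil>tp k * r\<rceil> + 1"
 have "corner k ` ball (0 :: 'a) r
   <= (%n. \<Sum>b\<in>Basis. (tm k * rint (n b)) *\<^sub>R b) ` (Pi\<^sub>E Basis (%_. {- M..M}))"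
 proof
  fix z assume "z : corner k ` ball (0 :: 'a) r"
  then obtain x :: 'a where x: "norm x < r" and z: "z = corner k x" by auto
  have "\<lfloor>tp k * (x \<bullet> b)\<rfloor> : {- M..M}" if b: "b : Basis" for b
  proof -
   have "\<bar>x \<bullet> b\<bar> <= r" using Basis_le_norm[OF b, of x] x by linarith
   then have "\<bar>tp k * (x \<bullet> b)\<bar> <= tp k * r" by (simp add: abs_mult)
   then show ?thesis unfolding M_def by (auto simp: floor_le_iff le_floor_iff) linarith+
  qed
  then show "z : (%n. \<Sum>b\<in>Basis. (tm k * rint (n b)) *\<^sub>R b) ` (Pi\<^sub>E Basis (%_. {- M..M}))"
   unfolding z corner_def
   by (intro image_eqI[of _ _ "restrict (%b. \<lfloor>tp k * (x \<bullet> b)\<rfloor>) Basis"]) auto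
 qed
 then show ?thesis by (rule finite_subset) (intro finite_imageI finite_PiE, auto)
qed

text \<open>Riemann sums over a dyadic lattice converge to the convolution in every Schwartz seminorm.\<close>
theorem tempered_sconv:
 fixes th ka :: "'a::euclidean_space => complex"
 assumes F: "F : tempered" and th: "th : schwartz" and ka: "ka : schwartz"
 shows "F (sconv th ka) = (LL y. th y * F (%x. ka (x - y)))"
proof -
 let ?d = "real DIM('a)"
 define p :: "'a => complex" where "p z = F (%x. ka (x - z))" for z
 note thint = schwartz_L1(2)[OF th] and thw = schwartz_L1(1)[OF th]
 have [measurable]: "th : BM" by (rule schwartz_meas[OF th])
 have pc: "continuous_on UNIV p" unfolding p_def by (rule tempered_shift_continuous[OF F ka])
 have [measurable]: "p : BM" by (rule borel_measurable_continuous_onI[OF pc])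
 obtain A N where A: "0 <= A" "!!z. norm (p z) <= A * (1 + norm z) ^ N"
  unfolding p_def using tempered_shift_bounds[OF F ka] by metis
 \<comment> \<open>Generation n + 1 keeps the distance to the lattice point at most d / (n + 1); the
   balls \<open>D n\<close> exhaust space, so each Riemann sum is finite.\<close>
 define L :: "nat => 'a => 'a" where "L n = corner (int (Suc n))" for n
 have [measurable]: "L n : BM" for n unfolding L_def by measurable
 define D where "D n = ball (0::'a) (real (Suc n))" for n
 have [measurable]: "D n : sets borel" for n by (simp add: D_def)
 define Z where "Z n = L n ` D n" for n
 have Z: "finite (Z n)" for n unfolding Z_def L_def D_def by (rule finite_lattice_image)
 define Q where "Q n z = {y : D n. L n y = z}" for n z
 have [measurable]: "Q n z : sets borel" for n z unfolding Q_def by measurable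
 define c where "c n z = (LL y. th y * indicator (Q n z) y)" for n z
 have cint: "integ (%y. th y * indicator (Q n z) y)" for n z
  by (rule integ_bounded[OF thint, of _ 1]) (auto simp: indicator_def)
 have disc: "(%y. indicator (D n) y * (th y * H (L n y))) = (%y. \<Sum>z\<in>Z n. th y * indicator (Q n z) y * H z)" for n and H :: "'a => complex"
 proof
  fix y
  show "indicator (D n) y * (th y * H (L n y)) = (\<Sum>z\<in>Z n. th y * indicator (Q n z) y * H z)"
  proof (cases "y : D n")
   case True
   then have "L n y : Z n" by (simp add: Z_def)
   have "(\<Sum>z\<in>Z n. th y * indicator (Q n z) y * H z) = (\<Sum>z\<in>Z n. if z = L n y then th y * H z else 0)"
    using True by (intro sum.cong) (auto simp: Q_def indicator_def)
   then show ?thesis using True \<open>L n y : Z n\<close> Z by simp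
  qed (auto simp: Q_def)
 qed
 have dint: "integ (%y. indicator (D n) y * (th y * H (L n y)))" for n and H :: "'a => complex"
  unfolding disc by (intro Bochner_Integration.integrable_sum integrable_mult_left cint)
 have dval: "(LL y. indicator (D n) y * (th y * H (L n y))) = (\<Sum>z\<in>Z n. c n z * H z)" for n and H :: "'a => complex"
  unfolding disc c_def by (subst Bochner_Integration.integral_sum) (auto intro!: integrable_mult_left cint)
 define R where "R n x = (\<Sum>z\<in>Z n. c n z * ka (x - z))" for n x
 have RS: "R n : schwartz" for n
  unfolding R_def[abs_def] by (intro schwartz_sum schwartz_cmult schwartz_shift ka)
 have FR: "F (R n) = (LL y. indicator (D n) y * (th y * p (L n y)))" for n
 proof -
  have "F (R n) = (\<Sum>z\<in>Z n. F (%x. c n z * ka (x - z)))"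
   unfolding R_def[abs_def] by (intro tempered_sum F schwartz_cmult schwartz_shift ka)
  also have "... = (\<Sum>z\<in>Z n. c n z * p z)"
   unfolding p_def by (intro sum.cong refl temperedD(2) F schwartz_shift ka)
  finally show ?thesis by (simp add: dval)
 qed
 have pdR: "pd bs (R n) x = (LL y. indicator (D n) y * (th y * pd bs ka (x - L n y)))"
  if bs: "set bs <= Basis" for bs n x
 proof -
  have "pd bs (R n) x = (\<Sum>z\<in>Z n. pd bs (%x. c n z * ka (x - z)) x)"
   unfolding R_def[abs_def] by (subst partial_derivs_sum) (auto intro!: Z schwartz_cmult schwartz_shift ka bs)
  also have "... = (\<Sum>z\<in>Z n. c n z * pd bs ka (x - z))"
   by (simp add: partial_derivs_cmult partial_derivs_shift schwartz_smooth schwartz_shift ka bs)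
  finally show ?thesis using dval[of n "%z. pd bs ka (x - z)"] by simp
 qed
 have Ld: "norm (y - L n y) <= ?d / real (Suc n)" for n y
 proof -
  have "norm (y - L n y) <= ?d * 2 powr (- rint (int (Suc n)))" unfolding L_def by (rule norm_diff_corner)
  also have "... <= ?d * (1 / real (Suc n))"
  proof (rule mult_left_mono)
   have "real (Suc n) <= 2 ^ Suc n" by (meson less_exp less_imp_le of_nat_less_numeral_power_cancel_iff)
   then show "2 powr (- rint (int (Suc n))) <= 1 / real (Suc n)"
    by (simp add: powr_minus powr_realpow field_simps del: power_Suc of_nat_Suc)
  qed simp
  finally show ?thesis by simp
 qed
 have Ld': "norm (y - L n y) <= ?d" for n y
  using Ld[of y n] by (rule order_trans) (simp add: divide_le_eq)
 obtain C0 M where C0: "!!ps. ps : schwartz ==> norm (F ps) <= C0 * schwartz_seminorm M ps"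
  using F unfolding tempered_def mem_Collect_eq by blast
 let ?S = "schwartz_seminorm (M + 1) ka"
 have S0: "0 <= ?S" by (rule schwartz_seminorm_nonneg[OF ka])
 define K where "K = ?S * (?d * ?d * (1 + ?d) ^ M + 1)"
 define I where "I = (LL y. (1 + norm y) ^ (M + 1) * norm (th y))"
 have semi: "schwartz_seminorm M (%x. sconv th ka x - R n x) <= real (card (multi_indices M :: 'a list set)) * (K * I / real (Suc n))" for n
 proof (rule schwartz_seminorm_le)
  fix bs :: "'a list" and x assume bs: "set bs <= Basis" "length bs <= M"
  let ?E = "pd bs ka"
  let ?m = "real (Suc n)"
  have ES: "?E : schwartz" by (rule schwartz_partial_derivs[OF ka bs(1)])
  have "pd bs (%x. sconv th ka x + (-1) * R n x) = (%x. pd bs (sconv th ka) x + pd bs (%x. (-1) * R n x) x)"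
   by (intro partial_derivs_add schwartz_smooth schwartz_cmult schwartz_sconv RS th ka bs)
  also have "pd bs (%x. (-1) * R n x) = (%x. (-1) * pd bs (R n) x)"
   by (intro partial_derivs_cmult schwartz_smooth RS bs)
  finally have "pd bs (%x. sconv th ka x - R n x) x = sconv th ?E x - pd bs (R n) x"
   by (simp add: partial_derivs_sconv[OF thint ka bs(1)])
  also have "... = (LL y. th y * ?E (x - y) - indicator (D n) y * (th y * ?E (x - L n y)))"
   unfolding sconv_def pdR[OF bs(1)]
   using sconv_integrable[OF thint ES, of x] dint[of n "%z. ?E (x - z)"] by simp
  finally have eq: "pd bs (%x. sconv th ka x - R n x) x = ..." .
  \<comment> \<open>Inside the ball the factor 1 / (n + 1) comes from the distance to the lattice
    point by the mean value inequality; outside it is bought with one extra power of 1 +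
    |y|.\<close>
  have pw: "(1 + norm x) ^ M * norm (th y * ?E (x - y) - indicator (D n) y * (th y * ?E (x - L n y)))
    <= K / ?m * ((1 + norm y) ^ (M + 1) * norm (th y))" for y
  proof -
   let ?g = "?E (x - y) - indicator (D n) y * ?E (x - L n y)"
   have xy: "(1 + norm x) ^ M <= (1 + norm y) ^ M * (1 + norm (x - y)) ^ M"
    using one_plus_norm_add_le[of y "x - y" M] by simp
   have g: "(1 + norm (x - y)) ^ M * norm ?g <= K / ?m * (1 + norm y)"
   proof (cases "y : D n")
    case True
    have "(1 + norm (x - y)) ^ M * norm (?E (x - L n y) - ?E (x - y))
      <= ?d * ?S * norm ((x - L n y) - (x - y)) * (1 + norm ((x - L n y) - (x - y))) ^ M"
     by (rule schwartz_diff_le[OF ka bs])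
    also have "(x - L n y) - (x - y) = y - L n y" by simp
    also have "?d * ?S * norm (y - L n y) * (1 + norm (y - L n y)) ^ M <= ?d * ?S * (?d / ?m) * (1 + ?d) ^ M"
     using S0 by (intro mult_mono mult_left_mono power_mono Ld add_left_mono Ld') auto
    also have "... <= K / ?m * 1" using S0 unfolding K_def by (simp add: field_simps)
    also have "... <= K / ?m * (1 + norm y)" using S0 unfolding K_def by (intro mult_left_mono) auto
    finally show ?thesis using True by (simp add: norm_minus_commute)
   next
    case False
    then have ym: "?m <= 1 + norm y" by (simp add: D_def)
    have "(1 + norm (x - y)) ^ M * norm (?E (x - y)) <= (1 + norm (x - y)) ^ (M + 1) * norm (?E (x - y))"
     by (intro mult_right_mono power_increasing) auto
    also have "... <= ?S" by (rule schwartz_seminorm_ge[OF ka]) (use bs in auto)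
    also have "... <= K" unfolding K_def using S0 mult_left_mono[of 1 "?d * ?d * (1 + ?d) ^ M + 1" ?S] by simp
    also have "K <= K / ?m * (1 + norm y)"
    proof -
     have "0 <= K" unfolding K_def using S0 by simp
     then have "K * ?m <= K * (1 + norm y)" using ym by (intro mult_left_mono)
     then show ?thesis by (simp add: field_simps)
    qed
    finally show ?thesis using False by simp
   qed
   have "(1 + norm x) ^ M * norm (th y * ?g) <= ((1 + norm y) ^ M * (1 + norm (x - y)) ^ M) * norm (th y * ?g)"
    by (intro mult_right_mono xy) auto
   also have "... = (1 + norm y) ^ M * norm (th y) * ((1 + norm (x - y)) ^ M * norm ?g)"
    by (simp only: norm_mult mult_ac)
   also have "... <= (1 + norm y) ^ M * norm (th y) * (K / ?m * (1 + norm y))"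
    by (intro mult_left_mono g) auto
   finally show ?thesis by (simp add: right_diff_distrib mult_ac)
  qed
  have "(1 + norm x) ^ M * norm (pd bs (%x. sconv th ka x - R n x) x)
    = norm (LL y. (1 + norm x) ^ M *\<^sub>R (th y * ?E (x - y) - indicator (D n) y * (th y * ?E (x - L n y))))"
   unfolding eq using one_plus_norm_pos[of x M] by simp
  also have "... <= (LL y. K / ?m * ((1 + norm y) ^ (M + 1) * norm (th y)))"
  proof (rule Bochner_Integration.integral_norm_bound_integral)
   show "integ (%y. (1 + norm x) ^ M *\<^sub>R (th y * ?E (x - y) - indicator (D n) y * (th y * ?E (x - L n y))))"
    using sconv_integrable[OF thint ES, of x] dint[of n "%z. ?E (x - z)"] by simp
   show "integ (%y. K / ?m * ((1 + norm y) ^ (M + 1) * norm (th y)))"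
    by (intro integrable_mult_right thw)
   show "norm ((1 + norm x) ^ M *\<^sub>R (th y * ?E (x - y) - indicator (D n) y * (th y * ?E (x - L n y))))
     <= K / ?m * ((1 + norm y) ^ (M + 1) * norm (th y))" for y
    using pw[of y] one_plus_norm_pos[of x M] by simp
  qed
  also have "... = K * I / ?m" unfolding I_def by (simp only: integral_mult_right_zero) simp
  finally show "(1 + norm x) ^ M * norm (pd bs (%x. sconv th ka x - R n x) x) <= K * I / ?m" .
 qed
 have lim1: "(%n. F (R n)) \<longlonglongrightarrow> F (sconv th ka)"
 proof (rule LIM_zero_cancel, rule Lim_null_comparison)
  let ?B = "\<bar>C0\<bar> * (real (card (multi_indices M :: 'a list set)) * (K * I))"
  show "\<forall>\<^sub>F n in sequentially. norm (F (R n) - F (sconv th ka)) <= ?B * (1 / real (Suc n))"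
  proof (rule always_eventually, rule allI)
   fix n
   have dS: "(%x. sconv th ka x - R n x) : schwartz" by (intro schwartz_diff schwartz_sconv RS th ka)
   have "norm (F (R n) - F (sconv th ka)) = norm (F (%x. sconv th ka x - R n x))"
    by (simp add: tempered_diff F schwartz_sconv RS th ka norm_minus_commute)
   also have "... <= C0 * schwartz_seminorm M (%x. sconv th ka x - R n x)" by (rule C0[OF dS])
   also have "... <= \<bar>C0\<bar> * schwartz_seminorm M (%x. sconv th ka x - R n x)"
    by (intro mult_right_mono schwartz_seminorm_nonneg dS) auto
   also have "... <= \<bar>C0\<bar> * (real (card (multi_indices M :: 'a list set)) * (K * I / real (Suc n)))"
    by (intro mult_left_mono semi) auto
   finally show "norm (F (R n) - F (sconv th ka)) <= ?B * (1 / real (Suc n))" by simp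
  qed
  show "(%n. ?B * (1 / real (Suc n))) \<longlonglongrightarrow> 0"
   using tendsto_mult_left[OF LIMSEQ_Suc[OF lim_1_over_n], of ?B] by simp
 qed
 have lim2: "(%n. LL y. indicator (D n) y * (th y * p (L n y))) \<longlonglongrightarrow> (LL y. th y * p y)"
 proof (rule integral_dominated_convergence[where w="%y. A * (1 + ?d) ^ N * ((1 + norm y) ^ N * norm (th y))"])
  show "integ (%y. A * (1 + ?d) ^ N * ((1 + norm y) ^ N * norm (th y)))"
   by (intro integrable_mult_right thw)
  show "AE y in lborel. (%n. indicator (D n) y * (th y * p (L n y))) \<longlonglongrightarrow> th y * p y"
  proof (rule AE_I2)
   fix y
   have "(%n. y - L n y) \<longlonglongrightarrow> 0"
   proof (rule Lim_null_comparison)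
    show "\<forall>\<^sub>F n in sequentially. norm (y - L n y) <= ?d * (1 / real (Suc n))"
     using Ld by (intro always_eventually allI) simp
    show "(%n. ?d * (1 / real (Suc n))) \<longlonglongrightarrow> 0"
     using tendsto_mult_left[OF LIMSEQ_Suc[OF lim_1_over_n], of ?d] by simp
   qed
   then have "(%n. y - (y - L n y)) \<longlonglongrightarrow> y - 0" by (intro tendsto_diff tendsto_const)
   then have "(%n. L n y) \<longlonglongrightarrow> y" by simp
   then have lp: "(%n. th y * p (L n y)) \<longlonglongrightarrow> th y * p y"
    using pc by (intro tendsto_mult_left isCont_tendsto_compose[of y p]) (auto simp: continuous_on_eq_continuous_at)
   obtain m :: nat where m: "norm y < real m" using reals_Archimedean2 by blast
   have "\<forall>\<^sub>F n in sequentially. indicator (D n) y * (th y * p (L n y)) = th y * p (L n y)"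
    using eventually_ge_at_top[of m] by eventually_elim (use m in "auto simp: D_def indicator_def")
   from tendsto_cong[OF this] lp show "(%n. indicator (D n) y * (th y * p (L n y))) \<longlonglongrightarrow> th y * p y"
    by blast
  qed
  show "AE y in lborel. norm (indicator (D n) y * (th y * p (L n y))) <= A * (1 + ?d) ^ N * ((1 + norm y) ^ N * norm (th y))" for n
  proof (rule AE_I2)
   fix y
   have "(1 + norm (L n y)) ^ N <= (1 + norm y) ^ N * (1 + norm (L n y - y)) ^ N"
    using one_plus_norm_add_le[of y "L n y - y" N] by simp
   also have "... <= (1 + norm y) ^ N * (1 + ?d) ^ N"
    using Ld'[of y n] by (intro mult_left_mono power_mono) (auto simp: norm_minus_commute)
   finally have "A * (1 + norm (L n y)) ^ N <= A * ((1 + norm y) ^ N * (1 + ?d) ^ N)" using A(1) by (rule mult_left_mono)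
   then have pl: "norm (p (L n y)) <= A * ((1 + norm y) ^ N * (1 + ?d) ^ N)" using A(2)[of "L n y"] by linarith
   have "norm (indicator (D n) y * (th y * p (L n y))) <= norm (th y) * norm (p (L n y))"
    by (simp add: norm_mult indicator_def)
   also have "... <= norm (th y) * (A * ((1 + norm y) ^ N * (1 + ?d) ^ N))" by (intro mult_left_mono pl) auto
   finally show "norm (indicator (D n) y * (th y * p (L n y))) <= A * (1 + ?d) ^ N * ((1 + norm y) ^ N * norm (th y))"
    by (simp only: mult_ac)
  qed
 qed measurable
 have "F (sconv th ka) = (LL y. th y * p y)"
  using lim1 lim2 unfolding FR by (rule LIMSEQ_unique)
 then show ?thesis by (simp add: p_def)
qed

section \<open>Littlewood--Paley pieces\<close>

lemma schwartz_eqI: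
 fixes f g :: "'a::euclidean_space => complex"
 assumes "f : schwartz" "g : schwartz" "!!xi. ft f xi = ft g xi"
 shows "f = g"
proof
 fix x :: 'a
 have d: "(%x. f x - g x) : schwartz" by (intro schwartz_diff assms)
 obtain B where B: "!!x. norm (f x - g x) <= B" using schwartz_bounded[OF d, of "[]"] by auto
 have "f x - g x = 0"
 proof (rule ft_injective[of "%x. f x - g x" B x])
  fix xi :: 'a
  show "ft (%x. f x - g x) xi = 0"
  proof -
   have "ft (%x. f x - g x) xi = ft f xi - ft g xi"
    unfolding ft_def left_diff_distrib
    by (intro Bochner_Integration.integral_diff integrable_times_cis schwartz_L1(2) assms) auto
   then show ?thesis by (simp add: assms)
  qed
 qed (use schwartz_L1(2)[OF d] schwartz_continuous[OF d] B in auto)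
 then show "f x = g x" by simp
qed

lemma sconv_commute:
 fixes th ka :: "'a::euclidean_space => complex"
 assumes [measurable]: "th : BM" "ka : BM"
 shows "sconv th ka = sconv ka th"
proof
 fix x
 have "sconv th ka x = (LL y. th (x - y) * ka (x - (x - y)))"
  unfolding sconv_def by (rule int_reflect(1)[symmetric]) measurable
 then show "sconv th ka x = sconv ka th x" by (simp add: sconv_def mult.commute)
qed

locale LP =
 fixes \<Phi> :: "'a::euclidean_space => complex"
 assumes LP: "littlewood_paley \<Phi>"
begin

abbreviation P :: "int => 'a => complex" where
 "P k \<equiv> dilate \<Phi> k"

lemma \<Phi>S: "\<Phi> : schwartz"
 using LP by (simp add: littlewood_paley_def)

lemma PS: "P k : schwartz"
 using schwartz_cmult[OF schwartz_affine[OF \<Phi>S, of "2 powi k" 0]] unfolding dilate_def[abs_def] by simp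

lemma P_measurable [measurable]: "P k : BM"
 by (rule schwartz_meas[OF PS])

lemma P_integrable: "integ (P k)"
 by (rule schwartz_L1(2)[OF PS])

lemma P_eq: "P k x = of_real (2 powr (rint k * real DIM('a))) * \<Phi> ((tp k) *\<^sub>R x)"
proof -
 have "(2::real) powi (k * int DIM('a)) = 2 powr (rint k * real DIM('a))"
  using powr_real_of_int'[of 2 "k * int DIM('a)"] by simp
 then show ?thesis by (simp add: dilate_def powr_real_of_int')
qed

lemma ft_P: "ft (P k) xi = ft \<Phi> ((tm k) *\<^sub>R xi)"
proof -
 let ?c = "tp k"
 have [measurable]: "\<Phi> : BM" by (rule schwartz_meas[OF \<Phi>S])
 have cd: "\<bar>?c\<bar> ^ DIM('a) = 2 powr (rint k * real DIM('a))"
  by (simp add: powr_realpow[symmetric] powr_powr)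
 have e: "(?c *\<^sub>R x) \<bullet> ((tm k) *\<^sub>R xi) = x \<bullet> xi" for x
  by (simp add: powr_minus field_simps)
 have "ft \<Phi> ((tm k) *\<^sub>R xi) =
   \<bar>?c\<bar> ^ DIM('a) *\<^sub>R (LL x. \<Phi> (0 + ?c *\<^sub>R x) * cis (- 2 * pi * ((0 + ?c *\<^sub>R x) \<bullet> ((tm k) *\<^sub>R xi))))"
  unfolding ft_def by (rule int_affine(1)) auto
 also have "... = (LL x. P k x * cis (- 2 * pi * (x \<bullet> xi)))"
  unfolding integral_scaleR_right[symmetric] cd
  by (intro Bochner_Integration.integral_cong refl) (simp only: P_eq scaleR_conv_of_real add_0 e mult.assoc)
 finally show ?thesis by (simp add: ft_def)
qed

lemma continuous_ft_\<Phi>: "continuous_on UNIV (ft \<Phi>)"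
proof -
 define I where "I = (LL x. (1 + norm x) ^ 1 * norm (\<Phi> x))"
 have le: "norm (ft \<Phi> xi - ft \<Phi> et) <= 2 * pi * norm (xi - et) * I" for xi et
 proof -
  let ?e = "%xi x. cis (- 2 * pi * (x \<bullet> xi))"
  have int: "integ (%x. \<Phi> x * ?e xi x)" for xi
   by (rule integrable_times_cis[OF schwartz_L1(2)[OF \<Phi>S]]) measurable
  have "ft \<Phi> xi - ft \<Phi> et = (LL x. \<Phi> x * ?e xi x - \<Phi> x * ?e et x)"
   unfolding ft_def using int by simp
  also have "norm ... <= (LL x. 2 * pi * norm (xi - et) * ((1 + norm x) ^ 1 * norm (\<Phi> x)))"
  proof (rule Bochner_Integration.integral_norm_bound_integral)
   fix x
   have "norm (?e xi x - ?e et x) <= \<bar>(- 2 * pi * (x \<bullet> xi)) - (- 2 * pi * (x \<bullet> et))\<bar>" by (rule norm_cis_diff)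
   also have "... = 2 * pi * \<bar>x \<bullet> (xi - et)\<bar>"
   proof -
    have "(- 2 * pi * (x \<bullet> xi)) - (- 2 * pi * (x \<bullet> et)) = - (2 * pi * (x \<bullet> (xi - et)))"
     by (simp add: inner_diff_right algebra_simps)
    then show ?thesis by (simp add: abs_mult)
   qed
   also have "... <= 2 * pi * (norm x * norm (xi - et))" by (intro mult_left_mono Cauchy_Schwarz_ineq2) auto
   also have "... <= 2 * pi * ((1 + norm x) * norm (xi - et))" by (intro mult_left_mono mult_right_mono) auto
   finally have "norm (\<Phi> x) * norm (?e xi x - ?e et x) <= norm (\<Phi> x) * (2 * pi * ((1 + norm x) * norm (xi - et)))"
    by (rule mult_left_mono) simp
   then show "norm (\<Phi> x * ?e xi x - \<Phi> x * ?e et x) <= 2 * pi * norm (xi - et) * ((1 + norm x) ^ 1 * norm (\<Phi> x))"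
    unfolding right_diff_distrib[symmetric] norm_mult by (simp add: mult_ac)
  qed (use int in "auto intro!: integrable_mult_right schwartz_L1(1)[OF \<Phi>S, of 1, simplified]")
  also have "... = 2 * pi * norm (xi - et) * I" unfolding I_def by (rule integral_mult_right_zero)
  finally show ?thesis .
 qed
 have "isCont (ft \<Phi>) et" for et
  unfolding isCont_def
 proof (rule Lim_null_comparison[THEN LIM_zero_cancel])
  show "\<forall>\<^sub>F xi in at et. norm (ft \<Phi> xi - ft \<Phi> et) <= 2 * pi * norm (xi - et) * I" using le by simp
  show "((%xi. 2 * pi * norm (xi - et) * I) \<longlongrightarrow> 0) (at et)" by (auto intro!: tendsto_eq_intros)
 qed
 then show ?thesis by (simp add: continuous_at_imp_continuous_on)
qed

text \<open>The set where the transform is nonzero is open and lies in the closed annulus; moving a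
  point of it radially in both directions excludes the boundary. The strict inequalities make the
  spectra of P_l and P_k disjoint already for |l - k| = 2, where the closed annuli still
  touch.\<close>

lemma ft_\<Phi>_support: "ft \<Phi> xi ~= 0 ==> 1/2 < norm xi & norm xi < 2"
proof -
 assume nz: "ft \<Phi> xi ~= 0"
 have cl: "1/2 <= norm et & norm et <= 2" if "ft \<Phi> et ~= 0" for et
 proof -
  have eq: "fourier \<Phi> = ft \<Phi>" by (intro ext fourier_eq_ft schwartz_meas \<Phi>S)
  have "closure {et. ft \<Phi> et ~= 0} <= {et. 1/2 <= norm et & norm et <= 2}"
   using LP unfolding littlewood_paley_def eq by (elim conjE)
  moreover have "et : closure {et. ft \<Phi> et ~= 0}" using that by (intro subsetD[OF closure_subset]) simp
  ultimately have "et : {et. 1/2 <= norm et & norm et <= 2}" by (rule subsetD)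
  then show ?thesis by simp
 qed
 have "open {et. ft \<Phi> et ~= 0}"
  using open_Collect_neq[OF continuous_ft_\<Phi> continuous_on_const] by simp
 then obtain e where e: "e > 0" "!!et. dist et xi < e ==> ft \<Phi> et ~= 0"
  using nz unfolding open_dist by auto
 have n: "1/2 <= norm xi" "norm xi <= 2" using cl[OF nz] by auto
 \<comment> \<open>Displacement small enough to stay where the transform is nonzero; s <= 1/2 keeps
   1 - s positive.\<close>
 define s where "s = min (1/2) (e / (2 * norm xi))"
 have s: "0 < s" "s <= 1/2" "s * norm xi < e"
 proof -
  have "norm xi > 0" using n by linarith
  then show "0 < s" using e by (simp add: s_def)
  show "s <= 1/2" by (simp add: s_def)
  have "s * norm xi <= e / (2 * norm xi) * norm xi" by (intro mult_right_mono) (auto simp: s_def)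
  also have "... = e / 2" using \<open>norm xi > 0\<close> by simp
  finally show "s * norm xi < e" using e by simp
 qed
 have "ft \<Phi> ((1 + s) *\<^sub>R xi) ~= 0" "ft \<Phi> ((1 - s) *\<^sub>R xi) ~= 0"
  using s by (auto intro!: e simp: dist_norm scaleR_add_left scaleR_diff_left)
 then have "norm ((1 + s) *\<^sub>R xi) <= 2" "1/2 <= norm ((1 - s) *\<^sub>R xi)" using cl by blast+
 then have a: "(1 + s) * norm xi <= 2" "1/2 <= (1 - s) * norm xi" using s by auto
 have "0 < s * norm xi" using s n by (intro mult_pos_pos) auto
 then show ?thesis using a by (simp add: algebra_simps)
qed

lemma ft_P_support:
 assumes "ft (P k) xi ~= 0"
 shows "2 powr (rint k - 1) < norm xi" "norm xi < 2 powr (rint k + 1)"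
proof -
 have "1/2 < tm k * norm xi & tm k * norm xi < 2"
  using ft_\<Phi>_support[of "(tm k) *\<^sub>R xi"] assms by (simp add: ft_P)
 then show "2 powr (rint k - 1) < norm xi" "norm xi < 2 powr (rint k + 1)"
  by (simp_all add: powr_minus powr_diff powr_add field_simps)
qed

lemma ft_P_disjoint: "\<bar>l - k\<bar> \<ge> 2 ==> ft (P l) xi * ft (P k) xi = 0"
proof (rule ccontr)
 assume lk: "\<bar>l - k\<bar> \<ge> 2" and "ft (P l) xi * ft (P k) xi ~= 0"
 then have nz: "ft (P l) xi ~= 0" "ft (P k) xi ~= 0" by auto
 have "2 powr (rint l - 1) < 2 powr (rint k + 1)" "2 powr (rint k - 1) < 2 powr (rint l + 1)"
  using ft_P_support[OF nz(1)] ft_P_support[OF nz(2)] by linarith+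
 then show False using lk by simp
qed

lemma ft_P_sum:
 assumes "ft (P k) xi ~= 0"
 shows "(\<Sum>l\<in>{k - 1, k, k + 1}. ft (P l) xi) = 1"
proof -
 have "xi ~= 0" using ft_P_support(1)[OF assms] by (metis norm_zero not_less powr_ge_zero)
 moreover have "fourier (P l) xi = ft (P l) xi" for l by (rule fourier_eq_ft) measurable
 ultimately have 1: "((%l. ft (P l) xi) has_sum 1) UNIV" using LP by (auto simp only: littlewood_paley_def)
 have "((%l. ft (P l) xi) has_sum 1) {k - 1, k, k + 1}"
 proof (rule iffD1[OF has_sum_cong_neutral 1])
  fix l assume "l : UNIV - {k - 1, k, k + 1}"
  then have "\<bar>l - k\<bar> \<ge> 2" by auto
  from ft_P_disjoint[OF this, of xi] show "ft (P l) xi = 0" using assms by simp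
 qed auto
 then show ?thesis using has_sum_finite[of "{k - 1, k, k + 1}" "%l. ft (P l) xi"] by (metis finite.emptyI finite.insertI has_sum_unique)
qed

definition PP :: "int => int => 'a => complex" where
 "PP l k = sconv (P l) (P k)"

lemma PPS: "PP l k : schwartz"
 unfolding PP_def by (intro schwartz_sconv PS)

lemma ft_PP: "ft (PP l k) xi = ft (P l) xi * ft (P k) xi"
 unfolding PP_def by (intro ft_sconv P_integrable)

lemma PP_commute: "PP l k = PP k l"
 unfolding PP_def by (rule sconv_commute) measurable

lemma PP_disjoint: "\<bar>l - k\<bar> \<ge> 2 ==> PP l k = (%x. 0)"
 by (intro schwartz_eqI PPS schwartz_zero) (simp add: ft_PP ft_P_disjoint, simp add: ft_def)

text \<open>On the spectrum of \<open>P k\<close> only three members of the partition of unity can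
  be nonzero, so they sum to 1; the transform determines a Schwartz function.\<close>

lemma PP_sum: "(%x. \<Sum>l\<in>{k - 1, k, k + 1}. PP l k x) = P k"
proof (intro schwartz_eqI schwartz_sum PPS PS)
 fix xi
 have "ft (%x. \<Sum>l\<in>{k - 1, k, k + 1}. PP l k x) xi = (\<Sum>l\<in>{k - 1, k, k + 1}. ft (PP l k) xi)"
  unfolding ft_def sum_distrib_right
  by (intro Bochner_Integration.integral_sum integrable_times_cis schwartz_L1(2) PPS) measurable
 also have "... = (\<Sum>l\<in>{k - 1, k, k + 1}. ft (P l) xi) * ft (P k) xi"
  unfolding ft_PP sum_distrib_right ..
 also have "... = ft (P k) xi" using ft_P_sum[of k xi] by (cases "ft (P k) xi = 0") auto
 finally show "ft (%x. \<Sum>l\<in>{k - 1, k, k + 1}. PP l k x) xi = ft (P k) xi" .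
qed

lemma reflected_schwartz: "ps : schwartz ==> (%y. ps (x - y)) : schwartz" for ps :: "'a => complex"
 using schwartz_affine[of ps "-1" x] by simp

lemma P_schwartz0: "(%y. P k (x - y)) : schwartz0"
proof (rule schwartz0I)
 show "(%y. P k (x - y)) : schwartz" by (rule reflected_schwartz[OF PS])
 show "0 < 2 powr (rint k - 1)" by simp
 fix xi :: 'a assume xi: "norm xi < 2 powr (rint k - 1)"
 have z: "ft (P k) (- xi) = 0"
  using ft_P_support(1)[of k "- xi"] xi by fastforce
 have "ft (%y. P k (x - y)) xi = (LL y. P k y * cis (- 2 * pi * ((x - y) \<bullet> xi)))"
  unfolding ft_def using int_reflect(1)[of "%y. P k y * cis (- 2 * pi * ((x - y) \<bullet> xi))" x] by simp
 also have "... = (LL y. cis (- 2 * pi * (x \<bullet> xi)) * (P k y * cis (- 2 * pi * (y \<bullet> (- xi)))))"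
  by (intro Bochner_Integration.integral_cong refl) (simp add: inner_diff_left algebra_simps cis_mult)
 also have "... = cis (- 2 * pi * (x \<bullet> xi)) * ft (P k) (- xi)" unfolding ft_def by (rule integral_mult_right_zero)
 finally show "ft (%y. P k (x - y)) xi = 0" using z by simp
qed

end

locale LP_dist = LP \<Phi> for \<Phi> :: "'a::euclidean_space => complex" +
 fixes X :: "(('a => complex) => complex) set" assumes X: "X : tempered_mod_poly"
begin

abbreviation f :: "int => 'a => complex" where
 "f k \<equiv> LP_piece \<Phi> k X"

text \<open>A single representative serves all k and x, because the test functions involved have
  vanishing moments.\<close>

lemma representative:
 obtains F where "F : tempered" "!!(k::int) x. f k x = F (%y. P k (x - y))"
proof -
 obtain F where F: "F : tempered" "X = mod_polynomials `` {F}"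
  using X unfolding tempered_mod_poly_def by (auto elim: quotientE)
 have "polynomial_function (%x::'a. 0 :: complex)" by simp
 then have "F : X" using F unfolding mod_polynomials_def by force
 then show ?thesis
  using F(1) pairing_eq[OF X _ P_schwartz0] by (intro that[of F]) (auto simp: LP_piece_def)
qed

lemma f_continuous: "continuous_on S (f k)"
proof -
 obtain F where F: "F : tempered" "!!(k::int) x. f k x = F (%y. P k (x - y))" by (rule representative) blast
 have ka: "(%z. P k (0 - z)) : schwartz" by (rule reflected_schwartz[OF PS])
 have "continuous_on S (%z. F (%x. P k (0 - (x - z))))" by (rule tempered_shift_continuous[OF F(1) ka])
 then show "continuous_on S (f k)" unfolding F(2)[abs_def] by (simp add: F(2))
qed

lemma f_measurable [measurable]: "f k : BM"
 by (rule borel_measurable_continuous_onI[OF f_continuous])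

text \<open>Associativity for a distribution and two Schwartz functions; this is where the limit of
  Riemann sums in \<open>tempered_sconv\<close> is used.\<close>

lemma sconv_f_P:
 assumes F: "F : tempered" "!!(k::int) x. f k x = F (%y. P k (x - y))"
 shows "sconv (f k) (P l) x = F (%z. PP l k (x - z))"
proof -
 let ?th = "%y. P l (x - y)" and ?ka = "%z. P k (0 - z)"
 have "F (sconv ?th ?ka) = (LL y. ?th y * F (%z. ?ka (z - y)))"
  by (rule tempered_sconv[OF F(1) reflected_schwartz[OF PS] reflected_schwartz[OF PS]])
 also have "... = sconv (f k) (P l) x" unfolding sconv_def F(2) by (simp add: mult.commute)
 also have "sconv ?th ?ka = (%z. PP l k (x - z))"
 proof
  fix z
  have "sconv ?th ?ka z = (LL y. P l (x - y) * P k (y - z))" by (simp add: sconv_def)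
  also have "... = (LL y. P l y * P k ((x - z) - y))"
   using int_reflect(1)[of "%y. P l y * P k ((x - z) - y)" x] by (simp add: algebra_simps)
  finally show "sconv ?th ?ka z = PP l k (x - z)" by (simp add: PP_def sconv_def)
 qed
 finally show ?thesis ..
qed

lemma sconv_f_P_commute: "sconv (f k) (P l) = sconv (f l) (P k)"
 and sconv_f_P_disjoint: "\<bar>l - k\<bar> \<ge> 2 ==> sconv (f k) (P l) x = 0"
 and f_eq_sum: "f k x = (\<Sum>l\<in>{k - 1, k, k + 1}. sconv (f k) (P l) x)"
proof -
 obtain F where F: "F : tempered" "!!(k::int) x. f k x = F (%y. P k (x - y))" by (rule representative) blast
 note c = sconv_f_P[OF F]
 show "sconv (f k) (P l) = sconv (f l) (P k)" by (intro ext) (simp add: c PP_commute[of l k])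
 show "sconv (f k) (P l) x = 0" if "\<bar>l - k\<bar> \<ge> 2"
  unfolding c PP_disjoint[OF that] by (rule tempered_zero[OF F(1)])
 have "f k x = F (%y. \<Sum>l\<in>{k - 1, k, k + 1}. PP l k (x - y))"
  unfolding F(2) fun_cong[OF PP_sum[of k], symmetric] ..
 also have "... = (\<Sum>l\<in>{k - 1, k, k + 1}. F (%y. PP l k (x - y)))"
  by (intro tempered_sum F(1) reflected_schwartz PPS)
 finally show "f k x = (\<Sum>l\<in>{k - 1, k, k + 1}. sconv (f k) (P l) x)" unfolding c .
qed

end

section \<open>Pointwise estimates\<close>

lemma nnconv_cmult:
 fixes h f :: "'a::euclidean_space => ennreal"
 assumes [measurable]: "h : LM" "f : LM"
 shows "nnconv (%x. c * h x) f x = c * nnconv h f x" "nnconv h (%x. c * f x) x = c * nnconv h f x"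
 unfolding nnconv_def by (subst nn_integral_cmult[symmetric]; simp add: mult_ac)+

lemma eta_neighbour:
 assumes N: "0 <= N" and l: "\<bar>l - k\<bar> <= 1"
 shows "eta N l (x :: 'a::euclidean_space) <= en (2 powr (real DIM('a) + N)) * eta N k x"
proof -
 let ?d = "real DIM('a)"
 have lk: "rint l <= rint k + 1" "rint k - 1 <= rint l" using l by linarith+
 have 1: "2 powr (rint l * ?d) <= 2 powr ?d * 2 powr (rint k * ?d)"
  using mult_right_mono[OF lk(1), of ?d] by (simp add: algebra_simps flip: powr_add)
 have "tp k <= 2 * tp l"
  using lk(2) powr_mono[of "rint k" "rint l + 1" 2] by (simp add: powr_add)
 then have "tp k * norm x <= 2 * (tp l * norm x)"
  using mult_right_mono[OF _ norm_ge_zero[of x]] by (simp add: mult.assoc[symmetric])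
 then have "(1 + tp k * norm x) / 2 <= 1 + tp l * norm x" by simp
 then have "(1 + tp l * norm x) powr (- N) <= ((1 + tp k * norm x) / 2) powr (- N)"
  using N by (intro powr_mono2') (auto intro: add_pos_nonneg)
 also have "... = 2 powr N * (1 + tp k * norm x) powr (- N)"
  by (subst powr_divide) (auto simp: powr_minus divide_inverse)
 finally have "2 powr (rint l * ?d) * (1 + tp l * norm x) powr (- N)
   <= (2 powr ?d * 2 powr (rint k * ?d)) * (2 powr N * (1 + tp k * norm x) powr (- N))"
  using 1 by (intro mult_mono) auto
 then show ?thesis
  unfolding eta_def by (subst ennreal_mult[symmetric]) (auto intro!: ennreal_leI simp: powr_add mult_ac)
qed

lemma norm_sconv_le: "en (norm (sconv th ka x)) <= nnconv (%x. en (norm (ka x))) (%x. en (norm (th x))) x"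
proof (cases "integ (%y. th y * ka (x - y))")
 case True
 from integral_norm_bound_ennreal[OF this] show ?thesis
  by (simp add: sconv_def nnconv_def norm_mult ennreal_mult mult.commute)
qed (simp add: sconv_def not_integrable_integral_eq)

text \<open>Peetre's argument: the weighted supremum \<open>S\<close> satisfies \<open>S <= c \<surd>S J\<close>, and it is finite since \<open>F\<close> is bounded.\<close>
lemma peetre_sqrt:
 fixes F :: "'a::euclidean_space => ennreal"
 assumes [measurable]: "F : BM" and N: "0 <= N"
  and bdd: "!!x. F x <= en b" and F: "!!z. F z <= en c * nnconv (eta (2 * N) k) F z"
 shows "epowr (F x) (1/2) <= en c * nnconv (eta N k) (%y. epowr (F y) (1/2)) x"
proof -
 define t where "t z = 1 + tp k * norm z" for z :: 'a
 have t: "1 <= t z" "0 < t z" for z by (auto simp: t_def intro: add_pos_nonneg)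
 have eta_t: "eta M k z = en (2 powr (rint k * real DIM('a)) * t z powr (- M))" for M z
  by (simp add: eta_def t_def)
 define w where "w z = en (t (x - z) powr (- (2 * N)))" for z
 define S where "S = (SUP z. F z * w z)"
 have F_half: "F y = epowr (F y) (1/2) * epowr (F y) (1/2)" for y by (simp flip: epowr_add)
 have "w z <= 1" for z
  unfolding w_def ennreal_le_1 using t(1)[of "x - z"] N powr_mono[of "- (2 * N)" 0 "t (x - z)"] t(2)[of "x - z"] by simp
 then have "F z * w z <= en b" for z using mult_mono[OF bdd, of "w z" 1 z] by simp
 then have "S <= en b" unfolding S_def by (intro SUP_least)
 then have Stop: "S < top" by (rule le_less_trans) simp
 have Fx: "F x <= S" unfolding S_def by (rule SUP_upper2[of x]) (auto simp: w_def t_def)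
 let ?J = "nnconv (eta N k) (%y. epowr (F y) (1/2)) x"
 have Fy: "epowr (F y) (1/2) <= epowr S (1/2) * en (t (x - y) powr N)" for y
 proof -
  have "w y * en (t (x - y) powr (2 * N)) = 1"
   unfolding w_def using t(2)[of "x - y"] by (subst ennreal_mult[symmetric]) (auto simp flip: powr_add)
  then have "F y = (F y * w y) * en (t (x - y) powr (2 * N))" by (simp add: mult.assoc)
  also have "... <= S * en (t (x - y) powr (2 * N))" unfolding S_def by (intro mult_right_mono SUP_upper) auto
  finally have "epowr (F y) (1/2) <= epowr (S * en (t (x - y) powr (2 * N))) (1/2)" by (intro epowr_mono) auto
  then show ?thesis using t(2)[of "x - y"] by (simp add: epowr_mult powr_powr)
 qed
 have main: "F z * w z <= en c * (epowr S (1/2) * ?J)" for z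
 proof -
  have pw: "eta (2 * N) k (z - y) * F y * w z <= epowr S (1/2) * (eta N k (x - y) * epowr (F y) (1/2))" for y
  proof -
   have "tp k * norm (x - y) <= tp k * norm (z - y) + tp k * norm (x - z)"
    unfolding distrib_left[symmetric] using norm_triangle_ineq[of "x - z" "z - y"] by (intro mult_left_mono) auto
   moreover have "0 <= (tp k * norm (z - y)) * (tp k * norm (x - z))" by simp
   ultimately have "t (x - y) <= t (z - y) * t (x - z)"
    unfolding t_def distrib_left distrib_right by linarith
   then have "t (x - y) powr (2 * N) <= t (z - y) powr (2 * N) * t (x - z) powr (2 * N)"
    using t N by (subst powr_mult[symmetric]) (auto intro!: powr_mono2 simp: less_imp_le)
   then have "t (z - y) powr (- (2 * N)) * t (x - z) powr (- (2 * N)) <= t (x - y) powr (- (2 * N))"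
    using t(2)[of "x - y"] t(2)[of "z - y"] t(2)[of "x - z"] by (simp add: powr_minus field_simps)
   then have "(t (z - y) powr (- (2 * N)) * t (x - z) powr (- (2 * N))) * t (x - y) powr N
     <= t (x - y) powr (- (2 * N)) * t (x - y) powr N" by (rule mult_right_mono) simp
   also have "... = t (x - y) powr (- N)" by (simp flip: powr_add)
   finally have "2 powr (rint k * real DIM('a)) * ((t (z - y) powr (- (2 * N)) * t (x - z) powr (- (2 * N))) * t (x - y) powr N)
     <= 2 powr (rint k * real DIM('a)) * t (x - y) powr (- N)" by (rule mult_left_mono) simp
   then have e: "eta (2 * N) k (z - y) * w z * en (t (x - y) powr N) <= eta N k (x - y)"
    unfolding eta_t w_def by (simp add: ennreal_mult[symmetric] ennreal_leI mult_ac)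
   have "eta (2 * N) k (z - y) * F y * w z = eta (2 * N) k (z - y) * w z * (epowr (F y) (1/2) * epowr (F y) (1/2))"
    by (simp add: mult_ac flip: F_half)
   also have "... <= eta (2 * N) k (z - y) * w z * ((epowr S (1/2) * en (t (x - y) powr N)) * epowr (F y) (1/2))"
    by (intro mult_left_mono mult_right_mono Fy) auto
   also have "... = (eta (2 * N) k (z - y) * w z * en (t (x - y) powr N)) * (epowr S (1/2) * epowr (F y) (1/2))"
    by (simp only: mult_ac)
   also have "... <= eta N k (x - y) * (epowr S (1/2) * epowr (F y) (1/2))" by (intro mult_right_mono e) auto
   finally show ?thesis by (simp only: mult_ac)
  qed
  have "F z * w z <= en c * nnconv (eta (2 * N) k) F z * w z" by (intro mult_right_mono F) auto
  also have "... = en c * (NN y. eta (2 * N) k (z - y) * F y * w z)"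
   unfolding nnconv_def by (subst nn_integral_multc) (auto simp: mult.assoc)
  also have "... <= en c * (NN y. epowr S (1/2) * (eta N k (x - y) * epowr (F y) (1/2)))"
   by (intro mult_left_mono nn_integral_mono pw) auto
  also have "... = en c * (epowr S (1/2) * ?J)" unfolding nnconv_def by (subst nn_integral_cmult) auto
  finally show ?thesis .
 qed
 have S_half: "S = epowr S (1/2) * epowr S (1/2)" by (simp flip: epowr_add)
 have "S <= en c * (epowr S (1/2) * ?J)" unfolding S_def[symmetric] by (subst S_def, rule SUP_least, rule main)
 then have *: "epowr S (1/2) * epowr S (1/2) <= epowr S (1/2) * (en c * ?J)"
  by (simp add: mult_ac flip: S_half)
 have "epowr S (1/2) <= en c * ?J"
 proof (cases "S = 0")
  case False
  then show ?thesis using * Stop by (subst (asm) ennreal_mult_le_mult_iff) auto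
 qed simp
 then show ?thesis using epowr_mono[OF _ Fx, of "1/2"] by (meson order_trans zero_le_divide_1_iff zero_le_numeral)
qed

section \<open>Convolution of bounded functions with integrable kernels\<close>

lemma sconv_bounded:
 fixes ka th :: "'a::euclidean_space => complex"
 assumes ka: "integ ka" and [measurable]: "th : BM" and b: "!!x. norm (th x) <= b"
 shows "integ (%y. ka y * th (x - y))" "norm (sconv ka th x) <= b * (LL y. norm (ka y))"
  and "sconv ka th : BM"
proof -
 have [measurable]: "ka : BM" using ka by (auto dest: borel_measurable_integrable)
 show int: "integ (%y. ka y * th (x - y))" by (rule integ_bounded[OF ka _ b]) measurable
 have "norm (sconv ka th x) <= (LL y. b * norm (ka y))"
  unfolding sconv_def
 proof (rule Bochner_Integration.integral_norm_bound_integral[OF int])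
  show "norm (ka y * th (x - y)) <= b * norm (ka y)" for y
   using mult_right_mono[OF b[of "x - y"], of "norm (ka y)"] by (simp add: norm_mult mult.commute)
 qed (use ka in auto)
 then show "norm (sconv ka th x) <= b * (LL y. norm (ka y))" by simp
 show "sconv ka th : BM" unfolding sconv_def[abs_def] by measurable
qed

lemma sconv_assoc:
 fixes ka ka' th :: "'a::euclidean_space => complex"
 assumes ka: "integ ka" "integ ka'" and [measurable]: "th : BM" and b: "!!x. norm (th x) <= b"
 shows "sconv (sconv ka ka') th = sconv ka (sconv ka' th)"
proof
 fix x
 have [measurable]: "ka' : BM" using ka by (auto dest: borel_measurable_integrable)
 have i: "(LL z. ka' (z - y) * th (x - z)) = sconv ka' th (x - y)" for y
  using int_shift(1)[of "%z. ka' z * th (x - y - z)" y] by (simp add: sconv_def algebra_simps)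
 have "sconv (sconv ka ka') th x = (LL y. ka y * (LL z. ka' (z - y) * th (x - z)))"
  unfolding sconv_def by (rule fubini_conv(1)[OF ka _ b]) measurable
 then show "sconv (sconv ka ka') th x = sconv ka (sconv ka' th) x" unfolding i by (simp add: sconv_def)
qed

lemma sconv_left_commute:
 fixes ka ka' th :: "'a::euclidean_space => complex"
 assumes ka: "integ ka" "integ ka'" and th: "th : BM" "!!x. norm (th x) <= b"
 shows "sconv ka (sconv ka' th) = sconv ka' (sconv ka th)"
 using sconv_assoc[OF ka th] sconv_assoc[OF ka(2,1) th] sconv_commute[of ka ka'] ka by (auto dest: borel_measurable_integrable)

lemma sconv_sum:
 fixes ka :: "'a::euclidean_space => complex"
 assumes ka: "integ ka" and "!!j. j : J ==> th j : BM & (EX b. ALL x. norm (th j x) <= b)"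
 shows "sconv ka (%x. \<Sum>j\<in>J. th j x) = (%x. \<Sum>j\<in>J. sconv ka (th j) x)"
proof
 fix x
 show "sconv ka (%x. \<Sum>j\<in>J. th j x) x = (\<Sum>j\<in>J. sconv ka (th j) x)"
  unfolding sconv_def sum_distrib_left
  by (rule Bochner_Integration.integral_sum) (use assms sconv_bounded(1) in fast)
qed

section \<open>Size of the Littlewood--Paley pieces\<close>

text \<open>One majorant at generation k for all the kernels that reproduce f_k, namely P_l with |l
  - k| <= 1.\<close>

lemma (in LP) P_le_eta:
 fixes N :: nat
 shows "EX c>0. ALL k l x. \<bar>l - k\<bar> <= 1 --> en (norm (P l x)) <= en c * eta (real N) k (x :: 'a)"
proof -
 obtain B where B: "0 < B" "!!x. (1 + norm x) ^ N * norm (pd [] \<Phi> x) <= B"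
  using schwartz_bound[OF \<Phi>S, of "[]"] by (auto simp del: partial_derivs.simps)
 have 1: "en (norm (P l x)) <= en B * eta (real N) l x" for l x
 proof -
  let ?t = "1 + tp l * norm x"
  have t: "0 < ?t" by (auto intro: add_pos_nonneg)
  have "?t ^ N * norm (\<Phi> ((tp l) *\<^sub>R x)) <= B" using B(2)[of "(tp l) *\<^sub>R x"] by simp
  then have "norm (\<Phi> ((tp l) *\<^sub>R x)) <= B * ?t powr (- real N)"
   using t by (simp add: powr_minus powr_realpow field_simps)
  then have "norm (P l x) <= 2 powr (rint l * real DIM('a)) * (B * ?t powr (- real N))"
   unfolding P_eq norm_mult by (simp add: mult_left_mono)
  then show ?thesis unfolding eta_def by (subst ennreal_mult[symmetric]) (use B in "auto intro!: ennreal_leI simp: mult_ac")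
 qed
 let ?c = "B * 2 powr (real DIM('a) + real N)"
 have "en (norm (P l x)) <= en ?c * eta (real N) k x" if "\<bar>l - k\<bar> <= 1" for k l x
 proof -
  have "en B * eta (real N) l x <= en B * (en (2 powr (real DIM('a) + real N)) * eta (real N) k x)"
   by (intro mult_left_mono eta_neighbour that) auto
  also have "... = en ?c * eta (real N) k x" using B by (simp add: ennreal_mult mult.assoc)
  finally show ?thesis using 1[of l x] by (rule order_trans[rotated])
 qed
 then show ?thesis using B by (intro exI[of _ ?c]) auto
qed

abbreviation nrm :: "('a => complex) => 'a => ennreal" where "nrm g \<equiv> %x. en (norm (g x))"

text \<open>Three neighbouring kernels reproduce f_k, hence the factor 3.\<close>

lemma (in LP_dist) f_le_eta:
 assumes c: "0 < c" "!!k l x. \<bar>l - k\<bar> <= 1 ==> ennreal (norm (P l x)) <= en c * eta N k (x :: 'a)"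
 shows "nrm (f k) x <= en (3 * c) * nnconv (eta N k) (nrm (f k)) x"
proof -
 let ?J = "{k - 1, k, k + 1}"
 have "norm (f k x) <= (\<Sum>l\<in>?J. norm (sconv (f k) (P l) x))" by (subst f_eq_sum) (rule norm_sum)
 then have "nrm (f k) x <= en (\<Sum>l\<in>?J. norm (sconv (f k) (P l) x))" by (rule ennreal_leI)
 also have "... = (\<Sum>l\<in>?J. nrm (sconv (f k) (P l)) x)" by (rule sum_ennreal[symmetric]) (rule norm_ge_zero)
 also have "... <= (\<Sum>l\<in>?J. en c * nnconv (eta N k) (nrm (f k)) x)"
 proof (rule sum_mono)
  fix l assume "l : ?J"
  then have l: "\<bar>l - k\<bar> <= 1" by auto
  have "nrm (sconv (f k) (P l)) x <= nnconv (nrm (P l)) (nrm (f k)) x" by (rule norm_sconv_le)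
  also have "... <= nnconv (%x. en c * eta N k x) (nrm (f k)) x" by (intro nnconv_mono c l) auto
  also have "... = en c * nnconv (eta N k) (nrm (f k)) x" by (rule nnconv_cmult) measurable
  finally show "nrm (sconv (f k) (P l)) x <= en c * nnconv (eta N k) (nrm (f k)) x" .
 qed
 also have "... = en (3 * c) * nnconv (eta N k) (nrm (f k)) x"
  using c by (simp add: ennreal_mult mult.assoc)
 finally show ?thesis .
qed

text \<open>A uniform bound for averages at scales 2^(-k) >= 1. It is a common consequence of the
  finite Triebel-Lizorkin norms considered here, and it is all that the construction of the image
  uses about the size of the pieces.\<close>

definition moderate :: "real => real => (int => 'a::euclidean_space => ennreal) => bool" where
 "moderate N B g \<longleftrightarrow> (ALL j. ALL k<=0. ALL x. nnconv (eta N k) (g j) x <= en B)"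

lemma moderate_Lp:
 fixes g :: "int => 'a::euclidean_space => ennreal"
 assumes N: "real DIM('a) < N" and p: "1 <= p" and [measurable]: "!!j. g j : BM"
  and M: "!!j. (NN x. epowr (g j x) p) <= M" "M < top"
 shows "\<exists>B\<ge>0. moderate N B g"
proof -
 obtain E where E: "0 < E" "!!k. (NN x. eta N k (x :: 'a)) <= en E" using nn_integral_eta_bound[OF N] by auto
 have M': "M = en (enn2real M)" using M(2) by simp
 have "nnconv (eta N k) (g j) x <= en (E + enn2real M)" if k: "k <= 0" for j k x
 proof -
  \<comment> \<open>For k <= 0 the kernel is at most 1, so values z <= 1 are absorbed by the
    integrable kernel and larger ones by z^p.\<close>
  have pw: "eta N k y * z <= eta N k y + epowr z p" for y :: 'a and z
  proof (cases "z <= 1")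
   case True
   then have "eta N k y * z <= eta N k y" using mult_left_mono[of z 1 "eta N k y"] by simp
   then show ?thesis by (rule order_trans) simp
  next
   case False
   have "2 powr (rint k * real DIM('a)) <= 1" using k powr_mono[of "rint k * real DIM('a)" 0 2] by (simp add: mult_nonpos_nonneg)
   moreover have "(1 + tp k * norm y) powr (- N) <= 1"
    using powr_mono[of "- N" 0 "1 + tp k * norm y"] N by (auto simp: add_nonneg_eq_0_iff)
   ultimately have "eta N k y <= 1" unfolding eta_def ennreal_le_1 by (intro mult_le_one) auto
   then have "eta N k y * z <= z" using mult_right_mono[of "eta N k y" 1 z] by simp
   also have "z <= epowr z p"
   proof (cases z)
    case (real r)
    then have "1 <= r" using False by simp
    then have "r powr 1 <= r powr p" by (intro powr_mono p)
    then show ?thesis using real \<open>1 <= r\<close> by (simp add: ennreal_leI)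
   qed simp
   finally show ?thesis by (rule order_trans) simp
  qed
  have "nnconv (eta N k) (g j) x <= (NN y. eta N k (x - y) + epowr (g j y) p)"
   unfolding nnconv_def by (intro nn_integral_mono pw)
  also have "... = (NN y. eta N k (x - y)) + (NN y. epowr (g j y) p)" by (rule nn_integral_add) measurable
  also have "... <= en E + M"
   by (intro add_mono M) (subst nn_reflect, auto intro: E)
  also have "... = en (E + enn2real M)" using E by (subst M') (simp add: ennreal_plus)
  finally show ?thesis .
 qed
 then show ?thesis using E unfolding moderate_def by (intro exI[of _ "E + enn2real M"]) auto
qed

lemma moderate_bounded:
 fixes g :: "int => 'a::euclidean_space => ennreal"
 assumes N: "real DIM('a) < N" and b: "0 <= b" "!!j x. g j x <= en b"
 shows "\<exists>B\<ge>0. moderate N B g"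
proof -
 obtain E where E: "0 < E" "!!k. (NN x. eta N k (x :: 'a)) <= en E" using nn_integral_eta_bound[OF N] by auto
 have "nnconv (eta N k) (g j) x <= en (E * b)" for j k x
 proof -
  have "nnconv (eta N k) (g j) x <= (NN y. eta N k (x - y) * en b)"
   unfolding nnconv_def by (intro nn_integral_mono mult_left_mono b) auto
  also have "... = (NN y. eta N k (x - y)) * en b" by (rule nn_integral_multc) measurable
  also have "... <= en E * en b"
   by (intro mult_right_mono) (subst nn_reflect, auto intro: E)
  finally show ?thesis using E b by (simp add: ennreal_mult)
 qed
 then show ?thesis using E b unfolding moderate_def by (intro exI[of _ "E * b"]) auto
qed

lemma (in LP_dist) f_bounded:
 assumes c: "0 < c" "!!k l x. \<bar>l - k\<bar> <= 1 ==> ennreal (norm (P l x)) <= en c * eta N k (x :: 'a)"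
  and N: "0 <= N" and B: "0 <= B" "moderate N B (%k. nrm (f k))"
 shows "EX b. ALL x. norm (f k x) <= b"
proof -
 \<comment> \<open>Averages are controlled for generations up to 0 only; a finer kernel is majorized
   by a coarser one at the cost of the ratio of their normalizations.\<close>
 define k0 where "k0 = min k 0"
 let ?D = "2 powr (rint (k - k0) * real DIM('a))"
 have k0: "k0 <= 0" "k0 <= k" by (auto simp: k0_def)
 have e: "eta N k y <= en ?D * eta N k0 y" for y :: 'a
 proof -
  have "(1 + tp k * norm y) powr (- N) <= (1 + tp k0 * norm y) powr (- N)"
   using N k0 by (intro powr_mono2') (auto intro!: mult_right_mono add_pos_nonneg)
  then have "2 powr (rint k * real DIM('a)) * (1 + tp k * norm y) powr (- N)
   <= ?D * 2 powr (rint k0 * real DIM('a)) * (1 + tp k0 * norm y) powr (- N)"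
   by (intro mult_mono) (auto simp: algebra_simps simp flip: powr_add)
  then show ?thesis unfolding eta_def by (subst ennreal_mult[symmetric]) (auto intro!: ennreal_leI simp: mult_ac)
 qed
 have "nrm (f k) x <= en (3 * c * (?D * B))" for x
 proof -
  have "nrm (f k) x <= en (3 * c) * nnconv (eta N k) (nrm (f k)) x" by (rule f_le_eta[OF c])
  also have "nnconv (eta N k) (nrm (f k)) x <= nnconv (%y. en ?D * eta N k0 y) (nrm (f k)) x" by (intro nnconv_mono e) auto
  also have "... = en ?D * nnconv (eta N k0) (nrm (f k)) x" by (rule nnconv_cmult) measurable
  also have "... <= en ?D * en B" using B k0 unfolding moderate_def by (intro mult_left_mono) auto
  finally show ?thesis using c B by (simp add: ennreal_mult mult_left_mono)
 qed
 then have "norm (f k x) <= 3 * c * (?D * B)" for x using c B by simp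
 then show ?thesis by (intro exI[of _ "3 * c * (?D * B)"] allI)
qed

text \<open>Order 2N goes into Peetre's argument and order N comes out. Boundedness of each piece
  makes the weighted supremum finite, but the bounds themselves do not enter the constant.\<close>

lemma (in LP_dist) f_sqrt_dominated:
 assumes c: "0 < c" "!!k l x. \<bar>l - k\<bar> <= 1 ==> ennreal (norm (P l x)) <= en c * eta (2 * N) k (x :: 'a)"
  and N: "0 <= N" and b: "!!k. EX b. ALL x. norm (f k x) <= b"
 shows "sqrt_dominated N (3 * c) (%k. nrm (f k))"
 unfolding sqrt_dominated_def
proof (intro conjI allI)
 fix k x
 obtain b where b: "!!x. norm (f k x) <= b" using b by blast
 show "epowr (nrm (f k) x) (1/2) <= en (3 * c) * nnconv (eta N k) (%y. epowr (nrm (f k) y) (1/2)) x"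
  by (rule peetre_sqrt[OF _ N, of _ b]) (auto intro: f_le_eta[OF c] ennreal_leI b)
qed measurable

section \<open>Existence of the image\<close>

lemma eta_antimono: "N <= M ==> eta M k x <= eta N k x"
 unfolding eta_def by (intro ennreal_leI mult_left_mono powr_mono) auto

lemma eta_0: "eta (real n) 0 x = en (inverse ((1 + norm x) ^ n))"
 using one_plus_norm_pos[of x 1] by (simp add: eta_def powr_minus powr_realpow)

lemma summable_int_geometric: "(%l::int. 2 powr (- rint \<bar>l\<bar>)) summable_on UNIV"
proof -
 have s: "(%n::nat. 2 powr (- real n)) summable_on UNIV"
  by (rule norm_summable_imp_summable_on) (simp add: powr_minus powr_realpow summable_geometric flip: power_inverse)
 have 1: "(%l::int. 2 powr (- rint \<bar>l\<bar>)) summable_on range int"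
  by (subst summable_on_reindex) (use s in "auto simp: comp_def")
 have 2: "(%l::int. 2 powr (- rint \<bar>l\<bar>)) summable_on range (%n. - int n)"
  by (subst summable_on_reindex) (use s in "auto simp: comp_def inj_on_def")
 have "l : range int \<union> range (%n. - int n)" for l :: int
  by (cases l rule: int_cases2) auto
 then have "UNIV = range int \<union> range (%n. - int n)" by blast
 then show ?thesis using summable_on_union[OF 1 2] by simp
qed

text \<open>The decay order 3n + 1 pays for 2n + 1 powers in the difference estimate of
  \<open>high_frequency\<close> and leaves order n > d for integrability. \<open>K_PP\<close> is the
  only link between the kernels of different k.\<close>

locale LP_mult = LP_dist \<Phi> X for \<Phi> :: "'a::euclidean_space => complex" and X +
 fixes K :: "int => 'a => complex" and A B c :: real and n :: nat
 assumes n: "DIM('a) < n"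
  and c: "0 < c" "!!k l x. \<bar>l - k\<bar> <= 1 ==> ennreal (norm (P l x)) <= en c * eta (real (3 * n + 1)) k (x :: 'a)"
  and K: "!!k. integ (K k)" and A: "0 <= A" "!!k. (NN x. nrm (K k) x) <= en A"
  and B: "0 <= B" "moderate (real n) B (%k. nrm (f k))"
  and K_PP: "!!l k. sconv (K l) (PP l k) = sconv (K k) (PP l k)"
begin

definition g :: "int => 'a => complex" where "g k = sconv (K k) (f k)"

lemma K_measurable [measurable]: "K k : BM"
 using K[of k] by (auto dest: borel_measurable_integrable)

lemma c': "\<bar>l - k\<bar> <= 1 ==> ennreal (norm (P l x)) <= en c * eta (real n) k (x :: 'a)"
 using c(2)[of l k x] eta_antimono[of "real n" "real (3 * n + 1)" k x] mult_left_mono[of "eta (real (3 * n + 1)) k x" "eta (real n) k x" "en c"]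
 by (auto intro: order_trans)

lemma f_bdd: "EX b. ALL x. norm (f k x) <= b"
 by (rule f_bounded[OF c(1) c' _ B]) auto

lemma bdd_sconv: "integ ka ==> h : BM & (EX b. ALL x. norm (h x) <= b)
  ==> sconv ka h : BM & (EX b. ALL x. norm (sconv ka h x) <= b)" for ka h :: "'a => complex"
 using sconv_bounded(2,3)[of ka h] by fast

lemma f_good: "f k : BM & (EX b. ALL x. norm (f k x) <= b)"
 using f_bdd by simp

lemma g_good: "g k : BM & (EX b. ALL x. norm (g k x) <= b)"
 unfolding g_def by (intro bdd_sconv K f_good)

lemma g_measurable [measurable]: "g k : BM"
 using g_good by simp

lemma left_commute:
 fixes ka ka' h :: "'a => complex"
 shows "integ ka ==> integ ka' ==> h : BM & (EX b. ALL x. norm (h x) <= b)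
  ==> sconv ka (sconv ka' h) = sconv ka' (sconv ka h)"
 using sconv_left_commute[of ka ka' h] by fast

lemma assoc:
 fixes ka ka' h :: "'a => complex"
 shows "integ ka ==> integ ka' ==> h : BM & (EX b. ALL x. norm (h x) <= b)
  ==> sconv (sconv ka ka') h = sconv ka (sconv ka' h)"
 using sconv_assoc[of ka ka' h] by fast

lemma f_expand: "f l = (%x. \<Sum>j\<in>{l - 1, l, l + 1}. sconv (P l) (f j) x)"
proof
 fix x
 have "sconv (f l) (P j) = sconv (P l) (f j)" for j
  using sconv_f_P_commute[of l j] sconv_commute[of "f j" "P l"] by simp
 then show "f l x = (\<Sum>j\<in>{l - 1, l, l + 1}. sconv (P l) (f j) x)" by (subst f_eq_sum) simp
qed

text \<open>Each piece of the image is exhibited as a sum of convolutions of P_l with bounded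
  functions, which makes the vanishing mean of P_l available.\<close>

lemma g_expand: "g l = (%x. \<Sum>j\<in>{l - 1, l, l + 1}. sconv (P l) (sconv (K l) (f j)) x)"
proof -
 have "g l = sconv (K l) (%x. \<Sum>j\<in>{l - 1, l, l + 1}. sconv (P l) (f j) x)"
  unfolding g_def using f_expand[of l] by simp
 also have "... = (%x. \<Sum>j\<in>{l - 1, l, l + 1}. sconv (K l) (sconv (P l) (f j)) x)"
  by (intro sconv_sum K bdd_sconv P_integrable f_good)
 finally show ?thesis unfolding left_commute[OF K P_integrable f_good] .
qed

text \<open>All convolutions with integrable kernels commute on bounded functions, so the product of
  P_k and P_l can be isolated; against it K_l may be exchanged for K_k.\<close>

lemma P_g: "sconv (P k) (g l) = sconv (K k) (sconv (P k) (f l))"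
proof -
 have PPI: "integ (PP a b)" for a b by (rule schwartz_L1(2)[OF PPS])
 have *: "sconv (P k) (sconv (K i) (sconv (P l) (f j))) = sconv (sconv (K i) (PP l k)) (f j)" for i j
 proof -
  have "sconv (P k) (sconv (K i) (sconv (P l) (f j))) = sconv (K i) (sconv (P k) (sconv (P l) (f j)))"
   by (intro left_commute P_integrable K bdd_sconv f_good)
  also have "sconv (P k) (sconv (P l) (f j)) = sconv (PP l k) (f j)"
   unfolding PP_commute[of l k] unfolding PP_def by (intro assoc[symmetric] P_integrable f_good)
  also have "sconv (K i) (sconv (PP l k) (f j)) = sconv (sconv (K i) (PP l k)) (f j)"
   by (intro assoc[symmetric] K PPI f_good)
  finally show ?thesis .
 qed
 let ?J = "{l - 1, l, l + 1}"
 have S: "sconv ka (%x. \<Sum>j\<in>?J. sconv ka' (sconv (P l) (f j)) x) = (%x. \<Sum>j\<in>?J. sconv ka (sconv ka' (sconv (P l) (f j))) x)"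
  if "integ ka" "integ ka'" for ka ka'
  using that by (intro sconv_sum bdd_sconv P_integrable f_good) auto
 have "sconv (P k) (g l) = (%x. \<Sum>j\<in>?J. sconv (P k) (sconv (K l) (sconv (P l) (f j))) x)"
  unfolding g_expand left_commute[OF P_integrable K f_good] by (rule S[OF P_integrable K])
 also have "... = (%x. \<Sum>j\<in>?J. sconv (P k) (sconv (K k) (sconv (P l) (f j))) x)"
  unfolding * K_PP ..
 also have "... = sconv (P k) (%x. \<Sum>j\<in>?J. sconv (K k) (sconv (P l) (f j)) x)" by (rule S[OF P_integrable K, symmetric])
 also have "(%x. \<Sum>j\<in>?J. sconv (K k) (sconv (P l) (f j)) x) = sconv (K k) (%x. \<Sum>j\<in>?J. sconv (P l) (f j) x)"
  by (intro sconv_sum[symmetric] K bdd_sconv P_integrable f_good)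
 also have "... = sconv (K k) (f l)" using f_expand[of l] by simp
 finally show ?thesis unfolding left_commute[OF P_integrable K f_good] .
qed

text \<open>Convolution with an integrable kernel commutes with averaging at unit scale, so the
  bound on averages of f_j is inherited with the L^1 norm of K_k.\<close>

lemma amalgam: "nnconv (eta (real n) 0) (nrm (sconv (K k) (f j))) x <= en (A * B)"
proof -
 have "nnconv (eta (real n) 0) (nrm (sconv (K k) (f j))) x <= nnconv (eta (real n) 0) (nnconv (nrm (f j)) (nrm (K k))) x"
  by (intro nnconv_mono norm_sconv_le) auto
 also have "nnconv (nrm (f j)) (nrm (K k)) = nnconv (nrm (K k)) (nrm (f j))" by (intro ext nnconv_commute) measurable
 also have "nnconv (eta (real n) 0) (nnconv (nrm (K k)) (nrm (f j))) x = nnconv (nnconv (eta (real n) 0) (nrm (K k))) (nrm (f j)) x"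
  by (rule nnconv_assoc) measurable
 also have "nnconv (eta (real n) 0) (nrm (K k)) = nnconv (nrm (K k)) (eta (real n) 0)" by (intro ext nnconv_commute) measurable
 also have "nnconv (nnconv (nrm (K k)) (eta (real n) 0)) (nrm (f j)) x = nnconv (nrm (K k)) (nnconv (eta (real n) 0) (nrm (f j))) x"
  by (rule nnconv_assoc[symmetric]) measurable
 also have "... <= nnconv (nrm (K k)) (%_. en B) x"
  using B unfolding moderate_def by (intro nnconv_mono) auto
 also have "... = (NN y. nrm (K k) (x - y)) * en B" unfolding nnconv_def by (rule nn_integral_multc) measurable
 also have "(NN y. nrm (K k) (x - y)) = (NN y. nrm (K k) y)" by (rule nn_reflect) measurable
 also have "... * en B <= en A * en B" by (intro mult_right_mono A) auto
 finally show ?thesis using A B by (simp add: ennreal_mult)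
qed

lemma ft_P_0: "ft (P l) 0 = 0"
proof (rule ccontr)
 assume "ft (P l) 0 ~= 0"
 from ft_P_support(1)[OF this] have "2 powr (rint l - 1) < (0::real)" by simp
 then show False by (simp add: not_less[symmetric])
qed

text \<open>P_l is transposed onto the test function. Its integral vanishes, so only increments of
  \<open>ps\<close> over distances of about 2^(-l) count; they gain 2^(-l) and decay fast enough at
  infinity to be paired with unit-scale averages of \<open>h\<close>.\<close>

lemma high_frequency:
 assumes E: "0 < E" "!!k. (NN x. eta (real n) k (x :: 'a)) <= en E"
  and l: "0 <= l" and ps: "ps : schwartz" and h: "h : BM" "EX b. ALL x. norm (h x) <= b"
  and M: "0 <= M" "nnconv (eta (real n) 0) (nrm h) 0 <= en M"
 shows "norm (LL x. sconv (P l) h x * ps x) <= real DIM('a) * schwartz_seminorm (2 * n + 1) ps * c * tm l * E * M"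
proof -
 note [measurable] = h(1) schwartz_meas[OF ps]
 obtain b where b: "!!x. norm (h x) <= b" using h by blast
 define S where "S = real DIM('a) * schwartz_seminorm (2 * n + 1) ps"
 have S: "0 <= S" unfolding S_def by (intro mult_nonneg_nonneg schwartz_seminorm_nonneg ps) auto
 note psI = schwartz_L1(2)[OF ps]
 define rh where "rh x = (LL y. ps y * P l (y - x))" for x
 have PI: "integ (%w. P l (- w))"
  using int_reflect(2)[of "P l" 0] P_integrable by simp
 have "(LL x. rh x * h x) = (LL y. ps y * (LL x. P l (y - x) * h x))"
  using fubini_conv(1)[OF psI PI h(1) b] by (simp add: rh_def)
 also have "... = (LL x. sconv (P l) h x * ps x)"
  unfolding sconv_commute[of "P l" h, OF P_measurable h(1)] by (simp add: sconv_def mult.commute)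
 finally have eq: "(LL x. sconv (P l) h x * ps x) = (LL x. rh x * h x)" ..
 have rh_le: "nrm rh x <= en (S * c * tm l * E) * eta (real n) 0 (0 - x)" for x
 proof -
  have i1: "integ (%w. ps (w + x) * P l w)"
   using integ_bounded[OF P_integrable, of "%w. ps (w + x)"] schwartz_bounded[OF ps, of "[]"] by (auto simp: mult.commute)
  have i2: "integ (%w. ps x * P l w)" by (intro integrable_mult_right P_integrable)
  have "rh x = (LL w. ps (w + x) * P l w)"
   using int_shift(1)[of "%w. ps (w + x) * P l w" x] by (simp add: rh_def)
  \<comment> \<open>The subtracted integral is 0 because P_l has mean zero.\<close>
  also have "... = (LL w. ps (w + x) * P l w) - (LL w. ps x * P l w)"
   using ft_P_0[of l] by (simp add: ft_def)
  also have "... = (LL w. (ps (w + x) - ps x) * P l w)"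
   unfolding left_diff_distrib by (rule Bochner_Integration.integral_diff[OF i1 i2, symmetric])
  finally have rheq: "rh x = ..." .
  have i3: "integ (%w. (ps (w + x) - ps x) * P l w)"
   unfolding left_diff_distrib by (rule Bochner_Integration.integrable_diff[OF i1 i2])
  let ?q = "inverse ((1 + norm x) ^ n)"
  have q: "0 <= ?q" using one_plus_norm_pos[of x n] by simp
  have pw: "nrm (%w. (ps (w + x) - ps x) * P l w) w <= en (S * ?q * c * tm l) * eta (real n) l w" for w
  proof -
   let ?t = "1 + tp l * norm w"
   have t: "1 <= ?t" by simp
   have lw: "1 <= tp l" using l by (simp add: ge_one_powr_ge_zero)
   have "(1 + norm x) ^ (2 * n) * norm (ps (w + x) - ps x) <= S * norm w * (1 + norm w) ^ (2 * n)"
    using schwartz_diff_le[OF ps, of "[]" "2 * n" x "w + x"] by (simp add: S_def)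
   \<comment> \<open>Half of the weight is given away here: the seminorm of order 2n + 1 is dictated
     by the low frequencies.\<close>
   moreover have "(1 + norm x) ^ n * norm (ps (w + x) - ps x) <= (1 + norm x) ^ (2 * n) * norm (ps (w + x) - ps x)"
    by (intro mult_right_mono power_increasing) auto
   ultimately have "(1 + norm x) ^ n * norm (ps (w + x) - ps x) <= S * norm w * (1 + norm w) ^ (2 * n)" by linarith
   then have 1: "norm (ps (w + x) - ps x) <= ?q * (S * norm w * (1 + norm w) ^ (2 * n))"
    using one_plus_norm_pos[of x n] by (simp add: field_simps)
   have "norm w <= tm l * ?t" by (simp add: powr_minus field_simps)
   moreover have "1 + norm w <= ?t" using mult_right_mono[OF lw, of "norm w"] by simp
   ultimately have "norm w * (1 + norm w) ^ (2 * n) <= (tm l * ?t) * ?t ^ (2 * n)"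
    by (intro mult_mono power_mono) auto
   then have "norm (ps (w + x) - ps x) <= ?q * (S * ((tm l * ?t) * ?t ^ (2 * n)))"
    using 1 S q mult_left_mono[of "norm w * (1 + norm w) ^ (2 * n)" _ "?q * S"] by (fastforce simp: mult.assoc)
   also have "... = S * ?q * tm l * ?t ^ (2 * n + 1)" by (simp add: mult_ac)
   finally have 2: "norm (ps (w + x) - ps x) <= S * ?q * tm l * ?t ^ (2 * n + 1)" .
   have "en (?t ^ (2 * n + 1)) * eta (real (3 * n + 1)) l w = eta (real n) l w"
   proof -
    have "?t ^ (2 * n + 1) * ?t powr (- real (3 * n + 1)) = ?t powr (real (2 * n + 1) + - real (3 * n + 1))"
     unfolding powr_add by (subst powr_realpow) (auto intro: add_pos_nonneg)
    then have "?t ^ (2 * n + 1) * ?t powr (- real (3 * n + 1)) = ?t powr (- real n)" by simp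
    then show ?thesis unfolding eta_def using t by (subst ennreal_mult[symmetric]) (auto simp: mult.left_commute)
   qed
   then have 3: "en (?t ^ (2 * n + 1)) * (en c * eta (real (3 * n + 1)) l w) = en c * eta (real n) l w"
    by (metis mult.left_commute)
   have "nrm (%w. (ps (w + x) - ps x) * P l w) w = nrm (%w. ps (w + x) - ps x) w * nrm (P l) w" by (simp add: norm_mult ennreal_mult)
   also have "... <= en (S * ?q * tm l * ?t ^ (2 * n + 1)) * (en c * eta (real (3 * n + 1)) l w)"
    by (intro mult_mono ennreal_leI 2 c) auto
   also have "... = en (S * ?q * tm l) * (en c * eta (real n) l w)"
    using S q t 3 by (simp add: ennreal_mult mult.assoc)
   also have "... = en (S * ?q * c * tm l) * eta (real n) l w"
    using S q c(1) by (simp add: ennreal_mult mult_ac)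
   finally show ?thesis .
  qed
  have "nrm rh x <= (NN w. nrm (%w. (ps (w + x) - ps x) * P l w) w)"
   unfolding rheq by (rule integral_norm_bound_ennreal[OF i3])
  also have "... <= (NN w. en (S * ?q * c * tm l) * eta (real n) l (w::'a))"
   by (intro nn_integral_mono pw)
  also have "... = en (S * ?q * c * tm l) * (NN w. eta (real n) l (w::'a))"
   by (rule nn_integral_cmult) measurable
  also have "... <= en (S * ?q * c * tm l) * en E" by (intro mult_left_mono E) auto
  also have "... = en (S * c * tm l * E) * en ?q"
   using S q c(1) E by (subst (1 2) ennreal_mult[symmetric]) (auto simp: mult_ac)
  finally show ?thesis by (simp add: eta_0)
 qed
 have "en (norm (LL x. rh x * h x)) <= (NN x. nrm (%x. rh x * h x) x)"
  by (cases "integ (%x. rh x * h x)") (auto intro: integral_norm_bound_ennreal simp: not_integrable_integral_eq)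
 also have "... <= (NN x. en (S * c * tm l * E) * (eta (real n) 0 (0 - x) * nrm h x))"
  by (intro nn_integral_mono) (simp only: norm_mult ennreal_mult[OF norm_ge_zero norm_ge_zero] mult.assoc[symmetric], intro mult_right_mono rh_le, simp)
 also have "... = en (S * c * tm l * E) * nnconv (eta (real n) 0) (nrm h) 0"
  unfolding nnconv_def by (rule nn_integral_cmult) measurable
 also have "... <= en (S * c * tm l * E) * en M" by (intro mult_left_mono M) auto
 also have "... = en (S * c * tm l * E * M)" using S c(1) E M by (simp add: ennreal_mult)
 finally show ?thesis unfolding eq using S c(1) E M by (simp add: S_def)
qed

text \<open>For l <= 0 the kernel P_l varies on the scale 2^(-l) >= 1, so increments gain 2^l. The
  increments are put on P_l, and averages of the f_j around the base point control the rest.\<close>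

lemma f_lipschitz:
 assumes l: "l <= 0"
 shows "norm (f l a - f l b) <= 3 * (real DIM('a) * schwartz_seminorm (n + 1) \<Phi> * B) * tp l * norm (a - b) * (1 + norm (a - b)) ^ n"
proof -
 define L where "L = real DIM('a) * schwartz_seminorm (n + 1) \<Phi>"
 have L: "0 <= L" unfolding L_def by (intro mult_nonneg_nonneg schwartz_seminorm_nonneg \<Phi>S) auto
 let ?l = "tp l"
 have l1: "?l <= 1" using l powr_mono[of "rint l" 0 2] by simp
 define r where "r = L * ?l * norm (a - b) * (1 + norm (a - b)) ^ n"
 have r: "0 <= r" unfolding r_def using L by auto
 have P: "nrm (%y. P l (a - y) - P l (b - y)) y <= en r * eta (real n) l (b - y)" for y
 proof -
  let ?t = "1 + ?l * norm (b - y)"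
  have t: "0 < ?t" by (auto intro: add_pos_nonneg)
  have "?t ^ n * norm (\<Phi> (?l *\<^sub>R (a - y)) - \<Phi> (?l *\<^sub>R (b - y)))
    <= L * norm (?l *\<^sub>R (a - b)) * (1 + norm (?l *\<^sub>R (a - b))) ^ n"
   using schwartz_diff_le[OF \<Phi>S, of "[]" n "?l *\<^sub>R (b - y)" "?l *\<^sub>R (a - y)"]
   by (simp add: L_def flip: scaleR_diff_right)
  also have "... <= L * (?l * norm (a - b)) * (1 + norm (a - b)) ^ n"
   using L l1 by (intro mult_mono power_mono) (auto intro: mult_left_le_one_le)
  also have "... = r" by (simp add: r_def)
  finally have "norm (\<Phi> (?l *\<^sub>R (a - y)) - \<Phi> (?l *\<^sub>R (b - y))) <= r * ?t powr (- real n)"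
   using t by (simp add: powr_minus powr_realpow field_simps)
  then have "norm (P l (a - y) - P l (b - y)) <= 2 powr (rint l * real DIM('a)) * (r * ?t powr (- real n))"
   unfolding P_eq right_diff_distrib[symmetric] norm_mult by (simp add: mult_left_mono)
  then show ?thesis unfolding eta_def using r by (subst ennreal_mult[symmetric]) (auto intro!: ennreal_leI simp: mult_ac)
 qed
 have 1: "norm (sconv (f j) (P l) a - sconv (f j) (P l) b) <= r * B" for j
 proof -
  obtain b0 where b0: "!!x. norm (f j x) <= b0" using f_bdd by blast
  have i: "integ (%y. f j y * P l (z - y))" for z
  proof -
   have "integ (%y. P l (z - y))" using int_reflect(2)[of "P l" z] P_integrable by simp
   from integ_bounded[OF this f_measurable b0] show ?thesis by (simp add: mult.commute)
  qed
  have "sconv (f j) (P l) a - sconv (f j) (P l) b = (LL y. f j y * (P l (a - y) - P l (b - y)))"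
   unfolding sconv_def right_diff_distrib by (rule Bochner_Integration.integral_diff[OF i i, symmetric])
  also have "en (norm ...) <= (NN y. nrm (%y. f j y * (P l (a - y) - P l (b - y))) y)"
   unfolding right_diff_distrib by (intro integral_norm_bound_ennreal Bochner_Integration.integrable_diff i)
  also have "... <= (NN y. en r * (eta (real n) l (b - y) * nrm (f j) y))"
   by (intro nn_integral_mono) (simp only: norm_mult ennreal_mult[OF norm_ge_zero norm_ge_zero] mult.assoc[symmetric],
    subst mult.commute, intro mult_right_mono P, simp)
  also have "... = en r * nnconv (eta (real n) l) (nrm (f j)) b"
   unfolding nnconv_def by (rule nn_integral_cmult) measurable
  also have "... <= en r * en B" using B l unfolding moderate_def by (intro mult_left_mono) auto
  finally show ?thesis using r B by (simp add: ennreal_mult[symmetric])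
 qed
 \<comment> \<open>The symmetry between f_l convolved with P_j and f_j convolved with P_l keeps the
   kernel at index l in all three terms.\<close>
 have "f l a - f l b = (\<Sum>j\<in>{l - 1, l, l + 1}. sconv (f j) (P l) a - sconv (f j) (P l) b)"
  unfolding sum_subtractf by (subst (1 2) f_eq_sum) (simp only: sconv_f_P_commute[of l])
 also have "norm ... <= (\<Sum>j\<in>{l - 1, l, l + 1}. r * B)" by (intro sum_norm_le 1)
 also have "... = 3 * (r * B)" by simp
 finally show ?thesis by (simp add: r_def L_def mult_ac)
qed

lemma norm_K: "(LL y. norm (K k y)) <= A"
proof -
 have "en (LL y. norm (K k y)) = (NN y. nrm (K k) y)"
  by (rule nn_integral_eq_integral[symmetric]) (use K in auto)
 then have "en (LL y. norm (K k y)) <= en A" using A(2)[of k] by simp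
 then show ?thesis using A by simp
qed

text \<open>Increments of f_l are inherited by the convolution with K_l, at the cost of the L^1 norm
  of the kernel. The growth |x| (1 + |x|)^n uses n + 1 powers of decay of \<open>ps\<close> and
  integrability uses n more, hence the seminorm of order 2n + 1.\<close>

lemma low_frequency:
 assumes E: "0 < E" "!!k. (NN x. eta (real n) k (x :: 'a)) <= en E"
  and l: "l <= 0" and ps: "ps : schwartz"
 shows "norm (LL x. (g l x - g l 0) * ps x)
   <= 3 * (real DIM('a) * schwartz_seminorm (n + 1) \<Phi> * B) * A * tp l * schwartz_seminorm (2 * n + 1) ps * E"
proof -
 define L where "L = 3 * (real DIM('a) * schwartz_seminorm (n + 1) \<Phi> * B)"
 have L: "0 <= L" unfolding L_def using B schwartz_seminorm_nonneg[OF \<Phi>S] by auto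
 define S where "S = schwartz_seminorm (2 * n + 1) ps"
 have S: "0 <= S" unfolding S_def by (rule schwartz_seminorm_nonneg[OF ps])
 note [measurable] = schwartz_meas[OF ps]
 obtain b where b: "!!x. norm (f l x) <= b" using f_bdd by blast
 have 1: "norm (g l x - g l 0) <= L * A * tp l * norm x * (1 + norm x) ^ n" for x
 proof -
  let ?R = "L * tp l * norm x * (1 + norm x) ^ n"
  note i = sconv_bounded(1)[OF K f_measurable b]
  have "g l x - g l 0 = (LL y. K l y * (f l (x - y) - f l (0 - y)))"
   unfolding g_def sconv_def right_diff_distrib by (rule Bochner_Integration.integral_diff[OF i i, symmetric])
  also have "norm ... <= (LL y. ?R * norm (K l y))"
  proof (rule Bochner_Integration.integral_norm_bound_integral)
   show "integ (%y. K l y * (f l (x - y) - f l (0 - y)))"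
    unfolding right_diff_distrib by (intro Bochner_Integration.integrable_diff i)
   show "integ (%y. ?R * norm (K l y))" using K by auto
   fix y
   have "norm (f l (x - y) - f l (0 - y)) <= ?R"
    using f_lipschitz[OF l, of "x - y" "0 - y"] by (simp add: L_def)
   from mult_left_mono[OF this norm_ge_zero[of "K l y"]]
   show "norm (K l y * (f l (x - y) - f l (0 - y))) <= ?R * norm (K l y)"
    unfolding norm_mult mult.commute[of ?R "norm (K l y)"] .
  qed
  also have "... = ?R * (LL y. norm (K l y))" by (rule integral_mult_right_zero)
  also have "... <= ?R * A" using L by (intro mult_left_mono norm_K) auto
  finally show ?thesis by (simp add: mult_ac)
 qed
 have 2: "nrm (%x. (g l x - g l 0) * ps x) x <= en (L * A * tp l * S) * eta (real n) 0 x" for x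
 proof -
  have p: "0 < (1 + norm x) ^ n" by (rule one_plus_norm_pos)
  have "(1 + norm x) ^ (n + (n + 1)) * norm (ps x) <= S"
   unfolding S_def using schwartz_seminorm_ge[OF ps, of "[]" "2 * n + 1" x] by (simp add: mult_2)
  then have "(1 + norm x) ^ n * ((1 + norm x) ^ (n + 1) * norm (ps x)) <= S"
   by (simp only: power_add[of _ n "n + 1"] mult.assoc)
  then have 3: "(1 + norm x) ^ (n + 1) * norm (ps x) <= S * inverse ((1 + norm x) ^ n)"
   using p by (simp add: field_simps)
  have "norm ((g l x - g l 0) * ps x) <= L * A * tp l * norm x * (1 + norm x) ^ n * norm (ps x)"
   unfolding norm_mult by (intro mult_right_mono 1) auto
  also have "... <= L * A * tp l * (1 + norm x) * (1 + norm x) ^ n * norm (ps x)"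
   using L A by (intro mult_right_mono mult_left_mono) auto
  also have "... = L * A * tp l * ((1 + norm x) ^ (n + 1) * norm (ps x))" by (simp add: mult_ac)
  also have "... <= L * A * tp l * (S * inverse ((1 + norm x) ^ n))" using L A by (intro mult_left_mono 3) auto
  finally have "norm ((g l x - g l 0) * ps x) <= (L * A * tp l * S) * inverse ((1 + norm x) ^ n)" by (simp add: mult_ac)
  then show ?thesis unfolding eta_0 using p L A S by (subst ennreal_mult[symmetric]) (auto intro!: ennreal_leI)
 qed
 have "en (norm (LL x. (g l x - g l 0) * ps x)) <= (NN x. nrm (%x. (g l x - g l 0) * ps x) x)"
  by (cases "integ (%x. (g l x - g l 0) * ps x)") (auto intro: integral_norm_bound_ennreal simp: not_integrable_integral_eq)
 also have "... <= (NN x. en (L * A * tp l * S) * eta (real n) 0 (x::'a))" by (intro nn_integral_mono 2)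
 also have "... = en (L * A * tp l * S) * (NN x. eta (real n) 0 (x::'a))" by (rule nn_integral_cmult) measurable
 also have "... <= en (L * A * tp l * S) * en E" by (intro mult_left_mono E) auto
 also have "... = en (L * A * tp l * S * E)" using L A S E by (simp add: ennreal_mult)
 finally show ?thesis using L A S E by (simp add: L_def S_def)
qed

text \<open>Subtracting the constants \<open>e l\<close> makes the sum of the low frequency pieces converge; test functions
 in "schwartz0" do not see them.\<close>
definition e :: "int => complex" where "e l = (if l <= 0 then g l 0 else 0)"
definition a :: "int => ('a => complex) => complex" where "a l ps = (LL x. (g l x - e l) * ps x)"

lemma a_integrable:
 assumes "ps : schwartz"
 shows "integ (%x. g l x * ps x)" "integ (%x. (g l x - e l) * ps x)"
proof -
 obtain b where b: "!!x. norm (g l x) <= b" using g_good by blast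
 note ps = schwartz_L1(2)[OF assms]
 show 1: "integ (%x. g l x * ps x)"
  using integ_bounded[OF ps g_measurable b] by (simp add: mult.commute)
 show "integ (%x. (g l x - e l) * ps x)"
  unfolding left_diff_distrib by (intro Bochner_Integration.integrable_diff 1 integrable_mult_right ps)
qed

lemma a_bound: "\<exists>D\<ge>0. ALL l. \<forall>ps\<in>schwartz. norm (a l ps) <= D * 2 powr (- rint \<bar>l\<bar>) * schwartz_seminorm (2 * n + 1) ps"
proof -
 have "real DIM('a) < real n" using n by simp
 from nn_integral_eta_bound[OF this] obtain E where E: "0 < E" "!!k. (NN x. eta (real n) k (x :: 'a)) <= en E" by auto
 define D1 where "D1 = 3 * (real DIM('a) * schwartz_seminorm (n + 1) \<Phi> * B) * A * E"
 define D2 where "D2 = 3 * (real DIM('a) * c * E * (A * B))"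
 have D: "0 <= D1" "0 <= D2"
  unfolding D1_def D2_def using A B E c(1) schwartz_seminorm_nonneg[OF \<Phi>S] by auto
 have "norm (a l ps) <= (D1 + D2) * 2 powr (- rint \<bar>l\<bar>) * schwartz_seminorm (2 * n + 1) ps" if ps: "ps : schwartz" for l ps
 proof -
  let ?S = "schwartz_seminorm (2 * n + 1) ps"
  let ?w = "2 powr (- rint \<bar>l\<bar>)"
  have S: "0 <= ?S" by (rule schwartz_seminorm_nonneg[OF ps])
  have "norm (a l ps) <= D1 * (?w * ?S) \<or> norm (a l ps) <= D2 * (?w * ?S)"
  proof (cases "l <= 0")
   case True
   have "norm (a l ps) <= D1 * (?w * ?S)"
    using low_frequency[OF E True ps] True by (simp add: a_def e_def D1_def mult_ac)
   then show ?thesis ..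
  next
   case False
   let ?J = "{l - 1, l, l + 1}"
   let ?h = "%j. sconv (K l) (f j)"
   have hg: "?h j : BM & (EX b. ALL x. norm (?h j x) <= b)" for j by (intro bdd_sconv K f_good)
   have i: "integ (%x. sconv (P l) (?h j) x * ps x)" for j
   proof -
    have "sconv (P l) (?h j) : BM & (EX b. ALL x. norm (sconv (P l) (?h j) x) <= b)"
     by (intro bdd_sconv hg P_integrable)
    then obtain b where b: "sconv (P l) (?h j) : BM" "!!x. norm (sconv (P l) (?h j) x) <= b" by auto
    show ?thesis using integ_bounded[OF schwartz_L1(2)[OF ps] b] by (simp add: mult.commute)
   qed
   have "a l ps = (LL x. (\<Sum>j\<in>?J. sconv (P l) (?h j) x * ps x))"
    unfolding a_def sum_distrib_right[symmetric] using False by (simp add: e_def fun_cong[OF g_expand])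
   also have "... = (\<Sum>j\<in>?J. LL x. sconv (P l) (?h j) x * ps x)"
    by (rule Bochner_Integration.integral_sum) (rule i)
   also have "norm ... <= (\<Sum>j\<in>?J. real DIM('a) * ?S * c * tm l * E * (A * B))"
    by (rule sum_norm_le, rule high_frequency[OF E _ ps]) (use False hg amalgam A B in auto)
   also have "... = D2 * (?w * ?S)" using False by (simp add: D2_def mult_ac)
   finally show ?thesis ..
  qed
  moreover have "0 <= D1 * (?w * ?S)" "0 <= D2 * (?w * ?S)" using D S by auto
  ultimately have "norm (a l ps) <= D1 * (?w * ?S) + D2 * (?w * ?S)" by linarith
  then show ?thesis by (simp add: distrib_right mult.assoc)
 qed
 then show ?thesis using D by (intro exI[of _ "D1 + D2"]) auto
qed

text \<open>Summed absolutely against every Schwartz function, the corrected pieces define a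
  tempered distribution. Its own pieces are found by testing with reflected P_k, which annihilate
  the constants and leave at most three indices l.\<close>

theorem image_exists:
 "\<exists>Y\<in>tempered_mod_poly. (ALL k. LP_piece \<Phi> k Y = g k) &
   (\<forall>ps\<in>schwartz0. (ALL k. integ (%x. g k x * ps x)) &
    ((%k. LL x. g k x * ps x) has_sum pairing Y ps) UNIV)"
proof -
 obtain D where D: "0 <= D" "!!l ps. ps : schwartz ==> norm (a l ps) <= D * 2 powr (- rint \<bar>l\<bar>) * schwartz_seminorm (2 * n + 1) ps"
  using a_bound by blast
 define F where "F ps = infsum (%l. a l ps) UNIV" for ps
 have sw: "(%l::int. D * 2 powr (- rint \<bar>l\<bar>) * s) summable_on UNIV" for s
  by (intro summable_on_cmult_left summable_on_cmult_right summable_int_geometric)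
 have abs: "(%l. norm (a l ps)) summable_on UNIV" if "ps : schwartz" for ps
  by (rule summable_on_comparison_test[OF sw]) (use D(2)[OF that] in auto)
 have sum: "(%l. a l ps) summable_on UNIV" if "ps : schwartz" for ps
  by (rule abs_summable_summable[OF abs[OF that]])
 have FT: "F : tempered"
  unfolding tempered_def mem_Collect_eq
 proof (intro conjI ballI allI)
  fix ps et :: "'a => complex" assume ps: "ps : schwartz" and et: "et : schwartz"
  have "a l (%x. ps x + et x) = a l ps + a l et" for l
   unfolding a_def distrib_left by (intro Bochner_Integration.integral_add a_integrable ps et)
  then show "F (%x. ps x + et x) = F ps + F et" unfolding F_def by (simp add: infsum_add sum ps et)
 next
  fix b and ps :: "'a => complex" assume ps: "ps : schwartz"
  have "a l (%x. b * ps x) = b * a l ps" for l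
   unfolding a_def mult.left_commute[of _ b] by (rule integral_mult_right_zero)
  then show "F (%x. b * ps x) = b * F ps" unfolding F_def by (simp add: infsum_cmult_right')
 next
  let ?W = "infsum (%l::int. 2 powr (- rint \<bar>l\<bar>)) UNIV"
  have "norm (F ps) <= D * ?W * schwartz_seminorm (2 * n + 1) ps" if ps: "ps : schwartz" for ps
  proof -
   have "norm (F ps) <= infsum (%l. norm (a l ps)) UNIV" unfolding F_def by (rule norm_infsum_bound[OF abs[OF ps]])
   also have "... <= infsum (%l::int. D * 2 powr (- rint \<bar>l\<bar>) * schwartz_seminorm (2 * n + 1) ps) UNIV"
    by (rule infsum_mono[OF abs[OF ps] sw]) (rule D(2)[OF ps])
   also have "... = D * ?W * schwartz_seminorm (2 * n + 1) ps" by (simp add: infsum_cmult_left' infsum_cmult_right')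
   finally show ?thesis .
  qed
  then show "EX C N. \<forall>ps\<in>schwartz. norm (F ps) <= C * schwartz_seminorm N ps" by blast
 qed
 define Y where "Y = mod_polynomials `` {F}"
 have Y: "Y : tempered_mod_poly" unfolding Y_def tempered_mod_poly_def by (rule quotientI[OF FT])
 have z: "polynomial_function (%x::'a. 0 :: complex)" "polynomial_function (%x::'a. 1 :: complex)" by simp_all
 have "F : Y" unfolding Y_def mod_polynomials_def using FT z(1) by force
 then have pair: "pairing Y ps = F ps" if "ps : schwartz0" for ps by (rule pairing_eq[OF Y _ that])
 have a_eq: "a l ps = (LL x. g l x * ps x)" and psS: "ps : schwartz" if ps: "ps : schwartz0" for l ps
 proof -
  show S: "ps : schwartz" using ps by (simp add: schwartz0_def)
  have "(LINT x|lebesgue. 1 * ps x) = 0" using ps z(2) unfolding schwartz0_def by blast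
  then have "(LL x. ps x) = 0"
   using schwartz_meas[OF S] by (simp add: integral_completion)
  then have z: "(LL x. e l * ps x) = 0" by simp
  have "integ (%x. e l * ps x)" by (intro integrable_mult_right schwartz_L1(2) S)
  from Bochner_Integration.integral_diff[OF a_integrable(1)[OF S] this]
  show "a l ps = (LL x. g l x * ps x)" unfolding a_def left_diff_distrib z by simp
 qed
 have hs: "((%k. LL x. g k x * ps x) has_sum pairing Y ps) UNIV" if ps: "ps : schwartz0" for ps
  using has_sum_infsum[OF sum[OF psS[OF ps]]] unfolding pair[OF ps] F_def a_eq[OF ps] .
 have "LP_piece \<Phi> k Y x = g k x" for k x
 proof -
  let ?J = "{k - 1, k, k + 1}"
  have r: "(LL y. g l y * P k (x - y)) = sconv (K k) (sconv (f l) (P k)) x" for l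
  proof -
   have "(LL y. g l y * P k (x - y)) = sconv (P k) (g l) x"
    unfolding sconv_commute[OF P_measurable g_measurable] by (simp add: sconv_def)
   then show ?thesis unfolding P_g sconv_commute[OF P_measurable f_measurable] .
  qed
  have "sconv (K k) (%x. 0) x = 0" by (simp add: sconv_def)
  moreover have "sconv (f l) (P k) = (%x. 0)" if "l \<notin> ?J" for l
   by (rule ext, rule sconv_f_P_disjoint) (use that in auto)
  ultimately have far: "sconv (K k) (sconv (f l) (P k)) x = 0" if "l \<notin> ?J" for l using that by simp
  have "((%l. LL y. g l y * P k (x - y)) has_sum LP_piece \<Phi> k Y x) UNIV"
   using hs[OF P_schwartz0] unfolding LP_piece_def .
  then have "((%l. sconv (K k) (sconv (f l) (P k)) x) has_sum LP_piece \<Phi> k Y x) UNIV" unfolding r .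
  then have "((%l. sconv (K k) (sconv (f l) (P k)) x) has_sum LP_piece \<Phi> k Y x) ?J"
   by (rule iffD1[OF has_sum_cong_neutral, rotated -1]) (use far in auto)
  then have "LP_piece \<Phi> k Y x = (\<Sum>l\<in>?J. sconv (K k) (sconv (f l) (P k)) x)"
   by (rule has_sum_unique) (intro has_sum_finite, simp)
  also have "... = sconv (K k) (%x. \<Sum>l\<in>?J. sconv (f l) (P k) x) x"
   by (rule fun_cong[OF sconv_sum[OF K, symmetric]])
    (unfold sconv_commute[OF f_measurable P_measurable], intro bdd_sconv P_integrable f_good)
  also have "(%x. \<Sum>l\<in>?J. sconv (f l) (P k) x) = f k"
   by (rule ext, subst f_eq_sum) (simp only: sconv_f_P_commute[of k])
  finally show ?thesis by (simp add: g_def)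
 qed
 then have "LP_piece \<Phi> k Y = g k" for k by (rule ext)
 then show ?thesis using Y hs a_integrable(1) psS by (intro bexI[of _ Y]) auto
qed

end

section \<open>Herz norms of kernels\<close>

lemma enn2real_recip: "0 < r ==> enn2real (1 / en r) = 1 / r"
 by (simp add: divide_ennreal flip: ennreal_1)

definition herz_term :: "ennreal => real => ('a::euclidean_space => complex) => nat => ennreal" where
 "herz_term u s f j = en (2 powr (s * real j)) * Lp_norm u (herz_shell j) (nrm f)"

lemma herz_term_le:
 assumes "0 < t"
 shows "herz_term u s f j <= herz_norm u s t f"
proof (cases t)
 case top
 then show ?thesis unfolding herz_norm_def herz_term_def Let_def by (auto intro!: SUP_upper2[of j])
next
 case (real r)
 then have r: "0 < r" using assms by simp
 have "epowr (herz_term u s f j) r <= (\<Sum>j. epowr (herz_term u s f j) r)"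
  using sum_le_suminf[of "%j. epowr (herz_term u s f j) r" "{j}"] by simp
 then have "herz_term u s f j <= epowr (\<Sum>j. epowr (herz_term u s f j) r) (1 / r)" by (simp add: epowr_le_swap r)
 then show ?thesis using real r by (simp add: herz_norm_def herz_term_def Let_def enn2real_recip)
qed

text \<open>The inclusion of l^t in l^1 for t <= 1: the factor a_j^(1 - t) of each term is bounded
  by the norm to the power 1 - t.\<close>

lemma herz_sum_le:
 assumes "0 < t" "t <= 1"
 shows "(\<Sum>j. herz_term u s f j) <= herz_norm u s t f"
proof (cases t)
 case (real r)
 then have r: "0 < r" "r <= 1" using assms by simp_all
 let ?S = "herz_norm u s t f"
 have S: "?S = epowr (\<Sum>j. epowr (herz_term u s f j) r) (1 / r)"
  using real r by (simp add: herz_norm_def herz_term_def Let_def enn2real_recip)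
 have "herz_term u s f j <= epowr (herz_term u s f j) r * epowr ?S (1 - r)" for j
 proof -
  have "herz_term u s f j = epowr (herz_term u s f j) (r + (1 - r))" by simp
  also have "... = epowr (herz_term u s f j) r * epowr (herz_term u s f j) (1 - r)" by (rule epowr_add)
  also have "... <= epowr (herz_term u s f j) r * epowr ?S (1 - r)"
   using r by (intro mult_left_mono epowr_mono herz_term_le assms) auto
  finally show ?thesis .
 qed
 then have "(\<Sum>j. herz_term u s f j) <= (\<Sum>j. epowr (herz_term u s f j) r * epowr ?S (1 - r))" by (intro suminf_le) auto
 also have "... = (\<Sum>j. epowr (herz_term u s f j) r) * epowr ?S (1 - r)" by simp
 also have "(\<Sum>j. epowr (herz_term u s f j) r) = epowr ?S r" unfolding S epowr_epowr using r by simp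
 also have "epowr ?S r * epowr ?S (1 - r) = ?S" by (simp flip: epowr_add)
 finally show ?thesis .
qed (use assms in "auto simp: top_unique")

lemma herz_shell_borel [measurable]: "herz_shell j : sets borel"
 unfolding herz_shell_def by (cases "j = 0") auto

lemma norm_herz_shell: "x : herz_shell j ==> norm x <= 2 ^ (j + 1)"
 by (cases "j = 0") (auto simp: herz_shell_def)

definition shell_vol :: "'a::euclidean_space itself => real" where
 "shell_vol _ = unit_ball_vol (real DIM('a)) * 2 ^ DIM('a)"

lemma shell_vol_pos: "0 < shell_vol TYPE('a::euclidean_space)"
 by (simp add: shell_vol_def)

lemma emeasure_herz_shell:
 "emeasure lborel (herz_shell j :: 'a::euclidean_space set) <= en (shell_vol TYPE('a) * 2 powr (real j * real DIM('a)))"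
proof -
 have "emeasure lborel (herz_shell j :: 'a set) <= emeasure lborel (cball (0::'a) (2 ^ (j + 1)))"
  by (intro emeasure_mono) (auto dest: norm_herz_shell)
 also have "... = en (unit_ball_vol (real DIM('a)) * (2 ^ (j + 1)) ^ DIM('a))" by (rule emeasure_cball) simp
 also have "(2 ^ (j + 1)) ^ DIM('a) = 2 ^ DIM('a) * (2::real) powr (real j * real DIM('a))"
  by (simp add: power_mult_distrib powr_powr flip: powr_realpow)
 finally show ?thesis by (simp add: shell_vol_def mult.assoc)
qed

text \<open>Hoelder on a shell from exponent u down to v < u. The case u infinite is separate
  because \<open>Lp_norm\<close> is then an essential supremum, and 1 / u is 0.\<close>

lemma shell_holder:
 fixes f :: "'a::euclidean_space => complex"
 assumes [measurable]: "f : BM" and u: "1 < u" and v: "0 < v" "v * enn2real (1 / u) < 1"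
 shows "(NN x. epowr (nrm f x) v * indicator (herz_shell j) x)
   <= epowr (emeasure lborel (herz_shell j :: 'a set)) (1 - v * enn2real (1 / u)) * epowr (Lp_norm u (herz_shell j) (nrm f)) v"
proof (cases u)
 case top
 let ?L = "Lp_norm u (herz_shell j) (nrm f)"
 have "AE x in lebesgue. nrm f x * indicator (herz_shell j) x <= ?L" unfolding Lp_norm_def using top by (simp add: esssup_AE)
 then have "AE x in lborel. nrm f x * indicator (herz_shell j) x <= ?L" by (simp add: AE_completion_iff)
 then have "AE x in lborel. epowr (nrm f x) v * indicator (herz_shell j) x <= epowr ?L v * indicator (herz_shell j) x"
 proof eventually_elim
  case (elim x)
  then show ?case using v epowr_mono[of v "nrm f x" ?L] by (auto simp: indicator_def)
 qed
 then have "(NN x. epowr (nrm f x) v * indicator (herz_shell j) x) <= (NN x. epowr ?L v * indicator (herz_shell j) (x::'a))"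
  by (rule nn_integral_mono_AE)
 also have "... = epowr ?L v * emeasure lborel (herz_shell j :: 'a set)" by (rule nn_integral_cmult_indicator) simp
 finally show ?thesis using top by (simp add: mult.commute)
next
 case (real U)
 then have U: "1 < U" using u by simp
 have r: "enn2real (1 / u) = 1 / U" using real U enn2real_recip[of U] by simp
 define th where "th = v / U"
 have th: "0 < th" "th < 1" "U * th = v" using v U unfolding r th_def by auto
 let ?i = "%x::'a. indicator (herz_shell j) x :: ennreal"
 have "(NN x. epowr (nrm f x) v * ?i x) = (NN x. epowr (epowr (nrm f x) U * ?i x) th * epowr (?i x) (1 - th))"
  by (intro nn_integral_cong) (auto simp: epowr_epowr th(3) indicator_def simp del: epowr_ennreal)
 also have "... <= epowr (NN x. epowr (nrm f x) U * ?i x) th * epowr (NN x. ?i x) (1 - th)"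
  by (rule holder_epowr) (use th in measurable)
 also have "(NN x. ?i x) = emeasure lborel (herz_shell j :: 'a set)" by simp
 also have "epowr (NN x. epowr (nrm f x) U * ?i x) th = epowr (Lp_norm u (herz_shell j) (nrm f)) v"
  unfolding Lp_norm_def r using real U by (simp add: nn_integral_completion epowr_epowr th_def)
 finally show ?thesis by (simp add: r th_def mult.commute)
qed

text \<open>The volume of the shell competes with the weight of the Herz norm: for v = 1 the
  exponent of 2^j is d (1 - 1/u) - s, which is 0 in the critical case and negative in the
  supercritical one.\<close>

lemma shell_bound:
 fixes f :: "'a::euclidean_space => complex"
 assumes f: "f : BM" and u: "1 < u" and v: "0 < v" "v * enn2real (1 / u) < 1"
 defines "r \<equiv> enn2real (1 / u)" and "d \<equiv> real DIM('a)"
 shows "(NN x. epowr (nrm f x) v * indicator (herz_shell j) x)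
   <= en (shell_vol TYPE('a) powr (1 - v * r) * 2 powr (real j * (d * (1 - v * r) - s * v))) * epowr (herz_term u s f j) v"
proof -
 let ?V = "shell_vol TYPE('a)" and ?L = "Lp_norm u (herz_shell j) (nrm f)"
 have "1 = 2 powr (- (s * real j)) * 2 powr (s * real j)" by (simp flip: powr_add)
 then have "?L = en (2 powr (- (s * real j)) * 2 powr (s * real j)) * ?L" by simp
 also have "... = en (2 powr (- (s * real j))) * herz_term u s f j"
  unfolding herz_term_def by (subst ennreal_mult) (auto simp: mult.assoc)
 finally have L: "epowr ?L v = en (2 powr (- (s * real j * v))) * epowr (herz_term u s f j) v"
  by (simp add: epowr_mult powr_powr)
 have "epowr (emeasure lborel (herz_shell j :: 'a set)) (1 - v * r) <= epowr (en (?V * 2 powr (real j * d))) (1 - v * r)"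
  using v unfolding r_def d_def by (intro epowr_mono emeasure_herz_shell) auto
 then have "(NN x. epowr (nrm f x) v * indicator (herz_shell j) x)
  <= epowr (en (?V * 2 powr (real j * d))) (1 - v * r) * (en (2 powr (- (s * real j * v))) * epowr (herz_term u s f j) v)"
  unfolding L[symmetric] by (intro order_trans[OF shell_holder[OF f u v, folded r_def] mult_right_mono]) auto
 also have "epowr (en (?V * 2 powr (real j * d))) (1 - v * r) = en (?V powr (1 - v * r) * 2 powr (real j * d * (1 - v * r)))"
  using shell_vol_pos[where 'a='a] by (simp add: powr_mult powr_powr)
 also have "... * (en (2 powr (- (s * real j * v))) * epowr (herz_term u s f j) v)
   = en (?V powr (1 - v * r) * 2 powr (real j * (d * (1 - v * r) - s * v))) * epowr (herz_term u s f j) v"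
  by (subst mult.assoc[symmetric], subst ennreal_mult[symmetric]) (auto simp: mult.assoc algebra_simps simp flip: powr_add)
 finally show ?thesis .
qed

lemma shell_cover:
 assumes "i = 0 \<or> 2 ^ i < norm x"
 shows "EX n. x : herz_shell (n + i)"
proof -
 \<comment> \<open>The first closed ball in the family that contains x. Minimality puts x outside
   the previous ball, as required unless j = 0, where the shell is a full ball.\<close>
 define j where "j = (LEAST j. norm x <= 2 ^ (j + 1))"
 obtain n :: nat where "norm x < 2 ^ n" using real_arch_pow[of 2 "norm x"] by auto
 then have "norm x <= 2 ^ (n + 1)" using power_increasing[of n "n + 1" "2::real"] by linarith
 then have j: "norm x <= 2 ^ (j + 1)" unfolding j_def by (rule LeastI)
 have l: "2 ^ j < norm x" if "0 < j"
 proof -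
  have "\<not> norm x <= 2 ^ ((j - 1) + 1)" using that unfolding j_def by (intro not_less_Least) simp
  then show ?thesis using that by simp
 qed
 have "i <= j"
 proof (cases "i = 0")
  case False
  then have "(2::real) ^ i < 2 ^ (j + 1)" using assms j by linarith
  then show ?thesis using power_less_imp_less_exp[of "2::real" i "j + 1"] by simp
 qed simp
 moreover have "x : herz_shell j" using j l by (cases "j = 0") (auto simp: herz_shell_def)
 ultimately show ?thesis by (intro exI[of _ "j - i"]) simp
qed

lemma tail_le_shells:
 fixes g :: "'a::euclidean_space => ennreal"
 assumes [measurable]: "g : BM" and I: "!!x. x : I ==> i = 0 \<or> 2 ^ i < norm x"
 shows "(NN x. g x * indicator I x) <= (\<Sum>n. NN x. g x * indicator (herz_shell (n + i)) x)"
proof -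
 have "(NN x. g x * indicator I x) <= (NN x. (\<Sum>n. g x * indicator (herz_shell (n + i)) x))"
 proof (rule nn_integral_mono)
  fix x
  show "g x * indicator I x <= (\<Sum>n. g x * indicator (herz_shell (n + i)) x)"
  proof (cases "x : I")
   case True
   then obtain n where "x : herz_shell (n + i)" using shell_cover I by blast
   then show ?thesis using True sum_le_suminf[of "%n. g x * indicator (herz_shell (n + i)) x" "{n}"] by simp
  qed simp
 qed
 also have "... = (\<Sum>n. NN x. g x * indicator (herz_shell (n + i)) x)" by (rule nn_integral_suminf) measurable
 finally show ?thesis .
qed

text \<open>Relates the two kernels attached to frequency 2^k: \<open>G\<close> belongs to the
  rescaled symbol measured by the Herz norm, \<open>K\<close> to the unscaled piece of the
  multiplier.\<close>

definition rescaled :: "int => ('a::euclidean_space => complex) => ('a => complex) => bool" where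
 "rescaled k G K \<longleftrightarrow> G : BM & K : BM &
   (ALL x. K x = of_real (2 powr (rint k * real DIM('a))) * G ((tp k) *\<^sub>R x))"

lemma rescaled_integral:
 fixes G K :: "'a::euclidean_space => complex"
 assumes K: "rescaled k G K" and [measurable]: "I : sets borel" and v: "0 < v"
 shows "(NN x. epowr (nrm K x) v * indicator {x. (tp k) *\<^sub>R x : I} x)
  = en (2 powr (rint k * real DIM('a) * (v - 1))) * (NN x. epowr (nrm G x) v * indicator I x)"
proof -
 let ?c = "tp k" and ?d = "real DIM('a)"
 have [measurable]: "G : BM" using K by (simp add: rescaled_def)
 have cd: "\<bar>?c\<bar> ^ DIM('a) = 2 powr (rint k * ?d)" by (simp add: powr_realpow[symmetric] powr_powr)
 have "epowr (nrm K x) v * indicator {x. ?c *\<^sub>R x : I} x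
   = en (2 powr (rint k * ?d * v)) * (epowr (nrm G (?c *\<^sub>R x)) v * indicator I (?c *\<^sub>R x))" for x
 proof -
  have "nrm K x = en (2 powr (rint k * ?d)) * nrm G (?c *\<^sub>R x)"
   using K by (simp add: rescaled_def norm_mult ennreal_mult)
  then have "epowr (nrm K x) v = en (2 powr (rint k * ?d * v)) * epowr (nrm G (?c *\<^sub>R x)) v"
   by (simp only: epowr_mult) (simp add: powr_powr)
  then show ?thesis by (simp add: mult.assoc indicator_def)
 qed
 then have "(NN x. epowr (nrm K x) v * indicator {x. ?c *\<^sub>R x : I} x)
   = en (2 powr (rint k * ?d * v)) * (NN x. epowr (nrm G (0 + ?c *\<^sub>R x)) v * indicator I (0 + ?c *\<^sub>R x))"
  by (simp only: add_0, subst nn_integral_cmult[symmetric]) auto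
 also have "en (2 powr (rint k * ?d * v)) = en (2 powr (rint k * ?d * (v - 1))) * en (\<bar>?c\<bar> ^ DIM('a))"
  unfolding cd by (subst ennreal_mult[symmetric]) (auto simp: algebra_simps simp flip: powr_add)
 finally show ?thesis
  using nn_affine[of "%x. epowr (nrm G x) v * indicator I x" ?c 0] by (simp add: mult.assoc)
qed

text \<open>Beyond the critical s the shells contribute a geometric series of ratio 2^(-ep), so
  bounds on the single terms of the Herz norm suffice and every t > 0 is covered.\<close>

lemma herz_scale_kernel:
 fixes s :: real
 assumes u: "1 < u" and t: "0 < t" and s: "s > real DIM('a::euclidean_space) - real DIM('a) * enn2real (1 / u)"
 shows "EX C>0. EX ep>0. \<forall>H\<ge>0. ALL K G. (ALL k. rescaled k (G k) (K k :: 'a => complex) & herz_norm u s t (G k) <= en H)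
   --> scale_kernel ep (C * H) (%k. nrm (K k))"
proof -
 define r where "r = enn2real (1 / u)"
 define ep where "ep = s - (real DIM('a) - real DIM('a) * r)"
 have ep: "0 < ep" using s by (simp add: ep_def r_def)
 have r: "r < 1"
 proof (cases u)
  case (real U)
  then show ?thesis using u enn2real_recip[of U] by (auto simp: r_def)
 qed (simp add: r_def)
 define V where "V = shell_vol TYPE('a) powr (1 - r)"
 have V: "0 < V" using shell_vol_pos[where 'a='a] by (simp add: V_def)
 let ?rh = "2 powr (- ep)"
 have rh: "0 < ?rh" "?rh < 1" using ep powr_less_mono[of "- ep" 0 2] by auto
 define C where "C = V / (1 - ?rh)"
 have C: "0 < C" using V rh by (simp add: C_def)
 have tail: "(NN x. nrm G x * indicator I x) <= en (C * H * 2 powr (- (real i * ep)))"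
  if [measurable]: "G : BM" and h: "herz_norm u s t G <= en H" and H: "0 <= H"
   and I: "!!x. x : I ==> i = 0 \<or> 2 ^ i < norm x" for G :: "'a => complex" and H i I
 proof -
  have "(NN x. nrm G x * indicator (herz_shell (n + i)) x) <= en (V * H * 2 powr (- (real i * ep)) * ?rh ^ n)" for n
  proof -
   have "(NN x. nrm G x * indicator (herz_shell (n + i)) x)
     <= en (V * 2 powr (real (n + i) * (- ep))) * herz_term u s G (n + i)"
    using shell_bound[of G u 1 "n + i" s] u r by (simp add: V_def r_def ep_def algebra_simps)
   also have "... <= en (V * 2 powr (real (n + i) * (- ep))) * en H"
    using order_trans[OF herz_term_le[OF t] h] by (intro mult_left_mono) auto
   also have "... = en (V * H * 2 powr (- (real i * ep)) * ?rh ^ n)"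
   proof -
    have "2 powr (real (n + i) * (- ep)) = 2 powr (- (real i * ep)) * ?rh ^ n"
     by (simp add: powr_realpow[symmetric] powr_powr algebra_simps flip: powr_add)
    then show ?thesis using V H by (simp add: ennreal_mult[symmetric] mult_ac)
   qed
   finally show ?thesis .
  qed
  then have "(NN x. nrm G x * indicator I x) <= (\<Sum>n. en (V * H * 2 powr (- (real i * ep)) * ?rh ^ n))"
   by (intro order_trans[OF tail_le_shells[OF _ I] suminf_le]) auto
  also have "... = en (V * H * 2 powr (- (real i * ep)) * (1 / (1 - ?rh)))"
   using V H rh by (intro suminf_ennreal_eq sums_mult geometric_sums) auto
  finally show ?thesis by (simp add: C_def mult_ac)
 qed
 have "scale_kernel ep (C * H) (%k. nrm (K k))"
  if H: "0 <= H" and KG: "!!k. rescaled k (G k) (K k :: 'a => complex)" "!!k. herz_norm u s t (G k) <= en H" for H K G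
  unfolding scale_kernel_def
 proof (intro allI conjI impI)
  fix k l :: int
  have [measurable]: "K k : BM" "G k : BM" using KG(1)[of k] by (auto simp: rescaled_def)
  show "nrm (K k) : LM" by measurable
  show "(NN y. nrm (K k) y) <= en (C * H)"
   using rescaled_integral[OF KG(1), of UNIV 1 k] tail[of "G k" H UNIV 0] KG(2)[of k] H by simp
  assume lk: "l <= k"
  \<comment> \<open>Radius 2^(-l) for \<open>K k\<close> corresponds to radius 2^(k - l) for
    \<open>G k\<close>, so only shells from index k - l on contribute.\<close>
  let ?I = "{x::'a. 2 ^ nat (k - l) < norm x}"
  have "tm l < norm y \<longleftrightarrow> (tp k) *\<^sub>R y : ?I" for y :: 'a
  proof -
   have "(2::real) ^ nat (k - l) = tp k * tm l"
    using lk by (simp add: powr_realpow[symmetric] flip: powr_add)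
   then show ?thesis by simp
  qed
  then have "{y. tm l < norm y} = {y. (tp k) *\<^sub>R y : ?I}" by auto
  then show "(NN y. nrm (K k) y * indicator {y. tm l < norm y} y)
    <= en (C * H * 2 powr (- (rint (k - l) * ep)))"
   using rescaled_integral[OF KG(1), of ?I 1 k] tail[of "G k" H ?I "nat (k - l)"] KG(2)[of k] H lk by simp
 qed
 then show ?thesis using C ep by (intro exI[of _ C] exI[of _ ep] conjI) auto
qed

text \<open>The blocks are the dilated shells. At critical s the shells give no decay in j, and
  summability of their weighted norms comes from t <= 1. The exponent u is lowered to v, which is a
  real number also for u infinite.\<close>

lemma herz_block_kernel:
 fixes v :: real
 assumes u: "1 < u" and t: "0 < t" "t <= 1" and v: "1 < v" "v * enn2real (1 / u) < 1"
  and s: "s = real DIM('a::euclidean_space) - real DIM('a) * enn2real (1 / u)"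
 shows "EX C>0. \<forall>H\<ge>0. ALL k K G. rescaled k G (K :: 'a => complex) & herz_norm u s t G <= en H
   --> (NN x. nrm K x) <= en (C * H) & (\<forall>A>C * H. block_kernel v A (nrm K))"
proof -
 define r where "r = enn2real (1 / u)"
 define d where "d = real DIM('a)"
 have r: "0 <= r" "v * r < 1" "r < 1" and rs: "s = d - d * r"
  using v s mult_right_mono[of 1 v r] by (auto simp: r_def d_def)
 define V where "V = shell_vol TYPE('a) powr (1 - r)"
 have V: "0 < V" using shell_vol_pos[where 'a='a] by (simp add: V_def)
 \<comment> \<open>The factor 2^(2 d (v - 1)) compensates for the 2 in the radius exponent
   \<open>R j\<close>.\<close>
 define W where "W = shell_vol TYPE('a) powr (1 - v * r) * 2 powr (2 * d * (v - 1))"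
 have W: "0 < W" using shell_vol_pos[where 'a='a] by (simp add: W_def)
 define C where "C = V + W powr (1 / v)"
 have C: "0 < C" using V by (simp add: C_def add_pos_nonneg)
 show ?thesis
 proof (intro exI[of _ C] conjI allI impI C)
  fix H :: real and k and K G :: "'a => complex" assume H: "0 <= H" and KG: "rescaled k G K & herz_norm u s t G <= en H"
  have [measurable]: "K : BM" "G : BM" using KG by (auto simp: rescaled_def)
  have a_sum: "(\<Sum>j. herz_term u s G j) <= en H" by (rule order_trans[OF herz_sum_le[OF t] conjunct2[OF KG]])
  have "(NN x. nrm K x) = (NN x. nrm G x * indicator UNIV x)"
   using rescaled_integral[of k G K UNIV 1] KG by simp
  also have "... <= (\<Sum>n. NN x. nrm G x * indicator (herz_shell (n + 0)) x)" by (rule tail_le_shells) auto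
  also have "... <= (\<Sum>n. en V * herz_term u s G n)"
  proof (intro suminf_le)
   fix n
   show "(NN x. nrm G x * indicator (herz_shell (n + 0)) x) <= en V * herz_term u s G n"
    using shell_bound[of G u 1 n s] u r by (simp add: V_def r_def[symmetric] rs d_def algebra_simps)
  qed auto
  also have "... = en V * (\<Sum>n. herz_term u s G n)" by simp
  also have "... <= en V * en H" by (intro mult_left_mono a_sum) auto
  also have "... = en (V * H)" using V H by (simp add: ennreal_mult)
  also have "... <= en (C * H)" using H by (intro ennreal_leI mult_right_mono) (auto simp: C_def)
  finally show "(NN x. nrm K x) <= en (C * H)" .
  fix A assume A: "C * H < A"
  define de where "de = A - C * H"
  have de: "0 < de" using A by (simp add: de_def)
  define al where "al j = enn2real (herz_term u s G j)" for j
  have al: "herz_term u s G j = en (al j)" "0 <= al j" for j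
  proof -
   have "herz_term u s G j <= en H" using herz_term_le[OF t(1), of u s G j] KG by (auto intro: order_trans)
   then have "herz_term u s G j < top" by (rule le_less_trans) simp
   then show "herz_term u s G j = en (al j)" "0 <= al j" by (simp_all add: al_def)
  qed
  \<comment> \<open>Blocks need positive constants although the norm on a shell may vanish; the
    slack A - C H is distributed geometrically over j.\<close>
  define c where "c j = W powr (1 / v) * al j + de * (1/2) ^ Suc j" for j
  have c: "0 < c j" "W powr (1 / v) * al j <= c j" for j
   using de al(2)[of j] by (auto simp: c_def intro!: add_nonneg_pos)
  \<comment> \<open>Shell j lies in the closed ball of radius 2^(j + 1); one more unit in the
    exponent makes the inclusion strict.\<close>
  define R where "R j = int j + 2 - k" for j
  define S where "S j = {y::'a. (tp k) *\<^sub>R y : herz_shell j}" for j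
  have [measurable]: "S j : sets borel" for j unfolding S_def by measurable
  show "block_kernel v A (nrm K)"
   unfolding block_kernel_def
  proof (intro exI[of _ c] exI[of _ R] exI[of _ "%j y. nrm K y * indicator (S j) y"] conjI allI impI)
   fix j
   show "(%y. nrm K y * indicator (S j) y) : LM" by measurable
   show "0 < c j" by (rule c)
   show "norm y < 2 powr rint (R j)" if "nrm K y * indicator (S j) y ~= 0" for y
   proof -
    have "(tp k) *\<^sub>R y : herz_shell j" using that by (auto simp: S_def indicator_def split: if_splits)
    then have "tp k * norm y <= 2 ^ (j + 1)" using norm_herz_shell by fastforce
    also have "... < 2 ^ (j + 2)" by simp
    also have "(2::real) ^ (j + 2) = tp k * 2 powr rint (R j)"
     by (simp add: R_def powr_realpow[symmetric] add.commute del: power_Suc flip: powr_add)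
    finally show ?thesis by simp
   qed
   have "epowr (nrm K y * indicator (S j) y) v = epowr (nrm K y) v * indicator (S j) y" for y
    by (simp add: indicator_def)
   then have "(NN y. epowr (nrm K y * indicator (S j) y) v)
     = en (2 powr (rint k * d * (v - 1))) * (NN x. epowr (nrm G x) v * indicator (herz_shell j) x)"
    using rescaled_integral[of k G K "herz_shell j" v] KG v by (simp add: S_def d_def)
   also have "... <= en (2 powr (rint k * d * (v - 1)))
     * (en (shell_vol TYPE('a) powr (1 - v * r) * 2 powr (real j * (d * (1 - v * r) - s * v))) * epowr (herz_term u s G j) v)"
    using shell_bound[of G u v j s] u v r unfolding d_def r_def by (intro mult_left_mono) auto
   also have "... = en (2 powr (rint k * d * (v - 1)) * (shell_vol TYPE('a) powr (1 - v * r) * 2 powr (real j * (d * (1 - v * r) - s * v))) * al j powr v)"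
    using al[of j] by (simp add: ennreal_mult mult.assoc)
   also have "2 powr (rint k * d * (v - 1)) * (shell_vol TYPE('a) powr (1 - v * r) * 2 powr (real j * (d * (1 - v * r) - s * v))) * al j powr v
     = (W powr (1 / v) * al j) powr v * 2 powr (- (rint (R j) * d * (v - 1)))"
   proof -
    have "2 powr (rint k * d * (v - 1)) * 2 powr (real j * (d * (1 - v * r) - s * v))
      = 2 powr (2 * d * (v - 1)) * 2 powr (- (rint (R j) * d * (v - 1)))"
     unfolding rs R_def by (simp add: algebra_simps flip: powr_add)
    moreover have "(W powr (1 / v) * al j) powr v = W * al j powr v"
     using W al(2)[of j] v by (simp add: powr_mult powr_powr)
    ultimately show ?thesis unfolding W_def by (simp only: mult_ac)
   qed
   also have "ennreal ... <= en (c j powr v * 2 powr (- (rint (R j) * d * (v - 1))))"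
    using c[of j] al(2)[of j] v by (intro ennreal_leI mult_right_mono powr_mono2) auto
   finally show "(NN y. epowr (nrm K y * indicator (S j) y) v)
     <= en (c j powr v * 2 powr (- (rint (R j) * real DIM('a) * (v - 1))))" by (simp add: d_def)
  next
   have "(\<Sum>j. en (c j)) = (\<Sum>j. en (W powr (1 / v)) * herz_term u s G j + en (de * (1/2) ^ Suc j))"
    unfolding c_def al(1) using al(2) de by (intro suminf_cong) (simp add: ennreal_plus ennreal_mult)
   also have "... = en (W powr (1 / v)) * (\<Sum>j. herz_term u s G j) + (\<Sum>j. en (de * (1/2) ^ Suc j))"
    by (subst suminf_add[symmetric]) auto
   also have "(\<Sum>j. en (de * (1/2) ^ Suc j)) = en (de * 1)"
    using de by (intro suminf_ennreal_eq sums_mult power_half_series) auto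
   also have "en (W powr (1 / v)) * (\<Sum>j. herz_term u s G j) + en (de * 1) <= en (W powr (1 / v)) * en H + en (de * 1)"
    by (intro add_mono mult_left_mono a_sum) auto
   also have "... = en (W powr (1 / v) * H + de)" using H de by (simp add: ennreal_mult ennreal_plus)
   also have "... <= en A"
    using H V by (intro ennreal_leI) (simp add: de_def C_def distrib_right)
   finally show "(\<Sum>j. en (c j)) <= en A" .
   fix y :: 'a
   obtain n where "(tp k) *\<^sub>R y : herz_shell (n + 0)" using shell_cover[of 0] by blast
   then show "nrm K y <= (\<Sum>j. nrm K y * indicator (S j) y)"
    using sum_le_suminf[of "%j. nrm K y * indicator (S j) y" "{n}"] by (simp add: S_def)
  qed
 qed
qed

section \<open>Multiplier kernels\<close>

lemma two_powi: "(2::real) powi k = tp k"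
 by (simp add: powr_real_of_int')

text \<open>A Borel representative bounded everywhere, obtained by altering \<open>m\<close> on a
  null set; with it the kernels become integrals over \<open>lborel\<close>, where Fubini
  applies.\<close>

lemma L_infinity_borel:
 fixes m :: "'a::euclidean_space => complex"
 assumes "m : L_infinity"
 shows "EX m' M. m' : BM & (ALL x. norm (m' x) <= M) & (AE x in lebesgue. m x = m' x)"
proof -
 have [measurable]: "m : borel_measurable lebesgue" using assms by (simp add: L_infinity_def)
 define E where "E = esssup lebesgue (%x. en (norm (m x)) * indicator UNIV x)"
 have E: "E < top" using assms by (simp add: L_infinity_def Lp_norm_def E_def)
 have bd: "AE x in lebesgue. norm (m x) <= enn2real E"
 proof -
  have "AE x in lebesgue. en (norm (m x)) * indicator UNIV x <= E" unfolding E_def by (rule esssup_AE)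
  then show ?thesis
  proof eventually_elim
   case (elim x)
   then have "en (norm (m x)) <= en (enn2real E)" using E by simp
   then show ?case by simp
  qed
 qed
 have "(%x. Re (m x)) : borel_measurable lebesgue" "(%x. Im (m x)) : borel_measurable lebesgue" by measurable
 from this[THEN completion_ex_borel_measurable_real]
 obtain a b where ab: "a : LM" "b : LM"
   "AE x in lborel. Re (m x) = a x" "AE x in lborel. Im (m x) = b x"
  by auto
 note [measurable] = ab(1,2)
 define m0 where "m0 x = Complex (a x) (b x)" for x
 have m0: "m0 = (%x. complex_of_real (a x) + \<i> * complex_of_real (b x))" by (auto simp: m0_def complex_eq_iff)
 have [measurable]: "m0 : BM" unfolding m0 by measurable
 define m' where "m' x = (if norm (m0 x) <= enn2real E then m0 x else 0)" for x
 have "AE x in lebesgue. m x = m' x"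
  using AE_completion[OF ab(3)] AE_completion[OF ab(4)] bd
 proof eventually_elim
  case (elim x)
  then have "m0 x = m x" by (simp add: m0_def complex_eq_iff)
  then show ?case using elim by (simp add: m'_def)
 qed
 moreover have "m' : BM" unfolding m'_def by measurable
 moreover have "norm (m' x) <= enn2real E" for x by (auto simp: m'_def)
 ultimately show ?thesis by blast
qed

lemma AE_lebesgue_scaling:
 fixes Q :: "'a::euclidean_space => bool"
 assumes "AE x in lebesgue. Q x" and c: "c ~= 0"
 shows "AE x in lebesgue. Q (c *\<^sub>R x)"
proof -
 have "AE x in lborel. Q x" using assms(1) by (simp add: AE_completion_iff)
 then obtain N where N: "N : null_sets lborel" "{x. \<not> Q x} <= N" by (auto simp: eventually_ae_filter)
 have [measurable]: "N : sets borel" using N(1) by (simp add: null_sets_def)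
 have "0 = en (\<bar>c\<bar> ^ DIM('a)) * (NN x. indicator N (0 + c *\<^sub>R x))"
  using nn_affine[of "indicator N" c 0] N(1) c by (simp add: null_sets_def)
 moreover have "en (\<bar>c\<bar> ^ DIM('a)) ~= 0" using c by (simp add: ennreal_eq_0_iff not_le)
 ultimately have "(NN x. indicator N (0 + c *\<^sub>R x)) = (0 :: ennreal)" by (metis mult_eq_0_iff)
 then have "(NN x. indicator {x. c *\<^sub>R x : N} x) = (0 :: ennreal)"
  by (simp add: indicator_def)
 then have "{x. c *\<^sub>R x : N} : null_sets lborel" by (simp add: null_sets_def)
 then have "AE x in lborel. Q (c *\<^sub>R x)" by (rule AE_I') (use N(2) in auto)
 then show ?thesis by (rule AE_completion)
qed

locale multiplier =
 fixes \<phi> :: "'a::euclidean_space => real" and m m' :: "'a => complex" and M :: real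
 assumes \<phi>: "cutoff \<phi>" and m [measurable]: "m : borel_measurable lebesgue" and m' [measurable]: "m' : BM"
  and M: "!!x. norm (m' x) <= M" and AE_m: "AE x in lebesgue. m x = m' x"
begin

abbreviation K :: "int => 'a => complex" where "K k \<equiv> multiplier_kernel \<phi> m k"

lemma \<phi>_measurable [measurable]: "\<phi> : BM"
 using \<phi> by (intro borel_measurable_continuous_onI smooth_continuous_on) (simp add: cutoff_def)

lemma \<phi>_le: "\<bar>\<phi> xi\<bar> <= 1"
 using \<phi> by (simp add: cutoff_def)

lemma \<phi>_support: "4 < norm xi ==> \<phi> xi = 0"
proof (rule ccontr)
 assume "4 < norm xi" "\<phi> xi ~= 0"
 moreover have "closure {xi. \<phi> xi ~= 0} <= {xi. 1/4 <= norm xi & norm xi <= 4}" using \<phi> by (simp only: cutoff_def)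
 moreover have "xi : closure {xi. \<phi> xi ~= 0}" using \<open>\<phi> xi ~= 0\<close> by (intro subsetD[OF closure_subset]) simp
 ultimately show False by auto
qed

definition mk :: "int => 'a => complex" where
 "mk k xi = m' xi * complex_of_real (\<phi> ((tm k) *\<^sub>R xi))"

lemma mk_measurable [measurable]: "mk k : BM"
 unfolding mk_def by measurable

lemma mk_integrable: "integ (mk k)"
proof (rule integrableI_bounded_set[where A="cball 0 (4 * tp k)" and B=M])
 show "AE x in lborel. x : cball 0 (4 * tp k) --> norm (mk k x) <= M"
 proof (intro AE_I2 impI)
  fix x
  have "0 <= M" using M[of 0] norm_ge_zero order_trans by blast
  then have "norm (m' x) * \<bar>\<phi> ((tm k) *\<^sub>R x)\<bar> <= M * 1" by (intro mult_mono M \<phi>_le) auto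
  then show "norm (mk k x) <= M" by (simp add: mk_def norm_mult)
 qed
 show "AE x in lborel. x \<notin> cball 0 (4 * tp k) --> mk k x = 0"
 proof (intro AE_I2 impI)
  fix x :: 'a assume "x \<notin> cball 0 (4 * tp k)"
  then have "4 < norm ((tm k) *\<^sub>R x)" by (simp add: powr_minus field_simps)
  then show "mk k x = 0" by (simp add: mk_def \<phi>_support)
 qed
qed (use emeasure_bounded_finite[OF bounded_cball] in auto)

lemma K_eq: "K k x = (LINT xi|lborel. mk k xi * cis (2 * pi * (x \<bullet> xi)))"
proof -
 have "K k x = (LINT xi|lebesgue. m xi * complex_of_real (\<phi> ((tm k) *\<^sub>R xi)) * cis (2 * pi * (x \<bullet> xi)))"
  unfolding multiplier_kernel_def inv_fourier_def two_powi by simp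
 also have "... = (LINT xi|lebesgue. mk k xi * cis (2 * pi * (x \<bullet> xi)))"
 proof (rule integral_cong_AE)
  show "AE xi in lebesgue. m xi * complex_of_real (\<phi> ((tm k) *\<^sub>R xi)) * cis (2 * pi * (x \<bullet> xi)) = mk k xi * cis (2 * pi * (x \<bullet> xi))"
   using AE_m by eventually_elim (simp add: mk_def)
 qed (intro borel_measurable_times m measurable_completion; measurable)+
 also have "... = (LINT xi|lborel. mk k xi * cis (2 * pi * (x \<bullet> xi)))" by (rule integral_completion) measurable
 finally show ?thesis .
qed

definition G :: "int => 'a => complex" where
 "G k = inv_fourier (%xi. m ((2 powi k) *\<^sub>R xi) * complex_of_real (\<phi> xi))"

lemma G_eq: "G k x = (LINT xi|lborel. m' ((tp k) *\<^sub>R xi) * complex_of_real (\<phi> xi) * cis (2 * pi * (x \<bullet> xi)))"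
proof -
 let ?c = "tp k"
 have [measurable]: "(%xi. m (?c *\<^sub>R xi)) : borel_measurable lebesgue"
  by (rule measurable_compose[OF lebesgue_measurable_scaling m])
 have "G k x = (LINT xi|lebesgue. m (?c *\<^sub>R xi) * complex_of_real (\<phi> xi) * cis (2 * pi * (x \<bullet> xi)))"
  unfolding G_def inv_fourier_def two_powi by simp
 also have "... = (LINT xi|lebesgue. m' (?c *\<^sub>R xi) * complex_of_real (\<phi> xi) * cis (2 * pi * (x \<bullet> xi)))"
 proof (rule integral_cong_AE)
  show "AE xi in lebesgue. m (?c *\<^sub>R xi) * complex_of_real (\<phi> xi) * cis (2 * pi * (x \<bullet> xi)) = m' (?c *\<^sub>R xi) * complex_of_real (\<phi> xi) * cis (2 * pi * (x \<bullet> xi))"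
  proof -
   have "AE xi in lebesgue. m (?c *\<^sub>R xi) = m' (?c *\<^sub>R xi)" by (rule AE_lebesgue_scaling[OF AE_m]) simp
   then show ?thesis by eventually_elim simp
  qed
 qed (intro borel_measurable_times measurable_compose[OF lebesgue_measurable_scaling m] measurable_completion; measurable)+
 also have "... = (LINT xi|lborel. m' (?c *\<^sub>R xi) * complex_of_real (\<phi> xi) * cis (2 * pi * (x \<bullet> xi)))" by (rule integral_completion) measurable
 finally show ?thesis .
qed

lemma K_rescaled: "rescaled k (G k) (K k)"
 unfolding rescaled_def
proof (intro conjI allI)
 show "G k : BM" unfolding G_eq[abs_def] by measurable
 show "K k : BM" unfolding K_eq[abs_def] by measurable
 fix x
 let ?c = "tp k"
 have cd: "\<bar>?c\<bar> ^ DIM('a) = 2 powr (rint k * real DIM('a))" by (simp add: powr_realpow[symmetric] powr_powr)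
 have e: "mk k (0 + ?c *\<^sub>R xi) * cis (2 * pi * (x \<bullet> (0 + ?c *\<^sub>R xi))) = m' (?c *\<^sub>R xi) * complex_of_real (\<phi> xi) * cis (2 * pi * ((?c *\<^sub>R x) \<bullet> xi))" for xi
  by (simp add: mk_def flip: powr_add)
 have "K k x = \<bar>?c\<bar> ^ DIM('a) *\<^sub>R (LINT xi|lborel. mk k (0 + ?c *\<^sub>R xi) * cis (2 * pi * (x \<bullet> (0 + ?c *\<^sub>R xi))))"
  unfolding K_eq by (rule int_affine(1)) auto
 then show "K k x = of_real (2 powr (rint k * real DIM('a))) * G k (?c *\<^sub>R x)"
  unfolding e cd G_eq scaleR_conv_of_real .
qed

lemma herz_G: "herz_norm u s t (G k) <= herz_multiplier_norm \<phi> u s t m"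
 unfolding G_def herz_multiplier_norm_def by (rule SUP_upper) simp

lemma K_measurable [measurable]: "K k : BM"
 using K_rescaled by (simp add: rescaled_def)

lemma sconv_K:
 assumes th: "integ th"
 shows "sconv (K k) th x = (LINT xi|lborel. mk k xi * ft th xi * cis (2 * pi * (x \<bullet> xi)))"
proof -
 have [measurable]: "th : BM" using th by (auto dest: borel_measurable_integrable)
 let ?F = "%y xi. th y * (mk k xi * cis (2 * pi * ((x - y) \<bullet> xi)))"
 have fin: "(NN y. (\<integral>\<^sup>+xi. en (norm (?F y xi)) \<partial>lborel)) < \<infinity>"
 proof -
  have "(NN y. (\<integral>\<^sup>+xi. en (norm (?F y xi)) \<partial>lborel)) = (NN y. nrm th y * (\<integral>\<^sup>+xi. nrm (mk k) xi \<partial>lborel))"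
   by (intro nn_integral_cong) (simp add: norm_mult ennreal_mult nn_integral_cmult)
  also have "... = (NN y. nrm th y) * (\<integral>\<^sup>+xi. nrm (mk k) xi \<partial>lborel)" by (rule nn_integral_multc) measurable
  also have "... < \<infinity>" using th mk_integrable[of k] by (simp add: integrable_iff_bounded ennreal_mult_less_top)
  finally show ?thesis .
 qed
 have "sconv (K k) th x = (LL y. th y * K k (x - y))"
  unfolding sconv_commute[OF K_measurable \<open>th : _\<close>] by (simp add: sconv_def)
 also have "... = (LL y. LINT xi|lborel. ?F y xi)" unfolding K_eq by simp
 also have "... = (LINT xi|lborel. LL y. ?F y xi)" by (rule fubini_bounded(1)[OF _ fin]) measurable
 also have "(%xi. LL y. ?F y xi) = (%xi. mk k xi * ft th xi * cis (2 * pi * (x \<bullet> xi)))"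
 proof
  fix xi
  have "?F y xi = (mk k xi * cis (2 * pi * (x \<bullet> xi))) * (th y * cis (- 2 * pi * (y \<bullet> xi)))" for y
  proof -
   have "2 * pi * ((x - y) \<bullet> xi) = 2 * pi * (x \<bullet> xi) + - 2 * pi * (y \<bullet> xi)" by (simp add: inner_diff_left algebra_simps)
   then have "cis (2 * pi * ((x - y) \<bullet> xi)) = cis (2 * pi * (x \<bullet> xi)) * cis (- 2 * pi * (y \<bullet> xi))" by (simp only: cis_plus_mult)
   then show ?thesis by (simp only: mult_ac)
  qed
  then have "(LL y. ?F y xi) = (LL y. (mk k xi * cis (2 * pi * (x \<bullet> xi))) * (th y * cis (- 2 * pi * (y \<bullet> xi))))"
   by (intro Bochner_Integration.integral_cong refl)
  also have "... = (mk k xi * cis (2 * pi * (x \<bullet> xi))) * ft th xi" unfolding ft_def by (rule integral_mult_right_zero)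
  finally show "(LL y. ?F y xi) = mk k xi * ft th xi * cis (2 * pi * (x \<bullet> xi))" by (simp only: mult_ac)
 qed
 finally show ?thesis .
qed

lemma K_PP:
 assumes "littlewood_paley \<Phi>"
 shows "sconv (K l) (LP.PP \<Phi> l k) = sconv (K k) (LP.PP \<Phi> l k)"
proof
 interpret LP \<Phi> by standard fact
 fix x
 \<comment> \<open>The cutoff of generation j is 1 on the spectrum of P_j, so on the common spectrum
   of P_l and P_k both truncated symbols equal the full one.\<close>
 have *: "\<phi> ((tm j) *\<^sub>R xi) = 1" if "ft (P j) xi ~= 0" for j xi
 proof -
  have "1/2 <= norm ((tm j) *\<^sub>R xi)" "norm ((tm j) *\<^sub>R xi) <= 2"
   using ft_P_support[OF that] by (simp_all add: powr_minus powr_diff powr_add field_simps)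
  then show ?thesis using \<phi> by (simp add: cutoff_def)
 qed
 have "mk l xi * ft (PP l k) xi = mk k xi * ft (PP l k) xi" for xi
  by (cases "ft (P l) xi = 0 \<or> ft (P k) xi = 0") (auto simp: ft_PP mk_def *)
 then show "sconv (K l) (PP l k) x = sconv (K k) (PP l k) x"
  by (simp only: sconv_K[OF schwartz_L1(2)[OF PPS]])
qed

end

section \<open>Triebel--Lizorkin norms of sequences\<close>

text \<open>The norm as a functional of the moduli of the pieces, so that it applies to arbitrary
  nonnegative sequences.\<close>

definition TL_seq :: "ennreal => ennreal => (int => 'a::euclidean_space => ennreal) => ennreal" where
 "TL_seq p q f =
   (if p < \<infinity> \<or> q = \<infinity>
   then Lp_norm p UNIV (%x. lq_norm q (%k. f k x))
   else (SUP (j, n) \<in> (UNIV :: (int \<times> ('a => int)) set).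
       epowr ((\<integral>\<^sup>+x\<in>dyadic_cube j n. (\<Sum>\<^sub>\<infinity>k\<in>{j..}. epowr (f k x) (enn2real q)) \<partial>lebesgue)
           / emeasure lebesgue (dyadic_cube j n :: 'a set)) (enn2real (1 / q))))"

lemma TL_norm_eq: "TL_norm \<Phi> p q X = TL_seq p q (%k. nrm (LP_piece \<Phi> k X))"
 unfolding TL_norm_def TL_seq_def ..

lemma TL_seq_int:
 assumes "0 < a" "0 < b"
 shows "TL_seq (en a) (en b) f = epowr (mixed_int a b f) (1 / a)"
 using assms by (simp add: TL_seq_def Lp_norm_def lq_norm_def enn2real_recip nn_integral_completion
   epowr_epowr infsum_int_nn_integral mixed_int_def)

lemma TL_seq_sup:
 assumes "0 < a"
 shows "TL_seq (en a) \<infinity> f = epowr (mixed_sup a f) (1 / a)"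
 using assms by (simp add: TL_seq_def Lp_norm_def lq_norm_def enn2real_recip nn_integral_completion mixed_sup_def)

lemma TL_seq_carleson:
 fixes f :: "int => 'a::euclidean_space => ennreal"
 assumes b: "0 < b" and T: "0 <= T"
 shows "TL_seq \<infinity> (en b) f <= en T \<longleftrightarrow> carleson b (T powr b) f"
proof -
 define I where "I j Q = (NN y. (CC k. epowr (f k y) b * indicator {j..} k) * indicator Q y)" for j and Q :: "'a set"
 define Q where "Q j x = (cube j x :: 'a set)" for j x
 have [measurable]: "Q j x : sets borel" for j x unfolding Q_def by measurable
 \<comment> \<open>Cubes indexed by lattice vectors and cubes through points form the same family,
   which turns the supremum into the quantifiers of \<open>carleson\<close>.\<close>
 have cubes: "range (dyadic_cube j) = range (Q j)" for j
 proof (intro equalityI image_subsetI)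
  show "dyadic_cube j n : range (Q j)" for n :: "'a => int" using dyadic_cube_point[of j n] by (auto simp: Q_def)
  show "Q j x : range (dyadic_cube j)" for x unfolding Q_def dyadic_cube_eq by simp
 qed
 have "TL_seq \<infinity> (en b) f <= en T
   \<longleftrightarrow> (ALL j. \<forall>S\<in>range (dyadic_cube j :: _ => 'a set). epowr (I j S / emeasure lebesgue S) (1 / b) <= en T)"
  using b by (auto simp: TL_seq_def SUP_le_iff enn2real_recip nn_integral_completion infsum_int_nn_integral_on I_def)
 also have "... \<longleftrightarrow> (ALL j x. epowr (I j (Q j x) / emeasure lebesgue (Q j x)) (1 / b) <= en T)"
  unfolding cubes by simp
 also have "... \<longleftrightarrow> (ALL j x. I j (Q j x) <= en (T powr b) * en (2 powr (- (rint j * real DIM('a)))))"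
 proof (intro iff_allI)
  fix j x
  let ?w = "en (2 powr (- (rint j * real DIM('a))))"
  have e: "emeasure lebesgue (Q j x) = ?w"
   using emeasure_cube[of j x] by (simp add: Q_def[symmetric])
  have w: "?w ~= 0" "?w ~= top" by (simp_all add: ennreal_eq_0_iff not_le)
  have "epowr (I j (Q j x) / ?w) (1 / b) <= en T \<longleftrightarrow> I j (Q j x) / ?w <= en (T powr b)"
   using b T by (simp add: epowr_le_swap)
  also have "... \<longleftrightarrow> I j (Q j x) <= en (T powr b) * ?w"
  proof
   assume "I j (Q j x) / ?w <= en (T powr b)"
   then have "I j (Q j x) / ?w * ?w <= en (T powr b) * ?w" by (rule mult_right_mono) simp
   then show "I j (Q j x) <= en (T powr b) * ?w"
    using w by (simp add: ennreal_divide_times mult_divide_eq_ennreal)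
  next
   assume "I j (Q j x) <= en (T powr b) * ?w"
   then show "I j (Q j x) / ?w <= en (T powr b)"
    using w by (intro divide_le_posI_ennreal) (auto simp: mult.commute zero_less_iff_neq_zero)
  qed
  finally show "epowr (I j (Q j x) / emeasure lebesgue (Q j x)) (1 / b) <= en T \<longleftrightarrow> I j (Q j x) <= en (T powr b) * ?w"
   unfolding e .
 qed
 finally show ?thesis unfolding carleson_def I_def Q_def .
qed

lemma ennreal_real_cases:
 assumes "(1 :: ennreal) <= p" "p < \<infinity>"
 obtains a where "p = en a" "1 <= a"
 using assms by (cases p) auto

section \<open>Boundedness\<close>

definition admissible :: "real => ennreal => real => ennreal => (int => 'a::euclidean_space => complex) => bool" where
 "admissible H u s t K \<longleftrightarrow> 0 <= H & (ALL k. EX G. rescaled k G (K k) & herz_norm u s t G <= en H)"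

text \<open>Collects what the norm estimates use about the moduli f of the pieces of X and g of the
  pieces of its image.\<close>

definition controlled ::
 "real => real => (int => 'a::euclidean_space => complex) => (int => 'a => ennreal) => (int => 'a => ennreal) => bool" where
 "controlled N c K f g \<longleftrightarrow> sqrt_dominated N c f & (ALL k. g k : BM &
   (ALL x. g k x <= nnconv (nrm (K k)) (f k) x & f k x <= en c * nnconv (eta N k) (f k) x))"

text \<open>Lets A decrease to H. Block kernels come with A strictly above a multiple of the Herz
  norm, a multiple that may be 0; finiteness of Y makes the loss arbitrarily small.\<close>

lemma le_limit:
 assumes le: "!!A. H < A ==> X <= en (C * A) * Y" and C: "0 < C" "0 <= H" and Y: "Y < top"
 shows "X <= en (C * H) * Y"
proof (rule ennreal_le_epsilon)
 fix e :: real assume e: "0 < e"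
 define y where "y = enn2real Y"
 have y: "Y = en y" "0 <= y" using Y by (simp_all add: y_def)
 \<comment> \<open>Dividing by y + 1 instead of y covers y = 0.\<close>
 define de where "de = e / (C * (y + 1))"
 have de: "0 < de" using e C y by (simp add: de_def)
 have "C * de = e / (y + 1)" using C by (simp add: de_def)
 then have "C * de * y = e * (y / (y + 1))" by simp
 also have "... <= e * 1" using e y by (intro mult_left_mono) auto
 finally have d: "C * de * y <= e" by simp
 have "X <= en (C * (H + de)) * Y" using de by (intro le) simp
 also have "... = en (C * H * y + C * de * y)" using C y de by (simp add: ennreal_mult[symmetric] algebra_simps)
 also have "... <= en (C * H * y + e)" using d by (intro ennreal_leI) simp
 also have "... = en (C * H) * Y + en e" using C y e by (simp add: ennreal_mult[symmetric] ennreal_plus)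
 finally show "X <= en (C * H) * Y + en e" .
qed

lemma epowr_root_le:
 assumes le: "X <= en (C * A powr a) * Y" and a: "0 < a" and C: "0 < C" "0 <= A"
 shows "epowr X (1 / a) <= en (C powr (1 / a) * A) * epowr Y (1 / a)"
proof -
 have "epowr X (1 / a) <= epowr (en (C * A powr a) * Y) (1 / a)" using le a by (intro epowr_mono) auto
 also have "... = en (C powr (1 / a) * A) * epowr Y (1 / a)"
  using a C by (simp add: epowr_mult powr_mult powr_powr)
 finally show ?thesis .
qed

lemma scale_kernel_mono:
 assumes h: "scale_kernel ep A h" and A: "A <= A'"
 shows "scale_kernel ep A' h"
 unfolding scale_kernel_def
 by (intro allI conjI impI scale_kernelD(1)[OF h] order_trans[OF scale_kernelD(2)[OF h] ennreal_leI[OF A]]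
   order_trans[OF scale_kernelD(3)[OF h] ennreal_leI[OF mult_right_mono[OF A powr_ge_zero]]])

lemma controlledD:
 assumes "controlled N c K f g"
 shows "f k : BM" "g k : BM" "g k x <= nnconv (nrm (K k)) (f k) x"
  "f k x <= en c * nnconv (eta N k) (f k) x"
 using assms by (auto simp: controlled_def sqrt_dominated_def)

text \<open>The block estimates are used with an exponent v in place of u: 1 - 1/v below 1 - 1/u
  keeps the Herz norm usable, above |1/p - 1/q| keeps the maximal functions bounded, and, for finite
  q, below 1/q or 1 - 1/q keeps the auxiliary exponents positive. The interval is nonempty because
  of the hypothesis and 1 < p < infinity.\<close>

lemma bound_critical:
 fixes p q u t :: ennreal
 assumes p: "1 < p" "p < \<infinity>" and q: "1 <= q" "p ~= q" and u: "1 < u" and t: "0 < t" "t <= 1"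
  and s: "s = real DIM('a::euclidean_space) - real DIM('a) * enn2real (1 / u)"
  and pq: "\<bar>enn2real (1 / p) - enn2real (1 / q)\<bar> < 1 - enn2real (1 / u)"
 shows "EX C>0. \<forall>H (K :: int => 'a => complex) f g. admissible H u s t K & controlled N c K f g & TL_seq p q f < top
   --> TL_seq p q g <= en (C * H) * TL_seq p q f"
proof -
 define r where "r = enn2real (1 / u)"
 have r: "0 <= r" by (simp add: r_def)
 obtain a where a: "p = en a" "1 < a" using p by (cases p) auto
 \<comment> \<open>Common to the three cases, with \<open>\<N>\<close> standing for the p-th power
   of the norm.\<close>
 have block: "EX C>0. \<forall>H (K :: int => 'a => complex) f g. admissible H u s t K & controlled N c K f g & TL_seq p q f < top
   --> TL_seq p q g <= en (C * H) * TL_seq p q f"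
  if v: "1 < v" "1 - 1 / v < 1 - r"
   and eq: "!!f. TL_seq p q f = epowr (\<N> f) (1 / a)"
   and mono: "!!f g. (!!k x. f k x <= g k x) ==> \<N> f <= \<N> g"
   and bound: "EX C>0. \<forall>A (h :: int => 'a => ennreal) f.
    (ALL k. block_kernel v A (h k) & h k : LM & f k : LM) -->
    \<N> (%k. nnconv (h k) (f k)) <= en (C * A powr a) * \<N> f"
  for v and \<N> :: "(int => 'a => ennreal) => ennreal"
 proof -
  have "v * r < 1" using v by (simp add: field_simps)
  then obtain C1 where C1: "0 < C1" and ker: "!!H k K G A. 0 <= H ==> rescaled k G (K :: 'a => complex) ==> herz_norm u s t G <= en H ==> C1 * H < A ==> block_kernel v A (nrm K)"
   using herz_block_kernel[OF u t v(1) _ s] unfolding r_def by metis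
  obtain C where C: "0 < C" and bd: "!!A (h :: int => 'a => ennreal) f.
    (!!k. block_kernel v A (h k) & h k : LM & f k : LM) ==>
    \<N> (%k. nnconv (h k) (f k)) <= en (C * A powr a) * \<N> f"
   using bound by metis
  have "TL_seq p q g <= en (C powr (1 / a) * (C1 * H)) * TL_seq p q f"
   if K: "admissible H u s t K" and fg: "controlled N c K f g" and fin: "TL_seq p q f < top" for H and K :: "int => 'a => complex" and f g
  proof (rule le_limit[OF _ _ _ fin])
   have H: "0 <= H" using K by (simp add: admissible_def)
   show "0 < C powr (1 / a)" "0 <= C1 * H" using C C1 H by auto
   fix A assume A: "C1 * H < A"
   have "0 <= C1 * H" using C1 H by simp
   then have A0: "0 <= A" using A by linarith
   have 1: "block_kernel v A (nrm (K k)) & nrm (K k) : LM & f k : LM" for k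
   proof -
    obtain G where G: "rescaled k G (K k)" "herz_norm u s t G <= en H" using K by (auto simp: admissible_def)
    then have "K k : BM" by (simp add: rescaled_def)
    then show ?thesis using ker[OF H G A] controlledD(1)[OF fg, of k] by simp
   qed
   have "\<N> g <= \<N> (%k. nnconv (nrm (K k)) (f k))" by (intro mono controlledD(3)[OF fg])
   also have "... <= en (C * A powr a) * \<N> f" by (rule bd[OF 1])
   finally show "TL_seq p q g <= en (C powr (1 / a) * A) * TL_seq p q f"
    unfolding eq by (rule epowr_root_le) (use a C A0 in auto)
  qed
  then show ?thesis using C C1 by (intro exI[of _ "C powr (1 / a) * C1"]) (auto simp: mult.assoc)
 qed
 have ra: "enn2real (1 / p) = 1 / a" using a by (simp add: enn2real_recip)
 show ?thesis
 proof (cases "q = \<infinity>")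
  case True
  have lt: "1 / a < 1 - r" using pq[unfolded ra True] a by (simp add: r_def)
  obtain v where v: "1 < v" "1 / a < 1 - 1 / v" "1 - 1 / v < 1 - r"
   using exists_exponent[OF _ lt] a r by auto
  show ?thesis
  proof (rule block[OF v(1,3), of "mixed_sup a"])
   show "TL_seq p q f = epowr (mixed_sup a f) (1 / a)" for f :: "int => 'a => ennreal"
    using a True TL_seq_sup[of a f] by simp
   show "mixed_sup a f <= mixed_sup a g" if "!!k x. f k x <= g k x" for f g :: "int => 'a => ennreal"
    using that a by (intro mixed_sup_mono) auto
  qed (rule block_bound_sup[OF a(2) v(1,2)])
 next
  case False
  then obtain b where b: "q = en b" "1 <= b" using q by (auto elim: ennreal_real_cases simp: top.not_eq_extremum)
  have rb: "enn2real (1 / q) = 1 / b" using b by (simp add: enn2real_recip)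
  have lt: "\<bar>1 / a - 1 / b\<bar> < 1 - r" using pq by (simp add: ra rb r_def)
  have ab: "a ~= b" using q a b by auto
  have eq: "TL_seq p q f = epowr (mixed_int a b f) (1 / a)" for f :: "int => 'a => ennreal"
   using a b by (simp add: TL_seq_int)
  have mono: "(!!k x. f k x <= g k x) ==> mixed_int a b f <= mixed_int a b g" for f g :: "int => 'a => ennreal"
   using mixed_int_mono[of f g a b] a b by auto
  show ?thesis
  proof (cases "b < a")
   case True
   then have ba: "0 <= 1 / b - 1 / a" using b by (simp add: field_simps)
   have R: "1 / b - 1 / a < min (1 - r) (1 / b)" "min (1 - r) (1 / b) <= 1" using lt a r by auto
   obtain v where v: "1 < v" "1 / b - 1 / a < 1 - 1 / v" "1 - 1 / v < min (1 - r) (1 / b)"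
    using exists_exponent[OF ba R] by blast
   have v': "1 - 1 / v < 1 - r" "1 - 1 / v < 1 / b" using v(3) by auto
   show ?thesis by (rule block[OF v(1) v'(1), of "mixed_int a b"])
     (rule eq, rule mono, blast, rule block_bound_less[OF b(2) True v(1,2) v'(2)])
  next
   case False
   then have ab': "a < b" using ab by simp
   then have ba: "0 <= 1 / a - 1 / b" using a by (simp add: field_simps)
   have R: "1 / a - 1 / b < min (1 - r) (1 - 1 / b)" "min (1 - r) (1 - 1 / b) <= 1" using lt a r by auto
   obtain v where v: "1 < v" "1 / a - 1 / b < 1 - 1 / v" "1 - 1 / v < min (1 - r) (1 - 1 / b)"
    using exists_exponent[OF ba R] by blast
   have v': "1 - 1 / v < 1 - r" "1 - 1 / v < 1 - 1 / b" using v(3) by auto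
   show ?thesis by (rule block[OF v(1) v'(1), of "mixed_int a b"])
     (rule eq, rule mono, blast, rule block_bound_greater[OF a(2) ab' v(1,2) v'(2)])
  qed
 qed
qed

text \<open>The case p infinite leads to the Carleson bound, p < q and q infinite to the square root
  bounds, and q < p to the bound obtained by duality.\<close>

lemma bound_supercritical:
 fixes p q u t :: ennreal
 assumes p: "1 <= p" and q: "1 <= q" "p ~= q" and u: "1 < u" and t: "0 < t"
  and s: "s > real DIM('a::euclidean_space) - real DIM('a) * enn2real (1 / u)"
  and N: "real DIM('a) < N" and c: "0 < c"
 shows "EX C>0. \<forall>H (K :: int => 'a => complex) f g. admissible H u s t K & controlled N c K f g & TL_seq p q f < top
   --> TL_seq p q g <= en (C * H) * TL_seq p q f"
proof -
 obtain C1 ep where C1: "0 < C1" and ep: "0 < ep" and ker: "!!H K G. 0 <= H ==>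
   (!!k. rescaled k (G k) (K k :: 'a => complex) & herz_norm u s t (G k) <= en H) ==> scale_kernel ep (C1 * H) (%k. nrm (K k))"
  using herz_scale_kernel[OF u t s] by metis
 \<comment> \<open>The bounds ask for A > 0, while the Herz norm may be 0; \<open>le_limit\<close>
   closes the gap.\<close>
 have reduce: "EX C>0. \<forall>H (K :: int => 'a => complex) f g. admissible H u s t K & controlled N c K f g & TL_seq p q f < top
   --> TL_seq p q g <= en (C * H) * TL_seq p q f"
  if D: "0 < D" and le: "!!A (K :: int => 'a => complex) f g. 0 < A ==> scale_kernel ep A (%k. nrm (K k)) ==> controlled N c K f g ==> TL_seq p q f < top
    ==> TL_seq p q g <= en (D * A) * TL_seq p q f" for D
 proof -
  have "TL_seq p q g <= en (D * (C1 * H)) * TL_seq p q f"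
   if K: "admissible H u s t K" and fg: "controlled N c K f g" and fin: "TL_seq p q f < top" for H and K :: "int => 'a => complex" and f g
  proof (rule le_limit[OF _ D _ fin])
   have H: "0 <= H" using K by (simp add: admissible_def)
   then show "0 <= C1 * H" using C1 by simp
   fix A assume A: "C1 * H < A"
   obtain G where G: "!!k. rescaled k (G k) (K k) & herz_norm u s t (G k) <= en H"
    using K unfolding admissible_def by metis
   have A0: "0 < A" using \<open>0 <= C1 * H\<close> A by linarith
   have "scale_kernel ep A (%k. nrm (K k))" by (rule scale_kernel_mono[OF ker[OF H G]]) (use A in auto)
   from le[OF A0 this fg fin] show "TL_seq p q g <= en (D * A) * TL_seq p q f" .
  qed
  then show ?thesis using D C1 by (intro exI[of _ "D * C1"]) (auto simp: mult.assoc)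
 qed
 \<comment> \<open>Inserting the average of f_k creates the kernel \<open>eta\<close> that duality
   moves onto the weight.\<close>
 have conv: "g k x <= nnconv (nrm (K k)) (%y. en c * nnconv (eta N k) (f k) y) x" if "controlled N c K f g" for K :: "int => 'a => complex" and f g k x
  using controlledD(3)[OF that] by (rule order_trans) (intro nnconv_mono controlledD(4)[OF that] order_refl)
 show ?thesis
 proof (cases "p = \<infinity>")
  case True
  then have "q ~= top" using q by auto
 then have "q < \<infinity>" using top.not_eq_extremum[of q] by simp
  then obtain b where b: "q = en b" "1 <= b" using q by (auto elim: ennreal_real_cases)
  obtain C where C: "0 < C" and bd: "!!A M h (f :: int => 'a => ennreal) g. 0 < A ==> 0 <= M ==> scale_kernel ep A h ==>
   (!!k. f k : BM & g k : BM & (ALL x. g k x <= nnconv (h k) (f k) x) &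
     (ALL x. f k x <= en c * nnconv (eta N k) (f k) x)) ==> carleson b M f ==> carleson b (C * A powr b * M) g"
   using carleson_bound[OF b(2) N c ep] by metis
  show ?thesis
  proof (rule reduce[of "C powr (1 / b)"])
   show "0 < C powr (1 / b)" using C by simp
   fix A and K :: "int => 'a => complex" and f g
   assume A: "0 < A" and K: "scale_kernel ep A (%k. nrm (K k))" and fg: "controlled N c K f g" and fin: "TL_seq p q f < top"
   define T where "T = enn2real (TL_seq p q f)"
   have T: "TL_seq p q f = en T" "0 <= T" using fin by (simp_all add: T_def)
   have "carleson b (T powr b) f" using TL_seq_carleson[of b T f] T b True by simp
   then have "carleson b (C * A powr b * T powr b) g"
    by (intro bd[OF A _ K]) (use controlledD[OF fg] in auto)
   also have "C * A powr b * T powr b = (C powr (1 / b) * A * T) powr b"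
    using C A T b by (simp add: powr_mult powr_powr)
   finally have "TL_seq \<infinity> (en b) g <= en (C powr (1 / b) * A * T)"
    using TL_seq_carleson[of b "C powr (1 / b) * A * T" g] T A b by simp
   then show "TL_seq p q g <= en (C powr (1 / b) * A) * TL_seq p q f"
    using T A by (simp add: b True ennreal_mult)
  qed
 next
  case False
  then obtain a where a: "p = en a" "1 <= a" using p by (auto elim: ennreal_real_cases simp: top.not_eq_extremum)
  have mixed: ?thesis
   if C: "0 < C" and eq: "!!f. TL_seq p q f = epowr (\<N> f) (1 / a)"
    and bd: "!!A (K :: int => 'a => complex) f g. 0 < A ==> scale_kernel ep A (%k. nrm (K k)) ==> controlled N c K f g ==> \<N> g <= en (C * A powr a) * \<N> f"
   for C and \<N> :: "(int => 'a => ennreal) => ennreal"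
  proof (rule reduce[of "C powr (1 / a)"])
   show "0 < C powr (1 / a)" using C by simp
   fix A and K :: "int => 'a => complex" and f g
   assume A: "0 < A" and K: "scale_kernel ep A (%k. nrm (K k))" and fg: "controlled N c K f g"
   show "TL_seq p q g <= en (C powr (1 / a) * A) * TL_seq p q f"
    unfolding eq by (rule epowr_root_le[OF bd[OF A K fg]]) (use a C A in auto)
  qed
  have sd: "sqrt_dominated N c f" if "controlled N c K f g" for K :: "int => 'a => complex" and f g
   using that by (simp add: controlled_def)
  show ?thesis
  proof (cases "q = \<infinity>")
   case True
   obtain C where C: "0 < C" and bd: "!!A h (f :: int => 'a => ennreal). 0 < A ==> scale_kernel ep A h ==> sqrt_dominated N c f ==>
     mixed_sup a (%k. nnconv (h k) (f k)) <= en (C * A powr a) * mixed_sup a f"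
    using sqrt_dominated_bound_sup[OF a(2) N c ep] by metis
   show ?thesis
   proof (rule mixed[OF C, of "mixed_sup a"])
    show "TL_seq p q f = epowr (mixed_sup a f) (1 / a)" for f :: "int => 'a => ennreal" using a True TL_seq_sup[of a f] by simp
    fix A and K :: "int => 'a => complex" and f g
    assume A: "0 < A" and K: "scale_kernel ep A (%k. nrm (K k))" and fg: "controlled N c K f g"
    have "mixed_sup a g <= mixed_sup a (%k. nnconv (nrm (K k)) (f k))" using a by (intro mixed_sup_mono controlledD(3)[OF fg]) auto
    also have "... <= en (C * A powr a) * mixed_sup a f" by (rule bd[OF A K sd[OF fg]])
    finally show "mixed_sup a g <= en (C * A powr a) * mixed_sup a f" .
   qed
  next
   case False
   then obtain b where b: "q = en b" "1 <= b" using q by (auto elim: ennreal_real_cases simp: top.not_eq_extremum)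
   have ab: "a ~= b" using q a b by auto
   have eq: "TL_seq p q f = epowr (mixed_int a b f) (1 / a)" for f :: "int => 'a => ennreal"
    using a b by (simp add: TL_seq_int)
   show ?thesis
   proof (cases "a < b")
    case True
    obtain C where C: "0 < C" and bd: "!!A h (f :: int => 'a => ennreal). 0 < A ==> scale_kernel ep A h ==> sqrt_dominated N c f ==>
      mixed_int a b (%k. nnconv (h k) (f k)) <= en (C * A powr a) * mixed_int a b f"
     using sqrt_dominated_bound_less[OF a(2) True N c ep] by metis
    show ?thesis
    proof (rule mixed[OF C eq])
     fix A and K :: "int => 'a => complex" and f g
     assume A: "0 < A" and K: "scale_kernel ep A (%k. nrm (K k))" and fg: "controlled N c K f g"
     have "mixed_int a b g <= mixed_int a b (%k. nnconv (nrm (K k)) (f k))"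
      using a b by (intro mixed_int_mono controlledD(3)[OF fg]) auto
     also have "... <= en (C * A powr a) * mixed_int a b f" by (rule bd[OF A K sd[OF fg]])
     finally show "mixed_int a b g <= en (C * A powr a) * mixed_int a b f" .
    qed
   next
    case False
    then have ba: "b < a" using ab by simp
    obtain C where C: "0 < C" and bd: "!!A h (f :: int => 'a => ennreal) g. 0 < A ==> scale_kernel ep A h ==>
     (!!k. f k : BM & g k : BM &
      (ALL x. g k x <= nnconv (h k) (%y. en c * nnconv (eta N k) (f k) y) x)) ==>
      mixed_int a b g <= en (C * A powr a) * mixed_int a b f"
     using smoothed_bound_greater[OF b(2) ba N c ep] by metis
    show ?thesis
     by (rule mixed[OF C eq], rule bd) (use conv controlledD in auto)
   qed
  qed
 qed
qed

text \<open>Integrability of the kernels comes before the operator, since otherwise its integrals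
  could be default values. In the critical case any v > 1 with 1 - 1/v < 1 - 1/u serves.\<close>

lemma admissible_L1:
 fixes u t :: ennreal
 assumes u: "1 < u" and t: "0 < t"
  and s: "s = real DIM('a::euclidean_space) - real DIM('a) * enn2real (1 / u) & t <= 1
     \<or> s > real DIM('a) - real DIM('a) * enn2real (1 / u)"
 shows "EX C>0. \<forall>H (K :: int => 'a => complex) k. admissible H u s t K --> (NN x. nrm (K k) x) <= en (C * H)"
 using s
proof (elim disjE conjE)
 assume "s > real DIM('a) - real DIM('a) * enn2real (1 / u)"
 from herz_scale_kernel[OF u t this] obtain C ep where C: "0 < C" and ker: "!!H K G. 0 <= H ==>
   (!!k. rescaled k (G k) (K k :: 'a => complex) & herz_norm u s t (G k) <= en H) ==> scale_kernel ep (C * H) (%k. nrm (K k))"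
  by metis
 have "(NN x. nrm (K k) x) <= en (C * H)" if K: "admissible H u s t K" for H and K :: "int => 'a => complex" and k
 proof -
  obtain G where G: "!!k. rescaled k (G k) (K k) & herz_norm u s t (G k) <= en H"
   using K unfolding admissible_def by metis
  show ?thesis by (rule scale_kernelD(2)[OF ker[OF _ G]]) (use K in "simp add: admissible_def")
 qed
 then show ?thesis using C by (intro exI[of _ C]) auto
next
 assume s: "s = real DIM('a) - real DIM('a) * enn2real (1 / u)" and t1: "t <= 1"
 have r: "enn2real (1 / u) < 1"
 proof (cases u)
  case (real U)
  then show ?thesis using u enn2real_recip[of U] by auto
 qed simp
 then obtain v where v: "1 < v" "1 - 1 / v < 1 - enn2real (1 / u)"
  using exists_exponent[of 0 "1 - enn2real (1 / u)"] by auto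
 have "v * enn2real (1 / u) < 1" using v by (simp add: field_simps)
 from herz_block_kernel[OF u t t1 v(1) this s] obtain C where C: "0 < C" and ker: "!!H k K G. 0 <= H ==> rescaled k G (K :: 'a => complex) ==>
   herz_norm u s t G <= en H ==> (NN x. nrm K x) <= en (C * H)"
  by metis
 have "(NN x. nrm (K k) x) <= en (C * H)" if K: "admissible H u s t K" for H and K :: "int => 'a => complex" and k
  using K ker unfolding admissible_def by blast
 then show ?thesis using C by (intro exI[of _ C]) auto
qed

text \<open>For p finite each term is dominated by the whole sequence and its L^p norm bounds the
  averages; for p infinite the Carleson condition gives a uniform pointwise bound.\<close>

lemma TL_seq_moderate:
 fixes f :: "int => 'a::euclidean_space => ennreal"
 assumes p: "1 <= p" and q: "1 <= q" "p ~= q" and N: "real DIM('a) < N" and c: "0 < c"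
  and [measurable]: "!!k. f k : BM" and f: "!!k x. f k x <= en c * nnconv (eta N k) (f k) x"
  and fin: "TL_seq p q f < top"
 shows "\<exists>B\<ge>0. moderate N B f"
proof (cases "p = \<infinity>")
 case True
 then have "q ~= top" using q by auto
 then have "q < \<infinity>" using top.not_eq_extremum[of q] by simp
 then obtain b where b: "q = en b" "1 <= b" using q by (auto elim: ennreal_real_cases)
 obtain E where E: "0 < E" "!!k. (NN x. eta N k (x :: 'a)) <= en E" using nn_integral_eta_bound[OF N] by auto
 define T where "T = enn2real (TL_seq p q f)"
 have T: "TL_seq p q f = en T" "0 <= T" using fin by (simp_all add: T_def)
 have car: "carleson b (T powr b) f" using TL_seq_carleson[of b T f] T b True by simp
 let ?B = "c powr b * E powr b * (1 + 2 * real DIM('a)) powr N * T powr b"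
 have "f k x <= en (?B powr (1 / b))" for k x
 proof -
  have "epowr (f k x) b <= en (c powr b * E powr b * (1 + 2 * real DIM('a)) powr N) * en (T powr b)"
   by (rule carleson_sup_bound[OF b(2) _ c E _ f car]) (use N in auto)
  then have "epowr (f k x) b <= en ?B" by (simp add: ennreal_mult)
  then show ?thesis using b by (simp add: epowr_le_swap)
 qed
 from moderate_bounded[OF N powr_ge_zero this] show ?thesis .
next
 case False
 then obtain a where a: "p = en a" "1 <= a" using p by (auto elim: ennreal_real_cases simp: top.not_eq_extremum)
 show ?thesis
 proof (cases "q = \<infinity>")
  case True
  have "mixed_sup a f < top" using fin a True TL_seq_sup[of a f] by simp
  moreover have "(NN x. epowr (f j x) a) <= mixed_sup a f" for j
   unfolding mixed_sup_def using a by (intro nn_integral_mono epowr_mono SUP_upper) auto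
  ultimately show ?thesis by (intro moderate_Lp[OF N a(2), of f "mixed_sup a f"]) auto
 next
  case False
  then obtain b where b: "q = en b" "1 <= b" using q by (auto elim: ennreal_real_cases simp: top.not_eq_extremum)
  have "mixed_int a b f < top" using fin a b TL_seq_int[of a b f] by simp
  moreover have "(NN x. epowr (f j x) a) <= mixed_int a b f" for j
   unfolding mixed_int_def
  proof (rule nn_integral_mono)
   fix x
   have "epowr (f j x) a = epowr (epowr (f j x) b) (a / b)" using b by (simp add: epowr_epowr)
   also have "... <= epowr (CC k. epowr (f k x) b) (a / b)"
    using a b by (intro epowr_mono nn_integral_ge_point) auto
   finally show "epowr (f j x) a <= epowr (CC k. epowr (f k x) b) (a / b)" .
  qed
  ultimately show ?thesis by (intro moderate_Lp[OF N a(2), of f "mixed_int a b f"]) auto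
 qed
qed

section \<open>The multiplier operator: existence of the image and the norm bound\<close>

lemma convolve_eq_sconv:
 fixes k h :: "'a::euclidean_space => complex"
 assumes [measurable]: "k : BM" "h : BM"
 shows "convolve k h = sconv h k"
proof
 fix x
 have "convolve k h x = (LL y. k (x - y) * h y)" unfolding convolve_def by (rule integral_completion) measurable
 then show "convolve k h x = sconv h k x" by (simp add: sconv_def mult.commute)
qed

lemma (in LP_mult) multiplier_imageI:
 assumes K_eq: "!!k. multiplier_kernel \<phi> m k = K k"
 shows "EX Y. multiplier_image \<phi> \<Phi> m X Y"
proof -
 have conv: "convolve (K k) (f k) = g k" for k
  unfolding g_def convolve_eq_sconv[OF K_measurable f_measurable] by (rule sconv_commute) measurable
 obtain Y where Y: "Y : tempered_mod_poly" "!!k. LP_piece \<Phi> k Y = g k"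
   "!!ps k. ps : schwartz0 ==> integ (%x. g k x * ps x)"
   "!!ps. ps : schwartz0 ==> ((%k. LL x. g k x * ps x) has_sum pairing Y ps) UNIV"
  using image_exists by blast
 have psm: "ps : BM" if "ps : schwartz0" for ps :: "'a => complex"
  using that by (intro schwartz_meas) (simp add: schwartz0_def)
 have gm: "(%x. g k x * ps x) : LM" if "ps : schwartz0" for k ps
  using psm[OF that] by measurable
 have "multiplier_image \<phi> \<Phi> m X Y"
  unfolding multiplier_image_def K_eq conv
 proof (intro conjI allI ballI)
  fix k
  show "integrable lebesgue (K k)" using K[of k] by (subst integrable_completion) auto
  fix x
  obtain b where b: "!!x. norm (f k x) <= b" using f_bdd by blast
  have "integ (%y. K k (x - y) * f k (x - (x - y)))"
   by (rule int_reflect(2)[OF _ sconv_bounded(1)[OF K f_measurable b]]) measurable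
  then show "integrable lebesgue (%y. K k (x - y) * f k y)" by (subst integrable_completion) auto
 next
  fix ps :: "'a => complex" and k assume ps: "ps : schwartz0"
  show "integrable lebesgue (%x. g k x * ps x)"
   unfolding integrable_completion[OF gm[OF ps]] by (rule Y(3)[OF ps])
 next
  fix ps :: "'a => complex" assume ps: "ps : schwartz0"
  show "((%k. LINT x|lebesgue. g k x * ps x) has_sum pairing Y ps) UNIV"
   unfolding integral_completion[OF gm[OF ps]] by (rule Y(4)[OF ps])
 qed (use Y in auto)
 then show ?thesis by blast
qed

theorem theorem2p5:
  fixes p q u t :: ennreal and s :: real
    and \<phi> :: "'a::euclidean_space \<Rightarrow> real" and \<Phi> :: "'a \<Rightarrow> complex"
  assumes "1 \<le> p" and "1 \<le> q" and "p \<noteq> q"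
    and "1 < u" and "0 < t"
    and "cutoff \<phi>" and "littlewood_paley \<Phi>"
    and "(s = real DIM('a) - real DIM('a) * enn2real (1 / u) \<and> t \<le> 1 \<and> 1 < p \<and> p < \<infinity> \<and>
            \<bar>enn2real (1 / p) - enn2real (1 / q)\<bar> < 1 - enn2real (1 / u))
         \<or> s > real DIM('a) - real DIM('a) * enn2real (1 / u)"
  shows "\<exists>C>0. \<forall>m\<in>L_infinity. herz_multiplier_norm \<phi> u s t m < \<infinity> \<longrightarrow>
           (\<forall>X\<in>TL_space \<Phi> p q.
              (\<exists>Y. multiplier_image \<phi> \<Phi> m X Y) \<and>
              (\<forall>Y. multiplier_image \<phi> \<Phi> m X Y \<longrightarrow>
                 Y \<in> TL_space \<Phi> p q \<and>
                 TL_norm \<Phi> p q Y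
                   \<le> ennreal C * herz_multiplier_norm \<phi> u s t m * TL_norm \<Phi> p q X))"
proof -
 interpret LP \<Phi> by standard fact
 \<comment> \<open>The least integer order above the dimension, for which \<open>eta\<close> is
   integrable.\<close>
 define n where "n = DIM('a) + 1"
 have n: "DIM('a) < n" "real DIM('a) < real n" by (simp_all add: n_def)
 obtain c where c: "0 < c" "!!k l x. \<bar>l - k\<bar> <= 1 ==> ennreal (norm (P l x)) <= en c * eta (real (3 * n + 1)) k (x :: 'a)"
  using P_le_eta[of "3 * n + 1"] by blast
 \<comment> \<open>One constant for order 3n + 1 covers order 2n for Peetre's argument and order n
   for the averages.\<close>
 have c': "en (norm (P l x)) <= en c * eta N k x" if "\<bar>l - k\<bar> <= 1" "N <= real (3 * n + 1)" for k l x N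
  by (rule order_trans[OF c(2)[OF that(1)] mult_left_mono[OF eta_antimono[OF that(2)]]]) simp
 have "EX C>0. \<forall>H (K :: int => 'a => complex) f g. admissible H u s t K & controlled (real n) (3 * c) K f g & TL_seq p q f < top
   --> TL_seq p q g <= en (C * H) * TL_seq p q f"
  using assms(8)
 proof (elim disjE conjE)
  assume "s = real DIM('a) - real DIM('a) * enn2real (1 / u)" "t <= 1" "1 < p" "p < \<infinity>"
   "\<bar>enn2real (1 / p) - enn2real (1 / q)\<bar> < 1 - enn2real (1 / u)"
  then show ?thesis using assms by (intro bound_critical) auto
 next
  assume "s > real DIM('a) - real DIM('a) * enn2real (1 / u)"
  then show ?thesis using assms n c(1) by (intro bound_supercritical) auto
 qed
 then obtain C where C: "0 < C" and bound: "!!H (K :: int => 'a => complex) f g. admissible H u s t K ==> controlled (real n) (3 * c) K f g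
   ==> TL_seq p q f < top ==> TL_seq p q g <= en (C * H) * TL_seq p q f" by metis
 have "s = real DIM('a) - real DIM('a) * enn2real (1 / u) & t <= 1 \<or> s > real DIM('a) - real DIM('a) * enn2real (1 / u)"
  using assms(8) by (elim disjE conjE) simp_all
 from admissible_L1[OF assms(4,5) this]
 obtain D where D: "0 < D" and L1: "!!H (K :: int => 'a => complex) k. admissible H u s t K ==> (NN x. nrm (K k) x) <= en (D * H)"
  by metis
 show ?thesis
 proof (intro exI[of _ C] conjI[OF C] ballI impI)
  fix m :: "'a => complex" and X
  assume m: "m : L_infinity" and fin: "herz_multiplier_norm \<phi> u s t m < \<infinity>" and X: "X : TL_space \<Phi> p q"
  define H where "H = enn2real (herz_multiplier_norm \<phi> u s t m)"
  have H: "herz_multiplier_norm \<phi> u s t m = en H" "0 <= H" using fin by (simp_all add: H_def)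
  obtain m' M where m': "m' : BM" "!!x. norm (m' x) <= M" "AE x in lebesgue. m x = m' x"
   using L_infinity_borel[OF m] by blast
  interpret T: multiplier \<phi> m m' M
   using m' m assms(6) by unfold_locales (auto simp: L_infinity_def)
  have adm: "admissible H u s t T.K"
   unfolding admissible_def using T.K_rescaled T.herz_G[of u s t] H by auto
  interpret LD: LP_dist \<Phi> X
   using X by unfold_locales (simp add: TL_space_def)
  have Xfin: "TL_seq p q (%k. nrm (LD.f k)) < top"
   using X by (simp add: TL_space_def TL_norm_eq)
  have f_le: "nrm (LD.f k) x <= en (3 * c) * nnconv (eta (real n) k) (nrm (LD.f k)) x" for k x
   by (rule LD.f_le_eta[OF c(1) c']) auto
  obtain B where B: "0 <= B" "moderate (real n) B (%k. nrm (LD.f k))"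
   using TL_seq_moderate[OF assms(1-3) n(2) _ _ f_le Xfin] c(1) by auto
  have bdd: "EX b. ALL x. norm (LD.f k x) <= b" for k
   by (rule LD.f_bounded[OF c(1) c' _ B]) auto
  have sd: "sqrt_dominated (real n) (3 * c) (%k. nrm (LD.f k))"
   by (rule LD.f_sqrt_dominated[OF c(1) c' _ bdd]) auto
  have KI: "integ (T.K k)" for k
   using L1[OF adm, of k] by (intro integrableI_bounded) (auto intro: le_less_trans)
  interpret LM: LP_mult \<Phi> X T.K "D * H" B c n
   by unfold_locales (use n c KI L1[OF adm] B D H T.K_PP[OF assms(7)] in auto)
  show "(EX Y. multiplier_image \<phi> \<Phi> m X Y) &
   (ALL Y. multiplier_image \<phi> \<Phi> m X Y --> Y : TL_space \<Phi> p q &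
     TL_norm \<Phi> p q Y <= en C * herz_multiplier_norm \<phi> u s t m * TL_norm \<Phi> p q X)"
  proof (intro conjI allI impI)
   show "EX Y. multiplier_image \<phi> \<Phi> m X Y" by (rule LM.multiplier_imageI) simp
   \<comment> \<open>The definition of the image fixes its pieces, so the estimate holds for every
     such Y and not only for the one constructed.\<close>
   fix Y assume Y: "multiplier_image \<phi> \<Phi> m X Y"
   have pY: "LP_piece \<Phi> k Y = sconv (LD.f k) (T.K k)" for k
    using Y convolve_eq_sconv[OF T.K_measurable LD.f_measurable] by (simp add: multiplier_image_def)
   have "sconv (LD.f k) (T.K k) = LM.g k" for k unfolding LM.g_def by (rule sconv_commute) measurable
   then have [measurable]: "LP_piece \<Phi> k Y : BM" for k unfolding pY by simp
   have g_le: "nrm (LP_piece \<Phi> k Y) x <= nnconv (nrm (T.K k)) (nrm (LD.f k)) x" for k x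
    unfolding pY by (rule norm_sconv_le)
   have "controlled (real n) (3 * c) T.K (%k. nrm (LD.f k)) (%k. nrm (LP_piece \<Phi> k Y))"
    unfolding controlled_def by (intro conjI allI sd f_le g_le) measurable
   from bound[OF adm this Xfin]
   show le: "TL_norm \<Phi> p q Y <= en C * herz_multiplier_norm \<phi> u s t m * TL_norm \<Phi> p q X"
    using C H by (simp add: TL_norm_eq ennreal_mult)
   have "en C * herz_multiplier_norm \<phi> u s t m * TL_norm \<Phi> p q X < \<infinity>"
    using Xfin H by (simp add: TL_norm_eq ennreal_mult_less_top)
   then show "Y : TL_space \<Phi> p q"
    using le Y by (auto simp: TL_space_def multiplier_image_def intro: le_less_trans)
  qed
 qed
qed

end
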